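(* Let $\Gamma$ be a compact metric graph with vertex partition $\mathcal{V}=\mathcal{V}_K\sqcup\mathcal{V}_D$. Let $a,\kappa\in\mathbb{L}_\infty(\Gamma)$ with $\inf_\Gamma a>0$, $\inf_\Gamma\kappa>0$, and assume that $a$ is Lipschitz on $\Gamma$. Let $\mathcal{L}=\kappa^2-\nabla(a\nabla)$ with Kirchhoff conditions on $\mathcal{V}_K$ and Dirichlet conditions on $\mathcal{V}_D$. Let $\alpha\in(-\frac32,\frac52)$, $\epsilon>0$, and let $\mathcal{W}$ be a Gaussian white noise on $\mathbb{L}_2(\Gamma)$. Then the SPDE $\mathcal{L}^{\alpha/2}u=\mathcal{W}$ has almost surely a unique solution $u\in H^{\alpha-\frac12-\epsilon}_{K,D}(\Gamma)$.
   Context: Graph. $\Gamma$ is a compact metric graph: it is obtained from a finite connected graph (loops and multiple edges allowed) by identifying every edge $e\in\mathcal{E}$ with an interval $[0,l_e]$, $0<l_e<\infty$, and gluing together the interval endpoints that correspond to the same vertex. "Lipschitz on $\Gamma$" is with respect to the geodesic distance. Each edge has two natural parameterizations $\zeta:[0,l_e]\to e$ (the two orientations); functions on $e$ are identified with functions on $[0,l_e]$. $\mathbb{L}_2(\Gamma)=\bigoplus_e\mathbb{L}_2(e)$ (real-valued), $H^s(e)=H^s(0,l_e)$. $D=\nabla$ is the edgewise weak derivative (odd orders depend on the orientation only up to sign). A function given edgewise is continuous on $\Gamma$ if it has a representative continuous on each closed edge with the same limit at each vertex along all incident edge ends. For a vertex $v$, $\mathrm{Dir}(v)$ is the set of pairs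 $(e,\zeta)$ with $\zeta$ a natural parameterization of $e$ and $\zeta(0)=v$ (a loop contributes two), and $\partial_{e,\zeta}u(v)$ is the right derivative of $u\circ\zeta$ at $0$. Spaces $H^\alpha(\Gamma)$. For $k\in\mathbb{N}$, $H^k(\Gamma)$ is the space of $\varphi\in\bigoplus_eH^k(e)$ such that $D^{2m}\varphi$ is continuous on $\Gamma$ for $0\le m\le\lfloor\frac{k-1}{2}\rfloor$, with norm$^2$ $\sum_e\|\varphi\|_{H^k(e)}^2$. For $\alpha\in(0,1)$, $H^\alpha(\Gamma)=[\mathbb{L}_2(\Gamma),H^1(\Gamma)]_\alpha$ and $H^\alpha_*(\Gamma)=[\mathbb{L}_2(\Gamma),\bigoplus_eH^1(e)]_\alpha$ (real interpolation with parameters $(\alpha,2)$). For non-integer $\alpha>1$, with $s=\alpha-\lfloor\alpha\rfloor$: $H^\alpha(\Gamma)$ is the space of $\varphi\in H^{\lfloor\alpha\rfloor}(\Gamma)$ with $D^{\lfloor\alpha\rfloor}\varphi\in H^s_*(\Gamma)$ if $\lfloor\alpha\rfloor$ is odd, and with $D^{\lfloor\alpha\rfloor}\varphi\in H^s(\Gamma)$ if $\lfloor\alpha\rfloor$ is even; norm$^2$ $=\|\varphi\|_{H^{\lfloor\alpha\rfloor}(\Gamma)}^2+\|D^{\lfloor\alpha\rfloor}\varphi\|^2$ (in $H^s_*(\Gamma)$, resp. $H^s(\Gamma)$). Vertex conditions. Let $\mathcal{E}_K$ (resp. $\mathcal{E}_D$) be the set of edges incident to some vertex of $\mathcal{V}_K$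 (resp. $\mathcal{V}_D$). For $n\in\mathbb{N}$, $K^n(\Gamma)$ is the set of $u\in\mathbb{L}_2(\Gamma)$ such that for some $s>2n-\frac12$, $u|_e\in H^s(e)$ for all $e\in\mathcal{E}_K$, and $\sum_{(e,\zeta)\in\mathrm{Dir}(v)}\partial_{e,\zeta}D^{2j}u(v)=0$ for all $v\in\mathcal{V}_K$, $0\le j\le n-1$. $D^n(\Gamma)$ is the set of $u\in\mathbb{L}_2(\Gamma)$ such that for some $s>2n-\frac32$, $u|_e\in H^s(e)$ for all $e\in\mathcal{E}_D$, and $D^{2j}u(v)=0$ for all $v\in\mathcal{V}_D$, $0\le j\le n-1$. $K^0(\Gamma)=D^0(\Gamma)=\mathbb{L}_2(\Gamma)$. For $\beta>0$, $H^\beta_{K,D}(\Gamma)=H^\beta(\Gamma)\cap K^{\lfloor\frac\beta2+\frac14\rfloor}(\Gamma)\cap D^{\lfloor\frac\beta2+\frac34\rfloor}(\Gamma)$ with the norm of $H^\beta(\Gamma)$; for $\beta<0$, $H^\beta_{K,D}(\Gamma)$ is the dual of $H^{-\beta}_{K,D}(\Gamma)$ (with pairing extending the $\mathbb{L}_2(\Gamma)$ inner product); $H^0_{K,D}(\Gamma)=\mathbb{L}_2(\Gamma)$. Operator. $\mathcal{L}u=\kappa^2u-\nabla(a\nabla u)$ with domain $H^2(\Gamma)\cap K^1(\Gamma)\cap D^1(\Gamma)$ is self-adjoint, positive, with compact inverse; let $\{\psi_i\}$ be an orthonormal eigenbasis with eigenvalues $\mu_i>0$. For $s\ge0$, $\dot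 H^s_{\mathcal{L}}=\{u\in\mathbb{L}_2(\Gamma):\sum_i\mu_i^s\langle u,\psi_i\rangle^2<\infty\}$, $\dot H^{-s}_{\mathcal{L}}$ is its dual, with norm$^2$ $\sum_i\mu_i^{\pm s}\langle u,\psi_i\rangle^2$. For $\alpha,s\in\mathbb{R}$, $\mathcal{L}^{\alpha/2}u=\sum_i\mu_i^{\alpha/2}\langle u,\psi_i\rangle\psi_i$ is an isometric isomorphism $\dot H^s_{\mathcal{L}}\to\dot H^{s-\alpha}_{\mathcal{L}}$. White noise. $\mathcal{W}$ is a centered Gaussian family $\{\mathcal{W}(h)\}_{h\in\mathbb{L}_2(\Gamma)}$ with covariance $\mathbb{E}[\mathcal{W}(h)\mathcal{W}(g)]=\langle h,g\rangle$, identified with the series $\sum_i\mathcal{W}(\psi_i)\psi_i$, which converges almost surely in $\dot H^{-\frac12-\delta}_{\mathcal{L}}$ for every $\delta>0$. A solution is an element $u$ of the scale $\bigcup_{s\in\mathbb{R}}\dot H^s_{\mathcal{L}}$ with $\mathcal{L}^{\alpha/2}u=\mathcal{W}$; uniqueness is in this scale. Elements of negative order spaces are identified as functionals through the pairing extending the $\mathbb{L}_2(\Gamma)$ inner product. *)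

theory Defs
  imports "HOL-Probability.Probability" "Graph_Theory.Digraph_Component"
begin

section \<open>Compact metric graphs\<close>

text \<open>
  A metric graph is a finite directed multigraph with edge lengths; the direction of an edge only
  records which of its two natural parameterizations serves as the reference coordinate
  \<open>x \<in> [0, len e]\<close>, with \<open>tail e\<close> at \<open>x = 0\<close> and \<open>head e\<close> at \<open>x = len e\<close>.
  Graph-theoretic connectedness is that of the underlying undirected graph.
\<close>

record ('v, 'e) metric_graph = "('v, 'e) pre_digraph" +
  len :: "'e \<Rightarrow> real"

definition compact_metric_graph :: "('v, 'e) metric_graph \<Rightarrow> bool" where
  "compact_metric_graph G \<longleftrightarrow>
     fin_digraph (pre_digraph.truncate G) \<and>
     Digraph_Component.connected (pre_digraph.truncate G) \<and>
     (\<forall>e\<in>arcs G. 0 < len G e)"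

text \<open>
  The two natural parameterizations of an edge are numbered by a Boolean (\<open>True\<close> is the reversed one);
  \<open>Dir G v\<close> consists of those starting at \<open>v\<close>, so that a loop contributes two elements.
\<close>

definition natural_param :: "('v, 'e) metric_graph \<Rightarrow> 'e \<Rightarrow> bool \<Rightarrow> real \<Rightarrow> real" where
  "natural_param G e b x = (if b then len G e - x else x)"

definition Dir :: "('v, 'e) metric_graph \<Rightarrow> 'v \<Rightarrow> ('e \<times> bool) set" where
  "Dir G v = {(e, b). e \<in> arcs G \<and> (if b then head G e else tail G e) = v}"

definition incident_edges :: "('v, 'e) metric_graph \<Rightarrow> 'v set \<Rightarrow> 'e set" where
  "incident_edges G U = {e \<in> arcs G. tail G e \<in> U \<or> head G e \<in> U}"

definition points :: "('v, 'e) metric_graph \<Rightarrow> ('e \<times> real) set" where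
  "points G = (SIGMA e:arcs G. {0..len G e})"

text \<open>Lengths of piecewise linear paths; passing between edge ends glued at a vertex is free.\<close>

inductive path_length :: "('v, 'e) metric_graph \<Rightarrow> 'e \<times> real \<Rightarrow> 'e \<times> real \<Rightarrow> real \<Rightarrow> bool"
  for G where
  segment: "\<lbrakk>(e, x) \<in> points G; (e, y) \<in> points G\<rbrakk> \<Longrightarrow> path_length G (e, x) (e, y) \<bar>x - y\<bar>"
| glue: "\<lbrakk>(e, b) \<in> Dir G v; (f, c) \<in> Dir G v\<rbrakk> \<Longrightarrow>
    path_length G (e, natural_param G e b 0) (f, natural_param G f c 0) 0"
| concat: "\<lbrakk>path_length G p q r; path_length G q q' r'\<rbrakk> \<Longrightarrow> path_length G p q' (r + r')"

definition geodesic_dist :: "('v, 'e) metric_graph \<Rightarrow> 'e \<times> real \<Rightarrow> 'e \<times> real \<Rightarrow> real" where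
  "geodesic_dist G p q = Inf {r. path_length G p q r}"


section \<open>Functions on an interval\<close>

definition L2_iv :: "real \<Rightarrow> (real \<Rightarrow> real) set" where
  "L2_iv l = {f. f \<in> borel_measurable (lebesgue_on {0..l}) \<and>
     integrable (lebesgue_on {0..l}) (\<lambda>x. (f x)\<^sup>2)}"

definition inner_iv :: "real \<Rightarrow> (real \<Rightarrow> real) \<Rightarrow> (real \<Rightarrow> real) \<Rightarrow> real" where
  "inner_iv l f g = integral\<^sup>L (lebesgue_on {0..l}) (\<lambda>x. f x * g x)"

definition test_fun :: "real \<Rightarrow> (real \<Rightarrow> real) \<Rightarrow> bool" where
  "test_fun l \<phi> \<longleftrightarrow>
     (\<forall>n x. (deriv ^^ n) \<phi> differentiable (at x)) \<and>
     (\<exists>K. compact K \<and> K \<subseteq> {0<..<l} \<and> (\<forall>x. x \<notin> K \<longrightarrow> \<phi> x = 0))"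

definition has_weak_deriv :: "nat \<Rightarrow> real \<Rightarrow> (real \<Rightarrow> real) \<Rightarrow> (real \<Rightarrow> real) \<Rightarrow> bool" where
  "has_weak_deriv n l f g \<longleftrightarrow> f \<in> L2_iv l \<and> g \<in> L2_iv l \<and>
     (\<forall>\<phi>. test_fun l \<phi> \<longrightarrow> inner_iv l f ((deriv ^^ n) \<phi>) = (-1) ^ n * inner_iv l g \<phi>)"

text \<open>Some representative; it is unique almost everywhere and is only used where it exists.\<close>

definition weak_deriv :: "nat \<Rightarrow> real \<Rightarrow> (real \<Rightarrow> real) \<Rightarrow> real \<Rightarrow> real" where
  "weak_deriv n l f = (SOME g. has_weak_deriv n l f g)"

definition continuous_rep :: "real \<Rightarrow> (real \<Rightarrow> real) \<Rightarrow> real \<Rightarrow> real" where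
  "continuous_rep l f =
     (SOME g. continuous_on {0..l} g \<and> (AE x in lebesgue_on {0..l}. g x = f x))"

definition Hk_iv :: "nat \<Rightarrow> real \<Rightarrow> (real \<Rightarrow> real) set" where
  "Hk_iv k l = {f \<in> L2_iv l. \<forall>j\<le>k. \<exists>g. has_weak_deriv j l f g}"

definition Hk_iv_norm :: "nat \<Rightarrow> real \<Rightarrow> (real \<Rightarrow> real) \<Rightarrow> real" where
  "Hk_iv_norm k l f = sqrt (\<Sum>j\<le>k. inner_iv l (weak_deriv j l f) (weak_deriv j l f))"


section \<open>Real interpolation\<close>

text \<open>
  The K-method with parameters \<open>(\<theta>, 2)\<close> for a couple \<open>X1 \<subseteq> X0\<close>, where \<open>N0\<close>, \<open>N1\<close> are the norms.
\<close>

definition K_functional ::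
  "('f::minus \<Rightarrow> real) \<Rightarrow> 'f set \<Rightarrow> ('f \<Rightarrow> real) \<Rightarrow> real \<Rightarrow> 'f \<Rightarrow> real" where
  "K_functional N0 X1 N1 t x = (INF y\<in>X1. N0 (x - y) + t * N1 y)"

definition interp_norm_sq ::
  "real \<Rightarrow> ('f::minus \<Rightarrow> real) \<Rightarrow> 'f set \<Rightarrow> ('f \<Rightarrow> real) \<Rightarrow> 'f \<Rightarrow> ennreal" where
  "interp_norm_sq \<theta> N0 X1 N1 x =
     (\<integral>\<^sup>+t\<in>{0<..}. ennreal ((t powr (- \<theta>) * K_functional N0 X1 N1 t x)\<^sup>2 / t) \<partial>lborel)"

definition interp ::
  "real \<Rightarrow> 'f::minus set \<Rightarrow> ('f \<Rightarrow> real) \<Rightarrow> 'f set \<Rightarrow> ('f \<Rightarrow> real) \<Rightarrow> 'f set" where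
  "interp \<theta> X0 N0 X1 N1 = {x \<in> X0. interp_norm_sq \<theta> N0 X1 N1 x < \<infinity>}"

definition interp_norm ::
  "real \<Rightarrow> ('f::minus \<Rightarrow> real) \<Rightarrow> 'f set \<Rightarrow> ('f \<Rightarrow> real) \<Rightarrow> 'f \<Rightarrow> real" where
  "interp_norm \<theta> N0 X1 N1 x = sqrt (enn2real (interp_norm_sq \<theta> N0 X1 N1 x))"

text \<open>\<open>H\<^sup>s(0, l)\<close> for real \<open>s \<ge> 0\<close>.\<close>

definition Hs_iv :: "real \<Rightarrow> real \<Rightarrow> (real \<Rightarrow> real) set" where
  "Hs_iv s l = (let k = nat \<lfloor>s\<rfloor> in
     if s \<in> \<int> then Hk_iv k l
     else {f \<in> Hk_iv k l. weak_deriv k l f \<in>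
             interp (frac s) (L2_iv l) (\<lambda>g. sqrt (inner_iv l g g)) (Hk_iv 1 l) (Hk_iv_norm 1 l)})"


section \<open>Function spaces on a metric graph\<close>

text \<open>
  A function on the graph is given edgewise in the reference coordinates; only its values on
  \<open>points G\<close>, up to null sets, matter.
\<close>

type_synonym 'e graph_fun = "'e \<Rightarrow> real \<Rightarrow> real"

definition L2_graph :: "('v, 'e) metric_graph \<Rightarrow> 'e graph_fun set" where
  "L2_graph G = {u. \<forall>e\<in>arcs G. u e \<in> L2_iv (len G e)}"

definition inner_graph :: "('v, 'e) metric_graph \<Rightarrow> 'e graph_fun \<Rightarrow> 'e graph_fun \<Rightarrow> real" where
  "inner_graph G u v = (\<Sum>e\<in>arcs G. inner_iv (len G e) (u e) (v e))"

definition L2_graph_norm :: "('v, 'e) metric_graph \<Rightarrow> 'e graph_fun \<Rightarrow> real" where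
  "L2_graph_norm G u = sqrt (inner_graph G u u)"

definition Linf_graph :: "('v, 'e) metric_graph \<Rightarrow> 'e graph_fun set" where
  "Linf_graph G = {u. \<exists>C. \<forall>e\<in>arcs G. u e \<in> borel_measurable (lebesgue_on {0..len G e}) \<and>
     (AE x in lebesgue_on {0..len G e}. \<bar>u e x\<bar> \<le> C)}"

definition ess_inf_pos :: "('v, 'e) metric_graph \<Rightarrow> 'e graph_fun \<Rightarrow> bool" where
  "ess_inf_pos G u \<longleftrightarrow> (\<exists>c>0. \<forall>e\<in>arcs G. AE x in lebesgue_on {0..len G e}. c \<le> u e x)"

definition Lipschitz_graph :: "('v, 'e) metric_graph \<Rightarrow> 'e graph_fun \<Rightarrow> bool" where
  "Lipschitz_graph G u \<longleftrightarrow> (\<exists>C. \<forall>(e, x)\<in>points G. \<forall>(f, y)\<in>points G.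
     \<bar>u e x - u f y\<bar> \<le> C * geodesic_dist G (e, x) (f, y))"

definition continuous_graph :: "('v, 'e) metric_graph \<Rightarrow> 'e graph_fun \<Rightarrow> bool" where
  "continuous_graph G u \<longleftrightarrow> (\<exists>w.
     (\<forall>e\<in>arcs G. continuous_on {0..len G e} (w e) \<and>
        (AE x in lebesgue_on {0..len G e}. w e x = u e x)) \<and>
     (\<forall>v\<in>verts G. \<exists>c. \<forall>(e, b)\<in>Dir G v. w e (natural_param G e b 0) = c))"

text \<open>Edgewise weak derivative in the reference coordinates.\<close>

definition D_graph :: "('v, 'e) metric_graph \<Rightarrow> nat \<Rightarrow> 'e graph_fun \<Rightarrow> 'e graph_fun" where
  "D_graph G n u = (\<lambda>e. weak_deriv n (len G e) (u e))"

definition Hk_edges :: "('v, 'e) metric_graph \<Rightarrow> nat \<Rightarrow> 'e graph_fun set" where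
  "Hk_edges G k = {u. \<forall>e\<in>arcs G. u e \<in> Hk_iv k (len G e)}"

definition Hk_graph_norm :: "('v, 'e) metric_graph \<Rightarrow> nat \<Rightarrow> 'e graph_fun \<Rightarrow> real" where
  "Hk_graph_norm G k u = sqrt (\<Sum>e\<in>arcs G. (Hk_iv_norm k (len G e) (u e))\<^sup>2)"

text \<open>Note that \<open>(int k - 1) div 2\<close> is the floor of \<open>(k - 1) / 2\<close>.\<close>

definition Hk_graph :: "('v, 'e) metric_graph \<Rightarrow> nat \<Rightarrow> 'e graph_fun set" where
  "Hk_graph G k = {u \<in> Hk_edges G k.
     \<forall>m. int m \<le> (int k - 1) div 2 \<longrightarrow> continuous_graph G (D_graph G (2 * m) u)}"

definition Hfrac_graph :: "('v, 'e) metric_graph \<Rightarrow> real \<Rightarrow> 'e graph_fun set" where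
  "Hfrac_graph G s =
     interp s (L2_graph G) (L2_graph_norm G) (Hk_graph G 1) (Hk_graph_norm G 1)"

definition Hfrac_graph_norm :: "('v, 'e) metric_graph \<Rightarrow> real \<Rightarrow> 'e graph_fun \<Rightarrow> real" where
  "Hfrac_graph_norm G s =
     interp_norm s (L2_graph_norm G) (Hk_graph G 1) (Hk_graph_norm G 1)"

definition Hfrac_edges :: "('v, 'e) metric_graph \<Rightarrow> real \<Rightarrow> 'e graph_fun set" where
  "Hfrac_edges G s =
     interp s (L2_graph G) (L2_graph_norm G) (Hk_edges G 1) (Hk_graph_norm G 1)"

definition Hfrac_edges_norm :: "('v, 'e) metric_graph \<Rightarrow> real \<Rightarrow> 'e graph_fun \<Rightarrow> real" where
  "Hfrac_edges_norm G s =
     interp_norm s (L2_graph_norm G) (Hk_edges G 1) (Hk_graph_norm G 1)"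

text \<open>\<open>H\<^sup>\<alpha>\<close> on the graph, for real \<open>\<alpha> > 0\<close>.\<close>

definition H_graph :: "('v, 'e) metric_graph \<Rightarrow> real \<Rightarrow> 'e graph_fun set" where
  "H_graph G \<alpha> = (let k = nat \<lfloor>\<alpha>\<rfloor>; s = frac \<alpha> in
     if \<alpha> \<in> \<int> then Hk_graph G k
     else if \<alpha> < 1 then Hfrac_graph G \<alpha>
     else {u \<in> Hk_graph G k.
             D_graph G k u \<in> (if odd k then Hfrac_edges G s else Hfrac_graph G s)})"

definition H_graph_norm :: "('v, 'e) metric_graph \<Rightarrow> real \<Rightarrow> 'e graph_fun \<Rightarrow> real" where
  "H_graph_norm G \<alpha> u = (let k = nat \<lfloor>\<alpha>\<rfloor>; s = frac \<alpha> in
     if \<alpha> \<in> \<int> then Hk_graph_norm G k u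
     else if \<alpha> < 1 then Hfrac_graph_norm G \<alpha> u
     else sqrt ((Hk_graph_norm G k u)\<^sup>2 +
            (if odd k then Hfrac_edges_norm G s (D_graph G k u)
             else Hfrac_graph_norm G s (D_graph G k u))\<^sup>2))"


section \<open>Vertex conditions\<close>

definition outward_deriv ::
  "('v, 'e) metric_graph \<Rightarrow> 'e \<Rightarrow> bool \<Rightarrow> 'e graph_fun \<Rightarrow> real" where
  "outward_deriv G e b u =
     vector_derivative (\<lambda>t. continuous_rep (len G e) (u e) (natural_param G e b t)) (at_right 0)"

definition end_value :: "('v, 'e) metric_graph \<Rightarrow> 'e \<Rightarrow> bool \<Rightarrow> 'e graph_fun \<Rightarrow> real" where
  "end_value G e b u = continuous_rep (len G e) (u e) (natural_param G e b 0)"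

definition K_space :: "('v, 'e) metric_graph \<Rightarrow> 'v set \<Rightarrow> nat \<Rightarrow> 'e graph_fun set" where
  "K_space G VK n = {u \<in> L2_graph G. n = 0 \<or>
     (\<exists>s > 2 * real n - 1/2. \<forall>e\<in>incident_edges G VK. u e \<in> Hs_iv s (len G e)) \<and>
     (\<forall>v\<in>VK. \<forall>j<n. (\<Sum>(e, b)\<in>Dir G v. outward_deriv G e b (D_graph G (2 * j) u)) = 0)}"

definition D_space :: "('v, 'e) metric_graph \<Rightarrow> 'v set \<Rightarrow> nat \<Rightarrow> 'e graph_fun set" where
  "D_space G VD n = {u \<in> L2_graph G. n = 0 \<or>
     (\<exists>s > 2 * real n - 3/2. \<forall>e\<in>incident_edges G VD. u e \<in> Hs_iv s (len G e)) \<and>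
     (\<forall>v\<in>VD. \<forall>j<n. \<forall>(e, b)\<in>Dir G v. end_value G e b (D_graph G (2 * j) u) = 0)}"

definition H_KD :: "('v, 'e) metric_graph \<Rightarrow> 'v set \<Rightarrow> 'v set \<Rightarrow> real \<Rightarrow> 'e graph_fun set" where
  "H_KD G VK VD \<beta> =
     (if \<beta> = 0 then L2_graph G
      else H_graph G \<beta> \<inter> K_space G VK (nat \<lfloor>\<beta>/2 + 1/4\<rfloor>) \<inter> D_space G VD (nat \<lfloor>\<beta>/2 + 3/4\<rfloor>))"

definition dual_space :: "'e graph_fun set \<Rightarrow> ('e graph_fun \<Rightarrow> real) \<Rightarrow> ('e graph_fun \<Rightarrow> real) set" where
  "dual_space X N = {F \<in> extensional X.
     (\<forall>\<phi>\<in>X. \<forall>\<eta>\<in>X. \<forall>c d. F (\<lambda>e x. c * \<phi> e x + d * \<eta> e x) = c * F \<phi> + d * F \<eta>) \<and>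
     (\<exists>C. \<forall>\<phi>\<in>X. \<bar>F \<phi>\<bar> \<le> C * N \<phi>)}"


section \<open>The operator and its scale of spaces\<close>

definition dom_op :: "('v, 'e) metric_graph \<Rightarrow> 'v set \<Rightarrow> 'v set \<Rightarrow> 'e graph_fun set" where
  "dom_op G VK VD = H_graph G 2 \<inter> K_space G VK 1 \<inter> D_space G VD 1"

definition graph_op ::
  "('v, 'e) metric_graph \<Rightarrow> 'e graph_fun \<Rightarrow> 'e graph_fun \<Rightarrow> 'e graph_fun \<Rightarrow> 'e graph_fun" where
  "graph_op G a \<kappa> u = (\<lambda>e x. (\<kappa> e x)\<^sup>2 * u e x - D_graph G 1 (\<lambda>e y. a e y * D_graph G 1 u e y) e x)"

text \<open>
  The index set \<open>I\<close> is a set of naturals rather than all of them only because of the degenerate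
  graph consisting of a single vertex, where \<open>L\<^sub>2\<close> is trivial.
\<close>

definition orthonormal_eigenbasis ::
  "('v, 'e) metric_graph \<Rightarrow> 'v set \<Rightarrow> 'v set \<Rightarrow> 'e graph_fun \<Rightarrow> 'e graph_fun \<Rightarrow>
   nat set \<Rightarrow> (nat \<Rightarrow> 'e graph_fun) \<Rightarrow> (nat \<Rightarrow> real) \<Rightarrow> bool" where
  "orthonormal_eigenbasis G VK VD a \<kappa> I \<psi> \<mu> \<longleftrightarrow>
     (\<forall>i\<in>I. \<psi> i \<in> dom_op G VK VD \<and> 0 < \<mu> i \<and>
        (\<forall>e\<in>arcs G. AE x in lebesgue_on {0..len G e}. graph_op G a \<kappa> (\<psi> i) e x = \<mu> i * \<psi> i e x)) \<and>
     (\<forall>i\<in>I. \<forall>j\<in>I. inner_graph G (\<psi> i) (\<psi> j) = (if i = j then 1 else 0)) \<and>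
     (\<forall>u\<in>L2_graph G.
        ((\<lambda>F. L2_graph_norm G (\<lambda>e x. u e x - (\<Sum>i\<in>F. inner_graph G u (\<psi> i) * \<psi> i e x)))
           \<longlongrightarrow> 0) (finite_subsets_at_top I))"

text \<open>The spaces of nonnegative order, as sets of functions.\<close>

definition hdot_fun ::
  "('v, 'e) metric_graph \<Rightarrow> nat set \<Rightarrow> (nat \<Rightarrow> 'e graph_fun) \<Rightarrow> (nat \<Rightarrow> real) \<Rightarrow> real \<Rightarrow>
   'e graph_fun set" where
  "hdot_fun G I \<psi> \<mu> s =
     {u \<in> L2_graph G. (\<lambda>i. \<mu> i powr s * (inner_graph G u (\<psi> i))\<^sup>2) summable_on I}"

definition hdot_fun_norm ::
  "('v, 'e) metric_graph \<Rightarrow> nat set \<Rightarrow> (nat \<Rightarrow> 'e graph_fun) \<Rightarrow> (nat \<Rightarrow> real) \<Rightarrow> real \<Rightarrow>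
   'e graph_fun \<Rightarrow> real" where
  "hdot_fun_norm G I \<psi> \<mu> s u =
     sqrt (\<Sum>\<^sub>\<infinity>i\<in>I. \<mu> i powr s * (inner_graph G u (\<psi> i))\<^sup>2)"

text \<open>
  To form the union of the scale, all its elements are represented as functionals on the intersection
  of the spaces of nonnegative order. This intersection contains the eigenfunctions and is dense in each
  of these spaces, hence functions (acting through the \<open>L\<^sub>2\<close> inner product, up to null sets) and
  elements of the duals are determined by their restrictions to it.
\<close>

definition hdot_test ::
  "('v, 'e) metric_graph \<Rightarrow> nat set \<Rightarrow> (nat \<Rightarrow> 'e graph_fun) \<Rightarrow> (nat \<Rightarrow> real) \<Rightarrow> 'e graph_fun set" where
  "hdot_test G I \<psi> \<mu> = (\<Inter>s\<in>{0..}. hdot_fun G I \<psi> \<mu> s)"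

definition fun_functional ::
  "('v, 'e) metric_graph \<Rightarrow> nat set \<Rightarrow> (nat \<Rightarrow> 'e graph_fun) \<Rightarrow> (nat \<Rightarrow> real) \<Rightarrow>
   'e graph_fun \<Rightarrow> ('e graph_fun \<Rightarrow> real)" where
  "fun_functional G I \<psi> \<mu> u = restrict (inner_graph G u) (hdot_test G I \<psi> \<mu>)"

definition hdot ::
  "('v, 'e) metric_graph \<Rightarrow> nat set \<Rightarrow> (nat \<Rightarrow> 'e graph_fun) \<Rightarrow> (nat \<Rightarrow> real) \<Rightarrow> real \<Rightarrow>
   ('e graph_fun \<Rightarrow> real) set" where
  "hdot G I \<psi> \<mu> s =
     (if 0 \<le> s then fun_functional G I \<psi> \<mu> ` hdot_fun G I \<psi> \<mu> s
      else (\<lambda>F. restrict F (hdot_test G I \<psi> \<mu>)) `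
             dual_space (hdot_fun G I \<psi> \<mu> (- s)) (hdot_fun_norm G I \<psi> \<mu> (- s)))"

definition hdot_norm ::
  "nat set \<Rightarrow> (nat \<Rightarrow> 'e graph_fun) \<Rightarrow> (nat \<Rightarrow> real) \<Rightarrow> real \<Rightarrow> ('e graph_fun \<Rightarrow> real) \<Rightarrow> real" where
  "hdot_norm I \<psi> \<mu> s U = sqrt (\<Sum>\<^sub>\<infinity>i\<in>I. \<mu> i powr s * (U (\<psi> i))\<^sup>2)"

definition op_power ::
  "('v, 'e) metric_graph \<Rightarrow> nat set \<Rightarrow> (nat \<Rightarrow> 'e graph_fun) \<Rightarrow> (nat \<Rightarrow> real) \<Rightarrow> real \<Rightarrow>
   ('e graph_fun \<Rightarrow> real) \<Rightarrow> ('e graph_fun \<Rightarrow> real)" where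
  "op_power G I \<psi> \<mu> \<gamma> U =
     restrict (\<lambda>\<phi>. \<Sum>\<^sub>\<infinity>i\<in>I. \<mu> i powr \<gamma> * U (\<psi> i) * inner_graph G (\<psi> i) \<phi>) (hdot_test G I \<psi> \<mu>)"

text \<open>
  The elements of the scale lying in \<open>H_KD\<close> of arbitrary real order. For negative order, an element
  \<open>F\<close> of a dual of \<open>hdot_fun\<close> is identified with the functional that it induces on \<open>H_KD G VK VD (- \<beta>)\<close>,
  provided that it is defined on all of that space.
\<close>

definition in_H_KD ::
  "('v, 'e) metric_graph \<Rightarrow> 'v set \<Rightarrow> 'v set \<Rightarrow> nat set \<Rightarrow> (nat \<Rightarrow> 'e graph_fun) \<Rightarrow> (nat \<Rightarrow> real) \<Rightarrow>
   real \<Rightarrow> ('e graph_fun \<Rightarrow> real) \<Rightarrow> bool" where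
  "in_H_KD G VK VD I \<psi> \<mu> \<beta> U \<longleftrightarrow>
     (if 0 \<le> \<beta> then U \<in> fun_functional G I \<psi> \<mu> ` H_KD G VK VD \<beta>
      else \<exists>t\<ge>0. \<exists>F\<in>dual_space (hdot_fun G I \<psi> \<mu> t) (hdot_fun_norm G I \<psi> \<mu> t).
             U = restrict F (hdot_test G I \<psi> \<mu>) \<and>
             H_KD G VK VD (- \<beta>) \<subseteq> hdot_fun G I \<psi> \<mu> t \<and>
             restrict F (H_KD G VK VD (- \<beta>)) \<in>
               dual_space (H_KD G VK VD (- \<beta>)) (H_graph_norm G (- \<beta>)))"


section \<open>White noise and solutions\<close>

definition gaussian_rv :: "'w measure \<Rightarrow> ('w \<Rightarrow> real) \<Rightarrow> bool" where
  "gaussian_rv M X \<longleftrightarrow> X \<in> borel_measurable M \<and>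
     (\<exists>m. (AE \<omega> in M. X \<omega> = m) \<or>
        (\<exists>\<sigma>>0. distributed M lborel X (\<lambda>x. ennreal (normal_density m \<sigma> x))))"

definition white_noise ::
  "('v, 'e) metric_graph \<Rightarrow> 'w measure \<Rightarrow> ('e graph_fun \<Rightarrow> 'w \<Rightarrow> real) \<Rightarrow> bool" where
  "white_noise G M W \<longleftrightarrow> prob_space M \<and>
     (\<forall>A c. finite A \<and> A \<subseteq> L2_graph G \<longrightarrow> gaussian_rv M (\<lambda>\<omega>. \<Sum>h\<in>A. c h * W h \<omega>)) \<and>
     (\<forall>h\<in>L2_graph G. integral\<^sup>L M (W h) = 0) \<and>
     (\<forall>h\<in>L2_graph G. \<forall>g\<in>L2_graph G. integral\<^sup>L M (\<lambda>\<omega>. W h \<omega> * W g \<omega>) = inner_graph G h g)"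

text \<open>\<open>Z\<close> is the sum of the series \<open>\<Sum>i. W (\<psi> i) \<omega> * \<psi> i\<close> in the spaces of order below \<open>-1/2\<close>.\<close>

definition is_noise_path ::
  "('v, 'e) metric_graph \<Rightarrow> nat set \<Rightarrow> (nat \<Rightarrow> 'e graph_fun) \<Rightarrow> (nat \<Rightarrow> real) \<Rightarrow>
   ('e graph_fun \<Rightarrow> 'w \<Rightarrow> real) \<Rightarrow> 'w \<Rightarrow> ('e graph_fun \<Rightarrow> real) \<Rightarrow> bool" where
  "is_noise_path G I \<psi> \<mu> W \<omega> Z \<longleftrightarrow> (\<forall>\<delta>>0. Z \<in> hdot G I \<psi> \<mu> (- 1/2 - \<delta>) \<and>
     ((\<lambda>F. hdot_norm I \<psi> \<mu> (- 1/2 - \<delta>)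
         (\<lambda>\<phi>. Z \<phi> - (\<Sum>i\<in>F. W (\<psi> i) \<omega> * fun_functional G I \<psi> \<mu> (\<psi> i) \<phi>)))
       \<longlongrightarrow> 0) (finite_subsets_at_top I))"

definition is_solution ::
  "('v, 'e) metric_graph \<Rightarrow> nat set \<Rightarrow> (nat \<Rightarrow> 'e graph_fun) \<Rightarrow> (nat \<Rightarrow> real) \<Rightarrow> real \<Rightarrow>
   ('e graph_fun \<Rightarrow> 'w \<Rightarrow> real) \<Rightarrow> 'w \<Rightarrow> ('e graph_fun \<Rightarrow> real) \<Rightarrow> bool" where
  "is_solution G I \<psi> \<mu> \<alpha> W \<omega> U \<longleftrightarrow>
     U \<in> (\<Union>s. hdot G I \<psi> \<mu> s) \<and> is_noise_path G I \<psi> \<mu> W \<omega> (op_power G I \<psi> \<mu> (\<alpha> / 2) U)"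

end

(*
  Expand u in the eigenbasis: formally u = sum_i mu_i^(-alpha/2) W(psi_i) psi_i. Point evaluations are bounded
  on the form domain, which gives Weyl's bound: at most C sqrt(M) eigenvalues are <= M. Hence
  sum_i mu_i^(-s) W(psi_i)^2 converges almost surely for all s > 1/2. This gives existence and uniqueness
  in the scale of spaces defined by L, and leaves the comparison of that scale with the Sobolev scale.
  Both inclusions are proved with a loss of an arbitrarily small order, by dyadic approximation: the
  partial sums over mu_i <= 4^j approximate u in the K-functional, and the traces in the vertex
  conditions pass to the limit; conversely the approximations supplied by the K-functional are corrected
  near the vertices, at scale 2^(-j), so that they satisfy the vertex conditions, and Green's formula then
  bounds the tails of their eigenfunction coefficients.
*)
theory Submission
  imports Defs
begin

text \<open>An exact comparison of the two scales would require interpolating subspaces cut out by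
  vertex conditions, which is delicate at the orders 1/2 and 3/2, where a trace just ceases to
  exist. Losing a little order avoids this: the K-functional is used at the parameters h = 2^(-j),
  and a critical exponent is replaced by a slightly smaller one. Frequencies match since eigenvalues
  near 4^j belong to the length h. The corrections cost nothing because of the exponent 1/2 in
  \<open>AC_sup_bound\<close>: an approximation of order \<theta> has end errors of size h^(\<theta>
  - 1/2), and a unit bump of width proportional to h has norm of order h^(1/2) and derivative norm
  of order h^(-1/2). Hence the error h^\<theta> and the derivative norm h^(\<theta> - 1) are both
  preserved. A Lipschitz coefficient \<open>a\<close> yields two derivatives, so the work is done at
  orders up to 2; this is where -3/2 < \<alpha> < 5/2, that is |\<alpha> - 1/2| < 2, enters. As
  functions are determined only up to null sets, exact representatives are carried along: a function
  with its derivatives, each the integral of the next.\<close>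

abbreviation (input) hp :: "nat => real => real" where "hp j s \<equiv> ((1/2) ^ j) powr s"
abbreviation (input) lc :: "real => ('e => real => real) => real => ('e => real => real) => 'e => real => real" where
 "lc c u d v \<equiv> %e x. c * u e x + d * v e x"
abbreviation (input) tends :: "(nat => 'a::topological_space) => 'a => bool" (infix "---->" 60) where
 "X ----> l \<equiv> X \<longlonglongrightarrow> l"
abbreviation (input) leb :: "real => real measure" where "leb l \<equiv> lebesgue_on {0..l}"
abbreviation (input) aeq :: "real => (real => real) => (real => real) => bool" where
 "aeq l f g \<equiv> AE x in leb l. f x = g x"
abbreviation (input) cont :: "real => (real => real) => bool" where "cont l \<equiv> continuous_on {0..l}"

section \<open>Test functions\<close>

definition smooth :: "(real => real) => bool" where
 "smooth f \<longleftrightarrow> (\<forall>n x. (deriv ^^ n) f differentiable (at x))"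

text \<open>Derivatives are quantified existentially here instead of being named by
  \<open>deriv\<close>, so that closure under sums, products and affine substitutions follows by one
  induction on the order.\<close>

fun ndiff :: "nat => (real => real) => bool" where
 "ndiff 0 f = True"
| "ndiff (Suc n) f = (\<exists>f'. (\<forall>x. (f has_real_derivative f' x) (at x)) & ndiff n f')"

lemma ndiff_SucD: "ndiff (Suc n) f ==> ndiff n f"
proof (induction n arbitrary: f)
 case (Suc n)
 then obtain f' where "\<forall>x. (f has_real_derivative f' x) (at x)" "ndiff (Suc n) f'" by auto
 with Suc.IH show ?case by auto
qed simp

lemma smooth_imp_ndiff: "smooth f ==> ndiff n f"
proof (induction n arbitrary: f)
 case (Suc n)
 have d: "(f has_real_derivative deriv f x) (at x)" for x
  using Suc.prems[unfolded smooth_def, rule_format, of 0 x]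
  by (simp add: DERIV_deriv_iff_real_differentiable)
 have "smooth (deriv f)"
  unfolding smooth_def
 proof (intro allI)
  fix m x show "(deriv ^^ m) (deriv f) differentiable at x"
   using Suc.prems[unfolded smooth_def, rule_format, of "Suc m" x] by (simp add: funpow_swap1)
 qed
 thus ?case using Suc.IH d by auto
qed simp

lemma ndiff_imp_differentiable: "ndiff (Suc n) f ==> (deriv ^^ n) f differentiable at x"
proof (induction n arbitrary: f)
 case 0
 thus ?case using real_differentiable_def by auto
next
 case (Suc n)
 then obtain f' where f': "\<forall>x. (f has_real_derivative f' x) (at x)" "ndiff (Suc n) f'" by auto
 hence "deriv f = f'" by (intro ext DERIV_imp_deriv) auto
 thus ?case using Suc.IH[OF f'(2)] by (simp add: funpow_swap1)
qed

lemma smooth_iff_ndiff: "smooth f \<longleftrightarrow> (\<forall>n. ndiff n f)"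
 using smooth_imp_ndiff ndiff_imp_differentiable unfolding smooth_def by blast

lemma smooth_imp_DERIV: "smooth f ==> (f has_real_derivative deriv f x) (at x)"
 unfolding smooth_def by (metis DERIV_deriv_iff_real_differentiable funpow_0)

lemma smooth_deriv: "smooth f ==> smooth (deriv f)"
 unfolding smooth_def by (metis comp_apply funpow_Suc_right)

lemma smooth_if_DERIV: "[|!!x. (f has_real_derivative f' x) (at x); smooth f'|] ==> smooth f"
 unfolding smooth_iff_ndiff by (metis ndiff.elims(3) ndiff.simps(2) not0_implies_Suc)

text \<open>Coinduction: a class closed under differentiation consists of smooth functions. It suits
  exp(-1/x), whose higher derivatives are needed only up to an unspecified polynomial in
  1/x.\<close>

lemma smooth_coinduct:
 assumes "f \<in> S" and "!!f. f \<in> S ==> \<exists>f'\<in>S. \<forall>x. (f has_real_derivative f' x) (at x)"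
 shows "smooth f"
proof -
 have "f \<in> S ==> ndiff n f" for n f
  by (induction n arbitrary: f) (use assms(2) in fastforce)+
 with assms(1) show ?thesis by (simp add: smooth_iff_ndiff)
qed

lemma ndiff_add: "[|ndiff n f; ndiff n g|] ==> ndiff n (%x. f x + g x)"
proof (induction n arbitrary: f g)
 case (Suc n)
 then obtain f' g' where "\<forall>x. (f has_real_derivative f' x) (at x)" "ndiff n f'"
  "\<forall>x. (g has_real_derivative g' x) (at x)" "ndiff n g'" by auto
 with Suc.IH show ?case by (auto intro!: exI[of _ "%x. f' x + g' x"] derivative_intros)
qed simp

lemma ndiff_const: "ndiff n (%x. c)"
proof (induction n arbitrary: c)
 case (Suc n)
 thus ?case by (auto intro!: exI[of _ "%x. 0"])
qed simp

lemma ndiff_mult: "[|ndiff n f; ndiff n g|] ==> ndiff n (%x. f x * g x)"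
proof (induction n arbitrary: f g)
 case (Suc n)
 then obtain f' g' where *: "\<forall>x. (f has_real_derivative f' x) (at x)" "ndiff n f'"
  "\<forall>x. (g has_real_derivative g' x) (at x)" "ndiff n g'" by auto
 have "ndiff n f" "ndiff n g" using Suc.prems ndiff_SucD by blast+
 hence "ndiff n (%x. f' x * g x + f x * g' x)" using * Suc.IH by (intro ndiff_add) auto
 moreover have "((%x. f x * g x) has_real_derivative f' x * g x + f x * g' x) (at x)" for x
  using * by (auto intro!: derivative_eq_intros)
 ultimately show ?case
  unfolding ndiff.simps by (intro exI[of _ "%x. f' x * g x + f x * g' x"]) blast
qed simp

lemma ndiff_affine: "ndiff n f ==> ndiff n (%x. f (c * x + d))"
proof (induction n arbitrary: f)
 case (Suc n)
 then obtain f' where *: "\<forall>x. (f has_real_derivative f' x) (at x)" "ndiff n f'" by auto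
 have "ndiff n (%x. c * f' (c * x + d))" using Suc.IH[OF *(2)] by (intro ndiff_mult ndiff_const)
 moreover have "((%x. f (c * x + d)) has_real_derivative c * f' (c * x + d)) (at x)" for x
  by (rule DERIV_cong[OF DERIV_chain2[OF *(1)[rule_format]]]) (auto intro!: derivative_eq_intros)
 ultimately show ?case
  unfolding ndiff.simps by (intro exI[of _ "%x. c * f' (c * x + d)"]) blast
qed simp

lemma smooth_add: "smooth f ==> smooth g ==> smooth (%x. f x + g x)"
 by (simp add: smooth_iff_ndiff ndiff_add)

lemma smooth_mult: "smooth f ==> smooth g ==> smooth (%x. f x * g x)"
 by (simp add: smooth_iff_ndiff ndiff_mult)

lemma smooth_const: "smooth (%x. c)"
 by (simp add: smooth_iff_ndiff ndiff_const)

lemma smooth_affine: "smooth f ==> smooth (%x. f (c * x + d))"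
 by (simp add: smooth_iff_ndiff ndiff_affine)

definition smooth_step :: "real => real" where
 "smooth_step x = (if x > 0 then exp (- (1 / x)) else 0)"

lemma poly_exp_tendsto_0: "((%y::real. poly Q y * exp (- y)) \<longlongrightarrow> 0) at_top"
proof -
 have "((%y::real. \<Sum>i\<le>degree Q. coeff Q i * (y ^ i / exp y)) \<longlongrightarrow> (\<Sum>i\<le>degree Q. coeff Q i * 0)) at_top"
  by (intro tendsto_intros tendsto_power_div_exp_0)
 thus ?thesis by (simp add: poly_altdef sum_distrib_right exp_minus divide_inverse mult.assoc)
qed

lemma smooth_smooth_step: "smooth smooth_step"
proof (rule smooth_coinduct)
 let ?E = "%P x::real. if x > 0 then poly P (1 / x) * exp (- (1 / x)) else 0"
 show "smooth_step \<in> range ?E"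
  by (rule image_eqI[of _ _ 1]) (auto simp: smooth_step_def fun_eq_iff)
 fix f assume "f \<in> range ?E"
 then obtain P where f: "f = ?E P" by auto
 \<comment> \<open>The derivative of P(1/x) exp(-1/x) is x^(-2) (P - P')(1/x) exp(-1/x); the factor
   \<open>[:0, 0, 1:]\<close> is x^(-2) in the variable 1/x.\<close>
 define Q where "Q = [:0, 0, 1:] * (P - pderiv P)"
 have "(?E P has_real_derivative ?E Q x) (at x)" for x
 proof -
  consider "x > 0" | "x < 0" | "x = 0" by linarith
  thus ?thesis
  proof cases
   case 1
   have "((%x. poly P (1 / x) * exp (- (1 / x))) has_real_derivative ?E Q x) (at x)"
    using 1 by (auto intro!: derivative_eq_intros simp: Q_def field_simps power2_eq_square)
   thus ?thesis
    by (rule has_field_derivative_transform_within_open[where S = "{0<..}"]) (use 1 in auto)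
  next
   case 2
   have "((%x. 0) has_real_derivative ?E Q x) (at x)" using 2 by auto
   thus ?thesis
    by (rule has_field_derivative_transform_within_open[where S = "{..<0}"]) (use 2 in auto)
  next
   case 3
   have inv: "filterlim (%x::real. 1 / x) at_top (at_right 0)"
    using filterlim_inverse_at_top_right by (simp add: inverse_eq_divide)
   have "((%h. poly ([:0, 1:] * P) (1 / h) * exp (- (1 / h))) \<longlongrightarrow> 0) (at_right 0)"
    by (rule filterlim_compose[OF poly_exp_tendsto_0 inv])
   hence r: "((%h. ?E P h / h) \<longlongrightarrow> 0) (at_right 0)"
    by (rule Lim_transform_eventually) (auto simp: eventually_at_filter field_simps)
   have l: "((%h. ?E P h / h) \<longlongrightarrow> 0) (at_left 0)"
    by (rule Lim_transform_eventually[OF tendsto_const]) (auto simp: eventually_at_filter)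
   show ?thesis
    using l r by (simp add: 3 has_field_derivative_iff filterlim_split_at)
  qed
 qed
 thus "\<exists>f'\<in>range ?E. \<forall>x. (f has_real_derivative f' x) (at x)"
  unfolding f by (intro bexI[of _ "?E Q"]) blast+
qed

lemma smooth_step_bounds: "0 <= smooth_step x" "smooth_step x <= 1"
 by (auto simp: smooth_step_def)

text \<open>For \<open>n > 0\<close> the factors are \<open>smooth_step\<close> at n (x - a) and at
  n (b - x). The product vanishes outside the interval from \<open>a\<close> to \<open>b\<close> and
  tends to 1 at an inner point as \<open>n\<close> grows.\<close>

definition plateau :: "real => real => real => real => real" where
 "plateau n a b x = smooth_step (n * x + (- n * a)) * smooth_step (- n * x + n * b)"

lemma test_fun_iff: "test_fun l \<phi> \<longleftrightarrow> smooth \<phi> &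
  (\<exists>K. compact K & K \<subseteq> {0<..<l} & (\<forall>x. x \<notin> K --> \<phi> x = 0))"
 by (simp add: test_fun_def smooth_def)

lemma test_fun_plateau:
 assumes "0 < a" "b < l" "0 < n"
 shows "test_fun l (plateau n a b)"
proof -
 have "smooth (plateau n a b)"
  unfolding plateau_def by (intro smooth_mult smooth_affine smooth_smooth_step)
 moreover have "plateau n a b x = 0" if "x \<notin> {a..b}" for x
 proof -
  have "n * x <= n * a \<or> n * b <= n * x" using that assms by auto
  thus ?thesis by (auto simp: plateau_def smooth_step_def)
 qed
 ultimately show ?thesis using assms unfolding test_fun_iff
  by (intro conjI exI[of _ "{a..b}"]) auto
qed

lemma plateau_bounds: "0 <= plateau n a b x" "plateau n a b x <= 1"
 unfolding plateau_def by (auto intro!: mult_nonneg_nonneg mult_le_one smooth_step_bounds)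

lemma test_fun_deriv:
 assumes "test_fun l \<phi>" shows "test_fun l (deriv \<phi>)"
proof -
 obtain K where K: "compact K" "K \<subseteq> {0<..<l}" "!!x. x \<notin> K ==> \<phi> x = 0" and s: "smooth \<phi>"
  using assms unfolding test_fun_iff by blast
 have "deriv \<phi> x = 0" if "x \<notin> K" for x
 proof (rule DERIV_imp_deriv)
  have "open (- K)" using K(1) by (simp add: compact_imp_closed open_Compl)
  thus "(\<phi> has_real_derivative 0) (at x)"
   by (rule has_field_derivative_transform_within_open[where f = "%x. 0", rotated])
    (use that K in auto)
 qed
 with K s show ?thesis unfolding test_fun_iff by (auto intro: smooth_deriv)
qed

lemma test_fun_lin:
 assumes "test_fun l \<phi>" "test_fun l \<eta>"
 shows "test_fun l (%x. \<phi> x + c * \<eta> x)"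
proof -
 obtain K L where K: "compact K" "K \<subseteq> {0<..<l}" "!!x. x \<notin> K ==> \<phi> x = 0" and s: "smooth \<phi>"
  and L: "compact L" "L \<subseteq> {0<..<l}" "!!x. x \<notin> L ==> \<eta> x = 0" and s': "smooth \<eta>"
  using assms unfolding test_fun_iff by blast
 have "compact (K \<union> L)" "K \<union> L \<subseteq> {0<..<l}" "!!x. x \<notin> K \<union> L ==> \<phi> x + c * \<eta> x = 0"
  using K L by auto
 moreover have "smooth (%x. \<phi> x + c * \<eta> x)"
  by (intro smooth_add smooth_mult smooth_const s s')
 ultimately show ?thesis unfolding test_fun_iff by blast
qed

lemma test_fun_isCont: "test_fun l \<phi> ==> isCont \<phi> x"
 unfolding test_fun_iff using smooth_imp_DERIV DERIV_isCont by blast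

lemma test_fun_continuous_on: "test_fun l \<phi> ==> continuous_on A \<phi>"
 using test_fun_isCont continuous_at_imp_continuous_on by blast

lemma test_fun_DERIV: "test_fun l \<phi> ==> (\<phi> has_real_derivative deriv \<phi> x) (at x)"
 unfolding test_fun_iff using smooth_imp_DERIV by blast

lemma test_fun_ends: "test_fun l \<phi> ==> \<phi> 0 = 0" "test_fun l \<phi> ==> \<phi> l = 0"
 unfolding test_fun_iff by (metis greaterThanLessThan_iff less_irrefl subsetD)+

text \<open>The primitive vanishing at 0 is constant on either side of the support of \<xi>. The
  constant on the right is the integral of \<xi>, so mean zero is exactly what keeps the support
  compact in the open interval.\<close>

lemma test_fun_antiderivative:
 assumes t: "test_fun l \<xi>" and l: "0 < l" and i: "integral {0..l} \<xi> = 0"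
 shows "\<exists>\<Phi>. test_fun l \<Phi> & deriv \<Phi> = \<xi>"
proof -
 obtain K where K: "compact K" "K \<subseteq> {0<..<l}" "!!x. x \<notin> K ==> \<xi> x = 0" and s: "smooth \<xi>"
  using t unfolding test_fun_iff by blast
 have "\<exists>c d. 0 < c & c <= d & d < l & K \<subseteq> {c..d}"
 proof (cases "K = {}")
  case True thus ?thesis using l by (intro exI[of _ "l/2"]) auto
 next
  case False
  obtain c where "c \<in> K" "\<forall>x\<in>K. c <= x" using compact_attains_inf[OF K(1) False] by auto
  moreover obtain d where "d \<in> K" "\<forall>x\<in>K. x <= d" using compact_attains_sup[OF K(1) False] by auto
  ultimately show ?thesis using K(2) by (intro exI[of _ c] exI[of _ d]) auto
 qed
 then obtain c d where cd: "0 < c" "c <= d" "d < l" "K \<subseteq> {c..d}" by blast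
 obtain \<Phi>0 where P0: "!!x. (\<Phi>0 has_real_derivative \<xi> x) (at x)"
  using einterval_antiderivative[of "-\<infinity>" "\<infinity>" \<xi>] test_fun_isCont[OF t]
  by (auto simp: has_real_derivative_iff_has_vector_derivative)
 define \<Phi> where "\<Phi> x = \<Phi>0 x - \<Phi>0 0" for x
 have P: "(\<Phi> has_real_derivative \<xi> x) (at x)" for x
  unfolding \<Phi>_def using P0 by (auto intro!: derivative_eq_intros)
 have z: "\<xi> x = 0" if "x < c \<or> d < x" for x using K(3) cd(4) that by fastforce
 have const: "\<Phi> x = \<Phi> y" if xy: "x < y" "y <= c \<or> d <= x" for x y
 proof -
  obtain z where z': "x < z" "z < y" "\<Phi> y - \<Phi> x = (y - x) * \<xi> z"
   using MVT2[OF xy(1), of \<Phi> \<xi>] P by blast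
  hence "\<xi> z = 0" using z[of z] xy(2) by auto
  thus ?thesis using z'(3) by simp
 qed
 have "(\<xi> has_integral (\<Phi> l - \<Phi> 0)) {0..l}"
  using P l by (intro fundamental_theorem_of_calculus)
   (auto simp flip: has_real_derivative_iff_has_vector_derivative intro: DERIV_subset)
 hence Pl: "\<Phi> l = 0" using i by (simp add: integral_unique \<Phi>_def)
 have P0: "\<Phi> 0 = 0" by (simp add: \<Phi>_def)
 have "\<Phi> x = 0" if "x \<notin> {c..d}" for x
 proof (cases "x < c")
  case True
  thus ?thesis using const[of x 0] const[of 0 x] P0 cd
   by (cases x "0::real" rule: linorder_cases) auto
 next
  case False
  hence "d < x" using that by auto
  thus ?thesis using const[of x l] const[of l x] Pl cd
   by (cases x l rule: linorder_cases) auto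
 qed
 moreover have "smooth \<Phi>" using smooth_if_DERIV[OF P s] .
 moreover have "{c..d} \<subseteq> {0<..<l}" using cd by auto
 ultimately have "test_fun l \<Phi>" unfolding test_fun_iff by (intro conjI exI[of _ "{c..d}"]) auto
 moreover have "deriv \<Phi> = \<xi>" using P by (intro ext DERIV_imp_deriv)
 ultimately show ?thesis by blast
qed

section \<open>Square integrable functions on an interval\<close>

definition nrm :: "real => (real => real) => real" where
 "nrm l f = sqrt (inner_iv l f f)"

lemma finite_measure_iv: "finite_measure (leb l)"
 by (simp add: finite_measure_lebesgue_on)

lemma L2_iv_measurable: "f \<in> L2_iv l ==> f \<in> borel_measurable (leb l)"
 by (simp add: L2_iv_def)

lemma L2_iv_mult_integrable:
 assumes "f \<in> L2_iv l" "g \<in> L2_iv l"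
 shows "integrable (leb l) (%x. f x * g x)"
proof (rule Bochner_Integration.integrable_bound)
 show "integrable (leb l) (%x. (f x)^2 + (g x)^2)"
  using assms by (auto simp: L2_iv_def)
 show "(%x. f x * g x) \<in> borel_measurable (leb l)"
  using assms by (auto simp: L2_iv_def)
 have "\<bar>f x * g x\<bar> <= (f x)^2 + (g x)^2" for x
  using sum_squares_bound[of "\<bar>f x\<bar>" "\<bar>g x\<bar>"] mult_nonneg_nonneg[of "\<bar>f x\<bar>" "\<bar>g x\<bar>"]
  unfolding abs_mult power2_abs by linarith
 thus "AE x in leb l. norm (f x * g x) <= norm ((f x)^2 + (g x)^2)"
  by auto
qed

lemma L2_iv_lin:
 assumes "f \<in> L2_iv l" "g \<in> L2_iv l"
 shows "(%x. c * f x + d * g x) \<in> L2_iv l"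
proof -
 have "integrable (leb l) (%x. c^2 * (f x * f x) + 2 * c * d * (f x * g x) + d^2 * (g x * g x))"
  using assms by (intro Bochner_Integration.integrable_add integrable_mult_right L2_iv_mult_integrable)
 hence "integrable (leb l) (%x. (c * f x + d * g x)^2)"
  by (simp add: power2_eq_square algebra_simps)
 thus ?thesis using assms by (auto simp: L2_iv_def)
qed

lemma L2_iv_add: "f \<in> L2_iv l ==> g \<in> L2_iv l ==> (%x. f x + g x) \<in> L2_iv l"
 using L2_iv_lin[of f l g 1 1] by simp

lemma L2_iv_diff: "f \<in> L2_iv l ==> g \<in> L2_iv l ==> (%x. f x - g x) \<in> L2_iv l"
 using L2_iv_lin[of f l g 1 "-1"] by simp

lemma L2_iv_cmult: "f \<in> L2_iv l ==> (%x. c * f x) \<in> L2_iv l"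
 using L2_iv_lin[of f l f c 0] by simp

lemma L2_iv_mult_bounded:
 assumes f: "f \<in> L2_iv l" and g: "g \<in> borel_measurable (leb l)"
  and b: "AE x in leb l. \<bar>g x\<bar> <= C"
 shows "(%x. g x * f x) \<in> L2_iv l"
proof -
 have "integrable (leb l) (%x. (g x * f x)^2)"
 proof (rule Bochner_Integration.integrable_bound)
  show "integrable (leb l) (%x. C^2 * (f x)^2)" using f by (auto simp: L2_iv_def)
  show "(%x. (g x * f x)^2) \<in> borel_measurable (leb l)"
   using f g by (auto simp: L2_iv_def)
  show "AE x in leb l. norm ((g x * f x)^2) <= norm (C^2 * (f x)^2)"
   using b
  proof eventually_elim
   case (elim x)
   hence "(g x)^2 <= C^2" by (metis abs_ge_zero order_trans power2_abs power_mono)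
   thus ?case by (simp add: power_mult_distrib mult_right_mono)
  qed
 qed
 thus ?thesis using f g by (auto simp: L2_iv_def)
qed

lemma L2_iv_const: "(%x. c) \<in> L2_iv l"
 by (simp add: L2_iv_def finite_measure.integrable_const[OF finite_measure_iv])

lemma L2_iv_bounded:
 "[|g \<in> borel_measurable (leb l); AE x in leb l. \<bar>g x\<bar> <= C|] ==> g \<in> L2_iv l"
 using L2_iv_mult_bounded[OF L2_iv_const[of 1], of g] by simp

lemma continuous_on_iv_bounded:
 assumes "continuous_on {0..l::real} g"
 obtains C where "0 <= C" "!!x. x \<in> {0..l} ==> \<bar>g x :: real\<bar> <= C"
proof -
 have "compact (g ` {0..l})" using assms by (intro compact_continuous_image) auto
 then obtain B where "\<forall>y\<in>g ` {0..l}. norm y <= B" using compact_imp_bounded bounded_iff by metis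
 thus thesis by (intro that[of "max B 0"]) force+
qed

lemma continuous_on_iv_measurable:
 "continuous_on {0..l::real} g ==> g \<in> borel_measurable (leb l)"
 by (simp add: continuous_imp_measurable_on_sets_lebesgue)

lemma AE_iv_I: "(!!x. x \<in> {0..l::real} ==> P x) ==> AE x in leb l. P x"
 by (rule AE_I2) simp

lemma L2_iv_continuous:
 assumes c: "cont l g" shows "g \<in> L2_iv l"
proof (rule continuous_on_iv_bounded[OF c])
 fix C assume C: "!!x. x \<in> {0..l} ==> \<bar>g x\<bar> <= C"
 show ?thesis using c by (intro L2_iv_bounded[OF _ AE_iv_I[OF C]] continuous_on_iv_measurable)
qed

lemma L2_iv_mult_continuous:
 assumes "f \<in> L2_iv l" "cont l g" shows "(%x. g x * f x) \<in> L2_iv l"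
 using continuous_on_iv_bounded[OF assms(2)]
  L2_iv_mult_bounded[OF assms(1) continuous_on_iv_measurable[OF assms(2)] AE_iv_I] by metis

lemma inner_iv_commute: "inner_iv l f g = inner_iv l g f"
 by (simp add: inner_iv_def mult.commute)

lemma inner_iv_lin:
 assumes "f \<in> L2_iv l" "g \<in> L2_iv l" "h \<in> L2_iv l"
 shows "inner_iv l (%x. c * f x + d * g x) h = c * inner_iv l f h + d * inner_iv l g h"
proof -
 have "inner_iv l (%x. c * f x + d * g x) h
   = integral\<^sup>L (leb l) (%x. c * (f x * h x) + d * (g x * h x))"
  by (simp add: inner_iv_def algebra_simps)
 thus ?thesis using assms by (simp add: L2_iv_mult_integrable inner_iv_def)
qed

lemma inner_iv_lin2:
 assumes "f \<in> L2_iv l" "g \<in> L2_iv l" "h \<in> L2_iv l"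
 shows "inner_iv l h (%x. c * f x + d * g x) = c * inner_iv l h f + d * inner_iv l h g"
 using inner_iv_lin[OF assms] by (simp add: inner_iv_commute)

lemma inner_iv_nonneg: "0 <= inner_iv l f f"
 by (simp add: inner_iv_def)

lemma inner_iv_cong_AE:
 assumes "f \<in> L2_iv l" "g \<in> L2_iv l" "f' \<in> L2_iv l" "g' \<in> L2_iv l"
  and "aeq l f f'" "aeq l g g'"
 shows "inner_iv l f g = inner_iv l f' g'"
 unfolding inner_iv_def
proof (rule integral_cong_AE)
 show "AE x in leb l. f x * g x = f' x * g' x"
  using assms(5,6) by eventually_elim simp
qed (intro borel_measurable_times L2_iv_measurable assms)+

lemma quadratic_discriminant_le:
 fixes a b c :: real
 assumes "!!t. 0 <= a + 2 * b * t + c * t^2" "0 <= c"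
 shows "b^2 <= a * c"
proof (cases "c = 0")
 case True
 have "b = 0"
 proof (rule ccontr)
  assume "b \<noteq> 0"
  with assms(1)[of "(-1 - a) / (2 * b)"] True show False by simp
 qed
 with True show ?thesis by simp
next
 case False
 hence "0 <= (a + 2 * b * (- b / c) + c * (- b / c)^2) * c"
  by (intro mult_nonneg_nonneg assms)
 moreover have "(a + 2 * b * (- b / c) + c * (- b / c)^2) * c = a * c - b^2"
  using False by (simp add: field_simps power2_eq_square)
 ultimately show ?thesis by linarith
qed

lemma inner_iv_expand:
 assumes "f \<in> L2_iv l" "g \<in> L2_iv l"
 shows "inner_iv l (%x. c * f x + d * g x) (%x. c * f x + d * g x)
  = c^2 * inner_iv l f f + 2 * c * d * inner_iv l f g + d^2 * inner_iv l g g"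
 unfolding inner_iv_lin[OF assms L2_iv_lin[OF assms]] inner_iv_lin2[OF assms assms(1)]
  inner_iv_lin2[OF assms assms(2)] inner_iv_commute[of l g f]
 by (simp add: algebra_simps power2_eq_square)

lemma inner_iv_Cauchy_Schwarz:
 assumes "f \<in> L2_iv l" "g \<in> L2_iv l"
 shows "\<bar>inner_iv l f g\<bar> <= nrm l f * nrm l g"
proof -
 have "(inner_iv l f g)^2 <= inner_iv l f f * inner_iv l g g"
 proof (rule quadratic_discriminant_le)
  fix t show "0 <= inner_iv l f f + 2 * inner_iv l f g * t + inner_iv l g g * t^2"
   using inner_iv_expand[OF assms, of 1 t] inner_iv_nonneg[of l "%x. 1 * f x + t * g x"]
   by (simp add: algebra_simps)
 qed (rule inner_iv_nonneg)
 thus ?thesis unfolding nrm_def real_sqrt_mult[symmetric]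
  by (metis real_sqrt_abs real_sqrt_le_iff)
qed

lemma nrm_nonneg [simp]: "0 <= nrm l f"
 by (simp add: nrm_def inner_iv_nonneg)

lemma nrm_sq: "(nrm l f)^2 = inner_iv l f f"
 by (simp add: nrm_def inner_iv_nonneg)

lemma nrm_add:
 assumes "f \<in> L2_iv l" "g \<in> L2_iv l"
 shows "nrm l (%x. f x + g x) <= nrm l f + nrm l g"
proof (rule power2_le_imp_le)
 show "(nrm l (%x. f x + g x))^2 <= (nrm l f + nrm l g)^2"
  using inner_iv_expand[OF assms, of 1 1] inner_iv_Cauchy_Schwarz[OF assms]
  by (simp add: nrm_sq power2_sum)
qed simp

lemma nrm_cmult: "nrm l (%x. c * f x) = \<bar>c\<bar> * nrm l f"
proof -
 have "inner_iv l (%x. c * f x) (%x. c * f x) = integral\<^sup>L (leb l) (%x. c^2 * (f x * f x))"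
  by (simp add: inner_iv_def algebra_simps power2_eq_square)
 also have "... = c^2 * inner_iv l f f" by (simp add: inner_iv_def)
 finally show ?thesis by (simp add: nrm_def real_sqrt_mult)
qed

lemma nrm_uminus: "nrm l (%x. - f x) = nrm l f"
 using nrm_cmult[of l "-1" f] by simp

lemma nrm_diff_commute: "nrm l (%x. f x - g x) = nrm l (%x. g x - f x)"
 using nrm_uminus[of l "%x. f x - g x"] by simp

lemma nrm_diff:
 assumes "f \<in> L2_iv l" "g \<in> L2_iv l"
 shows "nrm l (%x. f x - g x) <= nrm l f + nrm l g"
 using nrm_add[OF assms(1) L2_iv_cmult[OF assms(2), of "-1"]] by (simp add: nrm_uminus)

lemma nrm_triangle:
 assumes "f \<in> L2_iv l" "g \<in> L2_iv l" "h \<in> L2_iv l"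
 shows "nrm l (%x. f x - h x) <= nrm l (%x. f x - g x) + nrm l (%x. g x - h x)"
 using nrm_add[OF L2_iv_diff[OF assms(1,2)] L2_iv_diff[OF assms(2,3)]] by simp

lemma nrm_cong_AE:
 assumes "f \<in> L2_iv l" "g \<in> L2_iv l" "aeq l f g"
 shows "nrm l f = nrm l g"
 unfolding nrm_def using inner_iv_cong_AE[OF assms(1,1,2,2,3,3)] by simp

lemma nrm_mono_AE:
 assumes "f \<in> L2_iv l" "g \<in> L2_iv l" "AE x in leb l. \<bar>f x\<bar> <= \<bar>g x\<bar>"
 shows "nrm l f <= nrm l g"
 unfolding nrm_def inner_iv_def
proof (intro real_sqrt_le_mono integral_mono_AE L2_iv_mult_integrable)
 show "AE x in leb l. f x * f x <= g x * g x"
  using assms(3) by eventually_elim (metis abs_le_square_iff power2_eq_square)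
qed (use assms in auto)

lemma nrm_le_bound:
 assumes "0 <= l" "f \<in> L2_iv l" "AE x in leb l. \<bar>f x\<bar> <= C" "0 <= C"
 shows "nrm l f <= C * sqrt l"
proof -
 have "nrm l f <= nrm l (%x. C)"
  using assms by (intro nrm_mono_AE L2_iv_const) auto
 also have "... = C * sqrt l"
  using assms by (simp add: nrm_def inner_iv_def real_sqrt_mult measure_restrict_space)
 finally show ?thesis .
qed

lemma nrm_mult_bounded:
 assumes f: "f \<in> L2_iv l" and g: "g \<in> borel_measurable (leb l)"
  and b: "AE x in leb l. \<bar>g x\<bar> <= C" and C: "0 <= C"
 shows "nrm l (%x. g x * f x) <= C * nrm l f"
proof -
 have "nrm l (%x. g x * f x) <= nrm l (%x. C * f x)"
 proof (rule nrm_mono_AE[OF L2_iv_mult_bounded[OF f g b] L2_iv_cmult[OF f]])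
  show "AE x in leb l. \<bar>g x * f x\<bar> <= \<bar>C * f x\<bar>"
   using b by eventually_elim (use C in \<open>auto simp: abs_mult intro!: mult_right_mono\<close>)
 qed
 thus ?thesis using C by (simp add: nrm_cmult)
qed

lemma nrm_eq_0_AE:
 assumes "f \<in> L2_iv l" "nrm l f = 0"
 shows "AE x in leb l. f x = 0"
proof -
 have "integral\<^sup>L (leb l) (%x. f x * f x) = 0"
  using assms(2) by (simp add: nrm_def inner_iv_def)
 thus ?thesis
  using integral_nonneg_eq_0_iff_AE[OF L2_iv_mult_integrable[OF assms(1,1)]] by simp
qed

lemma nrm_AE_0:
 assumes "AE x in leb l. f x = 0"
 shows "nrm l f = 0"
proof -
 have "integral\<^sup>L (leb l) (%x. f x * f x) = 0"
  by (rule integral_eq_zero_AE) (use assms in auto)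
 thus ?thesis by (simp add: nrm_def inner_iv_def)
qed

lemma L2_iv_integrable: "f \<in> L2_iv l ==> integrable (leb l) f"
 using L2_iv_mult_integrable[of f l "%x. 1"] L2_iv_const by simp

lemma integrable_iv_iff: "integrable (leb l) f \<longleftrightarrow> f absolutely_integrable_on {0..l}"
 by (simp add: integrable_restrict_space set_integrable_def)

lemma L2_iv_absolutely_integrable: "f \<in> L2_iv l ==> f absolutely_integrable_on {0..l}"
 by (drule L2_iv_integrable) (simp only: integrable_iv_iff)

lemma L2_iv_integrable_on: "f \<in> L2_iv l ==> x <= l ==> 0 <= y ==> f integrable_on {y..x}"
 by (rule integrable_on_subinterval[of f "{0..l}"])
  (auto dest!: L2_iv_absolutely_integrable simp: absolutely_integrable_on_def)

lemma inner_iv_integral: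
 assumes "f \<in> L2_iv l" "g \<in> L2_iv l"
 shows "inner_iv l f g = integral {0..l} (%x. f x * g x)"
 unfolding inner_iv_def by (rule lebesgue_integral_eq_integral[OF L2_iv_mult_integrable[OF assms]]) simp

lemma AE_iv_iff_negligible:
 "(AE x in leb l. P x) \<longleftrightarrow> negligible {x\<in>{0..l}. \<not> P x}"
proof -
 have "(AE x in leb l. P x) \<longleftrightarrow> (AE x in lebesgue. x \<in> {0..l} --> P x)"
  by (rule AE_restrict_space_iff) simp
 also have "... \<longleftrightarrow> (\<exists>N. negligible N & {x. \<not> (x \<in> {0..l} --> P x)} \<subseteq> N)"
  by (rule eventually_ae_filter_negligible)
 also have "... \<longleftrightarrow> negligible {x. \<not> (x \<in> {0..l} --> P x)}"
  using negligible_subset by blast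
 also have "{x. \<not> (x \<in> {0..l} --> P x)} = {x\<in>{0..l}. \<not> P x}" by auto
 finally show ?thesis .
qed

text \<open>The continuous function |F - G| has integral 0. Hence a continuous representative is
  unique on the closed interval, ends included, and traces are well defined.\<close>

lemma continuous_AE_imp_eq:
 fixes F G :: "real => real"
 assumes l: "0 < l" and c: "cont l F" "cont l G"
  and ae: "aeq l F G" and x: "x \<in> {0..l}"
 shows "F x = G x"
proof -
 have "((%x. \<bar>F x - G x\<bar>) has_integral 0) (cbox 0 l)"
  by (rule has_integral_spike[where f = "%x. 0", OF ae[unfolded AE_iv_iff_negligible]]) auto
 hence "\<bar>F x - G x\<bar> = 0"
  by (rule has_integral_0_cbox_imp_0[rotated 2]) (use l x c in \<open>auto intro!: continuous_intros\<close>)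
 thus ?thesis by simp
qed

text \<open>Fubini's theorem and the uniqueness of densities are applied below over
  \<open>lborel\<close>; this replaces a Lebesgue measurable integrand by a Borel measurable one
  that agrees with it off a null set.\<close>

lemma borel_rep_absolutely_integrable:
 fixes g :: "real => real"
 assumes g: "g absolutely_integrable_on {0..l}"
 obtains g' N where "integrable lborel g'" "!!x. x \<notin> {0..l} ==> g' x = 0"
  "negligible N" "!!x. x \<in> {0..l} - N ==> g' x = g x"
proof -
 let ?g = "%x. indicator {0..l} x * g x"
 have int: "integrable lebesgue ?g" using g by (simp add: set_integrable_def)
 then obtain h where h: "h \<in> borel_measurable lborel" "AE x in lborel. ?g x = h x"
  using completion_ex_borel_measurable_real by (metis borel_measurable_integrable)
 define g' where "g' x = indicator {0..l} x * h x" for x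
 have m: "g' \<in> borel_measurable lborel" unfolding g'_def using h(1) by auto
 have ae: "AE x in lborel. ?g x = g' x"
  using h(2) by eventually_elim (auto simp: g'_def split: split_indicator)
 hence "AE x in lebesgue. ?g x = g' x" by (rule AE_completion)
 hence "integrable lebesgue g'"
  using int borel_measurable_integrable[OF int] measurable_completion[OF m]
  by (subst (asm) integrable_cong_AE[where g = g'])
 hence "integrable lborel g'" using integrable_completion[OF m] by simp
 moreover obtain N where N: "N \<in> null_sets lborel" "{x \<in> space lborel. ?g x \<noteq> g' x} \<subseteq> N"
  using ae by (metis AE_E null_setsI)
 moreover have "negligible N" using N(1) negligible_iff_null_sets null_sets_completionI by blast
 moreover have "g' x = g x" if "x \<in> {0..l} - N" for x using that N(2) by (force simp: indicator_def)
 ultimately show thesis by (intro that[of g' N]) (auto simp: g'_def)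
qed

text \<open>The positive and the negative part of \<open>g\<close>, taken as densities, give the
  same finite mass to every half-line. So they define the same measure and agree almost everywhere,
  which is possible only where both vanish.\<close>

lemma AE_0_if_integrals_0:
 fixes g :: "real => real"
 assumes l: "0 <= l" and g: "g absolutely_integrable_on {0..l}"
  and z: "!!x. x \<in> {0..l} ==> integral {x..l} g = 0"
 shows "AE x in leb l. g x = 0"
proof -
 obtain g' N where g': "integrable lborel g'" "!!x. x \<notin> {0..l} ==> g' x = 0"
  and N: "negligible N" "!!x. x \<in> {0..l} - N ==> g' x = g x"
  using borel_rep_absolutely_integrable[OF g] by metis
 note [measurable] = borel_measurable_integrable[OF g'(1)]
 have int: "integrable lborel (%y. indicator {x<..} y * g' y)" for x
  using integrable_mult_indicator[OF _ g'(1), of "{x<..}"] by simp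
 have zero: "(\<integral>y. indicator {x<..} y * g' y \<partial>lborel) = 0" for x
 proof -
  \<comment> \<open>Half-lines start anywhere on the real line, while the hypothesis concerns
    starting points in \<open>{0..l}\<close>; clamping is harmless because \<open>g'\<close>
    vanishes outside the interval.\<close>
  define x' where "x' = (if x < 0 then 0 else min x l)"
  have x': "x' \<in> {0..l}" using l by (auto simp: x'_def)
  have "(\<integral>y. indicator {x<..} y * g' y \<partial>lborel) = integral UNIV (%y. indicator {x<..} y * g' y)"
   using integral_lborel[OF int] by simp
  also have "... = integral UNIV (%y. if y \<in> {x'..l} then g y else 0)"
  proof (rule integral_spike)
   show "negligible (insert x' N)" using N(1) by (simp add: negligible_insert)
   show "(if y \<in> {x'..l} then g y else 0) = indicator {x<..} y * g' y" if "y \<in> UNIV - insert x' N" for y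
    using that N(2)[of y] g'(2)[of y] x' by (auto simp: x'_def split: if_splits)
  qed
  also have "... = integral {x'..l} g" by (rule integral_restrict_UNIV)
  finally show ?thesis using z[OF x'] by simp
 qed
 have e: "(\<integral>\<^sup>+y. ennreal (indicator {x<..} y * g' y) \<partial>lborel) = (\<integral>\<^sup>+y. ennreal (- (indicator {x<..} y * g' y)) \<partial>lborel)"
   "(\<integral>\<^sup>+y. ennreal (indicator {x<..} y * g' y) \<partial>lborel) < \<infinity>" for x
 proof -
  obtain r q where "0 <= r" "0 <= q"
   "(\<integral>\<^sup>+y. ennreal (indicator {x<..} y * g' y) \<partial>lborel) = ennreal r"
   "(\<integral>\<^sup>+y. ennreal (- (indicator {x<..} y * g' y)) \<partial>lborel) = ennreal q"
   "(\<integral>y. indicator {x<..} y * g' y \<partial>lborel) = r - q" by (rule integrableE[OF int[of x]]) blast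
  thus "(\<integral>\<^sup>+y. ennreal (indicator {x<..} y * g' y) \<partial>lborel) = (\<integral>\<^sup>+y. ennreal (- (indicator {x<..} y * g' y)) \<partial>lborel)"
   "(\<integral>\<^sup>+y. ennreal (indicator {x<..} y * g' y) \<partial>lborel) < \<infinity>" using zero[of x] by auto
 qed
 have em: "emeasure (density lborel (%y. ennreal (g' y))) {x<..} = (\<integral>\<^sup>+y. ennreal (indicator {x<..} y * g' y) \<partial>lborel)"
  "emeasure (density lborel (%y. ennreal (- g' y))) {x<..} = (\<integral>\<^sup>+y. ennreal (- (indicator {x<..} y * g' y)) \<partial>lborel)" for x
  by (subst emeasure_density, measurable, intro nn_integral_cong, simp split: split_indicator)+
 have "density lborel (%y. ennreal (g' y)) = density lborel (%y. ennreal (- g' y))"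
 proof (rule measure_eqI_lessThan)
  fix x :: real
  show "emeasure (density lborel (%y. ennreal (g' y))) {x<..} < \<infinity>"
   unfolding em using e(2) .
  show "emeasure (density lborel (%y. ennreal (g' y))) {x<..} = emeasure (density lborel (%y. ennreal (- g' y))) {x<..}"
   unfolding em using e(1) .
 qed simp_all
 hence "AE y in lborel. ennreal (g' y) = ennreal (- g' y)"
  by (subst (asm) sigma_finite_measure.density_unique_iff[OF sigma_finite_lborel]) auto
 hence "AE y in lborel. g' y = 0"
 proof eventually_elim
  case (elim y)
  thus ?case by (cases "g' y" "0::real" rule: linorder_cases) (auto simp: ennreal_neg)
 qed
 hence "AE y in lebesgue. g' y = 0" by (rule AE_completion)
 moreover have "AE y in lebesgue. y \<notin> N" using N(1) by (metis AE_not_in negligible_iff_null_sets)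
 ultimately have "AE y in lebesgue. y \<in> {0..l} --> g y = 0" by eventually_elim (use N(2) in auto)
 thus ?thesis by (simp add: AE_restrict_space_iff)
qed

lemma L2_iv_test_fun: "test_fun l \<phi> ==> \<phi> \<in> L2_iv l"
 by (simp add: L2_iv_continuous test_fun_continuous_on)

lemma iv_indicator_measurable:
 "(%y. if y \<in> {a<..<b::real} then 1 else 0 :: real) \<in> borel_measurable (leb l)"
proof -
 have "(%y. if y \<in> {a<..<b} then 1 else 0 :: real) = indicator {a<..<b}" by auto
 moreover have "indicat_real {a<..<b} \<in> borel_measurable (leb l)"
  by (intro measurable_restrict_space1 borel_measurable_indicator) simp
 ultimately show ?thesis by metis
qed

text \<open>Test functions that converge to the indicator of the open interval from \<open>x\<close>
  to \<open>l\<close> show, by dominated convergence, that all integrals of \<open>g\<close> over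
  \<open>{x..l}\<close> vanish.\<close>

lemma fundamental_lemma:
 assumes l: "0 < l" and g: "g \<in> L2_iv l" and z: "!!\<phi>. test_fun l \<phi> ==> inner_iv l g \<phi> = 0"
 shows "AE x in leb l. g x = 0"
proof (rule AE_0_if_integrals_0)
 show "0 <= l" "g absolutely_integrable_on {0..l}" using l g by (auto intro: L2_iv_absolutely_integrable)
 fix x assume x: "x \<in> {0..l}"
 show "integral {x..l} g = 0"
 proof (cases "x = l")
  case True thus ?thesis by simp
 next
  case False
  hence xl: "x < l" "0 <= x" using x by auto
  \<comment> \<open>The ends are moved strictly inwards, so that the support stays compact in the
    open interval even for \<open>x = 0\<close>; they approach \<open>x\<close> and \<open>l\<close>
    while the steepness grows.\<close>
  define a where "a n = x + (l - x) / (real n + 3)" for n :: nat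
  define b where "b n = l - (l - x) / (real n + 3)" for n :: nat
  define \<phi> where "\<phi> n = plateau ((real n + 1)^2) (a n) (b n)" for n
  have ab: "0 < a n" "b n < l" for n using xl by (auto simp: a_def b_def add_nonneg_pos)
  have t: "test_fun l (\<phi> n)" for n
   unfolding \<phi>_def using ab by (intro test_fun_plateau) auto
  have lim: "(%n. \<phi> n y) ----> (if y \<in> {x<..<l} then 1 else 0)" if y: "y \<in> {0..l}" for y
  proof (cases "y \<in> {x<..<l}")
   case True
   have st: "(%n. smooth_step (u n)) ----> 1" if "filterlim u at_top sequentially" for u :: "nat => real"
   proof -
    have "(%n. exp (- (1 / u n))) ----> exp (- 0)"
     by (intro tendsto_intros tendsto_divide_0[OF tendsto_const] filterlim_at_top_imp_at_infinity that)
    moreover have "eventually (%n. exp (- (1 / u n)) = smooth_step (u n)) sequentially"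
     using that[unfolded filterlim_at_top_dense, rule_format, of 0]
     by eventually_elim (simp add: smooth_step_def)
    ultimately show ?thesis using Lim_transform_eventually by fastforce
   qed
   have "(%n. smooth_step ((real n + 1)^2 * (y - a n))) ----> 1"
   proof (rule st)
    have "(%n. y - a n) ----> y - (x + 0)" unfolding a_def by real_asymp
    moreover have "filterlim (%n. (real n + 1)^2) at_top sequentially" by real_asymp
    ultimately show "filterlim (%n. (real n + 1)^2 * (y - a n)) at_top sequentially"
     using True by (subst mult.commute) (auto intro!: filterlim_tendsto_pos_mult_at_top)
   qed
   moreover have "(%n. smooth_step ((real n + 1)^2 * (b n - y))) ----> 1"
   proof (rule st)
    have "(%n. b n - y) ----> (l - 0) - y" unfolding b_def by real_asymp
    moreover have "filterlim (%n. (real n + 1)^2) at_top sequentially" by real_asymp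
    ultimately show "filterlim (%n. (real n + 1)^2 * (b n - y)) at_top sequentially"
     using True by (subst mult.commute) (auto intro!: filterlim_tendsto_pos_mult_at_top)
   qed
   ultimately have "(%n. \<phi> n y) ----> 1 * 1"
    unfolding \<phi>_def plateau_def by (intro tendsto_mult) (auto simp: algebra_simps)
   thus ?thesis using True by simp
  next
   case False
   have "\<phi> n y = 0" for n
   proof -
    have "y <= a n \<or> b n <= y" using False xl y by (auto simp: a_def b_def intro: order_trans[of _ x] add_increasing2)
    hence "(real n + 1)^2 * y <= (real n + 1)^2 * a n \<or> (real n + 1)^2 * b n <= (real n + 1)^2 * y"
     by (auto intro: mult_left_mono)
    thus ?thesis by (auto simp: \<phi>_def plateau_def smooth_step_def)
   qed
   thus ?thesis using False by auto
  qed
  have "(%n. integral\<^sup>L (leb l) (%y. g y * \<phi> n y))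
   ----> integral\<^sup>L (leb l) (%y. g y * (if y \<in> {x<..<l} then 1 else 0))"
  proof (rule integral_dominated_convergence)
   show "integrable (leb l) (%y. \<bar>g y\<bar>)" using L2_iv_integrable[OF g] by auto
   show "AE y in leb l. (%n. g y * \<phi> n y) ----> g y * (if y \<in> {x<..<l} then 1 else 0)"
    by (intro AE_iv_I tendsto_mult tendsto_const lim)
   show "AE y in leb l. norm (g y * \<phi> n y) <= \<bar>g y\<bar>" for n
    using plateau_bounds by (auto simp: \<phi>_def abs_mult mult_left_le)
   show "(%y. g y * (if y \<in> {x<..<l} then 1 else 0)) \<in> borel_measurable (leb l)"
    by (intro borel_measurable_times L2_iv_measurable[OF g] iv_indicator_measurable)
   show "(%y. g y * \<phi> n y) \<in> borel_measurable (leb l)" for n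
    by (intro borel_measurable_times L2_iv_measurable g L2_iv_test_fun t)
  qed
  hence "integral\<^sup>L (leb l) (%y. g y * (if y \<in> {x<..<l} then 1 else 0)) = 0"
   using z[OF t] by (simp add: inner_iv_def LIMSEQ_const_iff)
  moreover have "integral\<^sup>L (leb l) (%y. g y * (if y \<in> {x<..<l} then 1 else 0)) = integral {x..l} g"
  proof -
   have "(%y. (if y \<in> {x<..<l} then 1 else 0 :: real)) \<in> borel_measurable (leb l)"
    using iv_indicator_measurable .
   hence "integrable (leb l) (%y. (if y \<in> {x<..<l} then 1 else 0) * g y)"
    by (intro L2_iv_integrable L2_iv_mult_bounded[OF g, of _ 1]) auto
   hence "integral\<^sup>L (leb l) (%y. g y * (if y \<in> {x<..<l} then 1 else 0))
    = integral {0..l} (%y. g y * (if y \<in> {x<..<l} then 1 else 0))"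
    by (intro lebesgue_integral_eq_integral) (auto simp: mult.commute)
   also have "... = integral {0..l} (%y. if y \<in> {x..l} then g y else 0)"
    by (rule integral_spike[where S = "{x, l}"]) auto
   also have "... = integral {x..l} g" using xl by (simp only: integral_restrict_Int) (simp add: Int_absorb1)
   finally show ?thesis .
  qed
  ultimately show ?thesis by simp
 qed
qed

text \<open>After subtracting the multiple of a fixed bump \<eta> with the same mean, a test
  function is the derivative of another one. So \<open>f\<close> acts on test functions like the
  constant obtained by pairing it with \<eta> and dividing by the integral of \<eta>.\<close>

lemma du_Bois_Reymond:
 assumes l: "0 < l" and f: "f \<in> L2_iv l" and z: "!!\<phi>. test_fun l \<phi> ==> inner_iv l f (deriv \<phi>) = 0"
 shows "\<exists>c. AE x in leb l. f x = c"
proof -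
 define \<eta> where "\<eta> = plateau 1 (l/4) (3*l/4)"
 have t: "test_fun l \<eta>" unfolding \<eta>_def using l by (intro test_fun_plateau) auto
 have c: "cont l \<eta>" using t test_fun_continuous_on by blast
 define k where "k = integral {0..l} \<eta>"
 have "k \<noteq> 0"
 proof
  assume "k = 0"
  hence "(\<eta> has_integral 0) (cbox 0 l)"
   using c by (simp add: k_def has_integral_integral[symmetric] has_integral_iff integrable_continuous_real)
  hence "\<eta> (l/2) = 0"
   by (rule has_integral_0_cbox_imp_0[rotated 2]) (use l c in \<open>auto simp: \<eta>_def plateau_bounds\<close>)
  thus False using l by (simp add: \<eta>_def plateau_def smooth_step_def split: if_splits)
 qed
 define m where "m = inner_iv l f \<eta> / k"
 have int: "integral {0..l} \<phi> = inner_iv l (%x. 1) \<phi>" if "test_fun l \<phi>" for \<phi>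
  using inner_iv_integral[OF L2_iv_const L2_iv_test_fun[OF that], of 1] by simp
 have "AE x in leb l. 1 * f x + (- m) * 1 = 0"
 proof (rule fundamental_lemma[OF l])
  show "(%x. 1 * f x + (- m) * 1) \<in> L2_iv l" by (intro L2_iv_lin f L2_iv_const)
  fix \<phi> assume p: "test_fun l \<phi>"
  define d where "d = - integral {0..l} \<phi> / k"
  have t': "test_fun l (%x. \<phi> x + d * \<eta> x)" by (rule test_fun_lin[OF p t])
  have "integral {0..l} (%x. \<phi> x + d * \<eta> x) = integral {0..l} \<phi> + d * k"
   unfolding k_def
   by (subst integral_add)
    (auto intro!: integrable_continuous_real continuous_intros test_fun_continuous_on[OF p] test_fun_continuous_on[OF t])
  hence "integral {0..l} (%x. \<phi> x + d * \<eta> x) = 0" using \<open>k \<noteq> 0\<close> by (simp add: d_def)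
  then obtain \<Phi> where "test_fun l \<Phi>" "deriv \<Phi> = (%x. \<phi> x + d * \<eta> x)"
   using test_fun_antiderivative[OF t' l] by blast
  hence "inner_iv l f (%x. 1 * \<phi> x + d * \<eta> x) = 0" using z by fastforce
  hence "inner_iv l f \<phi> + d * inner_iv l f \<eta> = 0"
   using inner_iv_lin2[OF L2_iv_test_fun[OF p] L2_iv_test_fun[OF t] f, of 1 d] by simp
  hence "inner_iv l f \<phi> = m * inner_iv l (%x. 1) \<phi>"
   using \<open>k \<noteq> 0\<close> int[OF p] by (simp add: m_def d_def field_simps)
  thus "inner_iv l (%x. 1 * f x + (- m) * 1) \<phi> = 0"
   unfolding inner_iv_lin[OF f L2_iv_const[of 1] L2_iv_test_fun[OF p], of 1 "-m"] by linarith
 qed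
 thus ?thesis by auto
qed

section \<open>Absolutely continuous functions with square integrable derivative\<close>

lemma integral_primitive_lborel:
 fixes f f' :: "real => real"
 assumes "integrable lborel f'" "!!x. x \<notin> {0..l} ==> f' x = 0"
  and "negligible N" "!!x. x \<in> {0..l} - N ==> f' x = f x" and s: "s \<in> {0..l}"
 shows "(\<integral>r. f' r * indicator {..s} r \<partial>lborel) = integral {0..s} f"
proof -
 have int: "integrable lborel (%r. f' r * indicator {..s} r)"
  using integrable_mult_indicator[OF _ assms(1), of "{..s}"] by (simp add: mult.commute)
 have "(\<integral>r. f' r * indicator {..s} r \<partial>lborel) = integral UNIV (%r. f' r * indicator {..s} r)"
  using integral_lborel[OF int] by simp
 also have "... = integral UNIV (%r. if r \<in> {0..s} then f r else 0)"
  by (rule integral_spike[OF assms(3)]) (use assms in \<open>auto simp: indicator_def\<close>)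
 also have "... = integral {0..s} f" by (rule integral_restrict_UNIV)
 finally show ?thesis .
qed

text \<open>Fubini on the triangle r <= s of the square with side \<open>l\<close>. This is
  integration by parts for two primitives whose integrands are merely integrable.\<close>

lemma integral_triangle_swap:
 fixes f g :: "real => real"
 assumes f: "f absolutely_integrable_on {0..l}" and g: "g absolutely_integrable_on {0..l}" and l: "0 <= l"
 shows "integral {0..l} (%s. g s * integral {0..s} f)
  = integral {0..l} f * integral {0..l} g - integral {0..l} (%r. f r * integral {0..r} g)"
proof -
 obtain f' N where f': "integrable lborel f'" "!!x. x \<notin> {0..l} ==> f' x = 0"
  and N: "negligible N" "!!x. x \<in> {0..l} - N ==> f' x = f x"
  using borel_rep_absolutely_integrable[OF f] by metis
 obtain g' M where g': "integrable lborel g'" "!!x. x \<notin> {0..l} ==> g' x = 0"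
  and M: "negligible M" "!!x. x \<in> {0..l} - M ==> g' x = g x"
  using borel_rep_absolutely_integrable[OF g] by metis
 note [measurable] = borel_measurable_integrable[OF f'(1)] borel_measurable_integrable[OF g'(1)]
 define h where "h r s = f' r * g' s * indicator {..s} r" for r s
 have "integrable (lborel \<Otimes>\<^sub>M lborel) (%(r, s). f' r * g' s)"
  by (rule lborel_pair.Fubini_integrable) (use f' g' in \<open>auto simp: abs_mult\<close>)
 hence inth: "integrable (lborel \<Otimes>\<^sub>M lborel) (%(r, s). h r s)"
 proof (rule Bochner_Integration.integrable_bound)
  have "(%(r, s). h r s) = (%(r, s). if r <= s then f' r * g' s else 0)"
   by (auto simp: h_def indicator_def)
  thus "(%(r, s). h r s) \<in> borel_measurable (lborel \<Otimes>\<^sub>M lborel)" by simp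
  show "AE x in lborel \<Otimes>\<^sub>M lborel. norm (case x of (r, s) => h r s) <= norm (case x of (r, s) => f' r * g' s)"
   by (auto simp: h_def indicator_def)
 qed
 define A where "A s = (\<integral>r. f' r * indicator {..s} r \<partial>lborel)" for s
 define B where "B r = (\<integral>s. g' s * indicator {..r} s \<partial>lborel)" for r
 have A: "A s = integral {0..s} f" if "s \<in> {0..l}" for s
  unfolding A_def using integral_primitive_lborel[OF f' N that] .
 have B: "B s = integral {0..s} g" if "s \<in> {0..l}" for s
  unfolding B_def using integral_primitive_lborel[OF g' M that] .
 have e1: "(\<integral>r. h r s \<partial>lborel) = g' s * A s" for s
  unfolding A_def by (subst integral_mult_right_zero[symmetric]) (simp add: h_def mult_ac)
 have e2: "(\<integral>s. h r s \<partial>lborel) = f' r * (integral\<^sup>L lborel g' - B r)" for r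
 proof -
  have "(\<integral>s. h r s \<partial>lborel) = f' r * (\<integral>s. g' s * indicator {r..} s \<partial>lborel)"
   by (subst integral_mult_right_zero[symmetric])
    (intro Bochner_Integration.integral_cong, auto simp: h_def indicator_def)
  also have "(\<integral>s. g' s * indicator {r..} s \<partial>lborel) = (\<integral>s. g' s - g' s * indicator {..r} s \<partial>lborel)"
  proof (rule integral_cong_AE)
   have "AE s in lborel. s \<noteq> r" by (rule AE_lborel_singleton)
   thus "AE s in lborel. g' s * indicator {r..} s = g' s - g' s * indicator {..r} s"
    by eventually_elim (auto simp: indicator_def)
  qed auto
  also have "... = integral\<^sup>L lborel g' - B r"
   unfolding B_def
  proof (rule Bochner_Integration.integral_diff[OF g'(1)])
   show "integrable lborel (%s. g' s * indicator {..r} s)"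
    using integrable_mult_indicator[OF _ g'(1), of "{..r}"] by (simp add: mult.commute)
  qed
  finally show ?thesis .
 qed
 have F: "(\<integral>s. g' s * A s \<partial>lborel) = (\<integral>r. f' r * (integral\<^sup>L lborel g' - B r) \<partial>lborel)"
  using lborel_pair.Fubini_integral[OF inth] by (simp add: e1 e2)
 have i1: "integrable lborel (%s. g' s * A s)"
  using lborel_pair.integrable_snd[OF inth] by (simp add: e1)
 have i2: "integrable lborel (%r. f' r * (integral\<^sup>L lborel g' - B r))"
  using lborel_pair.integrable_fst[OF inth] by (simp add: e2)
 have i3: "integrable lborel (%r. f' r * B r)"
 proof -
  have "integrable lborel (%r. f' r * integral\<^sup>L lborel g' - f' r * (integral\<^sup>L lborel g' - B r))"
   using f'(1) i2 by auto
  thus ?thesis by (simp add: algebra_simps)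
 qed
 have "integral {0..l} (%s. g s * integral {0..s} f) = integral UNIV (%s. if s \<in> {0..l} then g s * integral {0..s} f else 0)"
  by (rule integral_restrict_UNIV[symmetric])
 also have "... = integral UNIV (%s. g' s * A s)"
  by (rule integral_spike[OF M(1)]) (use M(2) A g'(2) in auto)
 also have "... = (\<integral>s. g' s * A s \<partial>lborel)" using integral_lborel[OF i1] .
 also have "... = (\<integral>r. f' r * integral\<^sup>L lborel g' - f' r * B r \<partial>lborel)"
  unfolding F by (simp add: algebra_simps)
 also have "... = integral\<^sup>L lborel f' * integral\<^sup>L lborel g' - (\<integral>r. f' r * B r \<partial>lborel)"
  using f'(1) i3 by simp
 also have "(\<integral>r. f' r * B r \<partial>lborel) = integral UNIV (%r. f' r * B r)" using integral_lborel[OF i3] ..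
 also have "... = integral UNIV (%s. if s \<in> {0..l} then f s * integral {0..s} g else 0)"
  by (rule integral_spike[OF N(1)]) (use N(2) B f'(2) in auto)
 also have "... = integral {0..l} (%r. f r * integral {0..r} g)" by (rule integral_restrict_UNIV)
 also have "integral\<^sup>L lborel f' = integral {0..l} f"
 proof -
  have "integral\<^sup>L lborel f' = A l"
   unfolding A_def by (rule Bochner_Integration.integral_cong) (use f'(2) in \<open>auto simp: indicator_def\<close>)
  thus ?thesis using A[of l] l by simp
 qed
 also have "integral\<^sup>L lborel g' = integral {0..l} g"
 proof -
  have "integral\<^sup>L lborel g' = B l"
   unfolding B_def by (rule Bochner_Integration.integral_cong) (use g'(2) in \<open>auto simp: indicator_def\<close>)
  thus ?thesis using B[of l] l by simp
 qed
 finally show ?thesis .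
qed

text \<open>Membership in H^1(0, l) with the representative fixed: \<open>F\<close> is a primitive
  at every point of \<open>{0..l}\<close>, so its end values are meaningful, while \<open>f\<close>
  matters up to null sets. For second derivatives the same \<open>f\<close> reappears as first
  component of another instance.\<close>

definition AC :: "real => (real => real) => (real => real) => bool" where
 "AC l F f \<longleftrightarrow> f \<in> L2_iv l & (\<forall>x\<in>{0..l}. F x = F 0 + integral {0..x} f)"

lemma AC_L2: "AC l F f ==> f \<in> L2_iv l"
 unfolding AC_def by blast

lemma AC_eq: "AC l F f ==> x \<in> {0..l} ==> F x = F 0 + integral {0..x} f"
 unfolding AC_def by blast

lemma continuous_on_primitive: "f \<in> L2_iv l ==> cont l (%x. integral {0..x} f)"
 by (rule indefinite_integral_continuous_1, erule L2_iv_integrable_on) simp_all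

lemma AC_continuous: assumes "AC l F f" shows "cont l F"
proof -
 have "cont l (%x. F 0 + integral {0..x} f)"
  using AC_L2[OF assms] by (intro continuous_intros continuous_on_primitive)
 thus ?thesis
  by (rule continuous_on_eq) (rule AC_eq[OF assms, symmetric])
qed

lemma AC_L2_fun: "AC l F f ==> F \<in> L2_iv l"
 by (rule L2_iv_continuous[OF AC_continuous])

lemma AC_primitive: "f \<in> L2_iv l ==> AC l (%x. c + integral {0..x} f) f"
 by (simp add: AC_def)

lemma AC_const: "AC l (%x. c) (%x. 0)"
 by (simp add: AC_def L2_iv_const)

lemma AC_lin:
 assumes "AC l F f" "AC l G g"
 shows "AC l (%x. c * F x + d * G x) (%x. c * f x + d * g x)"
 unfolding AC_def
proof (intro conjI ballI)
 show "(%x. c * f x + d * g x) \<in> L2_iv l" using assms by (intro L2_iv_lin AC_L2)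
 fix x assume x: "x \<in> {0..l}"
 have "f integrable_on {0..x}" "g integrable_on {0..x}"
  using x assms by (auto intro!: L2_iv_integrable_on AC_L2)
 hence "integral {0..x} (%x. c * f x + d * g x) = c * integral {0..x} f + d * integral {0..x} g"
  by (subst integral_add) (use x in \<open>auto intro!: L2_iv_integrable_on L2_iv_cmult AC_L2[OF assms(1)] AC_L2[OF assms(2)]\<close>)
 thus "c * F x + d * G x = c * F 0 + d * G 0 + integral {0..x} (%x. c * f x + d * g x)"
  using AC_eq[OF assms(1) x] AC_eq[OF assms(2) x] by (simp add: algebra_simps)
qed

lemma AC_add: "AC l F f ==> AC l G g ==> AC l (%x. F x + G x) (%x. f x + g x)"
 using AC_lin[of l F f G g 1 1] by simp

lemma AC_diff: "AC l F f ==> AC l G g ==> AC l (%x. F x - G x) (%x. f x - g x)"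
 using AC_lin[of l F f G g 1 "-1"] by simp

lemma AC_increment:
 assumes "AC l F f" "0 <= y" "y <= x" "x <= l"
 shows "F x - F y = integral {y..x} f"
proof -
 have "integral {0..y} f + integral {y..x} f = integral {0..x} f"
  by (rule Henstock_Kurzweil_Integration.integral_combine) (use assms in \<open>auto intro!: L2_iv_integrable_on AC_L2\<close>)
 thus ?thesis using AC_eq[OF assms(1), of x] AC_eq[OF assms(1), of y] assms by auto
qed

text \<open>Each factor is a constant plus a primitive; the product of the two primitives is handled
  by \<open>integral_triangle_swap\<close> on \<open>{0..x}\<close>.\<close>

lemma AC_mult:
 assumes F: "AC l F f" and G: "AC l G g"
 shows "AC l (%x. F x * G x) (%x. f x * G x + F x * g x)"
 unfolding AC_def
proof (intro conjI ballI)
 have fG: "(%x. G x * f x) \<in> L2_iv l" and Fg: "(%x. F x * g x) \<in> L2_iv l"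
  by (rule L2_iv_mult_continuous[OF AC_L2[OF F] AC_continuous[OF G]]
    L2_iv_mult_continuous[OF AC_L2[OF G] AC_continuous[OF F]])+
 show "(%x. f x * G x + F x * g x) \<in> L2_iv l"
  using L2_iv_add[OF fG Fg] by (simp add: mult.commute)
 fix x assume x: "x \<in> {0..l}"
 have int: "h integrable_on {0..x}" if "h \<in> L2_iv l" for h
  using that x by (intro L2_iv_integrable_on) auto
 have abs: "h absolutely_integrable_on {0..x}" if "h \<in> L2_iv l" for h
  using absolutely_integrable_on_subinterval[OF L2_iv_absolutely_integrable[OF that], of 0 x] x by auto
 note fL = AC_L2[OF F] and gL = AC_L2[OF G]
 have p1: "(%s. integral {0..s} g * f s) \<in> L2_iv l" "(%s. integral {0..s} f * g s) \<in> L2_iv l"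
  by (auto intro!: L2_iv_mult_continuous continuous_on_primitive fL gL)
 have "integral {0..x} (%x. f x * G x + F x * g x)
  = integral {0..x} (%s. (G 0 * f s + F 0 * g s) + (integral {0..s} g * f s + integral {0..s} f * g s))"
 proof (rule Henstock_Kurzweil_Integration.integral_cong)
  fix s assume "s \<in> {0..x}"
  hence "s \<in> {0..l}" using x by auto
  hence "F s = F 0 + integral {0..s} f" "G s = G 0 + integral {0..s} g"
   using AC_eq[OF F] AC_eq[OF G] by blast+
  thus "f s * G s + F s * g s
   = (G 0 * f s + F 0 * g s) + (integral {0..s} g * f s + integral {0..s} f * g s)"
   by (simp only:) (simp add: algebra_simps)
 qed
 also have "... = integral {0..x} (%s. G 0 * f s + F 0 * g s)
   + integral {0..x} (%s. integral {0..s} g * f s + integral {0..s} f * g s)"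
  by (rule integral_add) (intro int L2_iv_lin L2_iv_add fL gL p1)+
 also have "integral {0..x} (%s. G 0 * f s + F 0 * g s) = G 0 * integral {0..x} f + F 0 * integral {0..x} g"
  by (subst integral_add) (auto intro!: int L2_iv_cmult fL gL)
 also have "integral {0..x} (%s. integral {0..s} g * f s + integral {0..s} f * g s)
   = integral {0..x} (%s. f s * integral {0..s} g) + integral {0..x} (%s. g s * integral {0..s} f)"
  by (subst integral_add[OF int[OF p1(1)] int[OF p1(2)]]) (simp add: mult.commute)
 also have "... = integral {0..x} f * integral {0..x} g"
  using integral_triangle_swap[OF abs[OF fL] abs[OF gL]] x by simp
 finally show "F x * G x = F 0 * G 0 + integral {0..x} (%x. f x * G x + F x * g x)"
  using AC_eq[OF F x] AC_eq[OF G x] by (simp add: algebra_simps)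
qed

lemma AC_by_parts:
 assumes F: "AC l F f" and G: "AC l G g" and l: "0 <= l"
 shows "inner_iv l f G + inner_iv l F g = F l * G l - F 0 * G 0"
proof -
 have "inner_iv l f G + inner_iv l F g = integral {0..l} (%x. f x * G x) + integral {0..l} (%x. F x * g x)"
  using F G by (simp add: inner_iv_integral AC_L2 AC_L2_fun)
 also have "... = integral {0..l} (%x. f x * G x + F x * g x)"
 proof (rule integral_add[symmetric])
  have "(%x. G x * f x) \<in> L2_iv l" "(%x. F x * g x) \<in> L2_iv l"
   by (rule L2_iv_mult_continuous[OF AC_L2[OF F] AC_continuous[OF G]]
    L2_iv_mult_continuous[OF AC_L2[OF G] AC_continuous[OF F]])+
  thus "(%x. f x * G x) integrable_on {0..l}" "(%x. F x * g x) integrable_on {0..l}"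
   using L2_iv_integrable_on[of _ l l 0] by (simp_all add: mult.commute)
 qed
 also have "... = F l * G l - F 0 * G 0"
  using AC_eq[OF AC_mult[OF F G], of l] l by simp
 finally show ?thesis .
qed

lemma AC_if_C1:
 assumes "!!x. x \<in> {0..l} ==> (F has_real_derivative f x) (at x within {0..l})" "cont l f"
 shows "AC l F f"
 unfolding AC_def
proof (intro conjI ballI)
 show "f \<in> L2_iv l" using assms(2) by (rule L2_iv_continuous)
 fix x assume x: "x \<in> {0..l}"
 have "(f has_integral (F x - F 0)) {0..x}"
 proof (rule fundamental_theorem_of_calculus)
  fix y assume "y \<in> {0..x}"
  with x assms(1)[of y] show "(F has_vector_derivative f y) (at y within {0..x})"
   by (auto simp flip: has_real_derivative_iff_has_vector_derivative intro: has_field_derivative_subset)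
 qed (use x in auto)
 thus "F x = F 0 + integral {0..x} f" by (simp add: integral_unique)
qed

lemma AC_C1_derivative:
 assumes "AC l F f" "cont l f" "x \<in> {0..l}"
 shows "(F has_real_derivative f x) (at x within {0..l})"
proof -
 have "((%x. F 0 + integral {0..x} f) has_real_derivative 0 + f x) (at x within {0..l})"
  by (intro derivative_intros integral_has_real_derivative) (use assms in auto)
 hence "((%x. F 0 + integral {0..x} f) has_real_derivative f x) (at x within {0..l})" by simp
 thus ?thesis
  by (rule has_field_derivative_transform_within[where d = 1])
   (use assms(3) in \<open>simp_all add: AC_eq[OF assms(1), symmetric]\<close>)
qed

lemma AC_test_fun: "test_fun l \<phi> ==> AC l \<phi> (deriv \<phi>)"
proof (rule AC_if_C1)
 assume t: "test_fun l \<phi>"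
 show "cont l (deriv \<phi>)" by (rule test_fun_continuous_on[OF test_fun_deriv[OF t]])
 show "(\<phi> has_real_derivative deriv \<phi> x) (at x within {0..l})" for x
  by (rule DERIV_subset[OF test_fun_DERIV[OF t]]) simp
qed

lemma L2_iv_AE_trans:
 assumes "aeq l f g" "aeq l g h"
 shows "aeq l f h"
 using assms by eventually_elim simp

lemma L2_iv_AE_sym:
 assumes "aeq l f g"
 shows "aeq l g f"
 using assms by eventually_elim simp

lemma has_weak_deriv_L2:
 "has_weak_deriv n l f g ==> f \<in> L2_iv l" "has_weak_deriv n l f g ==> g \<in> L2_iv l"
 unfolding has_weak_deriv_def by simp_all

lemma has_weak_deriv_test:
 "has_weak_deriv n l f g ==> test_fun l \<phi> ==> inner_iv l f ((deriv ^^ n) \<phi>) = (- 1) ^ n * inner_iv l g \<phi>"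
 unfolding has_weak_deriv_def by simp

lemma AC_has_weak_deriv:
 assumes l: "0 < l" and F: "AC l F f" and u: "u \<in> L2_iv l" "aeq l F u"
 shows "has_weak_deriv 1 l u f"
 unfolding has_weak_deriv_def
proof (intro conjI allI impI)
 fix \<phi> assume t: "test_fun l \<phi>"
 have "inner_iv l u (deriv \<phi>) = inner_iv l F (deriv \<phi>)"
  by (rule inner_iv_cong_AE)
   (intro u(1) L2_iv_test_fun test_fun_deriv t AC_L2_fun[OF F] L2_iv_AE_sym[OF u(2)] AE_I2 refl)+
 moreover have "inner_iv l f \<phi> + inner_iv l F (deriv \<phi>) = 0"
  using AC_by_parts[OF F AC_test_fun[OF t]] l t by (simp add: test_fun_ends)
 ultimately show "inner_iv l u ((deriv ^^ 1) \<phi>) = (- 1) ^ 1 * inner_iv l f \<phi>" by simp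
next
 show "u \<in> L2_iv l" by (rule u(1))
 show "f \<in> L2_iv l" by (rule AC_L2[OF F])
qed

text \<open>The difference of \<open>u\<close> and the primitive of \<open>g\<close> is orthogonal
  to all derivatives of test functions, hence constant by \<open>du_Bois_Reymond\<close>; the
  constant is absorbed into the primitive.\<close>

lemma has_weak_deriv_imp_AC:
 assumes l: "0 < l" and w: "has_weak_deriv 1 l u g"
 shows "\<exists>F. AC l F g & (aeq l F u)"
proof -
 define G where "G x = 0 + integral {0..x} g" for x
 have G: "AC l G g" using AC_primitive[OF has_weak_deriv_L2(2)[OF w], of 0] by (simp only: G_def[abs_def])
 have uL: "u \<in> L2_iv l" and GL: "G \<in> L2_iv l" using has_weak_deriv_L2(1)[OF w] AC_L2_fun[OF G] .
 have "\<exists>c. AE x in leb l. u x - G x = c"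
 proof (rule du_Bois_Reymond[OF l L2_iv_diff[OF uL GL]])
  fix \<phi> assume t: "test_fun l \<phi>"
  have "inner_iv l (%x. 1 * u x + (-1) * G x) (deriv \<phi>) = 1 * inner_iv l u (deriv \<phi>) + (-1) * inner_iv l G (deriv \<phi>)"
   by (rule inner_iv_lin) (intro uL GL L2_iv_test_fun test_fun_deriv t)+
  moreover have "inner_iv l u (deriv \<phi>) = - inner_iv l g \<phi>"
   using has_weak_deriv_test[OF w t] by simp
  moreover have "inner_iv l G (deriv \<phi>) = - inner_iv l g \<phi>"
   using has_weak_deriv_test[OF AC_has_weak_deriv[OF l G GL] t] by simp
  ultimately show "inner_iv l (%x. u x - G x) (deriv \<phi>) = 0" by simp
 qed
 then obtain c where c: "AE x in leb l. u x - G x = c" by blast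
 have "AC l (%x. c + integral {0..x} g) g" by (rule AC_primitive[OF has_weak_deriv_L2(2)[OF w]])
 moreover have "AE x in leb l. c + integral {0..x} g = u x"
  using c by eventually_elim (simp add: G_def)
 ultimately show ?thesis by blast
qed

lemma abs_integral_le_nrm:
 assumes f: "f \<in> L2_iv l" and "0 <= y" "y <= x" "x <= l"
 shows "\<bar>integral {y..x} f\<bar> <= sqrt l * nrm l f"
proof -
 let ?h = "%t. if t \<in> {y..x} then 1 else 0 :: real"
 have "?h = indicat_real {y..x}" by auto
 hence m: "?h \<in> borel_measurable (leb l)"
  by (simp only:) (intro measurable_restrict_space1 borel_measurable_indicator, simp)
 have h: "?h \<in> L2_iv l" by (rule L2_iv_bounded[OF m, of 1]) auto
 have "integral {y..x} f = integral {0..l} (%t. if t \<in> {y..x} then f t else 0)"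
  using assms by (simp only: integral_restrict_Int) (simp add: Int_absorb2)
 also have "... = integral {0..l} (%t. ?h t * f t)"
  by (rule Henstock_Kurzweil_Integration.integral_cong) auto
 also have "... = inner_iv l ?h f" using inner_iv_integral[OF h f] by simp
 finally have "\<bar>integral {y..x} f\<bar> <= nrm l ?h * nrm l f" using inner_iv_Cauchy_Schwarz[OF h f] by simp
 also have "nrm l ?h <= 1 * sqrt l" by (rule nrm_le_bound) (use assms h in auto)
 finally show ?thesis by (simp add: mult_right_mono)
qed

lemma AC_increment_le:
 assumes "AC l F f" "y \<in> {0..l}" "x \<in> {0..l}"
 shows "\<bar>F x - F y\<bar> <= sqrt l * nrm l f"
proof (cases "y <= x")
 case True
 thus ?thesis
  using abs_integral_le_nrm[OF AC_L2[OF assms(1)], of y x] AC_increment[OF assms(1), of y x] assms by auto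
next
 case False
 thus ?thesis
  using abs_integral_le_nrm[OF AC_L2[OF assms(1)], of x y] AC_increment[OF assms(1), of x y] assms by auto
qed

text \<open>F(x)^2 is at most F(y)^2 plus twice the integral of |F f|; apply Cauchy-Schwarz and
  average over y. Having the product of the two norms, rather than the sum of their squares, is what
  yields the threshold 1/2 for traces and the square root in Weyl's bound.\<close>

lemma AC_sup_bound:
 assumes F: "AC l F f" and l: "0 < l" and x: "x \<in> {0..l}"
 shows "(F x)^2 <= (nrm l F)^2 / l + 2 * nrm l F * nrm l f"
proof -
 have FL: "F \<in> L2_iv l" and fL: "f \<in> L2_iv l" using AC_L2_fun[OF F] AC_L2[OF F] .
 have sq: "AC l (%x. F x * F x) (%x. f x * F x + F x * f x)" by (rule AC_mult[OF F F])
 have Ff: "(%x. F x * f x) \<in> L2_iv l" by (intro L2_iv_mult_continuous fL AC_continuous[OF F])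
 have b: "\<bar>integral {s..t} (%x. f x * F x + F x * f x)\<bar> <= 2 * nrm l F * nrm l f"
  if "0 <= s" "s <= t" "t <= l" for s t
 proof -
  have "\<bar>integral {s..t} (%x. f x * F x + F x * f x)\<bar> = 2 * norm (integral {s..t} (%x. F x * f x))"
   by (simp add: mult.commute[of "f _"] abs_mult flip: mult_2)
  also have "norm (integral {s..t} (%x. F x * f x)) <= integral {s..t} (%x. \<bar>F x * f x\<bar>)"
  proof (rule integral_norm_bound_integral)
   have "(%x. F x * f x) absolutely_integrable_on {s..t}"
    using absolutely_integrable_on_subinterval[OF L2_iv_absolutely_integrable[OF Ff]] that by auto
   thus "(%x. F x * f x) integrable_on {s..t}" "(%x. \<bar>F x * f x\<bar>) integrable_on {s..t}"
    by (auto simp: absolutely_integrable_on_def)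
  qed auto
  also have "... <= integral {0..l} (%x. \<bar>F x * f x\<bar>)"
  proof (rule integral_subset_le)
   have "(%x. F x * f x) absolutely_integrable_on {0..l}" by (rule L2_iv_absolutely_integrable[OF Ff])
   thus "(%x. \<bar>F x * f x\<bar>) integrable_on {0..l}" by (auto simp: absolutely_integrable_on_def)
   thus "(%x. \<bar>F x * f x\<bar>) integrable_on {s..t}"
    by (rule integrable_on_subinterval) (use that in auto)
  qed (use that in auto)
  also have "... = inner_iv l (%x. \<bar>F x\<bar>) (%x. \<bar>f x\<bar>)"
   using inner_iv_integral[of "%x. \<bar>F x\<bar>" l "%x. \<bar>f x\<bar>"] FL fL by (auto simp: L2_iv_def abs_mult)
  also have "... <= nrm l (%x. \<bar>F x\<bar>) * nrm l (%x. \<bar>f x\<bar>)"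
   using inner_iv_Cauchy_Schwarz[of "%x. \<bar>F x\<bar>" l "%x. \<bar>f x\<bar>"] FL fL by (auto simp: L2_iv_def)
  also have "... = nrm l F * nrm l f" by (simp add: nrm_def inner_iv_def flip: abs_mult)
  finally show ?thesis by simp
 qed
 have d: "(F x)^2 - 2 * nrm l F * nrm l f <= F y * F y" if y: "y \<in> {0..l}" for y
 proof (cases "y <= x")
  case True
  thus ?thesis using AC_increment[OF sq, of y x] b[of y x] x y by (auto simp: power2_eq_square)
 next
  case False
  thus ?thesis using AC_increment[OF sq, of x y] b[of x y] x y by (auto simp: power2_eq_square)
 qed
 have "integral {0..l} (%y. (F x)^2 - 2 * nrm l F * nrm l f) <= integral {0..l} (%y. F y * F y)"
 proof (rule integral_le)
  show "(%y. F y * F y) integrable_on {0..l}"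
   using AC_continuous[OF F] by (intro integrable_continuous_real continuous_intros)
 qed (use d in auto)
 also have "... = (nrm l F)^2" by (simp add: nrm_sq inner_iv_integral FL)
 finally have "l * ((F x)^2 - 2 * nrm l F * nrm l f) <= (nrm l F)^2" using l by simp
 thus ?thesis using l by (simp add: field_simps)
qed

section \<open>Completeness and Lipschitz functions\<close>

text \<open>Riesz-Fischer: along a fast subsequence the increments are summable in L1, so it
  converges almost everywhere; Fatou's lemma turns this into convergence of the whole sequence in
  norm.\<close>

lemma L2_iv_complete:
 fixes f :: "nat => real => real"
 assumes f: "!!n. f n \<in> L2_iv l"
  and C: "!!e. 0 < e ==> \<exists>N. \<forall>m\<ge>N. \<forall>n\<ge>N. nrm l (%x. f m x - f n x) < e"
 shows "\<exists>g\<in>L2_iv l. (%n. nrm l (%x. f n x - g x)) ----> 0"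
proof -
 let ?M = "leb l"
 have "\<exists>r. \<forall>k. \<forall>m\<ge>r k. \<forall>n\<ge>r k. nrm l (%x. f m x - f n x) < (1/2) ^ k"
  by (rule choice) (use C in auto)
 then obtain r where r: "!!k m n. r k <= m ==> r k <= n ==> nrm l (%x. f m x - f n x) < (1/2) ^ k"
  by blast
 \<comment> \<open>Summing the thresholds gives a single index that lies beyond \<open>r i\<close>
   for all \<open>i <= k\<close>.\<close>
 define R where "R k = (\<Sum>i\<le>k. r i)" for k
 have rR: "r i <= R k" if "i <= k" for i k unfolding R_def using that by (intro member_le_sum) auto
 define g where "g k = f (R k)" for k
 have g: "g k \<in> L2_iv l" for k by (simp add: g_def f)
 note [measurable] = L2_iv_measurable[OF g] L2_iv_measurable[OF f]
 define D where "D k x = \<bar>g (Suc k) x - g k x\<bar>" for k x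
 have DL: "D k \<in> L2_iv l" for k
  using L2_iv_diff[OF g[of "Suc k"] g[of k]] unfolding D_def by (auto simp: L2_iv_def)
 have Dn: "nrm l (D k) <= (1/2) ^ k" for k
 proof -
  have "nrm l (D k) = nrm l (%x. g (Suc k) x - g k x)"
   by (simp add: nrm_def inner_iv_def D_def flip: abs_mult)
  also have "... < (1/2) ^ k" unfolding g_def by (intro r rR) auto
  finally show ?thesis by simp
 qed
 define c where "c = nrm l (%x. 1)"
 have "(\<integral>\<^sup>+x. (\<Sum>k. ennreal (D k x)) \<partial>?M) = (\<Sum>k. \<integral>\<^sup>+x. ennreal (D k x) \<partial>?M)"
  by (rule nn_integral_suminf) (unfold D_def, measurable)
 also have "... <= (\<Sum>k. ennreal (c * (1/2) ^ k))"
 proof (rule suminf_le)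
  fix k
  have "(\<integral>\<^sup>+x. ennreal (D k x) \<partial>?M) = ennreal (integral\<^sup>L ?M (D k))"
   by (rule nn_integral_eq_integral[OF L2_iv_integrable[OF DL]]) (simp add: D_def)
  also have "integral\<^sup>L ?M (D k) = inner_iv l (%x. 1) (D k)" by (simp add: inner_iv_def)
  also have "ennreal (inner_iv l (%x. 1) (D k)) <= ennreal (c * (1/2) ^ k)"
  proof (rule ennreal_leI)
   have "inner_iv l (%x. 1) (D k) <= c * nrm l (D k)"
    using inner_iv_Cauchy_Schwarz[OF L2_iv_const DL, of 1 k] by (simp add: c_def)
   also have "... <= c * (1/2) ^ k" by (intro mult_left_mono Dn) (simp add: c_def)
   finally show "inner_iv l (%x. 1) (D k) <= c * (1/2) ^ k" .
  qed
  finally show "(\<integral>\<^sup>+x. ennreal (D k x) \<partial>?M) <= ennreal (c * (1/2) ^ k)" .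
 qed auto
 also have "... < \<infinity>"
 proof -
  have "summable (%k. c * (1/2) ^ k)" by (intro summable_mult summable_geometric) simp
  thus ?thesis
   by (subst suminf_ennreal2) (auto simp: c_def)
 qed
 finally have fin: "(\<integral>\<^sup>+x. (\<Sum>k. ennreal (D k x)) \<partial>?M) \<noteq> \<infinity>" by simp
 have "(%x. \<Sum>k. ennreal (D k x)) \<in> borel_measurable ?M" unfolding D_def by measurable
 hence "AE x in ?M. (\<Sum>k. ennreal (D k x)) \<noteq> \<infinity>"
  using fin by (rule nn_integral_noteq_infinite)
 hence conv: "AE x in ?M. (%k. g k x) ----> lim (%k. g k x)"
 proof eventually_elim
  case (elim x)
  hence "summable (%k. D k x)"
   by (intro summable_suminf_not_top) (auto simp: D_def)
  hence "summable (%k. g (Suc k) x - g k x)"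
   unfolding D_def by (rule summable_rabs_cancel)
  hence "convergent (%n. \<Sum>k<n. g (Suc k) x - g k x)" by (simp add: summable_iff_convergent)
  hence "convergent (%n. g n x - g 0 x)" by (simp only: sum_lessThan_telescope[of "%k. g k x"])
  hence "convergent (%n. (g n x - g 0 x) + g 0 x)" by (intro convergent_add convergent_const)
  thus ?case by (simp add: convergent_LIMSEQ_iff)
 qed
 define h where "h x = lim (%k. g k x)" for x
 have [measurable]: "h \<in> borel_measurable ?M" unfolding h_def by measurable
 have *: "(%x. f n x - h x) \<in> L2_iv l & nrm l (%x. f n x - h x) <= (1/2) ^ k" if n: "R k <= n" for n k
 proof -
  have "(\<integral>\<^sup>+x. ennreal ((f n x - h x)^2) \<partial>?M) = (\<integral>\<^sup>+x. liminf (%j. ennreal ((f n x - g j x)^2)) \<partial>?M)"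
  proof (rule nn_integral_cong_AE)
   show "AE x in ?M. ennreal ((f n x - h x)^2) = liminf (%j. ennreal ((f n x - g j x)^2))"
    using conv
   proof eventually_elim
    case (elim x)
    hence "(%j. ennreal ((f n x - g j x)^2)) ----> ennreal ((f n x - h x)^2)"
     unfolding h_def by (intro tendsto_ennrealI tendsto_intros)
    from lim_imp_Liminf[OF _ this] show ?case by simp
   qed
  qed
  also have "... <= liminf (%j. \<integral>\<^sup>+x. ennreal ((f n x - g j x)^2) \<partial>?M)"
   by (rule nn_integral_liminf) measurable
  also have "... <= liminf (%j::nat. ennreal (((1/2) ^ k)^2))"
  proof (rule Liminf_mono)
   show "eventually (%j. (\<integral>\<^sup>+x. ennreal ((f n x - g j x)^2) \<partial>?M) <= ennreal (((1/2) ^ k)^2)) sequentially"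
    using eventually_ge_at_top[of k]
   proof eventually_elim
    case (elim j)
    have d: "(%x. f n x - g j x) \<in> L2_iv l" by (intro L2_iv_diff f g)
    have "(\<integral>\<^sup>+x. ennreal ((f n x - g j x)^2) \<partial>?M) = ennreal (integral\<^sup>L ?M (%x. (f n x - g j x)^2))"
     by (rule nn_integral_eq_integral) (use d in \<open>auto simp: L2_iv_def\<close>)
    also have "integral\<^sup>L ?M (%x. (f n x - g j x)^2) = (nrm l (%x. f n x - g j x))^2"
     by (simp only: nrm_sq) (simp add: inner_iv_def power2_eq_square)
    also have "ennreal ... <= ennreal (((1/2) ^ k)^2)"
    proof (intro ennreal_leI power_mono)
     have "r k <= R j" using elim by (intro rR)
     moreover have "r k <= n" using n rR[of k k] by simp
     ultimately show "nrm l (%x. f n x - g j x) <= (1/2) ^ k"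
      unfolding g_def using r less_imp_le by blast
    qed simp
    finally show ?case .
   qed
  qed
  also have "... = ennreal (((1/2) ^ k)^2)" by (simp add: Liminf_const)
  finally have le: "(\<integral>\<^sup>+x. ennreal ((f n x - h x)^2) \<partial>?M) <= ennreal (((1/2) ^ k)^2)" .
  have int: "integrable ?M (%x. (f n x - h x)^2)"
  proof (rule integrableI_bounded)
   show "(\<integral>\<^sup>+x. ennreal (norm ((f n x - h x)^2)) \<partial>?M) < \<infinity>"
    using le by (simp add: order_le_less_trans)
  qed measurable
  hence L: "(%x. f n x - h x) \<in> L2_iv l" by (simp add: L2_iv_def)
  have "ennreal (integral\<^sup>L ?M (%x. (f n x - h x)^2)) <= ennreal (((1/2) ^ k)^2)"
   using le nn_integral_eq_integral[OF int] by simp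
  hence "integral\<^sup>L ?M (%x. (f n x - h x)^2) <= ((1/2) ^ k)^2" by (simp add: ennreal_le_iff)
  hence "(nrm l (%x. f n x - h x))^2 <= ((1/2) ^ k)^2"
   unfolding nrm_sq by (simp add: inner_iv_def power2_eq_square)
  hence "nrm l (%x. f n x - h x) <= (1/2) ^ k"
   by (rule power2_le_imp_le) simp
  with L show ?thesis by simp
 qed
 have "h \<in> L2_iv l"
  using L2_iv_diff[OF f[of "R 0"] conjunct1[OF *[of 0 "R 0"]]] by simp
 moreover have "(%n. nrm l (%x. f n x - h x)) ----> 0"
 proof (rule LIMSEQ_I)
  fix e :: real assume "0 < e"
  then obtain k where "(1/2 :: real) ^ k < e" using real_arch_pow_inv[of e "1/2"] by auto
  hence "\<forall>n\<ge>R k. norm (nrm l (%x. f n x - h x) - 0) < e" using *[of k] by fastforce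
  thus "\<exists>n0. \<forall>n\<ge>n0. norm (nrm l (%x. f n x - h x) - 0) < e" by blast
 qed
 ultimately show ?thesis by blast
qed

lemma tendsto_integral_L2:
 assumes "!!n. f n \<in> L2_iv l" "g \<in> L2_iv l" "(%n. nrm l (%x. f n x - g x)) ----> 0"
  and "0 <= y" "y <= x" "x <= l"
 shows "(%n. integral {y..x} (f n)) ----> integral {y..x} g"
proof (rule LIM_zero_cancel, rule Lim_null_comparison)
 show "eventually (%n. norm (integral {y..x} (f n) - integral {y..x} g) <= sqrt l * nrm l (%x. f n x - g x)) sequentially"
 proof (rule always_eventually, rule allI)
  fix n
  have "integral {y..x} (f n) - integral {y..x} g = integral {y..x} (%x. f n x - g x)"
   by (rule Henstock_Kurzweil_Integration.integral_diff[symmetric]; rule L2_iv_integrable_on) (use assms in auto)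
  thus "norm (integral {y..x} (f n) - integral {y..x} g) <= sqrt l * nrm l (%x. f n x - g x)"
   using abs_integral_le_nrm[OF L2_iv_diff[OF assms(1,2)] assms(4-6)] by simp
 qed
 show "(%n. sqrt l * nrm l (%x. f n x - g x)) ----> 0"
  using tendsto_mult[OF tendsto_const assms(3), of "sqrt l"] by simp
qed

text \<open>
 The slopes of the dyadic interpolants of \<open>a\<close> form a bounded martingale; it converges in \<open>L\<^sub>2\<close>
 to a derivative of \<open>a\<close>.
\<close>

lemma AC_if_Lipschitz:
 assumes l: "0 < l" and lip: "!!x y. x \<in> {0..l} ==> y \<in> {0..l} ==> \<bar>a x - a y\<bar> <= C * \<bar>x - y\<bar>"
 shows "\<exists>a'. AC l a a'"
proof -
 have "0 <= C * l" using lip[of 0 l] l by auto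
 hence C: "0 <= C" using l by (simp add: zero_le_mult_iff)
 define x where "x n k = l * real k / 2 ^ n" for n k :: nat
 define c where "c n k = (a (x n (Suc k)) - a (x n k)) / (l / 2 ^ n)" for n k
 define d where "d n t = (if t \<in> {0..<l} then c n (nat \<lfloor>t * 2 ^ n / l\<rfloor>) else 0)" for n t
 have x0: "x n 0 = 0" for n by (simp add: x_def)
 have xl: "x n (2 ^ n) = l" for n by (simp add: x_def)
 have xm: "x n i <= x n j" if "i <= j" for n i j
  using that l by (simp add: x_def divide_right_mono)
 have xi: "x n i \<in> {0..l}" if "i <= 2 ^ n" for n i
  using xm[of 0 i n] xm[OF that, of n] by (simp add: x0 xl)
 have step: "x n (Suc k) - x n k = l / 2 ^ n" for n k
  by (simp add: x_def field_simps)
 have cell: "d n t = c n k" if k: "k < 2 ^ n" and t: "x n k <= t" "t < x n (Suc k)" for n k t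
 proof -
  have "real k <= t * 2 ^ n / l" "t * 2 ^ n / l < real k + 1"
   using t l by (auto simp: x_def field_simps)
  hence "\<lfloor>t * 2 ^ n / l\<rfloor> = int k" by (intro floor_unique) auto
  moreover have "t \<in> {0..<l}"
   using t xi[of k n] xi[of "Suc k" n] k by auto
  ultimately show ?thesis by (simp add: d_def)
 qed
 have dC: "\<bar>d n t\<bar> <= C" for n t
 proof (cases "t \<in> {0..<l}")
  case True
  define k where "k = nat \<lfloor>t * 2 ^ n / l\<rfloor>"
  have "0 <= t * 2 ^ n / l" using True l by simp
  hence "real k <= t * 2 ^ n / l" unfolding k_def by simp
  also have "t * 2 ^ n / l < 2 ^ n" using True l by (simp add: field_simps)
  finally have "k < 2 ^ n" by (metis of_nat_less_iff of_nat_numeral of_nat_power)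
  hence "\<bar>a (x n (Suc k)) - a (x n k)\<bar> <= C * \<bar>x n (Suc k) - x n k\<bar>"
   by (intro lip xi) auto
  hence "\<bar>a (x n (Suc k)) - a (x n k)\<bar> <= C * (l / 2 ^ n)" unfolding step using l by simp
  moreover have "\<bar>c n k\<bar> = \<bar>a (x n (Suc k)) - a (x n k)\<bar> / (l / 2 ^ n)"
   unfolding c_def abs_divide using l by (simp del: divide_divide_eq_right)
  ultimately have "\<bar>c n k\<bar> <= C"
   using l by (simp add: pos_divide_le_eq del: divide_divide_eq_right times_divide_eq_right)
  thus ?thesis using True by (simp add: d_def k_def)
 qed (use C in \<open>auto simp: d_def\<close>)
 have dL: "d n \<in> L2_iv l" for n
 proof (rule L2_iv_bounded[of _ _ C])
  have "d n \<in> borel_measurable borel" unfolding d_def by measurable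
  thus "d n \<in> borel_measurable (leb l)"
   by (intro measurable_restrict_space1 measurable_completion) simp
 qed (use dC in auto)
 have int: "h integrable_on {x n i..x n j}" if "h \<in> L2_iv l" "i <= j" "j <= 2 ^ n" for h n i j
  by (rule L2_iv_integrable_on[OF that(1)]) (use xi[of j n] xi[of i n] that in auto)
 have bdm: "(%t. d n t * g t) \<in> L2_iv l" if "g \<in> L2_iv l" for n g
  by (rule L2_iv_mult_bounded[OF that L2_iv_measurable[OF dL] AE_I2[OF dC]])
 have celli: "integral {x n k..x n (Suc k)} (%t. d n t * g t) = c n k * integral {x n k..x n (Suc k)} g"
  if "k < 2 ^ n" for n k g
 proof -
  have "integral {x n k..x n (Suc k)} (%t. d n t * g t) = integral {x n k..x n (Suc k)} (%t. c n k * g t)"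
   by (rule integral_spike[of "{x n (Suc k)}"]) (use cell[OF that] in auto)
  thus ?thesis by simp
 qed
 have Q: "integral {0..x n j} (%t. d n t * g t) = (\<Sum>k<j. c n k * integral {x n k..x n (Suc k)} g)"
  if "g \<in> L2_iv l" "j <= 2 ^ n" for n j g
  using that(2)
 proof (induction j)
  case (Suc j)
  have "integral {x n 0..x n j} (%t. d n t * g t) + integral {x n j..x n (Suc j)} (%t. d n t * g t)
   = integral {x n 0..x n (Suc j)} (%t. d n t * g t)"
   by (rule Henstock_Kurzweil_Integration.integral_combine)
    (use Suc.prems in \<open>auto intro!: xm int bdm that(1)\<close>)
  thus ?case using Suc celli[of j n g] by (simp add: x0)
 qed (simp add: x0)
 have P: "integral {0..x n j} (d n) = a (x n j) - a 0" if "j <= 2 ^ n" for n j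
 proof -
  have "integral {0..x n j} (d n) = (\<Sum>k<j. c n k * (x n (Suc k) - x n k))"
   using Q[OF L2_iv_const that, of 1] xm[of _ "Suc _" n] by simp
  also have "... = (\<Sum>k<j. a (x n (Suc k)) - a (x n k))"
   unfolding step c_def using l by simp
  also have "... = a (x n j) - a 0" by (simp only: sum_lessThan_telescope[of "%k. a (x n k)"] x0)
  finally show ?thesis .
 qed
 have refine: "x n k = x m (k * 2 ^ (m - n))" if "n <= m" for n m k
 proof -
  have "(2::real) ^ m = 2 ^ n * 2 ^ (m - n)" using that by (simp flip: power_add)
  thus ?thesis by (simp add: x_def)
 qed
 have P': "integral {0..x n j} (d m) = a (x n j) - a 0" if "n <= m" "j <= 2 ^ n" for n m j
 proof -
  have "j * 2 ^ (m - n) <= 2 ^ n * 2 ^ (m - n)" using that by simp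
  also have "... = 2 ^ m" using that by (simp flip: power_add)
  finally show ?thesis using P[of "j * 2 ^ (m - n)" m] refine[OF that(1), of j] by simp
 qed
 have P'': "integral {x n k..x n (Suc k)} (d m) = a (x n (Suc k)) - a (x n k)" if "n <= m" "k < 2 ^ n" for n m k
 proof -
  have "integral {x n 0..x n k} (d m) + integral {x n k..x n (Suc k)} (d m) = integral {x n 0..x n (Suc k)} (d m)"
   by (rule Henstock_Kurzweil_Integration.integral_combine) (use that in \<open>auto intro!: xm int dL\<close>)
  thus ?thesis using P'[OF that(1), of k] P'[OF that(1), of "Suc k"] that by (simp add: x0)
 qed
 \<comment> \<open>Martingale property: the coarse slopes are constant on cells, and on each cell
   finer slopes integrate to the same increment of \<open>a\<close> as the coarse ones.\<close>
 have orth: "inner_iv l (d n) (d m) = (\<Sum>k<2^n. c n k * (a (x n (Suc k)) - a (x n k)))" if "n <= m" for n m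
  using Q[OF dL, of "2 ^ n" n m] P''[OF that] by (simp add: inner_iv_integral dL xl)
 have orth': "inner_iv l (d n) (d m) = inner_iv l (d n) (d n)" if "n <= m" for n m
  by (simp only: orth[OF that] orth[OF order_refl])
 define E where "E n = inner_iv l (d n) (d n)" for n
 \<comment> \<open>Orthogonality of the increments to the past: squared distances are differences of
   the increasing sequence \<open>E\<close>, whose boundedness then gives the Cauchy
   property.\<close>
 have diff: "(nrm l (%t. d m t - d n t))^2 = E m - E n" if "n <= m" for n m
  using inner_iv_expand[OF dL[of m] dL[of n], of 1 "-1"] orth'[OF that]
  by (simp add: nrm_sq E_def inner_iv_commute[of l "d m" "d n"])
 have Em: "incseq E"
 proof (rule monoI)
  fix n m :: nat assume "n <= m"
  thus "E n <= E m" using diff[of n m] zero_le_power2[of "nrm l (%t. d m t - d n t)"] by linarith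
 qed
 have "E n <= (C * sqrt l)^2" for n
  unfolding E_def nrm_sq[symmetric] using l dC C by (intro power_mono nrm_le_bound dL) auto
 hence "convergent E" using Em by (metis convergent_def incseq_convergent)
 hence cau: "Cauchy E" by (rule convergent_Cauchy)
 have "\<exists>g\<in>L2_iv l. (%n. nrm l (%t. d n t - g t)) ----> 0"
 proof (rule L2_iv_complete[OF dL])
  fix e :: real assume e: "0 < e"
  obtain N where N: "!!m n. N <= m ==> N <= n ==> dist (E m) (E n) < e^2"
   using cau e unfolding Cauchy_def by (metis zero_less_power)
  have 1: "nrm l (%t. d m t - d n t) < e" if "N <= n" "n <= m" for m n
  proof (rule power2_less_imp_less)
   show "(nrm l (%t. d m t - d n t))^2 < e^2"
    using N[of m n] that diff[of n m] by (simp add: dist_real_def)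
  qed (use e in simp)
  have "nrm l (%t. d m t - d n t) < e" if "N <= n" "N <= m" for m n
   using 1[of n m] 1[of m n] that nrm_diff_commute[of l "d m" "d n"] by (cases "n <= m") auto
  thus "\<exists>N. \<forall>m\<ge>N. \<forall>n\<ge>N. nrm l (%t. d m t - d n t) < e" by blast
 qed
 then obtain g where g: "g \<in> L2_iv l" "(%n. nrm l (%t. d n t - g t)) ----> 0" by blast
 have dy: "integral {0..x n j} g = a (x n j) - a 0" if "j <= 2 ^ n" for n j
 proof -
  have "(%m. integral {0..x n j} (d m)) ----> integral {0..x n j} g"
   by (rule tendsto_integral_L2[OF dL g]) (use xi[OF that] in auto)
  moreover have "(%m. integral {0..x n j} (d m)) ----> a (x n j) - a 0"
   by (rule tendsto_eventually, rule eventually_mono[OF eventually_ge_at_top[of n]]) (rule P'[OF _ that])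
  ultimately show ?thesis by (rule LIMSEQ_unique)
 qed
 have ca: "cont l a"
 proof (rule continuous_onI)
  fix y e :: real assume "y \<in> {0..l}" "0 < e"
  thus "\<exists>\<delta>>0. \<forall>z\<in>{0..l}. dist z y < \<delta> --> dist (a z) (a y) <= e"
  proof (intro exI[of _ "e / (C + 1)"] conjI ballI impI)
   fix z assume z: "z \<in> {0..l}" "dist z y < e / (C + 1)"
   have "dist (a z) (a y) <= C * \<bar>z - y\<bar>" using lip[OF z(1) \<open>y \<in> _\<close>] by (simp add: dist_real_def)
   also have "... <= (C + 1) * (e / (C + 1))"
    using z(2) C by (intro mult_mono) (auto simp: dist_real_def)
   finally show "dist (a z) (a y) <= e" using C by simp
  qed (use C in auto)
 qed
 have eq: "a t = a 0 + integral {0..t} g" if t: "t \<in> {0..l}" for t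
 proof -
  define F where "F t = a t - a 0 - integral {0..t} g" for t
  have cF: "cont l F"
   unfolding F_def by (intro continuous_intros ca continuous_on_primitive g)
  define y where "y n = x n (nat \<lfloor>t * 2 ^ n / l\<rfloor>)" for n
  have kn: "nat \<lfloor>t * 2 ^ n / l\<rfloor> <= 2 ^ n" for n
  proof -
   have "t * 2 ^ n / l <= 2 ^ n" using t l by (simp add: field_simps)
   hence "\<lfloor>t * 2 ^ n / l\<rfloor> <= 2 ^ n" by (metis floor_mono floor_numeral_power)
   thus ?thesis by (simp add: nat_le_iff)
  qed
  have "F (y n) = 0" for n using dy[OF kn] by (simp add: F_def y_def)
  moreover have "(%n. F (y n)) ----> F t"
  proof (rule continuous_on_tendsto_compose[OF cF _ t])
   show "eventually (%n. y n \<in> {0..l}) sequentially" unfolding y_def using xi[OF kn] by simp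
   show "y ----> t"
   proof (rule LIM_zero_cancel, rule Lim_null_comparison)
    show "eventually (%n. norm (y n - t) <= l * (1/2) ^ n) sequentially"
    proof (rule always_eventually, rule allI)
     fix n
     define q where "q = t * 2 ^ n / l"
     have q0: "0 <= q" using t l by (simp add: q_def)
     have e1: "y n - t = (real_of_int \<lfloor>q\<rfloor> - q) * (l * (1/2) ^ n)"
      using l q0 by (simp add: y_def x_def q_def field_simps power_one_over)
     have "\<bar>real_of_int \<lfloor>q\<rfloor> - q\<bar> <= 1" by linarith
     hence "\<bar>real_of_int \<lfloor>q\<rfloor> - q\<bar> * (l * (1/2) ^ n) <= 1 * (l * (1/2) ^ n)"
      using l by (intro mult_right_mono) auto
     thus "norm (y n - t) <= l * (1/2) ^ n" unfolding e1 using l by (simp add: abs_mult)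
    qed
    show "(%n. l * (1/2) ^ n) ----> 0" by (intro tendsto_mult_right_zero LIMSEQ_power_zero) simp
   qed
  qed
  ultimately have "F t = 0" by (simp add: LIMSEQ_const_iff)
  thus ?thesis by (simp add: F_def)
 qed
 have "AC l a g" unfolding AC_def using eq g(1) by blast
 thus ?thesis by blast
qed

section \<open>Weak derivatives\<close>

lemma inner_iv_diff:
 "[|f \<in> L2_iv l; g \<in> L2_iv l; h \<in> L2_iv l|] ==> inner_iv l (%x. f x - g x) h = inner_iv l f h - inner_iv l g h"
 using inner_iv_lin[of f l g h 1 "-1"] by simp

lemma test_fun_deriv_funpow: "test_fun l \<phi> ==> test_fun l ((deriv ^^ n) \<phi>)"
 by (induction n) (auto intro: test_fun_deriv)

lemma has_weak_deriv_unique: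
 assumes l: "0 < l" and g: "has_weak_deriv n l f g" and h: "has_weak_deriv n l f h"
 shows "aeq l g h"
proof -
 note gL = has_weak_deriv_L2(2)[OF g] and hL = has_weak_deriv_L2(2)[OF h]
 have "AE x in leb l. g x - h x = 0"
 proof (rule fundamental_lemma[OF l L2_iv_diff[OF gL hL]])
  fix \<phi> assume t: "test_fun l \<phi>"
  have "(-1) ^ n * inner_iv l g \<phi> = (-1) ^ n * inner_iv l h \<phi>"
   using has_weak_deriv_test[OF g t] has_weak_deriv_test[OF h t] by simp
  thus "inner_iv l (%x. g x - h x) \<phi> = 0"
   by (simp add: inner_iv_diff gL hL L2_iv_test_fun[OF t])
 qed
 thus ?thesis by simp
qed

lemma weak_deriv_has_weak_deriv: "has_weak_deriv n l f g ==> has_weak_deriv n l f (weak_deriv n l f)"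
 unfolding weak_deriv_def using someI[of "%g. has_weak_deriv n l f g" g] by simp

lemma weak_deriv_AE:
 "[|0 < l; has_weak_deriv n l f g|] ==> AE x in leb l. weak_deriv n l f x = g x"
 by (rule has_weak_deriv_unique[OF _ weak_deriv_has_weak_deriv])

lemma has_weak_deriv_cong:
 assumes w: "has_weak_deriv n l f g" and L: "f' \<in> L2_iv l" "g' \<in> L2_iv l"
  and ae: "aeq l f f'" "aeq l g g'"
 shows "has_weak_deriv n l f' g'"
 unfolding has_weak_deriv_def
proof (intro conjI allI impI L)
 fix \<phi> assume t: "test_fun l \<phi>"
 note L' = has_weak_deriv_L2[OF w] and td = L2_iv_test_fun[OF test_fun_deriv_funpow[OF t]] L2_iv_test_fun[OF t]
 have "inner_iv l f' ((deriv ^^ n) \<phi>) = inner_iv l f ((deriv ^^ n) \<phi>)"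
  by (rule inner_iv_cong_AE[OF L(1) td(1) L'(1) td(1) L2_iv_AE_sym[OF ae(1)]]) simp
 moreover have "inner_iv l g' \<phi> = inner_iv l g \<phi>"
  by (rule inner_iv_cong_AE[OF L(2) td(2) L'(2) td(2) L2_iv_AE_sym[OF ae(2)]]) simp
 ultimately show "inner_iv l f' ((deriv ^^ n) \<phi>) = (-1) ^ n * inner_iv l g' \<phi>"
  using has_weak_deriv_test[OF w t] by simp
qed

lemma has_weak_deriv_lin:
 assumes "has_weak_deriv n l f f'" "has_weak_deriv n l g g'"
 shows "has_weak_deriv n l (%x. c * f x + d * g x) (%x. c * f' x + d * g' x)"
 unfolding has_weak_deriv_def
proof (intro conjI allI impI)
 note L = has_weak_deriv_L2[OF assms(1)] has_weak_deriv_L2[OF assms(2)]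
 show "(%x. c * f x + d * g x) \<in> L2_iv l" "(%x. c * f' x + d * g' x) \<in> L2_iv l"
  by (intro L2_iv_lin L)+
 fix \<phi> assume t: "test_fun l \<phi>"
 show "inner_iv l (%x. c * f x + d * g x) ((deriv ^^ n) \<phi>)
   = (-1) ^ n * inner_iv l (%x. c * f' x + d * g' x) \<phi>"
  using has_weak_deriv_test[OF assms(1) t] has_weak_deriv_test[OF assms(2) t]
  by (simp add: inner_iv_lin L L2_iv_test_fun[OF t] L2_iv_test_fun[OF test_fun_deriv_funpow[OF t]] algebra_simps)
qed

lemma has_weak_deriv_0: "f \<in> L2_iv l ==> has_weak_deriv 0 l f f"
 by (simp add: has_weak_deriv_def)

lemma has_weak_deriv_Suc:
 assumes w: "has_weak_deriv n l f g"
 shows "has_weak_deriv (Suc n) l f h \<longleftrightarrow> has_weak_deriv 1 l g h"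
proof -
 have eq: "inner_iv l f ((deriv ^^ Suc n) \<phi>) = (-1) ^ n * inner_iv l g (deriv \<phi>)" if "test_fun l \<phi>" for \<phi>
  using has_weak_deriv_test[OF w test_fun_deriv[OF that]] by (simp add: funpow_swap1)
 have "(inner_iv l f ((deriv ^^ Suc n) \<phi>) = (-1) ^ Suc n * inner_iv l h \<phi>)
   \<longleftrightarrow> inner_iv l g ((deriv ^^ 1) \<phi>) = (-1) ^ 1 * inner_iv l h \<phi>" if "test_fun l \<phi>" for \<phi>
  unfolding eq[OF that] by (auto simp: uminus_power_if)
 thus ?thesis
  unfolding has_weak_deriv_def[of "Suc n"] has_weak_deriv_def[of 1]
  using has_weak_deriv_L2[OF w] by blast
qed

lemma Hk_iv_D: "f \<in> Hk_iv k l ==> j <= k ==> has_weak_deriv j l f (weak_deriv j l f)"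
 unfolding Hk_iv_def using weak_deriv_has_weak_deriv by blast

lemma Hk_iv_L2: "f \<in> Hk_iv k l ==> f \<in> L2_iv l"
 by (simp add: Hk_iv_def)

lemma Hk_iv_mono: "k <= m ==> Hk_iv m l \<subseteq> Hk_iv k l"
 by (auto simp: Hk_iv_def)

lemma Hk_iv_0: "Hk_iv 0 l = L2_iv l"
 using has_weak_deriv_0 by (auto simp: Hk_iv_def)

lemma Hk_iv_1: "f \<in> Hk_iv 1 l \<longleftrightarrow> (\<exists>g. has_weak_deriv 1 l f g)"
proof
 assume "\<exists>g. has_weak_deriv 1 l f g"
 then obtain g where g: "has_weak_deriv 1 l f g" by blast
 have "\<exists>h. has_weak_deriv j l f h" if "j <= 1" for j
  using that g has_weak_deriv_0[OF has_weak_deriv_L2(1)[OF g]] by (cases "j = 0") (auto simp: le_Suc_eq)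
 thus "f \<in> Hk_iv 1 l" using has_weak_deriv_L2(1)[OF g] by (auto simp: Hk_iv_def)
qed (use Hk_iv_D in blast)

lemma Hk_iv_Suc: "f \<in> Hk_iv (Suc k) l \<longleftrightarrow> f \<in> Hk_iv k l & weak_deriv k l f \<in> Hk_iv 1 l"
proof -
 have *: "(\<exists>h. has_weak_deriv (Suc k) l f h) \<longleftrightarrow> weak_deriv k l f \<in> Hk_iv 1 l" if "f \<in> Hk_iv k l"
  unfolding Hk_iv_1 by (simp only: has_weak_deriv_Suc[OF Hk_iv_D[OF that order_refl]])
 have "f \<in> Hk_iv (Suc k) l \<longleftrightarrow> f \<in> Hk_iv k l & (\<exists>h. has_weak_deriv (Suc k) l f h)"
  unfolding Hk_iv_def by (auto simp: le_Suc_eq)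
 with * show ?thesis by blast
qed

lemma Hk_iv_lin:
 assumes "f \<in> Hk_iv k l" "g \<in> Hk_iv k l"
 shows "(%x. c * f x + d * g x) \<in> Hk_iv k l"
 unfolding Hk_iv_def
 using L2_iv_lin[OF Hk_iv_L2[OF assms(1)] Hk_iv_L2[OF assms(2)], of c d]
  has_weak_deriv_lin[OF Hk_iv_D[OF assms(1)] Hk_iv_D[OF assms(2)], of _ c d] by blast

lemma weak_deriv_lin_AE:
 assumes "0 < l" "f \<in> Hk_iv k l" "g \<in> Hk_iv k l" "j <= k"
 shows "AE x in leb l. weak_deriv j l (%x. c * f x + d * g x) x
  = c * weak_deriv j l f x + d * weak_deriv j l g x"
 using weak_deriv_AE[OF assms(1) has_weak_deriv_lin[OF Hk_iv_D[OF assms(2,4)] Hk_iv_D[OF assms(3,4)], of c d]] .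

lemma Hk_iv_norm_nonneg: "0 <= Hk_iv_norm k l f"
 unfolding Hk_iv_norm_def by (intro real_sqrt_ge_zero sum_nonneg inner_iv_nonneg)

lemma Hk_iv_norm_sq: "(Hk_iv_norm k l f)^2 = (\<Sum>j\<le>k. (nrm l (weak_deriv j l f))^2)"
 unfolding Hk_iv_norm_def nrm_sq by (intro real_sqrt_pow2 sum_nonneg inner_iv_nonneg)

lemma nrm_weak_deriv_le: "j <= k ==> nrm l (weak_deriv j l f) <= Hk_iv_norm k l f"
 by (rule power2_le_imp_le)
  (auto simp: Hk_iv_norm_sq Hk_iv_norm_nonneg intro!: member_le_sum[of j "{..k}" "%j. (nrm l (weak_deriv j l f))^2"])

lemma Hk_iv_norm_1:
 assumes l: "0 < l" and w: "has_weak_deriv 1 l f g"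
 shows "(Hk_iv_norm 1 l f)^2 = (nrm l f)^2 + (nrm l g)^2"
proof -
 have w0: "has_weak_deriv 0 l f f" by (rule has_weak_deriv_0[OF has_weak_deriv_L2(1)[OF w]])
 have "nrm l (weak_deriv 0 l f) = nrm l f"
  by (rule nrm_cong_AE[OF has_weak_deriv_L2(2)[OF weak_deriv_has_weak_deriv[OF w0]] has_weak_deriv_L2(1)[OF w]
     weak_deriv_AE[OF l w0]])
 moreover have "nrm l (weak_deriv 1 l f) = nrm l g"
  by (rule nrm_cong_AE[OF has_weak_deriv_L2(2)[OF weak_deriv_has_weak_deriv[OF w]] has_weak_deriv_L2(2)[OF w]
     weak_deriv_AE[OF l w]])
 ultimately show ?thesis by (simp add: Hk_iv_norm_sq)
qed

lemma AC_weak_deriv_1: "0 < l ==> AC l F f ==> has_weak_deriv 1 l F f"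
 by (rule AC_has_weak_deriv) (auto intro: AC_L2_fun)

text \<open>Uniqueness of continuous representatives makes the choice in
  \<open>continuous_rep\<close> irrelevant on the closed interval; all traces in the vertex
  conditions are computed through this.\<close>

lemma continuous_rep_eq:
 assumes l: "0 < l" and c: "cont l F" and ae: "aeq l F u"
  and x: "x \<in> {0..l}"
 shows "continuous_rep l u x = F x"
proof -
 have "cont l (continuous_rep l u) & (AE x in leb l. continuous_rep l u x = u x)"
  unfolding continuous_rep_def
  using someI[of "%g. cont l g & (aeq l g u)" F] c ae by blast
 thus ?thesis
  using continuous_AE_imp_eq[OF l _ c _ x, of "continuous_rep l u"] L2_iv_AE_trans[OF _ L2_iv_AE_sym[OF ae]]
  by blast
qed

section \<open>Real interpolation\<close>

lemma K_functional_le: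
 fixes N0 N1 :: "'f::minus => real"
 assumes "!!z. 0 <= N0 z" "!!z. 0 <= N1 z" "y \<in> X1" "0 <= t"
 shows "K_functional N0 X1 N1 t x <= N0 (x - y) + t * N1 y"
 unfolding K_functional_def
 by (rule cINF_lower) (use assms in \<open>auto intro!: bdd_belowI[of _ 0] add_nonneg_nonneg\<close>)

lemma K_functional_nonneg:
 fixes N0 N1 :: "'f::minus => real"
 assumes "!!z. 0 <= N0 z" "!!z. 0 <= N1 z" "X1 \<noteq> {}" "0 <= t"
 shows "0 <= K_functional N0 X1 N1 t x"
 unfolding K_functional_def
 by (rule cINF_greatest) (use assms in \<open>auto intro!: add_nonneg_nonneg\<close>)

lemma K_functional_mono:
 fixes N0 N1 :: "'f::minus => real"
 assumes "!!z. 0 <= N0 z" "!!z. 0 <= N1 z" "X1 \<noteq> {}" "0 <= s" "s <= t"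
 shows "K_functional N0 X1 N1 s x <= K_functional N0 X1 N1 t x"
 unfolding K_functional_def[of _ _ _ t]
proof (rule cINF_greatest)
 fix y assume "y \<in> X1"
 hence "K_functional N0 X1 N1 s x <= N0 (x - y) + s * N1 y"
  by (intro K_functional_le assms)
 also have "... <= N0 (x - y) + t * N1 y" using assms by (simp add: mult_right_mono)
 finally show "K_functional N0 X1 N1 s x <= N0 (x - y) + t * N1 y" .
qed fact

lemma K_functional_less:
 assumes "K_functional N0 X1 N1 t x < c" "X1 \<noteq> {}"
 obtains y where "y \<in> X1" "N0 (x - y) + t * N1 y < c"
 using assms unfolding K_functional_def by (auto dest!: cInf_lessD[rotated])

text \<open>Nearly optimal decompositions of \<open>x\<close> and \<open>y\<close> are merged into
  one of \<open>z\<close>. The relation between them is only the property \<open>ex\<close>, because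
  later \<open>z\<close> equals a linear combination merely almost everywhere.\<close>

lemma K_functional_combine:
 fixes N0 N1 :: "'f::minus => real"
 assumes N: "!!z. 0 <= N0 z" "!!z. 0 <= N1 z" "X1 \<noteq> {}" "0 <= A" "0 <= B" "0 <= t"
  and ex: "!!x1 y1. x1 \<in> X1 ==> y1 \<in> X1 ==> \<exists>z1\<in>X1. N0 (z - z1) <= A * N0 (x - x1) + B * N0 (y - y1)
   & N1 z1 <= A * N1 x1 + B * N1 y1"
 shows "K_functional N0 X1 N1 t z <= A * K_functional N0 X1 N1 t x + B * K_functional N0 X1 N1 t y"
proof (rule field_le_epsilon)
 fix e :: real assume e: "0 < e"
 define d where "d = e / (A + B + 1)"
 have d: "0 < d" "(A + B) * d <= e" using e N(4,5) by (auto simp: d_def field_simps)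
 obtain x1 where x1: "x1 \<in> X1" "N0 (x - x1) + t * N1 x1 < K_functional N0 X1 N1 t x + d"
  using K_functional_less[of N0 X1 N1 t x "K_functional N0 X1 N1 t x + d"] d N(3) by auto
 obtain y1 where y1: "y1 \<in> X1" "N0 (y - y1) + t * N1 y1 < K_functional N0 X1 N1 t y + d"
  using K_functional_less[of N0 X1 N1 t y "K_functional N0 X1 N1 t y + d"] d N(3) by auto
 obtain z1 where z1: "z1 \<in> X1" "N0 (z - z1) <= A * N0 (x - x1) + B * N0 (y - y1)" "N1 z1 <= A * N1 x1 + B * N1 y1"
  using ex[OF x1(1) y1(1)] by blast
 have "K_functional N0 X1 N1 t z <= N0 (z - z1) + t * N1 z1" by (rule K_functional_le[OF N(1,2) z1(1) N(6)])
 also have "... <= (A * N0 (x - x1) + B * N0 (y - y1)) + t * (A * N1 x1 + B * N1 y1)"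
  by (intro add_mono mult_left_mono z1 N)
 also have "... = A * (N0 (x - x1) + t * N1 x1) + B * (N0 (y - y1) + t * N1 y1)" by (simp add: algebra_simps)
 also have "... <= A * (K_functional N0 X1 N1 t x + d) + B * (K_functional N0 X1 N1 t y + d)"
  using x1 y1 N(4,5) by (intro add_mono[OF mult_left_mono mult_left_mono]) auto
 also have "... <= A * K_functional N0 X1 N1 t x + B * K_functional N0 X1 N1 t y + e"
  using d by (simp add: algebra_simps)
 finally show "K_functional N0 X1 N1 t z <= A * K_functional N0 X1 N1 t x + B * K_functional N0 X1 N1 t y + e" .
qed

text \<open>On \<open>{t..2 * t}\<close> the functional is at least its value at \<open>t\<close>
  and the weight at least its value at \<open>2 * t\<close>, so this part of the integral already
  gives the bound. It is the embedding of the parameters (\<theta>, 2) into (\<theta>,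
  \<infinity>).\<close>

lemma K_functional_le_interp_norm:
 fixes N0 N1 :: "'f::minus => real"
 assumes N: "!!z. 0 <= N0 z" "!!z. 0 <= N1 z" "X1 \<noteq> {}" and fin: "interp_norm_sq \<theta> N0 X1 N1 x < \<infinity>"
  and th: "0 < \<theta>" and t: "0 < t"
 shows "K_functional N0 X1 N1 t x <= sqrt 2 * (2 * t) powr \<theta> * interp_norm \<theta> N0 X1 N1 x"
proof -
 define K where "K s = K_functional N0 X1 N1 s x" for s
 define c where "c = ((2 * t) powr (- \<theta>) * K t)^2 / (2 * t)"
 have K0: "0 <= K s" if "0 <= s" for s unfolding K_def by (intro K_functional_nonneg N that)
 have c0: "0 <= c" using t by (simp add: c_def)
 have "ennreal (c * t) = ennreal c * emeasure lborel {t..2 * t}" using t c0 by (simp add: ennreal_mult)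
 also have "... = (\<integral>\<^sup>+s. ennreal c * indicator {t..2 * t} s \<partial>lborel)"
  by (rule nn_integral_cmult_indicator[symmetric]) simp
 also have "... <= interp_norm_sq \<theta> N0 X1 N1 x"
  unfolding interp_norm_sq_def
 proof (rule nn_integral_mono)
  fix s
  show "ennreal c * indicator {t..2 * t} s
   <= ennreal ((s powr (- \<theta>) * K_functional N0 X1 N1 s x)^2 / s) * indicator {0<..} s"
  proof (cases "s \<in> {t..2 * t}")
   case True
   have "(2 * t) powr (- \<theta>) <= s powr (- \<theta>)" using True t th by (intro powr_mono2') auto
   moreover have "K t <= K s" unfolding K_def using True t by (intro K_functional_mono N) auto
   ultimately have "c <= (s powr (- \<theta>) * K s)^2 / s"
    unfolding c_def using True t K0[of t]
    by (intro frac_le power_mono mult_mono) (auto intro!: mult_nonneg_nonneg)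
   thus ?thesis using True t by (auto simp: K_def intro!: ennreal_leI)
  qed auto
 qed
 finally have "c * t <= enn2real (interp_norm_sq \<theta> N0 X1 N1 x)"
  using fin c0 t by (metis enn2real_ennreal enn2real_mono infinity_ennreal_def mult_nonneg_nonneg less_imp_le)
 moreover have "c * t = ((2 * t) powr (- \<theta>) * K t / sqrt 2)^2"
  using t by (simp add: c_def power_divide)
 ultimately have "(2 * t) powr (- \<theta>) * K t / sqrt 2 <= interp_norm \<theta> N0 X1 N1 x"
  unfolding interp_norm_def by (metis real_le_rsqrt)
 hence "K t <= sqrt 2 * (2 * t) powr \<theta> * interp_norm \<theta> N0 X1 N1 x"
  using t by (simp add: powr_minus field_simps)
 thus ?thesis by (simp add: K_def)
qed

text \<open>Converse of the preceding bound with a loss of order: near 0 the integrand is at most a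
  constant times t^(2 (\<theta>' - \<theta>) - 1), which is integrable since \<theta> < \<theta>',
  and for large t boundedness of the functional suffices.\<close>

lemma interp_norm_sq_finite:
 fixes N0 N1 :: "'f::minus => real"
 assumes N: "!!z. 0 <= N0 z" "!!z. 0 <= N1 z" "X1 \<noteq> {}" and th: "0 < \<theta>" "\<theta> < \<theta>'"
  and s: "!!t. 0 < t ==> t <= 1 ==> K_functional N0 X1 N1 t x <= C * t powr \<theta>'"
  and b: "!!t. 1 <= t ==> K_functional N0 X1 N1 t x <= C"
 shows "interp_norm_sq \<theta> N0 X1 N1 x < \<infinity>"
proof -
 define K where "K s = K_functional N0 X1 N1 s x" for s
 have K0: "0 <= K s" if "0 <= s" for s unfolding K_def by (intro K_functional_nonneg N that)
 define p where "p = 2 * (\<theta>' - \<theta>) - 1"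
 define q where "q = - 2 * \<theta> - 1"
 let ?f = "%t. C^2 * t powr p" and ?g = "%t. C^2 * t powr q"
 have "(?f has_integral (C^2 * (1 powr (p + 1) / (p + 1)))) {0..1}"
  by (intro has_integral_mult_right has_integral_powr_from_0) (use th in \<open>auto simp: p_def\<close>)
 hence f: "(\<integral>\<^sup>+t. ennreal (indicator {0..1} t * ?f t) \<partial>lborel) = ennreal (C^2 * (1 powr (p + 1) / (p + 1)))"
  by (intro nn_integral_has_integral_lebesgue) auto
 have "(?g has_integral (C^2 * (- (1 powr (q + 1)) / (q + 1)))) {1..}"
  by (intro has_integral_mult_right has_integral_powr_to_inf) (use th in \<open>auto simp: q_def\<close>)
 hence g: "(\<integral>\<^sup>+t. ennreal (indicator {1..} t * ?g t) \<partial>lborel) = ennreal (C^2 * (- (1 powr (q + 1)) / (q + 1)))"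
  by (intro nn_integral_has_integral_lebesgue) auto
 have "interp_norm_sq \<theta> N0 X1 N1 x
  <= (\<integral>\<^sup>+t. ennreal (indicator {0..1} t * ?f t) + ennreal (indicator {1..} t * ?g t) \<partial>lborel)"
  unfolding interp_norm_sq_def
 proof (rule nn_integral_mono)
  fix t :: real
  consider "t <= 0" | "0 < t" "t <= 1" | "1 < t" by linarith
  thus "ennreal ((t powr (- \<theta>) * K_functional N0 X1 N1 t x)^2 / t) * indicator {0<..} t
    <= ennreal (indicator {0..1} t * ?f t) + ennreal (indicator {1..} t * ?g t)"
  proof cases
   case 2
   have "(t powr (- \<theta>) * K t)^2 / t <= (t powr (- \<theta>) * (C * t powr \<theta>'))^2 / t"
    using 2 s[of t] K0[of t] by (intro divide_right_mono power_mono mult_left_mono) (auto simp: K_def)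
   also have "... = C^2 * (t powr (2 * (\<theta>' - \<theta>)) / t powr 1)"
    using 2 by (simp add: power_mult_distrib powr_power flip: powr_add)
   also have "... = ?f t" using 2 by (simp only: p_def powr_diff[symmetric])
   finally have "ennreal ((t powr (- \<theta>) * K_functional N0 X1 N1 t x)^2 / t) <= ennreal (?f t)"
    unfolding K_def by (rule ennreal_leI)
   thus ?thesis using 2 by (auto simp: add_increasing2)
  next
   case 3
   have "(t powr (- \<theta>) * K t)^2 / t <= (t powr (- \<theta>) * C)^2 / t"
    using 3 b[of t] K0[of t] by (intro divide_right_mono power_mono mult_left_mono) (auto simp: K_def)
   also have "... = C^2 * (t powr (- 2 * \<theta>) / t powr 1)"
    using 3 by (simp add: power_mult_distrib powr_power)
   also have "... = ?g t" using 3 by (simp only: q_def powr_diff[symmetric])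
   finally have "ennreal ((t powr (- \<theta>) * K_functional N0 X1 N1 t x)^2 / t) <= ennreal (?g t)"
    unfolding K_def by (rule ennreal_leI)
   thus ?thesis using 3 by auto
  qed auto
 qed
 also have "... = (\<integral>\<^sup>+t. ennreal (indicator {0..1} t * ?f t) \<partial>lborel) + (\<integral>\<^sup>+t. ennreal (indicator {1..} t * ?g t) \<partial>lborel)"
  by (rule nn_integral_add) measurable
 also have "... < \<infinity>" unfolding f g by simp
 finally show ?thesis .
qed

lemma interp_norm_sq_combine:
 fixes N0 N1 :: "'f::minus => real"
 assumes N: "!!z. 0 <= N0 z" "!!z. 0 <= N1 z" "X1 \<noteq> {}" "0 <= A" "0 <= B"
  and ex: "!!x1 y1. x1 \<in> X1 ==> y1 \<in> X1 ==> \<exists>z1\<in>X1. N0 (z - z1) <= A * N0 (x - x1) + B * N0 (y - y1)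
   & N1 z1 <= A * N1 x1 + B * N1 y1"
  and x: "interp_norm_sq \<theta> N0 X1 N1 x < \<infinity>" and y: "interp_norm_sq \<theta> N0 X1 N1 y < \<infinity>"
 shows "interp_norm_sq \<theta> N0 X1 N1 z < \<infinity>"
proof -
 define K where "K x s = K_functional N0 X1 N1 s x" for x s
 have K0: "0 <= K x s" if "0 <= s" for s x unfolding K_def by (intro K_functional_nonneg N that)
 have meas: "(%t. ennreal ((t powr (- \<theta>) * K x t)^2 / t) * indicator {0<..} t) \<in> borel_measurable lborel" for x
 proof -
  \<comment> \<open>Measurability comes from monotonicity, which holds for nonnegative arguments;
    \<open>max 0\<close> extends it to the whole line.\<close>
  have [measurable]: "(%t. K x (max 0 t)) \<in> borel_measurable borel"
   by (intro borel_measurable_mono monoI) (auto simp: K_def intro!: K_functional_mono N)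
  have "(%t. ennreal ((t powr (- \<theta>) * K x (max 0 t))^2 / t) * indicator {0<..} t) \<in> borel_measurable lborel"
   by measurable
  also have "(%t. ennreal ((t powr (- \<theta>) * K x (max 0 t))^2 / t) * indicator {0<..} t)
   = (%t. ennreal ((t powr (- \<theta>) * K x t)^2 / t) * indicator {0<..} t)"
   by (auto simp: indicator_def max_def)
  finally show ?thesis .
 qed
 have I: "interp_norm_sq \<theta> N0 X1 N1 x = (\<integral>\<^sup>+t. ennreal ((t powr (- \<theta>) * K x t)^2 / t) * indicator {0<..} t \<partial>lborel)" for x
  by (simp add: interp_norm_sq_def K_def)
 have "interp_norm_sq \<theta> N0 X1 N1 z
  <= (\<integral>\<^sup>+t. ennreal (2 * A^2) * (ennreal ((t powr (- \<theta>) * K x t)^2 / t) * indicator {0<..} t)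
    + ennreal (2 * B^2) * (ennreal ((t powr (- \<theta>) * K y t)^2 / t) * indicator {0<..} t) \<partial>lborel)"
  unfolding I
 proof (rule nn_integral_mono)
  fix t :: real
  show "ennreal ((t powr (- \<theta>) * K z t)^2 / t) * indicator {0<..} t
   <= ennreal (2 * A^2) * (ennreal ((t powr (- \<theta>) * K x t)^2 / t) * indicator {0<..} t)
    + ennreal (2 * B^2) * (ennreal ((t powr (- \<theta>) * K y t)^2 / t) * indicator {0<..} t)"
  proof (cases "0 < t")
   case True
   have "K z t <= A * K x t + B * K y t"
    unfolding K_def by (rule K_functional_combine[OF N _ ex]) (use True in auto)
   hence "(t powr (- \<theta>) * K z t)^2 <= (t powr (- \<theta>) * (A * K x t + B * K y t))^2"
    using True K0[of t z] by (intro power_mono mult_left_mono) auto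
   also have "... = (t powr (- \<theta>))^2 * (A * K x t + B * K y t)^2" by (simp add: power_mult_distrib)
   also have "... <= (t powr (- \<theta>))^2 * (2 * (A * K x t)^2 + 2 * (B * K y t)^2)"
    using zero_le_power2[of "A * K x t - B * K y t"]
    by (intro mult_left_mono) (auto simp: power2_eq_square algebra_simps)
   also have "... = 2 * A^2 * (t powr (- \<theta>) * K x t)^2 + 2 * B^2 * (t powr (- \<theta>) * K y t)^2"
    by (simp add: power_mult_distrib algebra_simps)
   finally have "(t powr (- \<theta>) * K z t)^2 / t
     <= (2 * A^2 * (t powr (- \<theta>) * K x t)^2 + 2 * B^2 * (t powr (- \<theta>) * K y t)^2) / t"
    using True by (intro divide_right_mono) auto
   also have "... = 2 * A^2 * ((t powr (- \<theta>) * K x t)^2 / t) + 2 * B^2 * ((t powr (- \<theta>) * K y t)^2 / t)"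
    by (simp add: add_divide_distrib)
   finally have "ennreal ((t powr (- \<theta>) * K z t)^2 / t)
    <= ennreal (2 * A^2 * ((t powr (- \<theta>) * K x t)^2 / t) + 2 * B^2 * ((t powr (- \<theta>) * K y t)^2 / t))"
    by (rule ennreal_leI)
   also have "... = ennreal (2 * A^2) * ennreal ((t powr (- \<theta>) * K x t)^2 / t)
    + ennreal (2 * B^2) * ennreal ((t powr (- \<theta>) * K y t)^2 / t)"
    using True by (subst ennreal_plus) (auto simp: ennreal_mult[symmetric])
   finally show ?thesis using True by simp
  qed auto
 qed
 also have "... = ennreal (2 * A^2) * interp_norm_sq \<theta> N0 X1 N1 x + ennreal (2 * B^2) * interp_norm_sq \<theta> N0 X1 N1 y"
 proof -
  note m = borel_measurable_times_ennreal[OF measurable_const meas]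
  show ?thesis unfolding I
   by (subst nn_integral_add[OF m m]) (simp_all only: nn_integral_cmult[OF meas] space_lborel space_borel UNIV_I)
 qed
 also have "... < \<infinity>" using x y by (auto simp: ennreal_mult_less_top)
 finally show ?thesis .
qed

lemma half_power_le_1: "(1/2 :: real) ^ j <= 1"
 by (simp add: power_le_one)

lemma interp_norm_sq_finite_dyadic:
 fixes N0 N1 :: "'f::minus => real"
 assumes N: "!!z. 0 <= N0 z" "!!z. 0 <= N1 z" "X1 \<noteq> {}" and th: "0 < \<theta>" "\<theta> < \<theta>'" and C: "0 <= C"
  and s: "!!j. K_functional N0 X1 N1 ((1/2) ^ j) x <= C * hp j \<theta>'"
  and b: "!!t. 1 <= t ==> K_functional N0 X1 N1 t x <= C"
 shows "interp_norm_sq \<theta> N0 X1 N1 x < \<infinity>"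
proof (rule interp_norm_sq_finite[OF N th, where C = "C * 2 powr \<theta>'"])
 fix t :: real assume t: "0 < t" "t <= 1"
 \<comment> \<open>This \<open>j\<close> brackets \<open>t\<close> between (1/2)^(j + 1) and
   (1/2)^j; replacing \<open>t\<close> by the scale above it costs the factor
   \<open>2 powr \<theta>'\<close>.\<close>
 define j where "j = (LEAST j. (1/2) ^ Suc j <= t)"
 obtain n where "(1/2) ^ n < t" using real_arch_pow_inv[OF t(1), of "1/2"] by auto
 hence ex: "(1/2) ^ Suc n <= t" using t(1) by simp
 have j1: "(1/2) ^ Suc j <= t" unfolding j_def by (rule LeastI[of _ n], rule ex)
 have j2: "t <= (1/2) ^ j"
 proof (cases j)
  case (Suc i)
  hence "\<not> (1/2) ^ Suc i <= t" using not_less_Least[of i "%j. (1/2) ^ Suc j <= t"] unfolding j_def by simp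
  thus ?thesis using Suc by simp
 qed (use t in simp)
 have "K_functional N0 X1 N1 t x <= K_functional N0 X1 N1 ((1/2) ^ j) x"
  using t j2 by (intro K_functional_mono N) auto
 also have "... <= C * hp j \<theta>'" by (rule s)
 also have "... <= C * (2 * t) powr \<theta>'"
  using j1 th C by (intro mult_left_mono powr_mono2) auto
 also have "... = C * 2 powr \<theta>' * t powr \<theta>'" using t by (simp add: powr_mult)
 finally show "K_functional N0 X1 N1 t x <= C * 2 powr \<theta>' * t powr \<theta>'" .
next
 fix t :: real assume "1 <= t"
 hence "K_functional N0 X1 N1 t x <= C" by (rule b)
 also have "... <= C * 2 powr \<theta>'" using C th by (simp add: mult_le_cancel_left1 ge_one_powr_ge_zero)
 finally show "K_functional N0 X1 N1 t x <= C * 2 powr \<theta>'" .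
qed

text \<open>Nearly optimal decompositions at the parameters (1/2)^j. The factor 3 bounds sqrt 2
  times 2^\<theta>, which is at most sqrt 8, and \<open>b\<close> is strictly larger because the
  infimum need not be attained.\<close>

lemma interp_dyadic:
 fixes N0 N1 :: "'f::minus => real"
 assumes N: "!!z. 0 <= N0 z" "!!z. 0 <= N1 z" "X1 \<noteq> {}" and x: "x \<in> interp \<theta> X0 N0 X1 N1"
  and th: "0 < \<theta>" "\<theta> <= 1" and b: "3 * interp_norm \<theta> N0 X1 N1 x < b"
 shows "\<exists>y. \<forall>j. y j \<in> X1 & N0 (x - y j) <= b * hp j \<theta> & N1 (y j) <= b * hp j (\<theta> - 1)"
proof (rule choice, rule allI)
 fix j
 let ?h = "(1/2::real) ^ j"
 have n0: "0 <= interp_norm \<theta> N0 X1 N1 x" by (simp add: interp_norm_def)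
 have "K_functional N0 X1 N1 ?h x <= sqrt 2 * (2 * ?h) powr \<theta> * interp_norm \<theta> N0 X1 N1 x"
  by (rule K_functional_le_interp_norm[OF N]) (use x th in \<open>auto simp: interp_def\<close>)
 also have "... = (sqrt 2 * 2 powr \<theta>) * hp j \<theta> * interp_norm \<theta> N0 X1 N1 x"
  by (simp add: powr_mult)
 also have "... <= 3 * hp j \<theta> * interp_norm \<theta> N0 X1 N1 x"
 proof (intro mult_right_mono n0)
  have "sqrt 2 * 2 powr \<theta> <= sqrt 2 * 2 powr 1" using th by (intro mult_left_mono powr_mono) auto
  also have "... = sqrt 8" by (simp add: real_sqrt_mult[of 4 2, simplified])
  also have "... <= 3" by (rule real_le_lsqrt) auto
  finally show "sqrt 2 * 2 powr \<theta> <= 3" .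
 qed auto
 also have "... = hp j \<theta> * (3 * interp_norm \<theta> N0 X1 N1 x)" by simp
 also have "... < hp j \<theta> * b" using b by (intro mult_strict_left_mono) auto
 finally obtain y where y: "y \<in> X1" "N0 (x - y) + ?h * N1 y < hp j \<theta> * b"
  using K_functional_less N(3) by metis
 have "N0 (x - y) <= b * hp j \<theta>"
  using y(2) N(2)[of y] by (smt (verit) mult.commute mult_nonneg_nonneg zero_le_power divide_nonneg_nonneg)
 moreover have "N1 y <= b * hp j (\<theta> - 1)"
 proof -
  have "?h * N1 y <= hp j \<theta> * b" using y(2) N(1)[of "x - y"] by linarith
  also have "hp j \<theta> = ?h * hp j (\<theta> - 1)" by (simp add: powr_mult_base)
  finally show ?thesis by (simp add: mult.commute)
 qed
 ultimately show "\<exists>y. y \<in> X1 & N0 (x - y) <= b * hp j \<theta> & N1 y <= b * hp j (\<theta> - 1)"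
  using y(1) by blast
qed

text \<open>An element \<open>z\<close> with vanishing \<open>N1\<close> keeps the functional
  bounded for large t; for small t the larger exponent \<theta>' provides the decay that
  \<open>interp_norm_sq_finite\<close> asks for.\<close>

lemma interp_mono:
 fixes N0 N1 :: "'f::minus => real"
 assumes N: "!!z. 0 <= N0 z" "!!z. 0 <= N1 z" and z: "z \<in> X1" "N1 z = 0"
  and th: "0 < \<theta>" "\<theta> <= \<theta>'" and x: "x \<in> interp \<theta>' X0 N0 X1 N1"
 shows "x \<in> interp \<theta> X0 N0 X1 N1"
proof (cases "\<theta> = \<theta>'")
 case False
 have X1: "X1 \<noteq> {}" using z by blast
 define C where "C = max (sqrt 2 * 2 powr \<theta>' * interp_norm \<theta>' N0 X1 N1 x) (N0 (x - z))"
 have "interp_norm_sq \<theta> N0 X1 N1 x < \<infinity>"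
 proof (rule interp_norm_sq_finite[where \<theta>' = \<theta>' and C = C, OF N X1 th(1)])
  fix t :: real assume t: "0 < t" "t <= 1"
  have "K_functional N0 X1 N1 t x <= sqrt 2 * (2 * t) powr \<theta>' * interp_norm \<theta>' N0 X1 N1 x"
   by (rule K_functional_le_interp_norm[OF N X1]) (use x th t in \<open>auto simp: interp_def\<close>)
  also have "... = (sqrt 2 * 2 powr \<theta>' * interp_norm \<theta>' N0 X1 N1 x) * t powr \<theta>'"
   using t by (simp add: powr_mult)
  also have "... <= C * t powr \<theta>'" by (intro mult_right_mono) (auto simp: C_def)
  finally show "K_functional N0 X1 N1 t x <= C * t powr \<theta>'" .
 next
  fix t :: real assume "1 <= t"
  hence "K_functional N0 X1 N1 t x <= N0 (x - z) + t * N1 z" by (intro K_functional_le N z) auto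
  thus "K_functional N0 X1 N1 t x <= C" using z(2) by (simp add: C_def)
 qed (use th False in auto)
 with x show ?thesis by (simp add: interp_def)
qed (use x in simp)

lemma interp_superset:
 fixes N0 N1 :: "'f::minus => real"
 assumes N: "!!z. 0 <= N0 z" "!!z. 0 <= N1 z" and z: "z \<in> X1" "N1 z = 0"
  and th: "0 < \<theta>" "\<theta> < 1" and x: "x \<in> X1" "x \<in> X0" "N0 (x - x) = 0"
 shows "x \<in> interp \<theta> X0 N0 X1 N1"
proof -
 have X1: "X1 \<noteq> {}" using z by blast
 define C where "C = max (N1 x) (N0 (x - z))"
 have "interp_norm_sq \<theta> N0 X1 N1 x < \<infinity>"
 proof (rule interp_norm_sq_finite[where C = C, OF N X1 th])
  fix t :: real assume t: "0 < t" "t <= 1"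
  have "K_functional N0 X1 N1 t x <= N0 (x - x) + t * N1 x" using t by (intro K_functional_le N x) auto
  also have "... <= t * C" using t x(3) by (simp add: C_def)
  finally show "K_functional N0 X1 N1 t x <= C * t powr 1" using t by (simp add: mult.commute)
 next
  fix t :: real assume "1 <= t"
  hence "K_functional N0 X1 N1 t x <= N0 (x - z) + t * N1 z" by (intro K_functional_le N z) auto
  thus "K_functional N0 X1 N1 t x <= C" using z(2) by (simp add: C_def)
 qed
 with x show ?thesis by (simp add: interp_def)
qed

section \<open>Dyadic approximation and the trace\<close>

lemma half_power_powr: "hp j a = ((1/2) powr a) ^ j"
proof -
 have "hp j a = ((1/2) powr real j) powr a" by (simp add: powr_realpow)
 also have "... = ((1/2) powr a) powr real j" by (simp only: powr_powr mult.commute)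
 also have "... = ((1/2) powr a) ^ j" by (rule powr_realpow) simp
 finally show ?thesis .
qed

lemma abs_le_if_power2_le: "x^2 <= y^2 ==> 0 <= y ==> \<bar>x\<bar> <= (y::real)"
 by (metis abs_le_square_iff abs_of_nonneg)

text \<open>The sup bound for consecutive differences. With h = (1/2)^j their norm is at most 2 b
  h^\<theta> (two errors) and their derivative norm at most 3 b h^(\<theta> - 1) (the finer one
  costs a factor 2); squaring gives 4 / l + 12 and the exponent \<theta> - 1/2.\<close>

lemma AC_dyadic_increment:
 assumes l: "0 < l" and u: "u \<in> L2_iv l" and th: "0 <= \<theta>" "\<theta> <= 1" and b: "0 <= b"
  and Y: "!!j. AC l (Y j) (y j)"
  and e: "!!j. nrm l (%x. u x - Y j x) <= b * hp j \<theta>"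
  and g: "!!j. nrm l (y j) <= b * hp j (\<theta> - 1)" and x: "x \<in> {0..l}"
 shows "\<bar>Y (Suc j) x - Y j x\<bar> <= sqrt (4 / l + 12) * b * ((1/2) powr (\<theta> - 1/2)) ^ j"
proof -
 define h :: real where "h = (1/2) ^ j"
 have h: "0 < h" "h <= 1" by (auto simp: h_def power_le_one)
 define d where "d x = Y (Suc j) x - Y j x" for x
 have d: "AC l d (%x. y (Suc j) x - y j x)" unfolding d_def by (rule AC_diff[OF Y Y])
 have YL: "Y i \<in> L2_iv l" for i by (rule AC_L2_fun[OF Y])
 have "nrm l d <= nrm l (%x. Y (Suc j) x - u x) + nrm l (%x. u x - Y j x)"
  unfolding d_def by (rule nrm_triangle[OF YL u YL])
 also have "... <= b * (h / 2) powr \<theta> + b * h powr \<theta>"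
  using e[of "Suc j"] e[of j] nrm_diff_commute[of l u "Y (Suc j)"] by (simp add: h_def)
 also have "... <= b * h powr \<theta> + b * h powr \<theta>"
  using h th b by (intro add_mono mult_left_mono powr_mono2) auto
 finally have n1: "nrm l d <= 2 * b * h powr \<theta>" by simp
 have "nrm l (%x. y (Suc j) x - y j x) <= nrm l (y (Suc j)) + nrm l (y j)"
  by (rule nrm_diff[OF AC_L2[OF Y] AC_L2[OF Y]])
 also have "... <= b * (h / 2) powr (\<theta> - 1) + b * h powr (\<theta> - 1)"
  using g[of "Suc j"] g[of j] by (simp add: h_def)
 also have "(h / 2) powr (\<theta> - 1) = h powr (\<theta> - 1) * 2 powr (1 - \<theta>)"
  using h powr_minus_divide[of 2 "\<theta> - 1"] by (simp add: powr_divide)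
 also have "b * (h powr (\<theta> - 1) * 2 powr (1 - \<theta>)) <= b * (h powr (\<theta> - 1) * 2 powr 1)"
  using th b by (intro mult_left_mono powr_mono) auto
 finally have n2: "nrm l (%x. y (Suc j) x - y j x) <= 3 * b * h powr (\<theta> - 1)" by (simp add: algebra_simps)
 have e1: "(h powr \<theta>)^2 = h powr (2 * \<theta>)" "h powr \<theta> * h powr (\<theta> - 1) = h powr (2 * \<theta> - 1)"
  using h by (auto simp: powr_power powr_add[symmetric])
 have "(d x)^2 <= (nrm l d)^2 / l + 2 * nrm l d * nrm l (%x. y (Suc j) x - y j x)"
  by (rule AC_sup_bound[OF d l x])
 also have "... <= (2 * b * h powr \<theta>)^2 / l + 2 * (2 * b * h powr \<theta>) * (3 * b * h powr (\<theta> - 1))"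
  using n1 n2 l b by (intro add_mono divide_right_mono power_mono mult_mono) auto
 also have "... = (4 / l) * b^2 * h powr (2 * \<theta>) + 12 * b^2 * h powr (2 * \<theta> - 1)"
  unfolding e1[symmetric] by (simp add: power2_eq_square algebra_simps)
 also have "... <= (4 / l) * b^2 * h powr (2 * \<theta> - 1) + 12 * b^2 * h powr (2 * \<theta> - 1)"
  using h l by (intro add_mono mult_left_mono powr_mono') auto
 also have "... = (4 / l + 12) * b^2 * (h powr (\<theta> - 1/2))^2"
  using h by (simp add: powr_power algebra_simps)
 also have "... = (sqrt (4 / l + 12) * b * h powr (\<theta> - 1/2))^2"
  using l by (simp add: power_mult_distrib)
 finally have "\<bar>d x\<bar> <= sqrt (4 / l + 12) * b * h powr (\<theta> - 1/2)"
  by (rule abs_le_if_power2_le) (use b l in auto)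
 thus ?thesis by (simp add: d_def h_def half_power_powr)
qed

text \<open>Below order 1/2 the bounds on the increments grow geometrically, so their sum is
  controlled by the last one: there need be no trace, but the rate at which point values may blow up
  is known.\<close>

lemma AC_dyadic_growth:
 assumes l: "0 < l" and u: "u \<in> L2_iv l" and th: "0 <= \<theta>" "\<theta> < 1/2" and b: "0 <= b"
  and Y: "!!j. AC l (Y j) (y j)"
  and e: "!!j. nrm l (%x. u x - Y j x) <= b * hp j \<theta>"
  and g: "!!j. nrm l (y j) <= b * hp j (\<theta> - 1)" and Y0: "nrm l (Y 0) <= b"
  and x: "x \<in> {0..l}"
 shows "\<bar>Y j x\<bar> <= (sqrt (1 / l + 2) + sqrt (4 / l + 12) / ((1/2) powr (\<theta> - 1/2) - 1)) * b * hp j (\<theta> - 1/2)"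
proof -
 define q :: real where "q = (1/2) powr (\<theta> - 1/2)"
 define c where "c = sqrt (4 / l + 12)"
 have "(1/2 :: real) powr 0 < (1/2) powr (\<theta> - 1/2)" using th by (intro powr_less_mono') auto
 hence q: "1 < q" by (simp add: q_def)
 have g0: "nrm l (y 0) <= b" using g[of 0] by simp
 have "(Y 0 x)^2 <= (nrm l (Y 0))^2 / l + 2 * nrm l (Y 0) * nrm l (y 0)" by (rule AC_sup_bound[OF Y l x])
 also have "... <= b^2 / l + 2 * b * b"
  using Y0 g0 l b by (intro add_mono divide_right_mono power_mono mult_mono) auto
 also have "... = (sqrt (1 / l + 2) * b)^2"
  using l by (simp add: power_mult_distrib algebra_simps power2_eq_square)
 finally have Y0x: "\<bar>Y 0 x\<bar> <= sqrt (1 / l + 2) * b"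
  by (rule abs_le_if_power2_le) (use b l in auto)
 have "\<bar>Y j x\<bar> <= sqrt (1 / l + 2) * b + (\<Sum>i<j. c * b * q ^ i)"
 proof (induction j)
  case (Suc j)
  thus ?case
   using AC_dyadic_increment[OF l u th(1) _ b Y e g x, of j] th unfolding q_def[symmetric] c_def[symmetric] by simp
 qed (use Y0x in simp)
 also have "(\<Sum>i<j. c * b * q ^ i) = c * b * ((q ^ j - 1) / (q - 1))"
  using q by (simp add: sum_distrib_left[symmetric] geometric_sum)
 also have "... <= c * b * (q ^ j / (q - 1))"
  using q b l by (intro mult_left_mono divide_right_mono) (auto simp: c_def)
 also have "sqrt (1 / l + 2) * b <= sqrt (1 / l + 2) * b * q ^ j"
  using q b l mult_left_mono[of 1 "q ^ j" "sqrt (1 / l + 2) * b"] by simp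
 finally show ?thesis by (simp add: q_def c_def half_power_powr algebra_simps)
qed

text \<open>Above order 1/2 the increments decay geometrically and the convergence is uniform. The
  limit is the continuous representative of \<open>u\<close>, and the tail of the series is the rate
  at which traces converge.\<close>

lemma AC_dyadic_limit:
 assumes l: "0 < l" and u: "u \<in> L2_iv l" and th: "1/2 < \<theta>" "\<theta> <= 1" and b: "0 <= b"
  and Y: "!!j. AC l (Y j) (y j)"
  and e: "!!j. nrm l (%x. u x - Y j x) <= b * hp j \<theta>"
  and g: "!!j. nrm l (y j) <= b * hp j (\<theta> - 1)"
 shows "\<exists>F. cont l F & (aeq l F u) &
  (\<forall>j. \<forall>x\<in>{0..l}. \<bar>Y j x - F x\<bar>
   <= sqrt (4 / l + 12) / (1 - (1/2) powr (\<theta> - 1/2)) * b * hp j (\<theta> - 1/2))"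
proof -
 define q :: real where "q = (1/2) powr (\<theta> - 1/2)"
 define c where "c = sqrt (4 / l + 12)"
 have "(1/2 :: real) powr (\<theta> - 1/2) < (1/2) powr 0" using th by (intro powr_less_mono') auto
 hence q: "0 < q" "q < 1" by (auto simp: q_def)
 have inc: "\<bar>Y (Suc j) x - Y j x\<bar> <= c * b * q ^ j" if "x \<in> {0..l}" for j x
  unfolding q_def c_def by (rule AC_dyadic_increment[OF l u _ _ b Y e g that]) (use th in auto)
 have sm: "summable (%j. c * b * q ^ j)" using q by (intro summable_mult summable_geometric) simp
 define F where "F x = Y 0 x + (\<Sum>j. Y (Suc j) x - Y j x)" for x
 have sx: "summable (%j. Y (Suc j) x - Y j x)" if "x \<in> {0..l}" for x
  by (rule summable_comparison_test'[OF sm]) (use inc[OF that] in auto)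
 have tail: "\<bar>Y j x - F x\<bar> <= c * b * q ^ j / (1 - q)" if x: "x \<in> {0..l}" for j x
 proof -
  have "(\<Sum>j. Y (Suc j) x - Y j x) = (\<Sum>i. Y (Suc (i + j)) x - Y (i + j) x) + (\<Sum>i<j. Y (Suc i) x - Y i x)"
   by (rule suminf_split_initial_segment[OF sx[OF x]])
  also have "(\<Sum>i<j. Y (Suc i) x - Y i x) = Y j x - Y 0 x"
   by (rule sum_lessThan_telescope[of "%i. Y i x"])
  finally have "Y j x - F x = - (\<Sum>i. Y (Suc (i + j)) x - Y (i + j) x)" by (simp add: F_def)
  also have "\<bar>...\<bar> <= (\<Sum>i. c * b * q ^ (i + j))"
  proof -
   have s1: "summable (%i. c * b * q ^ (i + j))" using sm by (subst summable_iff_shift)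
   have s2: "summable (%i. \<bar>Y (Suc (i + j)) x - Y (i + j) x\<bar>)"
    by (rule summable_comparison_test'[OF s1]) (use inc[OF x] in auto)
   have "\<bar>\<Sum>i. Y (Suc (i + j)) x - Y (i + j) x\<bar> <= (\<Sum>i. \<bar>Y (Suc (i + j)) x - Y (i + j) x\<bar>)"
    by (rule summable_rabs[OF s2])
   also have "... <= (\<Sum>i. c * b * q ^ (i + j))" by (rule suminf_le[OF inc[OF x] s2 s1])
   finally show ?thesis by simp
  qed
  also have "... = (\<Sum>i. (c * b * q ^ j) * q ^ i)" by (simp add: power_add mult_ac)
  also have "... = c * b * q ^ j / (1 - q)"
   using q by (subst suminf_mult) (auto simp: suminf_geometric)
  finally show ?thesis .
 qed
 have q0: "(%j. c * b * q ^ j / (1 - q)) ----> 0"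
  using q by (intro tendsto_divide_zero tendsto_mult_right_zero LIMSEQ_power_zero) auto
 have "uniform_limit {0..l} Y F sequentially"
 proof (rule uniform_limitI)
  fix d :: real assume "0 < d"
  with q0 have "eventually (%j. c * b * q ^ j / (1 - q) < d) sequentially"
   by (rule order_tendstoD)
  thus "\<forall>\<^sub>F j in sequentially. \<forall>x\<in>{0..l}. dist (Y j x) (F x) < d"
  proof (rule eventually_mono, intro ballI)
   fix j x assume "c * b * q ^ j / (1 - q) < d" "x \<in> {0..l}"
   thus "dist (Y j x) (F x) < d" using tail[of x j] unfolding dist_real_def by linarith
  qed
 qed
 hence cF: "cont l F"
  by (rule uniform_limit_theorem[rotated]) (simp_all add: AC_continuous[OF Y])
 have FL: "F \<in> L2_iv l" by (rule L2_iv_continuous[OF cF])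
 have YL: "Y j \<in> L2_iv l" for j by (rule AC_L2_fun[OF Y])
 have "nrm l (%x. F x - u x) <= 0"
 proof (rule LIMSEQ_le_const)
  have "(%j. c * b * q ^ j / (1 - q) * sqrt l + b * ((1/2) powr \<theta>) ^ j) ----> 0 * sqrt l + b * 0"
  proof (intro tendsto_add tendsto_mult tendsto_const q0 LIMSEQ_power_zero)
   have "(1/2 :: real) powr \<theta> < (1/2) powr 0" using th by (intro powr_less_mono') auto
   thus "norm ((1/2 :: real) powr \<theta>) < 1" by simp
  qed
  thus "(%j. c * b * q ^ j / (1 - q) * sqrt l + b * ((1/2) powr \<theta>) ^ j) ----> 0" by simp
  have "nrm l (%x. F x - u x) <= c * b * q ^ j / (1 - q) * sqrt l + b * ((1/2) powr \<theta>) ^ j" for j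
  proof -
   have "nrm l (%x. F x - u x) <= nrm l (%x. F x - Y j x) + nrm l (%x. Y j x - u x)"
    by (rule nrm_triangle[OF FL YL u])
   moreover have "nrm l (%x. F x - Y j x) <= c * b * q ^ j / (1 - q) * sqrt l"
    using tail[of _ j] b q l
    by (intro nrm_le_bound L2_iv_diff FL YL AE_iv_I) (auto simp: abs_minus_commute c_def)
   moreover have "nrm l (%x. Y j x - u x) <= b * ((1/2) powr \<theta>) ^ j"
    using e[of j] by (simp add: nrm_diff_commute[of l u] half_power_powr)
   ultimately show ?thesis by linarith
  qed
  thus "\<exists>N. \<forall>n\<ge>N. nrm l (%x. F x - u x) <= c * b * q ^ n / (1 - q) * sqrt l + b * ((1/2) powr \<theta>) ^ n"
   by blast
 qed
 hence "nrm l (%x. F x - u x) = 0" by (simp add: order_antisym)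
 hence "AE x in leb l. F x - u x = 0" by (rule nrm_eq_0_AE[OF L2_iv_diff[OF FL u]])
 hence "aeq l F u" by simp
 thus ?thesis
  using cF tail by (intro exI[of _ F]) (simp add: q_def c_def half_power_powr)
qed

section \<open>Sobolev spaces of real order on an interval\<close>

abbreviation Hfrac_iv :: "real => real => (real => real) set" where
 "Hfrac_iv \<theta> l \<equiv> interp \<theta> (L2_iv l) (%g. sqrt (inner_iv l g g)) (Hk_iv 1 l) (Hk_iv_norm 1 l)"

lemma sqrt_inner_iv: "(%g. sqrt (inner_iv l g g)) = nrm l"
 by (simp add: nrm_def fun_eq_iff)

lemma Hk_iv_1_AC:
 assumes l: "0 < l" and f: "f \<in> Hk_iv 1 l"
 obtains F g where "AC l F g" "aeq l F f" "has_weak_deriv 1 l f g"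
  "nrm l F <= Hk_iv_norm 1 l f" "nrm l g <= Hk_iv_norm 1 l f"
proof -
 obtain g where g: "has_weak_deriv 1 l f g" using f Hk_iv_1 by blast
 obtain F where F: "AC l F g" "aeq l F f"
  using has_weak_deriv_imp_AC[OF l g] by blast
 have "nrm l F = nrm l f" by (rule nrm_cong_AE[OF AC_L2_fun[OF F(1)] Hk_iv_L2[OF f] F(2)])
 hence "nrm l F <= Hk_iv_norm 1 l f" "nrm l g <= Hk_iv_norm 1 l f"
  using Hk_iv_norm_1[OF l g] by (auto intro!: power2_le_imp_le[OF _ Hk_iv_norm_nonneg])
 with F g show thesis using that by blast
qed

lemma zero_Hk_iv_1: "0 < l ==> (%x. 0) \<in> Hk_iv 1 l" "0 < l ==> Hk_iv_norm 1 l (%x. 0) = 0"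
proof -
 assume l: "0 < l"
 have w: "has_weak_deriv 1 l (%x. 0) (%x. 0)" by (rule AC_weak_deriv_1[OF l AC_const])
 show "(%x. 0) \<in> Hk_iv 1 l" using w Hk_iv_1 by blast
 have "nrm l (%x. 0) = 0" by (rule nrm_AE_0) simp
 thus "Hk_iv_norm 1 l (%x. 0) = 0" using Hk_iv_norm_1[OF l w] by simp
qed

lemma Hfrac_iv_mono:
 assumes "0 < l" "0 < \<theta>" "\<theta> <= \<theta>'" shows "Hfrac_iv \<theta>' l \<subseteq> Hfrac_iv \<theta> l"
 unfolding sqrt_inner_iv
 using interp_mono[of "nrm l" "Hk_iv_norm 1 l" "%x. 0" "Hk_iv 1 l" \<theta> \<theta>' _ "L2_iv l",
   OF nrm_nonneg Hk_iv_norm_nonneg zero_Hk_iv_1[OF assms(1)] assms(2,3)] by (rule subsetI)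

lemma Hk_iv_1_Hfrac:
 assumes l: "0 < l" and th: "0 < \<theta>" "\<theta> < 1" shows "Hk_iv 1 l \<subseteq> Hfrac_iv \<theta> l"
 unfolding sqrt_inner_iv
proof
 fix x assume x: "x \<in> Hk_iv 1 l"
 show "x \<in> interp \<theta> (L2_iv l) (nrm l) (Hk_iv 1 l) (Hk_iv_norm 1 l)"
 proof (rule interp_superset[of "nrm l" "Hk_iv_norm 1 l" "%x. 0" "Hk_iv 1 l" \<theta> x "L2_iv l",
    OF nrm_nonneg Hk_iv_norm_nonneg zero_Hk_iv_1[OF l] th x Hk_iv_L2[OF x]])
  show "nrm l (x - x) = 0" by (rule nrm_AE_0) simp
 qed
qed

lemma Hk_iv_norm_1_lin:
 assumes l: "0 < l" and f: "f \<in> Hk_iv 1 l" and g: "g \<in> Hk_iv 1 l"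
 shows "Hk_iv_norm 1 l (%x. c * f x + d * g x) <= \<bar>c\<bar> * Hk_iv_norm 1 l f + \<bar>d\<bar> * Hk_iv_norm 1 l g"
proof -
 obtain f' where f': "has_weak_deriv 1 l f f'" using f Hk_iv_1 by blast
 obtain g' where g': "has_weak_deriv 1 l g g'" using g Hk_iv_1 by blast
 note w = has_weak_deriv_lin[OF f' g', of c d]
 note L = has_weak_deriv_L2[OF f'] has_weak_deriv_L2[OF g']
 have tri: "nrm l (%x. c * u x + d * v x) <= \<bar>c\<bar> * nrm l u + \<bar>d\<bar> * nrm l v"
  if "u \<in> L2_iv l" "v \<in> L2_iv l" for u v
  using nrm_add[OF L2_iv_cmult[OF that(1), of c] L2_iv_cmult[OF that(2), of d]] by (simp add: nrm_cmult)
 define P where "P u v = sqrt ((nrm l u)^2 + (nrm l v)^2)" for u v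
 have P: "Hk_iv_norm 1 l u = P u v" if "has_weak_deriv 1 l u v" for u v
  unfolding P_def using Hk_iv_norm_1[OF l that] Hk_iv_norm_nonneg[of 1 l u]
  by (metis real_sqrt_unique)
 have "P (%x. c * f x + d * g x) (%x. c * f' x + d * g' x)
  <= sqrt ((\<bar>c\<bar> * nrm l f + \<bar>d\<bar> * nrm l g)^2 + (\<bar>c\<bar> * nrm l f' + \<bar>d\<bar> * nrm l g')^2)"
  unfolding P_def by (intro real_sqrt_le_mono add_mono power_mono tri L) auto
 also have "... <= sqrt ((\<bar>c\<bar> * nrm l f)^2 + (\<bar>c\<bar> * nrm l f')^2) + sqrt ((\<bar>d\<bar> * nrm l g)^2 + (\<bar>d\<bar> * nrm l g')^2)"
  by (rule real_sqrt_sum_squares_triangle_ineq)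
 also have "... = \<bar>c\<bar> * P f f' + \<bar>d\<bar> * P g g'"
  by (simp add: P_def power_mult_distrib real_sqrt_mult flip: distrib_left)
 finally show ?thesis by (simp only: P[OF w] P[OF f'] P[OF g'])
qed

text \<open>\<open>weak_deriv\<close> picks a representative and is linear only almost everywhere;
  therefore \<open>z\<close> is tied to the linear combination only up to a null set.\<close>

lemma Hfrac_iv_lin:
 assumes l: "0 < l" and f: "f \<in> Hfrac_iv \<theta> l" and g: "g \<in> Hfrac_iv \<theta> l"
  and z: "z \<in> L2_iv l" "AE x in leb l. z x = c * f x + d * g x"
 shows "z \<in> Hfrac_iv \<theta> l"
proof -
 have fL: "f \<in> L2_iv l" and gL: "g \<in> L2_iv l" using f g by (auto simp: interp_def)
 have "interp_norm_sq \<theta> (nrm l) (Hk_iv 1 l) (Hk_iv_norm 1 l) z < \<infinity>"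
 proof (rule interp_norm_sq_combine[where A = "\<bar>c\<bar>" and B = "\<bar>d\<bar>" and x = f and y = g])
  fix f1 g1 assume 1: "f1 \<in> Hk_iv 1 l" "g1 \<in> Hk_iv 1 l"
  note L = Hk_iv_L2[OF 1(1)] Hk_iv_L2[OF 1(2)]
  let ?z1 = "%x. c * f1 x + d * g1 x"
  have "nrm l (z - ?z1) = nrm l (%x. c * (f x - f1 x) + d * (g x - g1 x))"
  proof (rule nrm_cong_AE)
   show "z - ?z1 \<in> L2_iv l" unfolding fun_diff_def by (rule L2_iv_diff[OF z(1) L2_iv_lin[OF L]])
   show "(%x. c * (f x - f1 x) + d * (g x - g1 x)) \<in> L2_iv l" by (rule L2_iv_lin[OF L2_iv_diff[OF fL L(1)] L2_iv_diff[OF gL L(2)]])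
   show "AE x in leb l. (z - ?z1) x = c * (f x - f1 x) + d * (g x - g1 x)"
    using z(2) by eventually_elim (simp add: algebra_simps)
  qed
  also have "... <= \<bar>c\<bar> * nrm l (%x. f x - f1 x) + \<bar>d\<bar> * nrm l (%x. g x - g1 x)"
   using nrm_add[OF L2_iv_cmult[OF L2_iv_diff[OF fL L(1)], of c] L2_iv_cmult[OF L2_iv_diff[OF gL L(2)], of d]]
   by (simp add: nrm_cmult)
  finally show "\<exists>z1\<in>Hk_iv 1 l. nrm l (z - z1) <= \<bar>c\<bar> * nrm l (f - f1) + \<bar>d\<bar> * nrm l (g - g1)
    & Hk_iv_norm 1 l z1 <= \<bar>c\<bar> * Hk_iv_norm 1 l f1 + \<bar>d\<bar> * Hk_iv_norm 1 l g1"
   by (intro bexI[of _ ?z1] conjI Hk_iv_norm_1_lin l 1 Hk_iv_lin) (simp_all add: fun_diff_def)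
 qed (use f g zero_Hk_iv_1(1)[OF l] in \<open>auto simp: interp_def sqrt_inner_iv Hk_iv_norm_nonneg\<close>)
 thus ?thesis using z(1) by (simp add: interp_def sqrt_inner_iv)
qed

lemma Hfrac_iv_AC:
 assumes l: "0 < l" and u: "u \<in> Hfrac_iv \<theta> l" and th: "0 < \<theta>" "\<theta> <= 1"
 obtains b Y y where "0 <= b" "!!j. AC l (Y j) (y j)"
  "!!j. nrm l (%x. u x - Y j x) <= b * hp j \<theta>"
  "!!j. nrm l (y j) <= b * hp j (\<theta> - 1)"
proof -
 define b where "b = 3 * interp_norm \<theta> (nrm l) (Hk_iv 1 l) (Hk_iv_norm 1 l) u + 1"
 have b0: "0 <= b" by (simp add: b_def interp_norm_def)
 have uL: "u \<in> L2_iv l" using u by (simp add: interp_def)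
 have "\<exists>f. \<forall>j. f j \<in> Hk_iv 1 l & nrm l (u - f j) <= b * hp j \<theta>
   & Hk_iv_norm 1 l (f j) <= b * hp j (\<theta> - 1)"
  by (rule interp_dyadic[of "nrm l" "Hk_iv_norm 1 l" "Hk_iv 1 l" u \<theta> "L2_iv l" b, OF nrm_nonneg Hk_iv_norm_nonneg _ _ th])
   (use zero_Hk_iv_1(1)[OF l] u[unfolded sqrt_inner_iv] in \<open>auto simp: b_def\<close>)
 then obtain f where f: "!!j. f j \<in> Hk_iv 1 l" "!!j. nrm l (%x. u x - f j x) <= b * hp j \<theta>"
  "!!j. Hk_iv_norm 1 l (f j) <= b * hp j (\<theta> - 1)"
  by (auto simp: fun_diff_def)
 have "\<exists>Z. AC l (fst Z) (snd Z) & nrm l (%x. u x - fst Z x) <= b * hp j \<theta>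
  & nrm l (snd Z) <= b * hp j (\<theta> - 1)" for j
 proof -
  obtain F g where F: "AC l F g" "aeq l F (f j)" "nrm l g <= Hk_iv_norm 1 l (f j)"
   using Hk_iv_1_AC[OF l f(1)[of j]] by metis
  have "nrm l (%x. u x - F x) = nrm l (%x. u x - f j x)"
  proof (rule nrm_cong_AE[OF L2_iv_diff[OF uL AC_L2_fun[OF F(1)]] L2_iv_diff[OF uL Hk_iv_L2[OF f(1)]]])
   show "AE x in leb l. u x - F x = u x - f j x" using F(2) by eventually_elim simp
  qed
  thus ?thesis using F f(2,3)[of j] by (intro exI[of _ "(F, g)"]) auto
 qed
 then obtain Z where Z: "!!j. AC l (fst (Z j)) (snd (Z j)) & nrm l (%x. u x - fst (Z j) x) <= b * hp j \<theta>
  & nrm l (snd (Z j)) <= b * hp j (\<theta> - 1)" by metis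
 show thesis by (rule that[OF b0, of "%j. fst (Z j)" "%j. snd (Z j)"]) (use Z in auto)
qed

lemma Hfrac_iv_continuous:
 assumes l: "0 < l" and u: "u \<in> Hfrac_iv \<theta> l" and th: "1/2 < \<theta>" "\<theta> <= 1"
 shows "\<exists>F. cont l F & (aeq l F u)"
proof -
 obtain b Y y where 1: "0 <= b" "!!j. AC l (Y j) (y j)"
  "!!j. nrm l (%x. u x - Y j x) <= b * hp j \<theta>"
  "!!j. nrm l (y j) <= b * hp j (\<theta> - 1)"
  by (rule Hfrac_iv_AC[OF l u]) (use th in auto)
 have "u \<in> L2_iv l" using u by (simp add: interp_def)
 from AC_dyadic_limit[OF l this th 1] show ?thesis by blast
qed

lemma Hs_iv_subset_Hk: "Hs_iv s l \<subseteq> Hk_iv (nat \<lfloor>s\<rfloor>) l"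
 unfolding Hs_iv_def Let_def by (cases "s \<in> \<int>") auto

lemma Hk_iv_subset_Hs:
 assumes l: "0 < l" and s: "0 <= s" "s <= real k"
 shows "Hk_iv k l \<subseteq> Hs_iv s l"
proof (cases "s \<in> \<int>")
 case True
 hence "nat \<lfloor>s\<rfloor> <= k" using s by (simp add: nat_le_iff floor_le_iff)
 thus ?thesis using Hk_iv_mono True by (auto simp: Hs_iv_def)
next
 case False
 define m where "m = nat \<lfloor>s\<rfloor>"
 have "s \<noteq> real k" using False by auto
 hence m: "Suc m <= k" using s unfolding m_def by linarith
 have fr: "0 < frac s" "frac s < 1" using False by (auto simp: frac_gt_0_iff frac_lt_1)
 show ?thesis
 proof
  fix f assume "f \<in> Hk_iv k l"
  hence "f \<in> Hk_iv (Suc m) l" using Hk_iv_mono[OF m] by blast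
  hence "f \<in> Hk_iv m l & weak_deriv m l f \<in> Hk_iv 1 l" by (rule Hk_iv_Suc[THEN iffD1])
  hence "f \<in> Hk_iv m l" "weak_deriv m l f \<in> Hfrac_iv (frac s) l"
   using Hk_iv_1_Hfrac[OF l fr] by blast+
  thus "f \<in> Hs_iv s l" using False by (simp add: Hs_iv_def Let_def m_def)
 qed
qed

lemma Hs_iv_mono:
 assumes l: "0 < l" and s: "0 <= s" "s <= s'"
 shows "Hs_iv s' l \<subseteq> Hs_iv s l"
proof (cases "s <= real (nat \<lfloor>s'\<rfloor>)")
 case True
 thus ?thesis using Hs_iv_subset_Hk Hk_iv_subset_Hs[OF l s(1)] by blast
next
 case False
 hence fl: "\<lfloor>s'\<rfloor> = \<lfloor>s\<rfloor>" and ns: "s \<notin> \<int>" "s' \<notin> \<int>"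
  using s by (auto simp: Ints_def) linarith+
 hence fr: "0 < frac s" "frac s <= frac s'" using s by (auto simp: frac_gt_0_iff) (auto simp: frac_def)
 show ?thesis using Hfrac_iv_mono[OF l fr] ns fl by (auto simp: Hs_iv_def Let_def)
qed

lemma Hs_iv_lin:
 assumes l: "0 < l" and f: "f \<in> Hs_iv s l" and g: "g \<in> Hs_iv s l"
 shows "(%x. c * f x + d * g x) \<in> Hs_iv s l"
proof (cases "s \<in> \<int>")
 case True
 thus ?thesis using f g by (auto simp: Hs_iv_def Let_def intro: Hk_iv_lin)
next
 case False
 define k where "k = nat \<lfloor>s\<rfloor>"
 have fg: "f \<in> Hk_iv k l" "g \<in> Hk_iv k l" "weak_deriv k l f \<in> Hfrac_iv (frac s) l" "weak_deriv k l g \<in> Hfrac_iv (frac s) l"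
  using f g False by (auto simp: Hs_iv_def Let_def k_def)
 note lin = Hk_iv_lin[OF fg(1,2), of c d]
 have "weak_deriv k l (%x. c * f x + d * g x) \<in> Hfrac_iv (frac s) l"
  by (rule Hfrac_iv_lin[OF l fg(3,4) has_weak_deriv_L2(2)[OF Hk_iv_D[OF lin order_refl]]
     weak_deriv_lin_AE[OF l fg(1,2) order_refl]])
 thus ?thesis using False lin by (simp add: Hs_iv_def Let_def k_def)
qed

text \<open>Either a whole derivative is left beyond order \<open>m\<close>, or the integer part of
  \<open>s\<close> equals \<open>m\<close> and the fractional part exceeds 1/2, where interpolation
  provides a continuous representative.\<close>

lemma Hs_iv_continuous_weak_deriv:
 assumes l: "0 < l" and s: "real m + 1/2 < s" and u: "u \<in> Hs_iv s l"
 shows "\<exists>F. cont l F & (AE x in leb l. F x = weak_deriv m l u x)"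
proof (cases "Suc m <= nat \<lfloor>s\<rfloor>")
 case True
 hence "u \<in> Hk_iv (Suc m) l" using u Hs_iv_subset_Hk Hk_iv_mono by blast
 hence "weak_deriv m l u \<in> Hk_iv 1 l" using Hk_iv_Suc by blast
 then obtain F g where "AC l F g" "AE x in leb l. F x = weak_deriv m l u x"
  using Hk_iv_1_AC[OF l] by metis
 thus ?thesis using AC_continuous by blast
next
 case False
 hence fl: "\<lfloor>s\<rfloor> = int m" using s by linarith
 have fr: "1/2 < frac s" using s fl by (simp add: frac_def)
 hence ns: "s \<notin> \<int>" by (auto simp flip: frac_eq_0_iff)
 have "weak_deriv m l u \<in> Hfrac_iv (frac s) l" using u ns fl by (simp add: Hs_iv_def Let_def)
 thus ?thesis by (rule Hfrac_iv_continuous[OF l _ fr]) (simp add: frac_lt_1 less_imp_le)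
qed

text \<open>The preceding lemma for the derivative of order \<open>Suc m\<close>. It makes the
  one-sided derivatives at the ends genuine, as needed to evaluate
  \<open>outward_deriv\<close>.\<close>

lemma Hs_iv_C1_weak_deriv:
 assumes l: "0 < l" and s: "real m + 3/2 < s" and u: "u \<in> Hs_iv s l"
 shows "\<exists>F f. AC l F f & cont l f & (AE x in leb l. F x = weak_deriv m l u x)"
proof -
 have "Suc m <= nat \<lfloor>s\<rfloor>" using s by linarith
 hence uk: "u \<in> Hk_iv (Suc m) l" using u Hs_iv_subset_Hk Hk_iv_mono by blast
 have "real (Suc m) + 1/2 < s" using s by simp
 from Hs_iv_continuous_weak_deriv[OF l this u]
 obtain f where f: "cont l f" "AE x in leb l. f x = weak_deriv (Suc m) l u x" by blast
 note w = Hk_iv_D[OF uk, of m, simplified]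
 have w1: "has_weak_deriv 1 l (weak_deriv m l u) (weak_deriv (Suc m) l u)"
  using has_weak_deriv_Suc[OF w] Hk_iv_D[OF uk order_refl] by blast
 have "has_weak_deriv 1 l (weak_deriv m l u) f"
  by (rule has_weak_deriv_cong[OF w1 has_weak_deriv_L2(1)[OF w1] L2_iv_continuous[OF f(1)] _ L2_iv_AE_sym[OF f(2)]]) simp
 from has_weak_deriv_imp_AC[OF l this] show ?thesis using f(1) by blast
qed

section \<open>Square integrable functions on a metric graph\<close>

locale metric_graph_loc =
 fixes G :: "('v, 'e) metric_graph"
 assumes compact: "compact_metric_graph G"
begin

lemma finite_arcs [simp]: "finite (arcs G)" and finite_verts [simp]: "finite (verts G)"
 and tail_in_verts: "e \<in> arcs G ==> tail G e \<in> verts G" and head_in_verts: "e \<in> arcs G ==> head G e \<in> verts G"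
proof -
 have "fin_digraph (pre_digraph.truncate G)" using compact by (simp add: compact_metric_graph_def)
 then interpret fin_digraph "pre_digraph.truncate G" .
 show "finite (arcs G)" using finite_arcs by (simp add: pre_digraph.truncate_def)
 show "finite (verts G)" using finite_verts by (simp add: pre_digraph.truncate_def)
 show "e \<in> arcs G ==> tail G e \<in> verts G" using tail_in_verts by (simp add: pre_digraph.truncate_def)
 show "e \<in> arcs G ==> head G e \<in> verts G" using head_in_verts by (simp add: pre_digraph.truncate_def)
qed

lemma len_pos: "e \<in> arcs G ==> 0 < len G e"
 using compact by (simp add: compact_metric_graph_def)

text \<open>Graph functions are plain functions and not classes modulo null sets; facts move from
  one representative to another along this relation.\<close>

definition AEeq :: "'e graph_fun => 'e graph_fun => bool" where
 "AEeq u v \<longleftrightarrow> (\<forall>e\<in>arcs G. aeq (len G e) (u e) (v e))"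

lemma AEeq_refl [simp]: "AEeq u u" by (simp add: AEeq_def)
lemma AEeq_sym: "AEeq u v ==> AEeq v u" unfolding AEeq_def using L2_iv_AE_sym by blast
lemma AEeq_trans: "AEeq u v ==> AEeq v w ==> AEeq u w" unfolding AEeq_def using L2_iv_AE_trans by blast

lemma AEeq_lin:
 assumes "AEeq u u'" "AEeq v v'" shows "AEeq (lc c u d v) (lc c u' d v')"
 unfolding AEeq_def
proof
 fix e assume "e \<in> arcs G"
 hence "aeq (len G e) (u e) (u' e)" "aeq (len G e) (v e) (v' e)"
  using assms by (auto simp: AEeq_def)
 thus "AE x in leb (len G e). c * u e x + d * v e x = c * u' e x + d * v' e x"
  by eventually_elim simp
qed

lemma AEeq_diff: "AEeq u u' ==> AEeq v v' ==> AEeq (%e x. u e x - v e x) (%e x. u' e x - v' e x)"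
 using AEeq_lin[of u u' v v' 1 "-1"] by simp

abbreviation nG :: "'e graph_fun => real" where "nG \<equiv> L2_graph_norm G"
abbreviation (input) dG :: "'e graph_fun => 'e graph_fun => real" where "dG u v \<equiv> nG (%e x. u e x - v e x)"
abbreviation (input) Ed :: "'e set" where "Ed \<equiv> arcs G"
abbreviation (input) DG :: "nat => 'e graph_fun => 'e graph_fun" where "DG \<equiv> D_graph G"
abbreviation (input) N1 :: "'e graph_fun => real" where "N1 \<equiv> Hk_graph_norm G 1"
abbreviation inn :: "'e graph_fun => 'e graph_fun => real" where "inn \<equiv> inner_graph G"
abbreviation LG :: "'e graph_fun set" where "LG \<equiv> L2_graph G"

lemma LG_D: "u \<in> LG ==> e \<in> Ed ==> u e \<in> L2_iv (len G e)"
 by (simp add: L2_graph_def)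

lemma LG_I: "(!!e. e \<in> Ed ==> u e \<in> L2_iv (len G e)) ==> u \<in> LG"
 by (simp add: L2_graph_def)

lemma LG_lin: "u \<in> LG ==> v \<in> LG ==> (lc c u d v) \<in> LG"
 by (simp add: L2_graph_def L2_iv_lin)

lemma LG_diff: "u \<in> LG ==> v \<in> LG ==> (%e x. u e x - v e x) \<in> LG"
 using LG_lin[of u v 1 "-1"] by simp

lemma LG_add: "u \<in> LG ==> v \<in> LG ==> (%e x. u e x + v e x) \<in> LG"
 using LG_lin[of u v 1 1] by simp

lemma LG_zero: "(%e x. 0) \<in> LG"
 by (simp add: L2_graph_def L2_iv_const)

lemma LG_sum: "finite F ==> (!!i. i \<in> F ==> u i \<in> LG) ==> (%e x. \<Sum>i\<in>F. c i * u i e x) \<in> LG"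
proof (induction F rule: finite_induct)
 case (insert i F)
 hence "(%e x. c i * u i e x + 1 * (\<Sum>i\<in>F. c i * u i e x)) \<in> LG" by (intro LG_lin) auto
 thus ?case using insert by simp
qed (simp add: LG_zero)

lemma inn_commute: "inn u v = inn v u"
 by (simp add: inner_graph_def inner_iv_commute)

lemma inn_lin:
 assumes "u \<in> LG" "v \<in> LG" "w \<in> LG"
 shows "inn (lc c u d v) w = c * inn u w + d * inn v w"
 unfolding inner_graph_def sum_distrib_left sum.distrib[symmetric]
 by (rule sum.cong) (auto intro!: inner_iv_lin LG_D assms)

lemma inn_lin2:
 assumes "u \<in> LG" "v \<in> LG" "w \<in> LG"
 shows "inn w (lc c u d v) = c * inn w u + d * inn w v"
 using inn_lin[OF assms] by (simp add: inn_commute)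

lemma inn_diff: "u \<in> LG ==> v \<in> LG ==> w \<in> LG ==> inn (%e x. u e x - v e x) w = inn u w - inn v w"
 using inn_lin[of u v w 1 "-1"] by simp

lemma inn_zero: "inn (%e x. 0) w = 0"
 by (simp add: inner_graph_def inner_iv_def)

lemma inn_sum:
 assumes "finite F" "!!i. i \<in> F ==> u i \<in> LG" "w \<in> LG"
 shows "inn (%e x. \<Sum>i\<in>F. c i * u i e x) w = (\<Sum>i\<in>F. c i * inn (u i) w)"
 using assms
proof (induction F rule: finite_induct)
 case (insert i F)
 hence "inn (%e x. c i * u i e x + 1 * (\<Sum>i\<in>F. c i * u i e x)) w
   = c i * inn (u i) w + 1 * inn (%e x. \<Sum>i\<in>F. c i * u i e x) w"
  by (intro inn_lin LG_sum) auto
 thus ?case using insert by simp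
qed (simp add: inn_zero)

lemma inn_cong_AE:
 assumes "u \<in> LG" "v \<in> LG" "u' \<in> LG" "v' \<in> LG" "AEeq u u'" "AEeq v v'"
 shows "inn u v = inn u' v'"
 unfolding inner_graph_def
 by (rule sum.cong) (use assms in \<open>auto simp: AEeq_def intro!: inner_iv_cong_AE LG_D\<close>)

lemma inn_nonneg: "0 <= inn u u"
 unfolding inner_graph_def by (intro sum_nonneg inner_iv_nonneg)

lemma nG_nonneg [simp]: "0 <= nG u"
 by (simp add: L2_graph_norm_def inn_nonneg)

lemma nG_sq: "(nG u)^2 = inn u u"
 by (simp add: L2_graph_norm_def inn_nonneg)

lemma nG_L2_set: "nG u = L2_set (%e. nrm (len G e) (u e)) (Ed)"
 by (simp add: L2_graph_norm_def inner_graph_def L2_set_def nrm_sq)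

lemma nG_sq_sum: "(nG u)^2 = (\<Sum>e\<in>Ed. (nrm (len G e) (u e))^2)"
 by (simp add: nG_sq inner_graph_def nrm_sq)

lemma nrm_le_nG: "e \<in> Ed ==> nrm (len G e) (u e) <= nG u"
 unfolding nG_L2_set by (rule member_le_L2_set) auto

lemma nG_le_sum: "nG u <= (\<Sum>e\<in>Ed. nrm (len G e) (u e))"
 unfolding nG_L2_set by (rule L2_set_le_sum) auto

lemma nG_add: "u \<in> LG ==> v \<in> LG ==> nG (%e x. u e x + v e x) <= nG u + nG v"
proof -
 assume uv: "u \<in> LG" "v \<in> LG"
 have "nG (%e x. u e x + v e x) <= L2_set (%e. nrm (len G e) (u e) + nrm (len G e) (v e)) (Ed)"
  unfolding nG_L2_set by (rule L2_set_mono) (auto intro!: nrm_add LG_D uv)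
 also have "... <= nG u + nG v" unfolding nG_L2_set by (rule L2_set_triangle_ineq)
 finally show ?thesis .
qed

lemma nG_cmult: "nG (%e x. c * u e x) = \<bar>c\<bar> * nG u"
 unfolding nG_L2_set by (simp add: nrm_cmult L2_set_right_distrib)

lemma nG_lin: "u \<in> LG ==> v \<in> LG ==> nG (lc c u d v) <= \<bar>c\<bar> * nG u + \<bar>d\<bar> * nG v"
 using nG_add[of "%e x. c * u e x" "%e x. d * v e x"] LG_lin[of u u c 0] LG_lin[of v v d 0]
 by (simp add: nG_cmult)

lemma nG_diff: "u \<in> LG ==> v \<in> LG ==> dG u v <= nG u + nG v"
 using nG_lin[of u v 1 "-1"] by simp

lemma nG_diff_commute: "dG u v = dG v u"
 using nG_cmult[of "-1" "%e x. u e x - v e x"] by simp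

lemma nG_triangle:
 assumes "u \<in> LG" "v \<in> LG" "w \<in> LG"
 shows "dG u w <= dG u v + dG v w"
 using nG_add[OF LG_diff[OF assms(1,2)] LG_diff[OF assms(2,3)]] by simp

lemma nG_cong_AE: "u \<in> LG ==> v \<in> LG ==> AEeq u v ==> nG u = nG v"
 unfolding L2_graph_norm_def using inn_cong_AE[of u u v v] by simp

lemma nG_zero: "nG (%e x. 0) = 0"
 by (simp add: L2_graph_norm_def inn_zero)

lemma inn_Cauchy_Schwarz: "u \<in> LG ==> v \<in> LG ==> \<bar>inn u v\<bar> <= nG u * nG v"
proof -
 assume uv: "u \<in> LG" "v \<in> LG"
 have "\<bar>inn u v\<bar> <= (\<Sum>e\<in>Ed. \<bar>nrm (len G e) (u e)\<bar> * \<bar>nrm (len G e) (v e)\<bar>)"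
  unfolding inner_graph_def
  by (rule order_trans[OF sum_abs sum_mono]) (use uv in \<open>auto intro!: inner_iv_Cauchy_Schwarz LG_D\<close>)
 also have "... <= nG u * nG v" unfolding nG_L2_set by (rule L2_set_mult_ineq)
 finally show ?thesis .
qed

lemma nG_le_if_edges:
 assumes "!!e. e \<in> Ed ==> nrm (len G e) (u e) <= C e * S"
 shows "nG u <= (\<Sum>e\<in>Ed. C e) * S"
 using order_trans[OF nG_le_sum sum_mono[OF assms]] by (simp add: sum_distrib_right)

section \<open>Sobolev functions on a metric graph\<close>

definition endv :: "'e graph_fun => 'e => bool => real" where
 "endv u e b = u e (if b then len G e else 0)"

text \<open>Here \<open>p\<close> stands for the derivative in the reference coordinate; the sign
  comes from the reversed parameterization.\<close>

definition outv :: "'e graph_fun => 'e => bool => real" where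
 "outv p e b = (if b then - p e (len G e) else p e 0)"

lemma natural_param_0: "natural_param G e b 0 = (if b then len G e else 0)"
 by (simp add: natural_param_def)

lemma Dir_arcs: "(e, b) \<in> Dir G v ==> e \<in> Ed"
 by (simp add: Dir_def)

lemma finite_Dir [simp]: "finite (Dir G v)"
proof (rule finite_subset)
 show "Dir G v \<subseteq> Ed \<times> UNIV" by (auto simp: Dir_def)
qed simp

text \<open>This is H^1 of the graph with exact representatives of the function and of its
  derivative.\<close>

definition vert_fun :: "'e graph_fun => 'e graph_fun => bool" where
 "vert_fun y p \<longleftrightarrow> (\<forall>e\<in>Ed. AC (len G e) (y e) (p e)) &
  (\<forall>v\<in>verts G. \<exists>c. \<forall>(e, b)\<in>Dir G v. endv y e b = c)"

lemma vert_fun_AC: "vert_fun y p ==> e \<in> Ed ==> AC (len G e) (y e) (p e)"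
 by (simp add: vert_fun_def)

lemma vert_fun_L2: "vert_fun y p ==> y \<in> LG" "vert_fun y p ==> p \<in> LG"
 by (rule LG_I, erule (1) AC_L2_fun[OF vert_fun_AC]) (rule LG_I, erule (1) AC_L2[OF vert_fun_AC])

lemma vert_fun_lin:
 assumes "vert_fun y p" "vert_fun z q"
 shows "vert_fun (lc c y d z) (lc c p d q)"
 unfolding vert_fun_def
proof (intro conjI ballI)
 fix v assume v: "v \<in> verts G"
 obtain c1 where c1: "\<forall>(e, b)\<in>Dir G v. endv y e b = c1" using assms(1) v by (auto simp: vert_fun_def)
 obtain c2 where c2: "\<forall>(e, b)\<in>Dir G v. endv z e b = c2" using assms(2) v by (auto simp: vert_fun_def)
 show "\<exists>k. \<forall>(e, b)\<in>Dir G v. endv (lc c y d z) e b = k"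
  using c1 c2 by (intro exI[of _ "c * c1 + d * c2"]) (simp add: endv_def case_prod_beta)
next
 fix e assume "e \<in> Ed"
 thus "AC (len G e) (%x. c * y e x + d * z e x) (%x. c * p e x + d * q e x)"
  by (intro AC_lin vert_fun_AC[OF assms(1)] vert_fun_AC[OF assms(2)])
qed

lemma weak_deriv_0_AE: "0 < l ==> f \<in> L2_iv l ==> AE x in leb l. weak_deriv 0 l f x = f x"
 by (rule weak_deriv_AE[OF _ has_weak_deriv_0])

lemma Hk_edges_L2: "u \<in> Hk_edges G k ==> u \<in> LG"
 by (rule LG_I, rule Hk_iv_L2[of _ k]) (simp add: Hk_edges_def)

lemma Hk_graph_edges: "u \<in> Hk_graph G k ==> u \<in> Hk_edges G k"
 by (simp add: Hk_graph_def)

lemma Hk_edges_mono: "k <= m ==> Hk_edges G m \<subseteq> Hk_edges G k"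
 unfolding Hk_edges_def using Hk_iv_mono by blast

lemma Hk_graph_mono: "k <= m ==> Hk_graph G m \<subseteq> Hk_graph G k"
 using Hk_edges_mono[of k m] by (auto simp: Hk_graph_def)

lemma D_graph_0_AEeq: "u \<in> LG ==> AEeq (DG 0 u) u"
 unfolding AEeq_def D_graph_def by (intro ballI weak_deriv_0_AE len_pos LG_D)

lemma D_graph_L2: "u \<in> Hk_edges G k ==> j <= k ==> DG j u \<in> LG"
proof (rule LG_I, unfold D_graph_def)
 fix e assume "u \<in> Hk_edges G k" "j <= k" "e \<in> Ed"
 hence "u e \<in> Hk_iv k (len G e)" by (simp add: Hk_edges_def)
 thus "weak_deriv j (len G e) (u e) \<in> L2_iv (len G e)"
  by (rule has_weak_deriv_L2(2)[OF Hk_iv_D]) fact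
qed

lemma continuous_graph_endv:
 assumes c: "continuous_graph G u" and y: "!!e. e \<in> Ed ==> cont (len G e) (y e)" "AEeq y u"
  and v: "v \<in> verts G"
 shows "\<exists>c. \<forall>(e, b)\<in>Dir G v. endv y e b = c"
proof -
 from c obtain w where W: "(\<forall>e\<in>Ed. cont (len G e) (w e) &
    (aeq (len G e) (w e) (u e))) &
  (\<forall>v\<in>verts G. \<exists>c. \<forall>(e, b)\<in>Dir G v. w e (natural_param G e b 0) = c)"
  unfolding continuous_graph_def ..
 have w: "cont (len G e) (w e)" "aeq (len G e) (w e) (u e)"
  if "e \<in> Ed" for e using conjunct1[OF W] that by blast+
 obtain c where c: "\<forall>(e, b)\<in>Dir G v. w e (natural_param G e b 0) = c" using bspec[OF conjunct2[OF W] v] ..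
 have "endv y e b = c" if eb: "(e, b) \<in> Dir G v" for e b
 proof -
  note e = Dir_arcs[OF eb]
  have ae: "aeq (len G e) (y e) (w e)"
   by (rule L2_iv_AE_trans[OF bspec[OF y(2)[unfolded AEeq_def] e] L2_iv_AE_sym[OF w(2)[OF e]]])
  have "natural_param G e b 0 \<in> {0..len G e}" using len_pos[OF e] by (simp add: natural_param_def)
  from continuous_AE_imp_eq[OF len_pos[OF e] y(1)[OF e] w(1)[OF e] ae this] show ?thesis
   using c eb by (auto simp: endv_def natural_param_def)
 qed
 thus ?thesis by (intro exI[of _ c]) auto
qed

lemma continuous_graph_if_endv:
 assumes y: "!!e. e \<in> Ed ==> cont (len G e) (y e)" "AEeq y u"
  and v: "!!v. v \<in> verts G ==> \<exists>c. \<forall>(e, b)\<in>Dir G v. endv y e b = c"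
 shows "continuous_graph G u"
 unfolding continuous_graph_def
 by (rule exI[of _ y]) (use y v in \<open>simp add: AEeq_def endv_def natural_param_0\<close>)

lemma Hk_graph_1: "u \<in> Hk_graph G 1 \<longleftrightarrow> u \<in> Hk_edges G 1 & continuous_graph G (DG 0 u)"
proof -
 have "int m <= (int 1 - 1) div 2 \<longleftrightarrow> m = 0" for m by auto
 thus ?thesis unfolding Hk_graph_def by auto
qed

lemma Hk_edges_1_AC:
 assumes "u \<in> Hk_edges G 1"
 obtains y p where "!!e. e \<in> Ed ==> AC (len G e) (y e) (p e)" "AEeq y u" "AEeq p (DG 1 u)"
proof -
 have "\<exists>Z. AC (len G e) (fst Z) (snd Z) & (AE x in leb (len G e). fst Z x = u e x)
   & (AE x in leb (len G e). snd Z x = weak_deriv 1 (len G e) (u e) x)" if e: "e \<in> Ed" for e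
 proof -
  have "u e \<in> Hk_iv 1 (len G e)" using assms e by (simp add: Hk_edges_def)
  then obtain F g where "AC (len G e) F g" "aeq (len G e) F (u e)" "has_weak_deriv 1 (len G e) (u e) g"
   using Hk_iv_1_AC[OF len_pos[OF e]] by metis
  thus ?thesis using L2_iv_AE_sym[OF weak_deriv_AE[OF len_pos[OF e]]]
   by (intro exI[of _ "(F, g)"]) auto
 qed
 hence "\<forall>e\<in>Ed. \<exists>Z. AC (len G e) (fst Z) (snd Z) & (AE x in leb (len G e). fst Z x = u e x)
   & (AE x in leb (len G e). snd Z x = weak_deriv 1 (len G e) (u e) x)" by blast
 from bchoice[OF this] obtain Z where Z: "!!e. e \<in> Ed ==> AC (len G e) (fst (Z e)) (snd (Z e))
  & (AE x in leb (len G e). fst (Z e) x = u e x)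
   & (AE x in leb (len G e). snd (Z e) x = weak_deriv 1 (len G e) (u e) x)" by blast
 show thesis by (rule that[of "%e. fst (Z e)" "%e. snd (Z e)"]) (use Z in \<open>auto simp: AEeq_def D_graph_def\<close>)
qed

lemma Hk_graph_1_vert_fun:
 assumes "u \<in> Hk_graph G 1"
 obtains y p where "vert_fun y p" "AEeq y u" "AEeq p (DG 1 u)"
proof -
 have u: "u \<in> Hk_edges G 1" "continuous_graph G (DG 0 u)" using assms Hk_graph_1 by auto
 obtain y p where y: "!!e. e \<in> Ed ==> AC (len G e) (y e) (p e)" "AEeq y u" "AEeq p (DG 1 u)"
  using Hk_edges_1_AC[OF u(1)] by metis
 have "AEeq y (DG 0 u)" by (rule AEeq_trans[OF y(2) AEeq_sym[OF D_graph_0_AEeq[OF Hk_edges_L2[OF u(1)]]]])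
 hence "vert_fun y p" unfolding vert_fun_def
  using y(1) continuous_graph_endv[OF u(2) AC_continuous[OF y(1)]] by blast
 with y show thesis using that by blast
qed

lemma AC_edges_Hk_edges:
 assumes "!!e. e \<in> Ed ==> AC (len G e) (y e) (p e)" "AEeq y u" "u \<in> LG"
 shows "u \<in> Hk_edges G 1" "AEeq (DG 1 u) p" "N1 u = sqrt ((nG y)^2 + (nG p)^2)"
proof -
 have w: "has_weak_deriv 1 (len G e) (u e) (p e)" if "e \<in> Ed" for e
  by (rule AC_has_weak_deriv[OF len_pos[OF that] assms(1)[OF that] LG_D[OF assms(3) that]])
   (use assms(2) that in \<open>simp add: AEeq_def\<close>)
 thus "u \<in> Hk_edges G 1" unfolding Hk_edges_def using Hk_iv_1 by blast
 show "AEeq (DG 1 u) p" unfolding AEeq_def D_graph_def using weak_deriv_AE[OF len_pos w] by blast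
 have yL: "y \<in> LG" by (rule LG_I, rule AC_L2_fun[OF assms(1)])
 have "(\<Sum>e\<in>Ed. (Hk_iv_norm 1 (len G e) (u e))^2) = (nG u)^2 + (nG p)^2"
  unfolding nG_sq_sum sum.distrib[symmetric]
  by (rule sum.cong[OF refl], rule Hk_iv_norm_1[OF len_pos w])
 thus "N1 u = sqrt ((nG y)^2 + (nG p)^2)"
  using nG_cong_AE[OF yL assms(3,2)] by (simp add: Hk_graph_norm_def)
qed

lemma vert_fun_Hk_graph:
 assumes y: "vert_fun y p" "AEeq y u" "u \<in> LG"
 shows "u \<in> Hk_graph G 1"
proof -
 have "AEeq y (DG 0 u)" by (rule AEeq_trans[OF y(2) AEeq_sym[OF D_graph_0_AEeq[OF y(3)]]])
 hence "continuous_graph G (DG 0 u)"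
  using y(1) by (intro continuous_graph_if_endv[of y]) (auto simp: vert_fun_def AC_continuous)
 thus ?thesis using AC_edges_Hk_edges(1)[OF vert_fun_AC[OF y(1)] y(2,3)] Hk_graph_1 by blast
qed

lemma Hk_graph_norm_nonneg: "0 <= Hk_graph_norm G k u"
 unfolding Hk_graph_norm_def by (intro real_sqrt_ge_zero sum_nonneg) auto

lemma nG_D_graph_le: "j <= k ==> nG (DG j u) <= Hk_graph_norm G k u"
 unfolding nG_L2_set L2_set_def Hk_graph_norm_def D_graph_def
 by (intro real_sqrt_le_mono sum_mono power_mono nrm_weak_deriv_le) auto

lemma end_value_eq:
 assumes "e \<in> Ed" "cont (len G e) (y e)" "aeq (len G e) (y e) (u e)"
 shows "end_value G e b u = endv y e b"
 unfolding end_value_def endv_def natural_param_0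
 by (rule continuous_rep_eq[OF len_pos[OF assms(1)] assms(2,3)]) (use len_pos[OF assms(1)] in auto)

lemma outward_deriv_eq:
 assumes e: "e \<in> Ed" and y: "AC (len G e) (y e) (p e)" and p: "cont (len G e) (p e)"
  and ae: "aeq (len G e) (y e) (u e)"
 shows "outward_deriv G e b u = outv p e b"
proof -
 let ?l = "len G e"
 have l: "0 < ?l" by (rule len_pos[OF e])
 define R where "R t = continuous_rep ?l (u e) (natural_param G e b t)" for t
 define Y where "Y t = y e (natural_param G e b t)" for t
 have rep: "continuous_rep ?l (u e) x = y e x" if "x \<in> {0..?l}" for x
  by (rule continuous_rep_eq[OF l AC_continuous[OF y] ae that])
 have RY: "R t = Y t" if "t \<in> {0..?l}" for t
  unfolding R_def Y_def using that by (intro rep) (auto simp: natural_param_def)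
 have "(Y has_real_derivative outv p e b) (at 0 within {0..?l})"
 proof (cases b)
  case True
  have d: "(y e has_real_derivative p e ?l) (at ?l within {0..?l})"
   by (rule AC_C1_derivative[OF y p]) (use l in auto)
  have "((%t. y e (?l - t)) has_real_derivative p e ?l * (0 - 1)) (at 0 within {0..?l})"
  proof -
   have im: "(%t. ?l - t) ` {0..?l} = {0..?l}"
    by (auto simp: image_iff intro!: bexI[of _ "?l - _"])
   have "((%t. ?l - t) has_real_derivative (0 - 1)) (at 0 within {0..?l})"
    by (auto intro!: derivative_eq_intros)
   hence "(y e \<circ> (%t. ?l - t) has_real_derivative p e ?l * (0 - 1)) (at 0 within {0..?l})"
    by (intro DERIV_image_chain) (use d im in auto)
   thus ?thesis by (simp add: o_def)
  qed
  moreover have "Y = (%t. y e (?l - t))" using True by (auto simp: Y_def natural_param_def)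
  ultimately show ?thesis using True by (simp add: outv_def)
 next
  case False
  hence "Y = y e" by (auto simp: Y_def natural_param_def)
  thus ?thesis using AC_C1_derivative[OF y p, of 0] l False by (simp add: outv_def)
 qed
 hence "(R has_real_derivative outv p e b) (at 0 within {0..?l})"
  by (rule has_field_derivative_transform_within[where d = 1]) (use l RY in auto)
 hence "(R has_vector_derivative outv p e b) (at_right 0)"
  using at_within_Icc_at_right[OF l] by (simp add: has_real_derivative_iff_has_vector_derivative)
 hence "vector_derivative R (at_right 0) = outv p e b"
  by (intro vector_derivative_within) simp
 thus ?thesis unfolding outward_deriv_def R_def .
qed

end

context metric_graph_loc
begin

lemma path_length_nonneg: "path_length G p q r ==> 0 <= r"
 by (induction rule: path_length.induct) auto

lemma geodesic_dist_le: "path_length G p q r ==> geodesic_dist G p q <= r"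
 unfolding geodesic_dist_def by (rule cInf_lower) (auto intro!: bdd_belowI[of _ 0] path_length_nonneg)

lemma geodesic_dist_nonneg: "path_length G p q r ==> 0 <= geodesic_dist G p q"
 unfolding geodesic_dist_def by (rule cInf_greatest) (auto intro: path_length_nonneg)

lemma Lipschitz_graph_path:
 assumes "Lipschitz_graph G u"
 shows "\<exists>C\<ge>0. \<forall>e x f y r. (e, x) \<in> points G --> (f, y) \<in> points G --> path_length G (e, x) (f, y) r
  --> \<bar>u e x - u f y\<bar> <= C * r"
proof -
 obtain C where C: "\<forall>(e, x)\<in>points G. \<forall>(f, y)\<in>points G. \<bar>u e x - u f y\<bar> <= C * geodesic_dist G (e, x) (f, y)"
  using assms unfolding Lipschitz_graph_def ..
 show ?thesis
 \<comment> \<open>The constant in the definition of a Lipschitz function may be negative, hence the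
   maximum.\<close>
 proof (intro exI[of _ "max C 0"] conjI allI impI)
  fix e x f y r assume p: "(e, x) \<in> points G" "(f, y) \<in> points G" "path_length G (e, x) (f, y) r"
  have "\<bar>u e x - u f y\<bar> <= C * geodesic_dist G (e, x) (f, y)"
   using bspec[OF C p(1)] p(2) by auto
  also have "... <= max C 0 * r"
   using geodesic_dist_nonneg[OF p(3)] geodesic_dist_le[OF p(3)] by (intro mult_mono) auto
  finally show "\<bar>u e x - u f y\<bar> <= max C 0 * r" .
 qed simp
qed

lemma Lipschitz_graph_edge:
 assumes "Lipschitz_graph G u" "e \<in> Ed"
 shows "\<exists>d. AC (len G e) (u e) d"
proof -
 obtain C where C: "!!e x f y r. (e, x) \<in> points G ==> (f, y) \<in> points G ==> path_length G (e, x) (f, y) r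
  ==> \<bar>u e x - u f y\<bar> <= C * r" using Lipschitz_graph_path[OF assms(1)] by metis
 show ?thesis
 proof (rule AC_if_Lipschitz[OF len_pos[OF assms(2)]])
  fix x y assume "x \<in> {0..len G e}" "y \<in> {0..len G e}"
  hence p: "(e, x) \<in> points G" "(e, y) \<in> points G" using assms(2) by (auto simp: points_def)
  show "\<bar>u e x - u e y\<bar> <= C * \<bar>x - y\<bar>" by (rule C[OF p path_length.segment[OF p]])
 qed
qed

text \<open>Gluing is a path of length 0 between two ends at the same vertex. That \<open>a\<close>
  has a single value at each vertex is what turns the Kirchhoff condition on derivatives into one on
  fluxes.\<close>

lemma Lipschitz_graph_endv:
 assumes "Lipschitz_graph G u" "(e, b) \<in> Dir G v" "(f, c) \<in> Dir G v"
 shows "endv u e b = endv u f c"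
proof -
 obtain C where C: "!!e x f y r. (e, x) \<in> points G ==> (f, y) \<in> points G ==> path_length G (e, x) (f, y) r
  ==> \<bar>u e x - u f y\<bar> <= C * r" using Lipschitz_graph_path[OF assms(1)] by metis
 have p: "(e, natural_param G e b 0) \<in> points G" if "(e, b) \<in> Dir G v" for e b
  using Dir_arcs[OF that] len_pos[OF Dir_arcs[OF that]] by (auto simp: points_def natural_param_def)
 have "\<bar>u e (natural_param G e b 0) - u f (natural_param G f c 0)\<bar> <= C * 0"
  by (rule C[OF p[OF assms(2)] p[OF assms(3)] path_length.glue[OF assms(2,3)]])
 thus ?thesis by (simp add: endv_def natural_param_0)
qed

text \<open>Every edge has two ends, each attached to one vertex, and a loop counts twice at its
  vertex. This regroups the boundary terms of an edgewise integration by parts.\<close>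

lemma sum_Dir:
 "(\<Sum>v\<in>verts G. \<Sum>(e, b)\<in>Dir G v. g e b) = (\<Sum>e\<in>Ed. g e False + g e True)" for g :: "'e => bool => real"
proof -
 let ?vx = "%(e, b). if b then head G e else tail G e"
 have D: "Dir G v = {x \<in> Ed \<times> UNIV. ?vx x = v}" for v by (auto simp: Dir_def)
 have "(\<Sum>v\<in>verts G. \<Sum>(e, b)\<in>Dir G v. g e b) = (\<Sum>(e, b)\<in>Ed \<times> UNIV. g e b)"
  unfolding D by (rule sum.group) (auto simp: tail_in_verts head_in_verts)
 also have "... = (\<Sum>e\<in>Ed. \<Sum>b\<in>UNIV. g e b)" by (simp add: sum.cartesian_product)
 also have "... = (\<Sum>e\<in>Ed. g e False + g e True)" by (simp add: UNIV_bool)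
 finally show ?thesis .
qed

definition mul :: "'e graph_fun => 'e graph_fun => 'e graph_fun" where
 "mul m u = (%e x. m e x * u e x)"

definition bounded_by :: "'e graph_fun => real => bool" where
 "bounded_by m C \<longleftrightarrow> 0 <= C & (\<forall>e\<in>Ed. m e \<in> borel_measurable (leb (len G e)) &
  (AE x in leb (len G e). \<bar>m e x\<bar> <= C))"

lemma mul_L2: assumes "bounded_by m C" "u \<in> LG" shows "mul m u \<in> LG"
proof (rule LG_I)
 fix e assume e: "e \<in> Ed"
 hence "m e \<in> borel_measurable (leb (len G e))" "AE x in leb (len G e). \<bar>m e x\<bar> <= C"
  using assms(1) by (auto simp: bounded_by_def)
 thus "mul m u e \<in> L2_iv (len G e)"
  unfolding mul_def by (rule L2_iv_mult_bounded[OF LG_D[OF assms(2) e]])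
qed

lemma nG_mul: assumes "bounded_by m C" "u \<in> LG" shows "nG (mul m u) <= C * nG u"
proof -
 have "nG (mul m u) <= L2_set (%e. C * nrm (len G e) (u e)) (Ed)"
  unfolding nG_L2_set mul_def
  by (rule L2_set_mono) (use assms in \<open>auto simp: bounded_by_def intro!: nrm_mult_bounded LG_D\<close>)
 also have "... = C * nG u" using assms unfolding nG_L2_set by (simp add: L2_set_right_distrib bounded_by_def)
 finally show ?thesis .
qed

lemma mul_lin: "mul m (lc c u d v) = (%e x. c * mul m u e x + d * mul m v e x)"
 by (simp add: mul_def algebra_simps)

lemma inn_mul_commute: "inn (mul m u) v = inn (mul m v) u"
 unfolding inner_graph_def inner_iv_def mul_def by (simp add: mult_ac)

lemma inn_mul_lower:
 assumes "bounded_by m C" "u \<in> LG" and c: "!!e. e \<in> Ed ==> AE x in leb (len G e). c <= m e x"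
 shows "c * (nG u)^2 <= inn (mul m u) u"
 unfolding nG_sq inner_graph_def sum_distrib_left
proof (rule sum_mono)
 fix e assume e: "e \<in> Ed"
 have "c * inner_iv (len G e) (u e) (u e) = integral\<^sup>L (leb (len G e)) (%x. c * (u e x * u e x))"
  by (simp add: inner_iv_def)
 also have "... <= integral\<^sup>L (leb (len G e)) (%x. mul m u e x * u e x)"
 proof (rule integral_mono_AE)
  show "integrable (leb (len G e)) (%x. c * (u e x * u e x))"
   using assms(2) e by (intro integrable_mult_right L2_iv_mult_integrable LG_D)
  show "integrable (leb (len G e)) (%x. mul m u e x * u e x)"
   using assms(2) mul_L2[OF assms(1,2)] e by (intro L2_iv_mult_integrable LG_D)
  show "AE x in leb (len G e). c * (u e x * u e x) <= mul m u e x * u e x"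
   using c[OF e] by eventually_elim (simp add: mul_def mult.assoc mult_right_mono)
 qed
 finally show "c * inner_iv (len G e) (u e) (u e) <= inner_iv (len G e) (mul m u e) (u e)"
  by (simp add: inner_iv_def)
qed

lemma inn_mul_add:
 assumes m: "bounded_by m C" and uv: "u \<in> LG" "v \<in> LG"
 shows "inn (mul m (%e x. 1 * u e x + 1 * v e x)) (%e x. 1 * u e x + 1 * v e x)
  = inn (mul m u) u + 2 * inn (mul m v) u + inn (mul m v) v"
proof -
 note M = mul_L2[OF m uv(1)] mul_L2[OF m uv(2)]
 show ?thesis
  unfolding mul_lin inn_lin[OF M LG_lin[OF uv]] inn_lin2[OF uv M(1)] inn_lin2[OF uv M(2)]
  using inn_mul_commute[of m u v] by simp
qed

end

section \<open>The differential operator\<close>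

locale quantum_graph = metric_graph_loc G for G :: "('v, 'e) metric_graph" +
 fixes VK VD :: "'v set" and a \<kappa> :: "'e graph_fun"
  and I :: "nat set" and \<psi> :: "nat => 'e graph_fun" and \<mu> :: "nat => real"
 assumes VKD: "VK \<union> VD = verts G"
  and a_Linf: "a \<in> Linf_graph G" and \<kappa>_Linf: "\<kappa> \<in> Linf_graph G"
  and a_pos: "ess_inf_pos G a" and \<kappa>_pos: "ess_inf_pos G \<kappa>"
  and a_Lip: "Lipschitz_graph G a"
  and basis: "orthonormal_eigenbasis G VK VD a \<kappa> I \<psi> \<mu>"
begin

definition adv :: "'e graph_fun" where "adv e = (SOME d. AC (len G e) (a e) d)"

lemma a_AC: "e \<in> Ed ==> AC (len G e) (a e) (adv e)"
 unfolding adv_def by (rule someI_ex[OF Lipschitz_graph_edge[OF a_Lip]])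

text \<open>The bound is given almost everywhere; as the minimum of \<open>a\<close> and the bound
  is continuous, it holds at every point of the closed edges.\<close>

lemma a_lower: "\<exists>c>0. \<forall>e\<in>Ed. \<forall>x\<in>{0..len G e}. c <= a e x"
proof -
 obtain c where c: "0 < c" "\<forall>e\<in>Ed. AE x in leb (len G e). c <= a e x"
  using a_pos unfolding ess_inf_pos_def by blast
 have "c <= a e x" if e: "e \<in> Ed" and x: "x \<in> {0..len G e}" for e x
 proof -
  have "AE x in leb (len G e). min (a e x) c = c"
   using bspec[OF c(2) e] by eventually_elim simp
  moreover have "cont (len G e) (%x. min (a e x) c)"
   by (intro continuous_intros AC_continuous[OF a_AC[OF e]])
  ultimately have "min (a e x) c = c"
   using continuous_AE_imp_eq[OF len_pos[OF e] _ continuous_on_const _ x] by blast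
  thus ?thesis by simp
 qed
 with c(1) show ?thesis by blast
qed

definition a_lo :: real where "a_lo = (SOME c. 0 < c & (\<forall>e\<in>Ed. \<forall>x\<in>{0..len G e}. c <= a e x))"

lemma a_lo: "0 < a_lo" "e \<in> Ed ==> x \<in> {0..len G e} ==> a_lo <= a e x"
 using someI_ex[OF a_lower] unfolding a_lo_def by blast+

lemma a_bounded: "\<exists>C. bounded_by a C"
proof -
 obtain C where "\<forall>e\<in>Ed. a e \<in> borel_measurable (leb (len G e)) &
  (AE x in leb (len G e). \<bar>a e x\<bar> <= C)"
  using a_Linf unfolding Linf_graph_def by blast
 hence "bounded_by a (max C 0)" unfolding bounded_by_def by (auto elim!: eventually_mono)
 thus ?thesis by blast
qed

definition a_hi :: real where "a_hi = (SOME C. bounded_by a C)"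

lemma a_hi: "bounded_by a a_hi"
 unfolding a_hi_def by (rule someI_ex[OF a_bounded])

definition \<kappa>2 :: "'e graph_fun" where "\<kappa>2 e x = (\<kappa> e x)^2"

lemma \<kappa>2_bounded: "\<exists>C. bounded_by \<kappa>2 C"
proof -
 obtain C where C: "\<forall>e\<in>Ed. \<kappa> e \<in> borel_measurable (leb (len G e)) &
  (AE x in leb (len G e). \<bar>\<kappa> e x\<bar> <= C)"
  using \<kappa>_Linf unfolding Linf_graph_def by blast
 have "bounded_by \<kappa>2 (C^2)" unfolding bounded_by_def
 proof (intro conjI ballI)
  fix e assume e: "e \<in> Ed"
  show "\<kappa>2 e \<in> borel_measurable (leb (len G e))"
   unfolding \<kappa>2_def using bspec[OF C e] by auto
  have "AE x in leb (len G e). \<bar>\<kappa> e x\<bar> <= C" using bspec[OF C e] by blast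
  thus "AE x in leb (len G e). \<bar>\<kappa>2 e x\<bar> <= C^2"
  proof eventually_elim
   case (elim x)
   thus ?case unfolding \<kappa>2_def using power_mono[OF elim, of 2] by simp
  qed
 qed simp
 thus ?thesis by blast
qed

definition \<kappa>_hi :: real where "\<kappa>_hi = (SOME C. bounded_by \<kappa>2 C)"

lemma \<kappa>_hi: "bounded_by \<kappa>2 \<kappa>_hi"
 unfolding \<kappa>_hi_def by (rule someI_ex[OF \<kappa>2_bounded])

lemma \<kappa>2_lower: "\<exists>c>0. \<forall>e\<in>Ed. AE x in leb (len G e). c <= \<kappa>2 e x"
proof -
 obtain c where c: "0 < c" "\<forall>e\<in>Ed. AE x in leb (len G e). c <= \<kappa> e x"
  using \<kappa>_pos unfolding ess_inf_pos_def by blast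
 have "AE x in leb (len G e). c^2 <= \<kappa>2 e x" if e: "e \<in> Ed" for e
  using bspec[OF c(2) e] unfolding \<kappa>2_def
 proof eventually_elim
  case (elim x)
  thus ?case using c(1) by (intro power_mono) auto
 qed
 thus ?thesis using c(1) by (intro exI[of _ "c^2"]) auto
qed

definition \<kappa>_lo :: real where "\<kappa>_lo = (SOME c. 0 < c & (\<forall>e\<in>Ed. AE x in leb (len G e). c <= \<kappa>2 e x))"

lemma \<kappa>_lo: "0 < \<kappa>_lo" "e \<in> Ed ==> AE x in leb (len G e). \<kappa>_lo <= \<kappa>2 e x"
 using someI_ex[OF \<kappa>2_lower] unfolding \<kappa>_lo_def by blast+

text \<open>The form domain. The Dirichlet condition is imposed on it, whereas the Kirchhoff
  condition is natural and enters only with the operator domain \<open>op_fun\<close>.\<close>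

definition form_fun :: "'e graph_fun => 'e graph_fun => bool" where
 "form_fun y p \<longleftrightarrow> vert_fun y p & (\<forall>v\<in>VD. \<forall>(e, b)\<in>Dir G v. endv y e b = 0)"

text \<open>The operator domain, with the first and second derivatives carried along as
  \<open>p\<close> and \<open>r\<close>. Being absolutely continuous, \<open>p\<close> has end
  values with which the Kirchhoff sum can be formed.\<close>

definition op_fun :: "'e graph_fun => 'e graph_fun => 'e graph_fun => bool" where
 "op_fun y p r \<longleftrightarrow> form_fun y p & (\<forall>e\<in>Ed. AC (len G e) (p e) (r e)) &
  (\<forall>v\<in>VK. (\<Sum>(e, b)\<in>Dir G v. outv p e b) = 0)"

text \<open>The differential expression with the derivative of the flux \<open>a * p\<close>
  expanded by the product rule; \<open>adv\<close> is the derivative of \<open>a\<close>.\<close>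

definition Lop :: "'e graph_fun => 'e graph_fun => 'e graph_fun => 'e graph_fun" where
 "Lop y p r = (%e x. \<kappa>2 e x * y e x - (adv e x * p e x + a e x * r e x))"

definition En :: "'e graph_fun => 'e graph_fun => 'e graph_fun => 'e graph_fun => real" where
 "En y p z q = inn (mul \<kappa>2 y) z + inn (mul a p) q"

lemma form_fun_vert: "form_fun y p ==> vert_fun y p"
 by (simp add: form_fun_def)

lemma op_fun_form: "op_fun y p r ==> form_fun y p"
 by (simp add: op_fun_def)

lemma op_fun_AC: "op_fun y p r ==> e \<in> Ed ==> AC (len G e) (p e) (r e)"
 by (simp add: op_fun_def)

lemma form_fun_L2: "form_fun y p ==> y \<in> LG" "form_fun y p ==> p \<in> LG"
 using vert_fun_L2[OF form_fun_vert] by blast+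

lemma op_fun_L2: "op_fun y p r ==> r \<in> LG"
 by (rule LG_I, rule AC_L2[OF op_fun_AC])

lemma form_fun_lin:
 assumes "form_fun y p" "form_fun z q"
 shows "form_fun (lc c y d z) (lc c p d q)"
proof -
 have "\<forall>v\<in>VD. \<forall>x\<in>Dir G v. endv y (fst x) (snd x) = 0" "\<forall>v\<in>VD. \<forall>x\<in>Dir G v. endv z (fst x) (snd x) = 0"
  using assms by (simp_all add: form_fun_def case_prod_beta)
 hence "\<forall>v\<in>VD. \<forall>x\<in>Dir G v. endv (lc c y d z) (fst x) (snd x) = 0"
  unfolding endv_def by simp
 thus ?thesis using vert_fun_lin[OF form_fun_vert form_fun_vert, OF assms]
  by (simp add: form_fun_def case_prod_beta)
qed

lemma op_fun_lin:
 assumes "op_fun y p r" "op_fun z q s"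
 shows "op_fun (lc c y d z) (lc c p d q) (lc c r d s)"
 unfolding op_fun_def
proof (intro conjI ballI)
 show "form_fun (lc c y d z) (lc c p d q)"
  by (intro form_fun_lin op_fun_form[OF assms(1)] op_fun_form[OF assms(2)])
 fix e assume "e \<in> Ed"
 thus "AC (len G e) (%x. c * p e x + d * q e x) (%x. c * r e x + d * s e x)"
  by (intro AC_lin op_fun_AC[OF assms(1)] op_fun_AC[OF assms(2)])
next
 fix v assume v: "v \<in> VK"
 have "(\<Sum>(e, b)\<in>Dir G v. outv (lc c p d q) e b)
   = c * (\<Sum>(e, b)\<in>Dir G v. outv p e b) + d * (\<Sum>(e, b)\<in>Dir G v. outv q e b)"
  unfolding sum_distrib_left sum.distrib[symmetric]
  by (rule sum.cong) (auto simp: outv_def algebra_simps)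
 also have "... = 0" using assms v by (simp add: op_fun_def)
 finally show "(\<Sum>(e, b)\<in>Dir G v. outv (lc c p d q) e b) = 0" .
qed

lemma op_fun_zero: "op_fun (%e x. 0) (%e x. 0) (%e x. 0)"
 by (auto simp: op_fun_def form_fun_def vert_fun_def endv_def outv_def AC_const intro!: sum.neutral)

lemma op_fun_sum:
 assumes "finite F" "!!i. i \<in> F ==> op_fun (y i) (p i) (r i)"
 shows "op_fun (%e x. \<Sum>i\<in>F. c i * y i e x) (%e x. \<Sum>i\<in>F. c i * p i e x) (%e x. \<Sum>i\<in>F. c i * r i e x)"
 using assms
proof (induction F rule: finite_induct)
 case (insert i F)
 hence "op_fun (%e x. c i * y i e x + 1 * (\<Sum>i\<in>F. c i * y i e x)) (%e x. c i * p i e x + 1 * (\<Sum>i\<in>F. c i * p i e x))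
   (%e x. c i * r i e x + 1 * (\<Sum>i\<in>F. c i * r i e x))"
  by (intro op_fun_lin) auto
 thus ?case using insert by simp
qed (simp add: op_fun_zero)

lemma flux_AC:
 assumes "op_fun y p r" "e \<in> Ed"
 shows "AC (len G e) (%x. a e x * p e x) (%x. adv e x * p e x + a e x * r e x)"
 by (rule AC_mult[OF a_AC[OF assms(2)] op_fun_AC[OF assms]])

lemma flux_L2: "op_fun y p r ==> (%e x. adv e x * p e x + a e x * r e x) \<in> LG"
 by (rule LG_I, rule AC_L2[OF flux_AC])

lemma Lop_L2: assumes "op_fun y p r" shows "Lop y p r \<in> LG"
 using LG_diff[OF mul_L2[OF \<kappa>_hi form_fun_L2(1)[OF op_fun_form[OF assms]]] flux_L2[OF assms]]
 by (simp add: Lop_def mul_def)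

lemma Lop_sum:
 "Lop (%e x. \<Sum>i\<in>F. c i * y i e x) (%e x. \<Sum>i\<in>F. c i * p i e x) (%e x. \<Sum>i\<in>F. c i * r i e x)
  = (%e x. \<Sum>i\<in>F. c i * Lop (y i) (p i) (r i) e x)"
 unfolding Lop_def sum_distrib_left sum.distrib[symmetric] sum_subtractf[symmetric]
 by (rule ext, rule ext, rule sum.cong) (auto simp: algebra_simps)

text \<open>
 Green's formula: at a vertex in \<open>VK\<close> the coefficient and the test function are constant along the
 incident ends and the outward derivatives add up to zero; at a vertex in \<open>VD\<close> the test function vanishes.
\<close>

lemma Green:
 assumes y: "op_fun y p r" and z: "form_fun z q"
 shows "En y p z q = inn (Lop y p r) z"
proof -
 define f where "f e x = adv e x * p e x + a e x * r e x" for e x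
 define g where "g e b = endv a e b * endv z e b * outv p e b" for e b
 have fL: "f \<in> LG" using flux_L2[OF y] unfolding f_def .
 note zL = form_fun_L2(1)[OF z]
 have v0: "(\<Sum>(e, b)\<in>Dir G v. g e b) = 0" if v: "v \<in> verts G" for v
 proof (cases "v \<in> VD")
  case True
  hence "\<forall>x\<in>Dir G v. endv z (fst x) (snd x) = 0" using z by (simp add: form_fun_def case_prod_beta)
  thus ?thesis unfolding g_def by (intro sum.neutral) (auto simp: case_prod_beta)
 next
  case False
  hence v': "v \<in> VK" using v VKD by blast
  obtain c where c: "\<forall>(e, b)\<in>Dir G v. endv z e b = c"
   using z v by (auto simp: form_fun_def vert_fun_def)
  show ?thesis
  proof (cases "Dir G v = {}")
   case False
   then obtain e0 b0 where eb: "(e0, b0) \<in> Dir G v" by auto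
   have "(\<Sum>(e, b)\<in>Dir G v. g e b) = (\<Sum>(e, b)\<in>Dir G v. (endv a e0 b0 * c) * outv p e b)"
    by (rule sum.cong) (use c Lipschitz_graph_endv[OF a_Lip _ eb] in \<open>auto simp: g_def\<close>)
   also have "... = (endv a e0 b0 * c) * (\<Sum>(e, b)\<in>Dir G v. outv p e b)"
    by (simp add: sum_distrib_left case_prod_beta)
   also have "... = 0" using y v' by (simp add: op_fun_def)
   finally show ?thesis .
  qed simp
 qed
 have "inn f z + inn (mul a p) q = (\<Sum>e\<in>Ed. inner_iv (len G e) (f e) (z e) + inner_iv (len G e) (mul a p e) (q e))"
  by (simp add: inner_graph_def sum.distrib)
 also have "... = (\<Sum>e\<in>Ed. - (g e False + g e True))"
 proof (rule sum.cong)
  fix e assume e: "e \<in> Ed"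
  have "inner_iv (len G e) (f e) (z e) + inner_iv (len G e) (%x. a e x * p e x) (q e)
    = a e (len G e) * p e (len G e) * z e (len G e) - a e 0 * p e 0 * z e 0"
   unfolding f_def using AC_by_parts[OF flux_AC[OF y e] vert_fun_AC[OF form_fun_vert[OF z] e]] len_pos[OF e]
   by simp
  also have "... = - (g e False + g e True)" by (simp add: g_def endv_def outv_def)
  finally show "inner_iv (len G e) (f e) (z e) + inner_iv (len G e) (mul a p e) (q e) = - (g e False + g e True)"
   by (simp add: mul_def)
 qed simp
 also have "... = - (\<Sum>v\<in>verts G. \<Sum>(e, b)\<in>Dir G v. g e b)" by (simp only: sum_Dir sum_negf)
 also have "... = 0" using v0 by simp
 finally have "inn (mul a p) q = - inn f z" by simp
 moreover have "inn (Lop y p r) z = inn (mul \<kappa>2 y) z - inn f z"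
  unfolding inn_diff[OF mul_L2[OF \<kappa>_hi form_fun_L2(1)[OF op_fun_form[OF y]]] fL zL, symmetric]
  by (simp add: Lop_def mul_def f_def)
 ultimately show ?thesis by (simp add: En_def)
qed

lemma En_commute: "En y p z q = En z q y p"
 by (simp add: En_def inn_mul_commute[of _ y] inn_mul_commute[of _ p])

lemma En_lower:
 assumes "y \<in> LG" "p \<in> LG"
 shows "\<kappa>_lo * (nG y)^2 + a_lo * (nG p)^2 <= En y p y p"
 unfolding En_def
 by (intro add_mono inn_mul_lower[OF \<kappa>_hi assms(1)] inn_mul_lower[OF a_hi assms(2)] \<kappa>_lo AE_iv_I a_lo)

lemma En_upper:
 assumes "y \<in> LG" "p \<in> LG"
 shows "En y p y p <= \<kappa>_hi * (nG y)^2 + a_hi * (nG p)^2"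
proof -
 have "inn (mul m u) u <= C * (nG u)^2" if m: "bounded_by m C" and u: "u \<in> LG" for m C u
 proof -
  have "inn (mul m u) u <= nG (mul m u) * nG u"
   using inn_Cauchy_Schwarz[OF mul_L2[OF m u] u] by simp
  also have "... <= (C * nG u) * nG u" by (intro mult_right_mono nG_mul[OF m u]) simp
  finally show ?thesis by (simp add: power2_eq_square mult.assoc)
 qed
 thus ?thesis unfolding En_def using \<kappa>_hi a_hi assms by (intro add_mono) auto
qed

lemma En_add:
 assumes "y \<in> LG" "p \<in> LG" "z \<in> LG" "q \<in> LG"
 shows "En (%e x. 1 * y e x + 1 * z e x) (%e x. 1 * p e x + 1 * q e x)
   (%e x. 1 * y e x + 1 * z e x) (%e x. 1 * p e x + 1 * q e x)
  = En y p y p + 2 * En z q y p + En z q z q"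
 unfolding En_def inn_mul_add[OF \<kappa>_hi assms(1,3)] inn_mul_add[OF a_hi assms(2,4)] by simp

end

lemma AC_sup_le:
 assumes F: "AC l F f" and l: "0 < l" and x: "x \<in> {0..l}"
 shows "\<bar>F x\<bar> <= sqrt (1 / l + 2) * (nrm l F + nrm l f)"
proof (rule abs_le_if_power2_le)
 define S where "S = nrm l F + nrm l f"
 have S: "nrm l F <= S" "nrm l f <= S" "0 <= S" by (auto simp: S_def)
 have "(F x)^2 <= (nrm l F)^2 / l + 2 * nrm l F * nrm l f" by (rule AC_sup_bound[OF F l x])
 also have "... <= S^2 / l + 2 * S * S" using S l by (intro add_mono divide_right_mono power_mono mult_mono) auto
 also have "... = (sqrt (1 / l + 2) * S)^2" using l by (simp add: power_mult_distrib algebra_simps power2_eq_square)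
 finally show "(F x)^2 <= (sqrt (1 / l + 2) * (nrm l F + nrm l f))^2" by (simp add: S_def)
qed (use l in auto)

text \<open>On a block the weight is at most \<open>4 powr \<bar>t\<bar>\<close> times its value at
  4^j, which leaves a geometric series of ratio 4^(t - \<gamma>). The term
  \<open>1 + m0 powr t\<close> covers the block below 1 for either sign of \<open>t\<close>. It
  serves both for Weyl's count (\<gamma> = -1/2, unit weights) and for squared coefficients.\<close>

lemma dyadic_block_sum:
 fixes \<nu> w :: "'i => real"
 assumes F: "finite F" and w: "!!i. i \<in> F ==> 0 <= w i" and m0: "0 < m0" "!!i. i \<in> F ==> m0 <= \<nu> i"
  and A: "0 <= A" and t: "t < \<gamma>"
  and low: "(\<Sum>i | i \<in> F & \<nu> i <= 1. w i) <= A"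
  and block: "!!j. (\<Sum>i | i \<in> F & 4 ^ j < \<nu> i & \<nu> i <= 4 ^ Suc j. w i) <= A * 4 powr (- real j * \<gamma>)"
 shows "(\<Sum>i\<in>F. \<nu> i powr t * w i) <= (1 + m0 powr t + 4 powr \<bar>t\<bar> / (1 - 4 powr (t - \<gamma>))) * A"
proof -
 define q :: real where "q = 4 powr (t - \<gamma>)"
 have q: "0 < q" "q < 1" using t by (auto simp: q_def powr_less_one)
 define B where "B N = (\<Sum>i | i \<in> F & \<nu> i <= 4 ^ N. \<nu> i powr t * w i)" for N
 have pos: "0 < \<nu> i" if "i \<in> F" for i using m0(1) m0(2)[OF that] by linarith
 have B0: "B 0 <= (1 + m0 powr t) * A"
 proof -
  have "B 0 <= (\<Sum>i | i \<in> F & \<nu> i <= 1. (1 + m0 powr t) * w i)"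
   unfolding B_def power_0
  proof (intro sum_mono mult_right_mono)
   fix i assume "i \<in> {i \<in> F. \<nu> i <= 1}"
   hence i: "i \<in> F" "\<nu> i <= 1" by auto
   show "0 <= w i" using w i by auto
   show "\<nu> i powr t <= 1 + m0 powr t"
   proof (cases "0 <= t")
    case True
    hence "\<nu> i powr t <= 1 powr t" using i pos[OF i(1)] by (intro powr_mono2) auto
    thus ?thesis by (simp add: add_increasing2)
   next
    case False
    hence "\<nu> i powr t <= m0 powr t" using m0 i by (intro powr_mono2') auto
    thus ?thesis by simp
   qed
  qed
  also have "... = (1 + m0 powr t) * (\<Sum>i | i \<in> F & \<nu> i <= 1. w i)" by (simp add: sum_distrib_left)
  also have "... <= (1 + m0 powr t) * A" using low by (intro mult_left_mono) auto
  finally show ?thesis .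
 qed
 have Bs: "B (Suc j) <= B j + 4 powr \<bar>t\<bar> * A * q ^ j" for j
 proof -
  have "B (Suc j) = (\<Sum>i\<in>{i \<in> F. \<nu> i <= 4 ^ j} \<union> {i \<in> F. 4 ^ j < \<nu> i & \<nu> i <= 4 ^ Suc j}. \<nu> i powr t * w i)"
   unfolding B_def by (rule sum.cong) (auto intro: order_trans[of _ "4 ^ j"])
  also have "... = B j + (\<Sum>i | i \<in> F & 4 ^ j < \<nu> i & \<nu> i <= 4 ^ Suc j. \<nu> i powr t * w i)"
   unfolding B_def using F by (intro sum.union_disjoint) auto
  finally have split: "B (Suc j) = B j + (\<Sum>i | i \<in> F & 4 ^ j < \<nu> i & \<nu> i <= 4 ^ Suc j. \<nu> i powr t * w i)" .
  have "(\<Sum>i | i \<in> F & 4 ^ j < \<nu> i & \<nu> i <= 4 ^ Suc j. \<nu> i powr t * w i)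
   <= (\<Sum>i | i \<in> F & 4 ^ j < \<nu> i & \<nu> i <= 4 ^ Suc j. (4 powr \<bar>t\<bar> * 4 powr (real j * t)) * w i)"
  proof (intro sum_mono mult_right_mono)
   fix i assume "i \<in> {i \<in> F. 4 ^ j < \<nu> i & \<nu> i <= 4 ^ Suc j}"
   hence i: "i \<in> F" "4 ^ j < \<nu> i" "\<nu> i <= 4 ^ Suc j" by auto
   show "0 <= w i" using w i by auto
   have p4: "(4::real) ^ k = 4 powr real k" for k by (simp add: powr_realpow)
   show "\<nu> i powr t <= 4 powr \<bar>t\<bar> * 4 powr (real j * t)"
   proof (cases "0 <= t")
    case True
    hence "\<nu> i powr t <= (4 ^ Suc j) powr t" using i pos[OF i(1)] by (intro powr_mono2) auto
    also have "... = 4 powr (real (Suc j) * t)" by (simp only: p4 powr_powr)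
    also have "... = 4 powr \<bar>t\<bar> * 4 powr (real j * t)"
     using True by (simp add: powr_add[symmetric] algebra_simps)
    finally show ?thesis .
   next
    case False
    hence "\<nu> i powr t <= (4 ^ j) powr t" using i by (intro powr_mono2') auto
    also have "... = 1 * 4 powr (real j * t)" by (simp only: p4 powr_powr mult_1)
    also have "... <= 4 powr \<bar>t\<bar> * 4 powr (real j * t)"
     by (intro mult_right_mono ge_one_powr_ge_zero) auto
    finally show ?thesis .
   qed
  qed
  also have "... = (4 powr \<bar>t\<bar> * 4 powr (real j * t)) * (\<Sum>i | i \<in> F & 4 ^ j < \<nu> i & \<nu> i <= 4 ^ Suc j. w i)"
   by (rule sum_distrib_left[symmetric])
  also have "... <= (4 powr \<bar>t\<bar> * 4 powr (real j * t)) * (A * 4 powr (- real j * \<gamma>))"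
   by (intro mult_left_mono block) auto
  also have "... = 4 powr \<bar>t\<bar> * A * 4 powr (real j * (t - \<gamma>))"
  proof -
   have "4 powr (real j * (t - \<gamma>)) = (4::real) powr (real j * t) * 4 powr (- real j * \<gamma>)"
    unfolding powr_add[symmetric] by (simp add: algebra_simps)
   thus ?thesis by simp
  qed
  also have "4 powr (real j * (t - \<gamma>)) = q ^ j"
   unfolding powr_realpow[OF q(1), symmetric] by (simp add: q_def powr_powr mult.commute)
  finally show ?thesis using split by simp
 qed
 have B: "B N <= (1 + m0 powr t) * A + 4 powr \<bar>t\<bar> * A * (\<Sum>j<N. q ^ j)" for N
 proof (induction N)
  case (Suc N)
  thus ?case using Bs[of N] by (simp add: distrib_left)
 qed (use B0 in simp)
 obtain N where N: "Max (insert 1 (\<nu> ` F)) < 4 ^ N" using real_arch_pow[of 4] by auto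
 have "\<nu> i <= 4 ^ N" if "i \<in> F" for i
 proof -
  have "\<nu> i <= Max (insert 1 (\<nu> ` F))" using F that by (intro Max_ge) auto
  with N show ?thesis by linarith
 qed
 hence "(\<Sum>i\<in>F. \<nu> i powr t * w i) = B N" unfolding B_def by (intro sum.cong) auto
 also have "... <= (1 + m0 powr t) * A + 4 powr \<bar>t\<bar> * A * (\<Sum>j<N. q ^ j)" by (rule B)
 also have "... <= (1 + m0 powr t) * A + 4 powr \<bar>t\<bar> * A * (1 / (1 - q))"
 proof (intro add_left_mono mult_left_mono)
  show "(\<Sum>j<N. q ^ j) <= 1 / (1 - q)"
   using q by (simp add: sum_gp_strict divide_right_mono)
 qed (use A in auto)
 finally show ?thesis by (simp add: q_def algebra_simps)
qed

context quantum_graph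
begin

text \<open>Since \<open>adv\<close> enters as an L2 function, the product is estimated by the sup
  norm of \<open>p\<close>, hence through \<open>p\<close> and its derivative
  \<open>r\<close>.\<close>

lemma nG_adv:
 "\<exists>C\<ge>0. \<forall>p r. (\<forall>e\<in>Ed. AC (len G e) (p e) (r e)) --> nG (%e x. adv e x * p e x) <= C * (nG p + nG r)"
proof -
 define D where "D e = sqrt (1 / len G e + 2) * nrm (len G e) (adv e)" for e
 have "nG (%e x. adv e x * p e x) <= (\<Sum>e\<in>Ed. D e) * (nG p + nG r)"
  if AC: "\<forall>e\<in>Ed. AC (len G e) (p e) (r e)" for p r
 proof (rule nG_le_if_edges)
  fix e assume e: "e \<in> Ed"
  note l = len_pos[OF e] and ac = bspec[OF AC e] and advL = AC_L2[OF a_AC[OF e]]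
  have "nrm (len G e) (%x. p e x * adv e x)
    <= (sqrt (1 / len G e + 2) * (nrm (len G e) (p e) + nrm (len G e) (r e))) * nrm (len G e) (adv e)"
   by (rule nrm_mult_bounded[OF advL continuous_on_iv_measurable[OF AC_continuous[OF ac]] AE_iv_I[OF AC_sup_le[OF ac l]]])
    (use l in auto)
  also have "... = D e * (nrm (len G e) (p e) + nrm (len G e) (r e))" by (simp add: D_def)
  also have "... <= D e * (nG p + nG r)"
   using l by (intro mult_left_mono add_mono nrm_le_nG e) (auto simp: D_def)
  finally show "nrm (len G e) (%x. adv e x * p e x) <= D e * (nG p + nG r)" by (simp add: mult.commute)
 qed
 moreover have "0 <= (\<Sum>e\<in>Ed. D e)" by (rule sum_nonneg) (auto simp: D_def dest: len_pos)
 ultimately show ?thesis by blast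
qed

lemma nG_Lop_le:
 "\<exists>C\<ge>0. \<forall>y p r. op_fun y p r --> nG (Lop y p r) <= C * (nG y + nG p + nG r)"
proof -
 obtain C where C: "0 <= C" "!!p r. (\<forall>e\<in>Ed. AC (len G e) (p e) (r e)) ==>
  nG (%e x. adv e x * p e x) <= C * (nG p + nG r)" using nG_adv by blast
 have hi: "0 <= \<kappa>_hi" "0 <= a_hi" using \<kappa>_hi a_hi by (auto simp: bounded_by_def)
 have "nG (Lop y p r) <= (\<kappa>_hi + C + a_hi) * (nG y + nG p + nG r)" if op: "op_fun y p r" for y p r
 proof -
  have L: "y \<in> LG" "p \<in> LG" "r \<in> LG"
   using form_fun_L2[OF op_fun_form[OF op]] op_fun_L2[OF op] by auto
  have ac: "\<forall>e\<in>Ed. AC (len G e) (p e) (r e)" using op by (simp add: op_fun_def)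
  have apL: "(%e x. adv e x * p e x) \<in> LG"
  proof (rule LG_I)
   fix e assume e: "e \<in> Ed"
   show "(%x. adv e x * p e x) \<in> L2_iv (len G e)"
    using L2_iv_mult_continuous[OF AC_L2[OF a_AC[OF e]] AC_continuous[OF bspec[OF ac e]]] by (simp add: mult.commute)
  qed
  note KL = mul_L2[OF \<kappa>_hi L(1)] and aL = mul_L2[OF a_hi L(3)]
  have "nG (Lop y p r) <= nG (mul \<kappa>2 y) + nG (%e x. adv e x * p e x + mul a r e x)"
   using nG_diff[OF KL LG_add[OF apL aL]] by (simp add: Lop_def mul_def)
  also have "... <= nG (mul \<kappa>2 y) + (nG (%e x. adv e x * p e x) + nG (mul a r))"
   by (intro add_left_mono nG_add apL aL)
  also have "... <= \<kappa>_hi * nG y + (C * (nG p + nG r) + a_hi * nG r)"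
   by (intro add_mono nG_mul[OF \<kappa>_hi] nG_mul[OF a_hi] L C(2)[OF ac])
  also have "... <= \<kappa>_hi * (nG y + nG p + nG r) + (C * (nG y + nG p + nG r) + a_hi * (nG y + nG p + nG r))"
   using hi C(1) by (intro add_mono mult_left_mono) auto
  finally show ?thesis by (simp add: algebra_simps)
 qed
 moreover have "0 <= \<kappa>_hi + C + a_hi" using hi C(1) by simp
 ultimately show ?thesis by blast
qed

text \<open>Elliptic regularity. Bounding \<open>adv * p\<close> by the sup norm of \<open>p\<close>
  would bring back \<open>r\<close>. Instead the flux \<open>a * p\<close> is used: its derivative
  is \<open>\<kappa>2 * y\<close> minus the operator applied to \<open>y\<close>, and
  \<open>p\<close> is recovered by dividing by \<open>a\<close>.\<close>

lemma nG_second_deriv_le: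
 "\<exists>C\<ge>0. \<forall>y p r. op_fun y p r --> nG r <= C * (nG y + nG p + nG (Lop y p r))"
proof -
 have hi: "0 <= \<kappa>_hi" "0 <= a_hi" using \<kappa>_hi a_hi by (auto simp: bounded_by_def)
 define D where "D e = sqrt (1 / len G e + 2) / a_lo * nrm (len G e) (adv e)" for e
 define E where "E = (\<Sum>e\<in>Ed. D e)"
 have E0: "0 <= E" unfolding E_def by (rule sum_nonneg) (use a_lo(1) in \<open>auto simp: D_def dest: len_pos\<close>)
 have "nG r <= ((1 + E) * (\<kappa>_hi + 1 + a_hi) / a_lo) * (nG y + nG p + nG (Lop y p r))" if op: "op_fun y p r" for y p r
 proof -
  have L: "y \<in> LG" "p \<in> LG" "r \<in> LG"
   using form_fun_L2[OF op_fun_form[OF op]] op_fun_L2[OF op] by auto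
  have ac: "\<forall>e\<in>Ed. AC (len G e) (p e) (r e)" using op by (simp add: op_fun_def)
  define f where "f e x = adv e x * p e x + a e x * r e x" for e x
  have fL: "f \<in> LG" using flux_L2[OF op] unfolding f_def .
  have apL: "(%e x. adv e x * p e x) \<in> LG"
  proof (rule LG_I)
   fix e assume e: "e \<in> Ed"
   show "(%x. adv e x * p e x) \<in> L2_iv (len G e)"
    using L2_iv_mult_continuous[OF AC_L2[OF a_AC[OF e]] AC_continuous[OF bspec[OF ac e]]] by (simp add: mult.commute)
  qed
  have S: "nG (mul a p) + nG f <= (\<kappa>_hi + 1 + a_hi) * (nG y + nG p + nG (Lop y p r))"
  proof -
   have "f = (%e x. mul \<kappa>2 y e x - Lop y p r e x)" by (simp add: f_def Lop_def mul_def fun_eq_iff)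
   hence "nG f <= \<kappa>_hi * nG y + nG (Lop y p r)"
    using nG_diff[OF mul_L2[OF \<kappa>_hi L(1)] Lop_L2[OF op]] nG_mul[OF \<kappa>_hi L(1)] by simp
   moreover have "nG (mul a p) <= a_hi * nG p" by (rule nG_mul[OF a_hi L(2)])
   moreover have "0 <= a_hi * nG y" "0 <= a_hi * nG (Lop y p r)" "0 <= \<kappa>_hi * nG p" "0 <= \<kappa>_hi * nG (Lop y p r)"
    using hi by auto
   moreover have "(\<kappa>_hi + 1 + a_hi) * (nG y + nG p + nG (Lop y p r))
    = \<kappa>_hi * nG y + \<kappa>_hi * nG p + \<kappa>_hi * nG (Lop y p r) + nG y + nG p + nG (Lop y p r)
     + a_hi * nG y + a_hi * nG p + a_hi * nG (Lop y p r)" by (simp add: algebra_simps)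
   ultimately show ?thesis using nG_nonneg[of y] nG_nonneg[of p] by linarith
  qed
  have adv: "nG (%e x. adv e x * p e x) <= E * (nG (mul a p) + nG f)"
   unfolding E_def
  proof (rule nG_le_if_edges)
   fix e assume e: "e \<in> Ed"
   note l = len_pos[OF e] and advL = AC_L2[OF a_AC[OF e]] and fl = flux_AC[OF op e]
   have fe: "f e = (%x. adv e x * p e x + a e x * r e x)" by (rule ext) (simp add: f_def)
   define T where "T = nrm (len G e) (mul a p e) + nrm (len G e) (f e)"
   have T: "0 <= T" by (simp add: T_def)
   have "\<bar>p e x\<bar> <= sqrt (1 / len G e + 2) * T / a_lo" if x: "x \<in> {0..len G e}" for x
   proof -
    have "a_lo * \<bar>p e x\<bar> <= \<bar>a e x * p e x\<bar>"
     using a_lo(2)[OF e x] a_lo(1) by (simp add: abs_mult mult_right_mono)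
    also have "... <= sqrt (1 / len G e + 2) * T"
     using AC_sup_le[OF fl l x] by (simp only: T_def fe mul_def)
    finally show ?thesis using a_lo(1) by (simp add: field_simps)
   qed
   hence "nrm (len G e) (%x. p e x * adv e x) <= (sqrt (1 / len G e + 2) * T / a_lo) * nrm (len G e) (adv e)"
    by (intro nrm_mult_bounded[OF advL continuous_on_iv_measurable[OF AC_continuous[OF bspec[OF ac e]]]] AE_iv_I)
     (use l T a_lo(1) in auto)
   also have "... = D e * T" by (simp add: D_def)
   also have "... <= D e * (nG (mul a p) + nG f)"
    unfolding T_def using l a_lo(1) by (intro mult_left_mono add_mono nrm_le_nG e) (auto simp: D_def)
   finally show "nrm (len G e) (%x. adv e x * p e x) <= D e * (nG (mul a p) + nG f)" by (simp add: mult.commute)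
  qed
  have "a_lo * nG r = nG (%e x. a_lo * r e x)" using a_lo(1) by (simp add: nG_cmult)
  also have "... <= nG (mul a r)"
   unfolding nG_L2_set
  proof (rule L2_set_mono)
   fix e assume e: "e \<in> Ed"
   show "nrm (len G e) (%x. a_lo * r e x) <= nrm (len G e) (mul a r e)"
   proof (rule nrm_mono_AE[OF L2_iv_cmult[OF LG_D[OF L(3) e]] LG_D[OF mul_L2[OF a_hi L(3)] e]], rule AE_iv_I)
    fix x assume "x \<in> {0..len G e}"
    hence "a_lo <= \<bar>a e x\<bar>" using a_lo(2)[OF e, of x] by linarith
    thus "\<bar>a_lo * r e x\<bar> <= \<bar>mul a r e x\<bar>"
     using a_lo(1) by (simp add: mul_def abs_mult mult_right_mono)
   qed
  qed simp
  also have "mul a r = (%e x. f e x - adv e x * p e x)" by (simp add: f_def mul_def)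
  also have "nG ... <= nG f + nG (%e x. adv e x * p e x)" by (rule nG_diff[OF fL apL])
  also have "... <= nG f + E * (nG (mul a p) + nG f)" using adv by simp
  also have "... <= (1 + E) * (nG (mul a p) + nG f)" by (simp add: algebra_simps)
  also have "... <= (1 + E) * ((\<kappa>_hi + 1 + a_hi) * (nG y + nG p + nG (Lop y p r)))"
   using S E0 by (intro mult_left_mono) auto
  finally show ?thesis using a_lo(1) by (simp add: field_simps)
 qed
 moreover have "0 <= (1 + E) * (\<kappa>_hi + 1 + a_hi) / a_lo" using E0 hi a_lo(1) by simp
 ultimately show ?thesis by blast
qed

section \<open>Spectral estimates\<close>

lemma form_fun_rep:
 assumes u: "u \<in> Hk_graph G 1" and D: "u \<in> D_space G VD n" "0 < n"
 obtains y p where "form_fun y p" "AEeq y u" "AEeq p (DG 1 u)"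
proof -
 obtain y p where y: "vert_fun y p" "AEeq y u" "AEeq p (DG 1 u)" using Hk_graph_1_vert_fun[OF u] .
 have yD: "AEeq y (DG 0 u)"
  by (rule AEeq_trans[OF y(2) AEeq_sym[OF D_graph_0_AEeq[OF Hk_edges_L2[OF Hk_graph_edges[OF u]]]]])
 have "endv y e b = 0" if v: "v \<in> VD" and eb: "(e, b) \<in> Dir G v" for v e b
 proof -
  have "end_value G e b (DG (2 * 0) u) = 0"
   using D v eb unfolding D_space_def by fastforce
  moreover have "end_value G e b (DG 0 u) = endv y e b"
   by (rule end_value_eq[where y = y, OF Dir_arcs[OF eb]])
    (use yD Dir_arcs[OF eb] AC_continuous[OF vert_fun_AC[OF y(1) Dir_arcs[OF eb]]] in \<open>simp_all add: AEeq_def\<close>)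
  ultimately show ?thesis by simp
 qed
 hence "form_fun y p" using y(1) by (auto simp: form_fun_def)
 with y show thesis using that by blast
qed

text \<open>The derivative that comes with a form domain representative is one of many equal almost
  everywhere; it is exchanged for the absolutely continuous one, for whose end values the Kirchhoff
  condition is stated.\<close>

lemma op_fun_rep:
 assumes u: "u \<in> Hk_graph G 2" and D: "u \<in> D_space G VD n" "0 < n" and K: "u \<in> K_space G VK m" "0 < m"
 obtains y p r where "op_fun y p r" "AEeq y u" "AEeq p (DG 1 u)" "AEeq r (DG 2 u)"
proof -
 have u1: "u \<in> Hk_graph G 1" using u Hk_graph_mono[of 1 2] by auto
 have ue: "u e \<in> Hk_iv 2 (len G e)" if "e \<in> Ed" for e
  using Hk_graph_edges[OF u] that by (simp add: Hk_edges_def)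
 note uL = Hk_edges_L2[OF Hk_graph_edges[OF u]]
 have w2: "has_weak_deriv 1 (len G e) (DG 1 u e) (DG 2 u e)" if e: "e \<in> Ed" for e
  using has_weak_deriv_Suc[OF Hk_iv_D[OF ue[OF e], of 1], of "weak_deriv 2 (len G e) (u e)"]
   Hk_iv_D[OF ue[OF e], of 2] by (simp add: D_graph_def numeral_2_eq_2)
 obtain y0 p0 where y0: "form_fun y0 p0" "AEeq y0 u" "AEeq p0 (DG 1 u)"
  using form_fun_rep[OF u1 D] .
 have "\<exists>P. AC (len G e) P (DG 2 u e) & (AE x in leb (len G e). P x = DG 1 u e x)"
  if e: "e \<in> Ed" for e by (rule has_weak_deriv_imp_AC[OF len_pos[OF e] w2[OF e]])
 hence "\<forall>e\<in>Ed. \<exists>P. AC (len G e) P (DG 2 u e) & (AE x in leb (len G e). P x = DG 1 u e x)"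
  by blast
 from bchoice[OF this] obtain p where
  p: "\<forall>e\<in>Ed. AC (len G e) (p e) (DG 2 u e) & (AE x in leb (len G e). p e x = DG 1 u e x)" ..
 have pA: "AEeq p (DG 1 u)" using p by (simp add: AEeq_def)
 have yp: "AC (len G e) (y0 e) (p e)" if e: "e \<in> Ed" for e
 proof -
  have ac: "AC (len G e) (y0 e) (p0 e)" by (rule vert_fun_AC[OF form_fun_vert[OF y0(1)] e])
  have pL: "p e \<in> L2_iv (len G e)" using p e AC_L2_fun by blast
  have ae: "aeq (len G e) (p0 e) (p e)"
   using AEeq_trans[OF y0(3) AEeq_sym[OF pA]] e by (simp add: AEeq_def)
  have "integral {0..x} (p0 e) = integral {0..x} (p e)" if x: "x \<in> {0..len G e}" for x
   by (rule integral_spike[OF ae[unfolded AE_iv_iff_negligible]]) (use x in auto)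
  thus ?thesis unfolding AC_def using pL AC_eq[OF ac] by metis
 qed
 have "form_fun y0 p" using y0(1) yp by (auto simp: form_fun_def vert_fun_def)
 moreover have "(\<Sum>(e, b)\<in>Dir G v. outv p e b) = 0" if v: "v \<in> VK" for v
 proof -
  have "(\<Sum>(e, b)\<in>Dir G v. outward_deriv G e b (DG (2 * 0) u)) = 0"
   using K v unfolding K_space_def by blast
  moreover have "(\<Sum>(e, b)\<in>Dir G v. outward_deriv G e b (DG (2 * 0) u)) = (\<Sum>(e, b)\<in>Dir G v. outv p e b)"
  proof (rule sum.cong[OF refl], clarify)
   fix e b assume eb: "(e, b) \<in> Dir G v"
   note e = Dir_arcs[OF eb]
   show "outward_deriv G e b (DG (2 * 0) u) = outv p e b"
   proof (rule outward_deriv_eq[OF e, where y = y0])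
    show "AC (len G e) (y0 e) (p e)" by (rule yp[OF e])
    show "cont (len G e) (p e)" using p e AC_continuous by blast
    show "AE x in leb (len G e). y0 e x = DG (2 * 0) u e x"
     using AEeq_trans[OF y0(2) AEeq_sym[OF D_graph_0_AEeq[OF uL]]] e by (simp add: AEeq_def)
   qed
  qed
  ultimately show ?thesis by simp
 qed
 ultimately have "op_fun y0 p (DG 2 u)" using p by (simp add: op_fun_def)
 thus thesis using that y0(2) pA AEeq_refl by blast
qed

lemma \<psi>_dom: "i \<in> I ==> \<psi> i \<in> dom_op G VK VD"
 and \<mu>_pos: "i \<in> I ==> 0 < \<mu> i"
 and \<psi>_eigen: "i \<in> I ==> \<forall>e\<in>Ed. AE x in leb (len G e). graph_op G a \<kappa> (\<psi> i) e x = \<mu> i * \<psi> i e x"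
 using basis unfolding orthonormal_eigenbasis_def by blast+

lemma \<psi>_L2: "i \<in> I ==> \<psi> i \<in> LG"
 using \<psi>_dom by (simp add: dom_op_def K_space_def)

lemma \<psi>_orthonormal: "i \<in> I ==> j \<in> I ==> inn (\<psi> i) (\<psi> j) = (if i = j then 1 else 0)"
 using basis unfolding orthonormal_eigenbasis_def by blast

text \<open>The weak derivative of the flux inside \<open>graph_op\<close> is identified with the
  product rule for absolutely continuous functions; this turns the eigenvalue equation into one for
  \<open>Lop\<close>.\<close>

lemma eigenfunction_rep:
 "\<exists>Y. \<forall>i\<in>I. op_fun (fst (Y i)) (fst (snd (Y i))) (snd (snd (Y i))) & AEeq (fst (Y i)) (\<psi> i) &
  AEeq (Lop (fst (Y i)) (fst (snd (Y i))) (snd (snd (Y i)))) (%e x. \<mu> i * \<psi> i e x)"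
proof (rule bchoice, rule ballI)
 fix i assume i: "i \<in> I"
 note d = \<psi>_dom[OF i] and ev = \<psi>_eigen[OF i]
 have H: "\<psi> i \<in> Hk_graph G 2" "\<psi> i \<in> K_space G VK 1" "\<psi> i \<in> D_space G VD 1"
  using d by (auto simp: dom_op_def H_graph_def)
 obtain y p r where y: "op_fun y p r" "AEeq y (\<psi> i)" "AEeq p (DG 1 (\<psi> i))"
  using op_fun_rep[OF H(1) H(3) zero_less_one H(2) zero_less_one] by metis
 have "AEeq (Lop y p r) (%e x. \<mu> i * \<psi> i e x)"
  unfolding AEeq_def
 proof
  fix e assume e: "e \<in> Ed"
  let ?g = "%x. a e x * DG 1 (\<psi> i) e x"
  have DL: "DG 1 (\<psi> i) \<in> LG" by (rule D_graph_L2[OF Hk_graph_edges[OF H(1)]]) simp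
  have gL: "?g \<in> L2_iv (len G e)" using LG_D[OF mul_L2[OF a_hi DL] e] by (simp add: mul_def)
  have "AE x in leb (len G e). p e x = DG 1 (\<psi> i) e x" using y(3) e by (simp add: AEeq_def)
  hence "AE x in leb (len G e). a e x * p e x = ?g x" by eventually_elim simp
  hence w: "has_weak_deriv 1 (len G e) ?g (%x. adv e x * p e x + a e x * r e x)"
   by (rule AC_has_weak_deriv[OF len_pos[OF e] flux_AC[OF y(1) e] gL])
  have 1: "AE x in leb (len G e). weak_deriv 1 (len G e) ?g x = adv e x * p e x + a e x * r e x"
   by (rule weak_deriv_AE[OF len_pos[OF e] w])
  have 2: "AE x in leb (len G e). y e x = \<psi> i e x" using y(2) e by (simp add: AEeq_def)
  show "AE x in leb (len G e). Lop y p r e x = \<mu> i * \<psi> i e x"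
   using bspec[OF ev e] 1 2
  proof eventually_elim
   case (elim x)
   have "graph_op G a \<kappa> (\<psi> i) e x = (\<kappa> e x)^2 * \<psi> i e x - weak_deriv 1 (len G e) ?g x"
    unfolding graph_op_def D_graph_def ..
   with elim show ?case by (simp add: Lop_def \<kappa>2_def)
  qed
 qed
 with y show "\<exists>Z. op_fun (fst Z) (fst (snd Z)) (snd (snd Z)) & AEeq (fst Z) (\<psi> i) &
  AEeq (Lop (fst Z) (fst (snd Z)) (snd (snd Z))) (%e x. \<mu> i * \<psi> i e x)"
  by (intro exI[of _ "(y, p, r)"]) auto
qed

end

context quantum_graph
begin

abbreviation "hF \<equiv> hdot_fun G I \<psi> \<mu>"
abbreviation "hN \<equiv> hdot_fun_norm G I \<psi> \<mu>"

text \<open>Coefficients beyond the eigenvalue 4^j gain a factor 2^(-j) against the H^1 norm on the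
  form domain, and in \<open>tail_op\<close> a factor 4^(-j) against the H^2 norm on the operator
  domain. The vertex conditions matter here: they remove the boundary terms in Green's
  formula.\<close>

abbreviation (input) "tail_form C \<equiv> \<forall>v q j F. form_fun v q --> finite F --> F \<subseteq> I --> (\<forall>i\<in>F. 4 ^ j < \<mu> i) -->
  L2_set (%i. inn v (\<psi> i)) F <= C * (1/2) ^ j * (nG v + nG q)"
abbreviation (input) "tail_op C \<equiv> \<forall>y p r j F. op_fun y p r --> finite F --> F \<subseteq> I --> (\<forall>i\<in>F. 4 ^ j < \<mu> i) -->
  L2_set (%i. inn y (\<psi> i)) F <= C * (1/4) ^ j * (nG y + nG p + nG r)"
abbreviation (input) "hdot_le t u B \<equiv> u \<in> hF t & hN t u <= B"
abbreviation (input) "hdot_from_tails t \<gamma> C \<equiv> \<forall>u\<in>LG. \<forall>N\<ge>0. nG u <= N -->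
  (\<forall>j F. finite F --> F \<subseteq> I --> (\<forall>i\<in>F. 4 ^ j < \<mu> i) --> L2_set (%i. inn u (\<psi> i)) F <= N * hp j \<gamma>) -->
  hdot_le t u (C * N)"
abbreviation (input) "wsummable s c \<equiv> (%i. \<mu> i powr s * (c i)^2) summable_on I"
abbreviation (input) "wsum s c \<equiv> \<Sum>\<^sub>\<infinity>i\<in>I. \<mu> i powr s * (c i)^2"

definition \<Psi> :: "nat => 'e graph_fun \<times> 'e graph_fun \<times> 'e graph_fun" where
 "\<Psi> = (SOME Y. \<forall>i\<in>I. op_fun (fst (Y i)) (fst (snd (Y i))) (snd (snd (Y i))) & AEeq (fst (Y i)) (\<psi> i) &
  AEeq (Lop (fst (Y i)) (fst (snd (Y i))) (snd (snd (Y i)))) (%e x. \<mu> i * \<psi> i e x))"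

definition "\<Psi>0 i = fst (\<Psi> i)"
definition "\<Psi>1 i = fst (snd (\<Psi> i))"
definition "\<Psi>2 i = snd (snd (\<Psi> i))"

lemma \<Psi>:
 assumes "i \<in> I"
 shows "op_fun (\<Psi>0 i) (\<Psi>1 i) (\<Psi>2 i)" "AEeq (\<Psi>0 i) (\<psi> i)"
  "AEeq (Lop (\<Psi>0 i) (\<Psi>1 i) (\<Psi>2 i)) (%e x. \<mu> i * \<psi> i e x)"
 using someI_ex[OF eigenfunction_rep, folded \<Psi>_def] assms unfolding \<Psi>0_def \<Psi>1_def \<Psi>2_def by blast+

definition S0 :: "nat set => (nat => real) => 'e graph_fun" where "S0 F c = (%e x. \<Sum>i\<in>F. c i * \<Psi>0 i e x)"
definition S1 :: "nat set => (nat => real) => 'e graph_fun" where "S1 F c = (%e x. \<Sum>i\<in>F. c i * \<Psi>1 i e x)"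
definition S2 :: "nat set => (nat => real) => 'e graph_fun" where "S2 F c = (%e x. \<Sum>i\<in>F. c i * \<Psi>2 i e x)"
abbreviation "SL F c \<equiv> Lop (S0 F c) (S1 F c) (S2 F c)"

lemma \<Psi>0_L2: "i \<in> I ==> \<Psi>0 i \<in> LG"
 by (rule form_fun_L2(1)[OF op_fun_form[OF \<Psi>(1)]])

lemma S_op_fun: "finite F ==> F \<subseteq> I ==> op_fun (S0 F c) (S1 F c) (S2 F c)"
 unfolding S0_def S1_def S2_def by (rule op_fun_sum) (auto intro: \<Psi>(1))

lemma S_L2:
 assumes "finite F" "F \<subseteq> I"
 shows "S0 F c \<in> LG" "S1 F c \<in> LG" "S2 F c \<in> LG" "SL F c \<in> LG"
 using form_fun_L2[OF op_fun_form[OF S_op_fun[OF assms]]] op_fun_L2[OF S_op_fun[OF assms]] Lop_L2[OF S_op_fun[OF assms]]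
 by blast+

lemma inn_S0:
 assumes F: "finite F" "F \<subseteq> I" and w: "w \<in> LG"
 shows "inn (S0 F c) w = (\<Sum>i\<in>F. c i * inn w (\<psi> i))"
proof -
 have "inn (S0 F c) w = (\<Sum>i\<in>F. c i * inn (\<Psi>0 i) w)"
  unfolding S0_def by (rule inn_sum) (use F w \<Psi>0_L2 in auto)
 also have "... = (\<Sum>i\<in>F. c i * inn w (\<psi> i))"
 proof (rule sum.cong[OF refl])
  fix i assume "i \<in> F"
  hence i: "i \<in> I" using F by blast
  show "c i * inn (\<Psi>0 i) w = c i * inn w (\<psi> i)"
   using inn_cong_AE[OF w \<Psi>0_L2[OF i] w \<psi>_L2[OF i] AEeq_refl \<Psi>(2)[OF i]] by (simp add: inn_commute)
 qed
 finally show ?thesis .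
qed

lemma inn_SL:
 assumes F: "finite F" "F \<subseteq> I" and w: "w \<in> LG"
 shows "inn (SL F c) w = (\<Sum>i\<in>F. c i * \<mu> i * inn w (\<psi> i))"
proof -
 have LL: "Lop (\<Psi>0 i) (\<Psi>1 i) (\<Psi>2 i) \<in> LG" if "i \<in> I" for i by (rule Lop_L2[OF \<Psi>(1)[OF that]])
 have "inn (SL F c) w = (\<Sum>i\<in>F. c i * inn (Lop (\<Psi>0 i) (\<Psi>1 i) (\<Psi>2 i)) w)"
  unfolding S0_def S1_def S2_def Lop_sum by (rule inn_sum) (use F w LL in auto)
 also have "... = (\<Sum>i\<in>F. c i * \<mu> i * inn w (\<psi> i))"
 proof (rule sum.cong[OF refl])
  fix i assume "i \<in> F"
  hence i: "i \<in> I" using F by blast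
  have mL: "(%e x. \<mu> i * \<psi> i e x) \<in> LG" using LG_lin[OF \<psi>_L2[OF i] \<psi>_L2[OF i], of "\<mu> i" 0] by simp
  have "inn (Lop (\<Psi>0 i) (\<Psi>1 i) (\<Psi>2 i)) w = inn (%e x. \<mu> i * \<psi> i e x) w"
   by (rule inn_cong_AE[OF LL[OF i] w mL w \<Psi>(3)[OF i] AEeq_refl])
  also have "... = \<mu> i * inn w (\<psi> i)"
   using inn_lin[OF \<psi>_L2[OF i] \<psi>_L2[OF i] w, of "\<mu> i" 0] by (simp add: inn_commute)
  finally show "c i * inn (Lop (\<Psi>0 i) (\<Psi>1 i) (\<Psi>2 i)) w = c i * \<mu> i * inn w (\<psi> i)" by simp
 qed
 finally show ?thesis .
qed

lemma coef_S0:
 assumes F: "finite F" "F \<subseteq> I" and i: "i \<in> I"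
 shows "inn (S0 F c) (\<psi> i) = (if i \<in> F then c i else 0)"
proof -
 have "inn (S0 F c) (\<psi> i) = (\<Sum>k\<in>F. if i = k then c k else 0)"
  unfolding inn_S0[OF F \<psi>_L2[OF i]] by (rule sum.cong) (use F i in \<open>auto simp: \<psi>_orthonormal subset_iff\<close>)
 thus ?thesis using F by simp
qed

lemma coef_SL:
 assumes F: "finite F" "F \<subseteq> I" and i: "i \<in> I"
 shows "inn (SL F c) (\<psi> i) = (if i \<in> F then c i * \<mu> i else 0)"
proof -
 have "inn (SL F c) (\<psi> i) = (\<Sum>k\<in>F. if i = k then c k * \<mu> k else 0)"
  unfolding inn_SL[OF F \<psi>_L2[OF i]] by (rule sum.cong) (use F i in \<open>auto simp: \<psi>_orthonormal subset_iff\<close>)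
 thus ?thesis using F by simp
qed

lemma nG_S0: "finite F ==> F \<subseteq> I ==> (nG (S0 F c))^2 = (\<Sum>i\<in>F. (c i)^2)"
 unfolding nG_sq inn_S0[OF _ _ S_L2(1)]
 by (rule sum.cong) (auto simp: coef_S0 subset_iff power2_eq_square)

lemma nG_SL: "finite F ==> F \<subseteq> I ==> (nG (SL F c))^2 = (\<Sum>i\<in>F. (\<mu> i * c i)^2)"
 unfolding nG_sq inn_SL[OF _ _ S_L2(4)]
 by (rule sum.cong) (auto simp: coef_SL subset_iff power2_eq_square)

lemma En_S:
 assumes F: "finite F" "F \<subseteq> I"
 shows "En (S0 F c) (S1 F c) (S0 F c) (S1 F c) = (\<Sum>i\<in>F. \<mu> i * (c i)^2)"
 unfolding Green[OF S_op_fun[OF F] op_fun_form[OF S_op_fun[OF F]]] inn_SL[OF F S_L2(1)[OF F]]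
 by (rule sum.cong) (use F in \<open>auto simp: coef_S0 subset_iff power2_eq_square\<close>)

text \<open>The energy of a normalized eigenfunction is its eigenvalue, and the zeroth order part of
  the energy is at least \<open>\<kappa>_lo\<close>.\<close>

lemma \<mu>_lower: assumes i: "i \<in> I" shows "\<kappa>_lo <= \<mu> i"
proof -
 have F: "finite {i}" "{i} \<subseteq> I" using i by auto
 have "\<kappa>_lo * (nG (S0 {i} (%_. 1)))^2 + a_lo * (nG (S1 {i} (%_. 1)))^2 <= \<mu> i"
  using En_lower[OF S_L2(1,2)[OF F, of "%_. 1"]] En_S[OF F, of "%_. 1"] by simp
 moreover have "0 <= a_lo * (nG (S1 {i} (%_. 1)))^2" using a_lo(1) by simp
 ultimately show ?thesis using nG_S0[OF F, of "%_. 1"] by simp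
qed

lemma nG_S1:
 assumes F: "finite F" "F \<subseteq> I"
 shows "nG (S1 F c) <= sqrt (1 / a_lo) * sqrt (\<Sum>i\<in>F. \<mu> i * (c i)^2)"
proof -
 have "a_lo * (nG (S1 F c))^2 <= (\<Sum>i\<in>F. \<mu> i * (c i)^2)"
 proof -
  have "0 <= \<kappa>_lo * (nG (S0 F c))^2" using \<kappa>_lo(1) by simp
  thus ?thesis using En_lower[OF S_L2(1,2)[OF F, of c]] En_S[OF F, of c] by linarith
 qed
 hence "(nG (S1 F c))^2 <= 1 / a_lo * (\<Sum>i\<in>F. \<mu> i * (c i)^2)" using a_lo(1) by (simp add: field_simps)
 thus ?thesis unfolding real_sqrt_mult[symmetric] by (rule real_le_rsqrt)
qed

text \<open>Second derivatives are controlled by the operator, hence by the coefficients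
  \<open>\<mu> i * c i\<close>; the lower order terms are absorbed because all eigenvalues are at
  least \<open>\<kappa>_lo\<close>.\<close>

lemma nG_S2: "\<exists>C\<ge>0. \<forall>F c. finite F --> F \<subseteq> I --> nG (S2 F c) <= C * sqrt (\<Sum>i\<in>F. (\<mu> i * c i)^2)"
proof -
 obtain C where C: "0 <= C" "!!y p r. op_fun y p r ==> nG r <= C * (nG y + nG p + nG (Lop y p r))"
  using nG_second_deriv_le by blast
 define k where "k = 1 / \<kappa>_lo"
 have k: "0 < k" using \<kappa>_lo(1) by (simp add: k_def)
 have "nG (S2 F c) <= (C * (k + sqrt (1 / a_lo) * sqrt k + 1)) * sqrt (\<Sum>i\<in>F. (\<mu> i * c i)^2)"
  if F: "finite F" "F \<subseteq> I" for F c
 proof -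
  define R where "R = sqrt (\<Sum>i\<in>F. (\<mu> i * c i)^2)"
  have m: "1 <= k * \<mu> i" if "i \<in> F" for i
   using \<mu>_lower[of i] that F \<kappa>_lo(1) by (auto simp: k_def field_simps)
  have "nG (S0 F c) = sqrt (\<Sum>i\<in>F. (c i)^2)" using nG_S0[OF F] by (metis nG_nonneg real_sqrt_unique)
  also have "... <= sqrt (\<Sum>i\<in>F. (k * (\<mu> i * c i))^2)"
  proof (intro real_sqrt_le_mono sum_mono)
   fix i assume i: "i \<in> F"
   have "\<bar>c i\<bar> <= \<bar>k * (\<mu> i * c i)\<bar>"
    using m[OF i] mult_right_mono[of 1 "k * \<mu> i" "\<bar>c i\<bar>"] k \<mu>_pos[of i] i F
    by (auto simp: abs_mult mult.assoc)
   thus "(c i)^2 <= (k * (\<mu> i * c i))^2" by (rule abs_le_square_iff[THEN iffD1])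
  qed
  also have "... = k * R" using k by (simp add: R_def power_mult_distrib sum_distrib_left[symmetric] real_sqrt_mult)
  finally have 0: "nG (S0 F c) <= k * R" .
  have "sqrt (\<Sum>i\<in>F. \<mu> i * (c i)^2) <= sqrt (\<Sum>i\<in>F. k * (\<mu> i * c i)^2)"
  proof (intro real_sqrt_le_mono sum_mono)
   fix i assume i: "i \<in> F"
   hence "0 < \<mu> i" using F \<mu>_pos by blast
   hence "1 * (\<mu> i * (c i)^2) <= k * \<mu> i * (\<mu> i * (c i)^2)"
    using m[OF i] by (intro mult_right_mono) auto
   thus "\<mu> i * (c i)^2 <= k * (\<mu> i * c i)^2" by (simp add: power2_eq_square mult_ac)
  qed
  also have "... = sqrt k * R" by (simp add: R_def sum_distrib_left[symmetric] real_sqrt_mult)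
  finally have "sqrt (1 / a_lo) * sqrt (\<Sum>i\<in>F. \<mu> i * (c i)^2) <= sqrt (1 / a_lo) * (sqrt k * R)"
   using a_lo(1) by (intro mult_left_mono) auto
  hence 1: "nG (S1 F c) <= sqrt (1 / a_lo) * sqrt k * R" using nG_S1[OF F, of c] by linarith
  have 2: "nG (SL F c) = R" unfolding R_def using nG_SL[OF F] by (metis nG_nonneg real_sqrt_unique)
  have "nG (S2 F c) <= C * (nG (S0 F c) + nG (S1 F c) + nG (SL F c))" by (rule C(2)[OF S_op_fun[OF F]])
  also have "... <= C * (k * R + sqrt (1 / a_lo) * sqrt k * R + R)"
   using 0 1 2 C(1) by (intro mult_left_mono add_mono) auto
  finally show ?thesis by (simp add: R_def algebra_simps)
 qed
 moreover have "0 <= C * (k + sqrt (1 / a_lo) * sqrt k + 1)" using C(1) k a_lo(1) by simp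
 ultimately show ?thesis by blast
qed

lemma Bessel:
 assumes u: "u \<in> LG" and F: "finite F" "F \<subseteq> I"
 shows "(\<Sum>i\<in>F. (inn u (\<psi> i))^2) <= (nG u)^2"
proof -
 define X where "X = (\<Sum>i\<in>F. (inn u (\<psi> i))^2)"
 have X0: "0 <= X" by (simp add: X_def sum_nonneg)
 have "X = inn (S0 F (%i. inn u (\<psi> i))) u"
  unfolding inn_S0[OF F u] by (simp add: X_def power2_eq_square)
 also have "... <= nG (S0 F (%i. inn u (\<psi> i))) * nG u"
  using inn_Cauchy_Schwarz[OF S_L2(1)[OF F] u] by (smt (verit))
 also have "nG (S0 F (%i. inn u (\<psi> i))) = sqrt X"
  unfolding X_def using nG_S0[OF F, of "%i. inn u (\<psi> i)"] by (metis nG_nonneg real_sqrt_unique)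
 finally have "sqrt X * sqrt X <= sqrt X * nG u" using X0 by simp
 hence "sqrt X <= nG u"
  using X0 nG_nonneg[of u] mult_left_le_imp_le[of "sqrt X" "sqrt X" "nG u"] by (cases "X = 0") auto
 hence "(sqrt X)^2 <= (nG u)^2" by (intro power_mono) (auto simp: X0)
 thus ?thesis using X0 by (simp add: X_def)
qed

text \<open>The remainder \<open>d\<close> has no coefficients in \<open>F\<close>, so by Green's
  formula it is orthogonal to the partial sum in the energy form; the energy of \<open>d\<close> is
  nonnegative and is dropped.\<close>

lemma Bessel_form:
 assumes v: "form_fun v q" and F: "finite F" "F \<subseteq> I"
 shows "(\<Sum>i\<in>F. \<mu> i * (inn v (\<psi> i))^2) <= En v q v q"
proof -
 define c where "c i = inn v (\<psi> i)" for i
 note op = S_op_fun[OF F, of c] and SL = S_L2[OF F, of c] and vL = form_fun_L2[OF v]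
 define d d' where "d = (%e x. v e x - S0 F c e x)" and "d' = (%e x. q e x - S1 F c e x)"
 have d: "form_fun d d'"
  using form_fun_lin[OF v op_fun_form[OF op], of 1 "-1"] by (simp add: d_def d'_def)
 note dL = form_fun_L2[OF d]
 have "En (S0 F c) (S1 F c) d d' = inn (SL F c) d" by (rule Green[OF op d])
 also have "... = (\<Sum>i\<in>F. c i * \<mu> i * inn d (\<psi> i))" by (rule inn_SL[OF F dL(1)])
 also have "... = 0"
 proof (rule sum.neutral, rule ballI)
  fix i assume i: "i \<in> F"
  hence iI: "i \<in> I" using F by blast
  have "inn d (\<psi> i) = c i - c i"
   unfolding d_def inn_diff[OF vL(1) SL(1) \<psi>_L2[OF iI]] coef_S0[OF F iI] using i by (simp add: c_def)
  thus "c i * \<mu> i * inn d (\<psi> i) = 0" by simp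
 qed
 finally have z: "En (S0 F c) (S1 F c) d d' = 0" .
 have "En v q v q = En d d' d d' + 2 * En (S0 F c) (S1 F c) d d' + En (S0 F c) (S1 F c) (S0 F c) (S1 F c)"
  unfolding En_add[OF dL SL(1,2), symmetric] by (simp add: d_def d'_def)
 moreover have "0 <= En d d' d d'"
  using En_lower[OF dL] \<kappa>_lo(1) a_lo(1) by (smt (verit) mult_nonneg_nonneg zero_le_power2)
 ultimately show ?thesis using z En_S[OF F, of c] by (simp add: c_def)
qed

text \<open>Symmetry of the operator, from Green's formula applied once in each direction.\<close>

lemma coef_Lop:
 assumes y: "op_fun y p r" and i: "i \<in> I"
 shows "inn (Lop y p r) (\<psi> i) = \<mu> i * inn y (\<psi> i)"
proof -
 note \<Psi>L = \<Psi>0_L2[OF i] and yL = form_fun_L2[OF op_fun_form[OF y]]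
 have F: "finite {i}" "{i} \<subseteq> I" using i by auto
 have mL: "(%e x. \<mu> i * \<psi> i e x) \<in> LG" using LG_lin[OF \<psi>_L2[OF i] \<psi>_L2[OF i], of "\<mu> i" 0] by simp
 have "inn (Lop y p r) (\<psi> i) = inn (Lop y p r) (\<Psi>0 i)"
  by (rule inn_cong_AE[OF Lop_L2[OF y] \<psi>_L2[OF i] Lop_L2[OF y] \<Psi>L AEeq_refl AEeq_sym[OF \<Psi>(2)[OF i]]])
 also have "... = En y p (\<Psi>0 i) (\<Psi>1 i)" by (rule Green[OF y op_fun_form[OF \<Psi>(1)[OF i]], symmetric])
 also have "... = En (\<Psi>0 i) (\<Psi>1 i) y p" by (rule En_commute)
 also have "... = inn (Lop (\<Psi>0 i) (\<Psi>1 i) (\<Psi>2 i)) y" by (rule Green[OF \<Psi>(1)[OF i] op_fun_form[OF y]])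
 also have "... = inn (%e x. \<mu> i * \<psi> i e x) y"
  by (rule inn_cong_AE[OF Lop_L2[OF \<Psi>(1)[OF i]] yL(1) mL yL(1) \<Psi>(3)[OF i] AEeq_refl])
 also have "... = \<mu> i * inn y (\<psi> i)"
  using inn_lin[OF \<psi>_L2[OF i] \<psi>_L2[OF i] yL(1), of "\<mu> i" 0] by (simp add: inn_commute)
 finally show ?thesis .
qed

lemma coef_tail_L2:
 assumes "u \<in> LG" "finite F" "F \<subseteq> I"
 shows "L2_set (%i. inn u (\<psi> i)) F <= nG u"
 unfolding L2_set_def by (rule real_le_lsqrt[OF _ Bessel[OF assms]]) auto

lemma coef_tail_form:
 "\<exists>C\<ge>0. tail_form C"
proof -
 have hi: "0 <= \<kappa>_hi" "0 <= a_hi" using \<kappa>_hi a_hi by (auto simp: bounded_by_def)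
 define K where "K = \<kappa>_hi + a_hi"
 have "L2_set (%i. inn v (\<psi> i)) F <= sqrt K * (1/2) ^ j * (nG v + nG q)"
  if v: "form_fun v q" and F: "finite F" "F \<subseteq> I" and \<mu>: "\<forall>i\<in>F. 4 ^ j < \<mu> i" for v q j F
  unfolding L2_set_def
 proof (rule real_le_lsqrt)
  have "4 ^ j * (\<Sum>i\<in>F. (inn v (\<psi> i))^2) <= (\<Sum>i\<in>F. \<mu> i * (inn v (\<psi> i))^2)"
   unfolding sum_distrib_left using \<mu> by (intro sum_mono mult_right_mono) (auto simp: less_imp_le)
  also have "... <= En v q v q" by (rule Bessel_form[OF v F])
  also have "... <= \<kappa>_hi * (nG v)^2 + a_hi * (nG q)^2" by (rule En_upper[OF form_fun_L2[OF v]])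
  also have "... <= \<kappa>_hi * (nG v + nG q)^2 + a_hi * (nG v + nG q)^2"
   using hi by (intro add_mono mult_left_mono power_mono) auto
  finally have "4 ^ j * (\<Sum>i\<in>F. (inn v (\<psi> i))^2) <= K * (nG v + nG q)^2" by (simp add: K_def algebra_simps)
  hence "(\<Sum>i\<in>F. (inn v (\<psi> i))^2) <= K * (nG v + nG q)^2 / 4 ^ j" by (simp add: pos_le_divide_eq mult.commute)
  also have "... = (sqrt K * (1/2) ^ j * (nG v + nG q))^2"
  proof -
   have "((1/2 :: real) ^ j)^2 = 1 / 4 ^ j" by (simp add: power_one_over power2_eq_square flip: power_mult_distrib)
   thus ?thesis using hi by (simp add: power_mult_distrib K_def)
  qed
  finally show "(\<Sum>i\<in>F. (inn v (\<psi> i))^2) <= (sqrt K * (1/2) ^ j * (nG v + nG q))^2" .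
 qed (use hi in \<open>auto simp: K_def\<close>)
 moreover have "0 <= sqrt K" using hi by (simp add: K_def)
 ultimately show ?thesis by blast
qed

lemma coef_tail_op:
 "\<exists>C\<ge>0. tail_op C"
proof -
 obtain C where C: "0 <= C" "!!y p r. op_fun y p r ==> nG (Lop y p r) <= C * (nG y + nG p + nG r)"
  using nG_Lop_le by blast
 have "L2_set (%i. inn y (\<psi> i)) F <= C * (1/4) ^ j * (nG y + nG p + nG r)"
  if y: "op_fun y p r" and F: "finite F" "F \<subseteq> I" and \<mu>: "\<forall>i\<in>F. 4 ^ j < \<mu> i" for y p r j F
 proof -
  have "4 ^ j * L2_set (%i. inn y (\<psi> i)) F = L2_set (%i. 4 ^ j * inn y (\<psi> i)) F"
   by (simp add: L2_set_right_distrib)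
  also have "... = L2_set (%i. \<bar>4 ^ j * inn y (\<psi> i)\<bar>) F" by (simp add: L2_set_def)
  also have "... <= L2_set (%i. \<bar>inn (Lop y p r) (\<psi> i)\<bar>) F"
  proof (rule L2_set_mono)
   fix i assume i: "i \<in> F"
   hence iI: "i \<in> I" using F by blast
   show "\<bar>4 ^ j * inn y (\<psi> i)\<bar> <= \<bar>inn (Lop y p r) (\<psi> i)\<bar>"
    unfolding coef_Lop[OF y iI] abs_mult using \<mu> i \<mu>_pos[OF iI] by (intro mult_right_mono) (auto simp: less_imp_le)
  qed simp
  also have "... = L2_set (%i. inn (Lop y p r) (\<psi> i)) F" by (simp add: L2_set_def)
  also have "... <= nG (Lop y p r)" by (rule coef_tail_L2[OF Lop_L2[OF y] F])
  also have "... <= C * (nG y + nG p + nG r)" by (rule C(2)[OF y])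
  finally show ?thesis by (simp add: power_one_over field_simps)
 qed
 with C(1) show ?thesis by blast
qed

lemma Parseval:
 assumes u: "u \<in> LG"
 shows "((%i. (inn u (\<psi> i))^2) has_sum (nG u)^2) I"
proof -
 define R where "R F = nG (%e x. u e x - (\<Sum>i\<in>F. inn u (\<psi> i) * \<psi> i e x))" for F
 have "(R \<longlongrightarrow> 0) (finite_subsets_at_top I)"
  using basis u unfolding orthonormal_eigenbasis_def R_def by blast
 hence lim: "((%F. (nG u)^2 - (R F)^2) \<longlongrightarrow> (nG u)^2 - 0^2) (finite_subsets_at_top I)"
  by (intro tendsto_intros)
 have "eventually (%F. (nG u)^2 - (R F)^2 = (\<Sum>i\<in>F. (inn u (\<psi> i))^2)) (finite_subsets_at_top I)"
 proof (rule eventually_finite_subsets_at_top_weakI)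
  fix F assume F: "finite F" "F \<subseteq> I"
  define s where "s = (%e x. \<Sum>i\<in>F. inn u (\<psi> i) * \<psi> i e x)"
  have \<psi>F: "\<psi> i \<in> LG" if "i \<in> F" for i using F that \<psi>_L2 by blast
  have sL: "s \<in> LG" unfolding s_def by (rule LG_sum[OF F(1) \<psi>F])
  have sw: "inn s w = (\<Sum>i\<in>F. inn u (\<psi> i) * inn (\<psi> i) w)" if "w \<in> LG" for w
   unfolding s_def by (rule inn_sum[OF F(1) \<psi>F that])
  have sj: "inn s (\<psi> i) = inn u (\<psi> i)" if "i \<in> F" for i
  proof -
   have "inn s (\<psi> i) = (\<Sum>k\<in>F. if i = k then inn u (\<psi> k) else 0)"
    unfolding sw[OF \<psi>F[OF that]] by (rule sum.cong) (use F that in \<open>auto simp: \<psi>_orthonormal subset_iff\<close>)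
   thus ?thesis using F that by simp
  qed
  have us: "inn s u = (\<Sum>i\<in>F. (inn u (\<psi> i))^2)"
   unfolding sw[OF u] by (simp add: inn_commute[of _ u] power2_eq_square)
  have ss: "inn s s = (\<Sum>i\<in>F. (inn u (\<psi> i))^2)"
   unfolding sw[OF sL] by (rule sum.cong) (auto simp: inn_commute[of _ s] sj power2_eq_square)
  have "(R F)^2 = inn (%e x. u e x - s e x) (%e x. u e x - s e x)" by (simp add: R_def s_def nG_sq)
  also have "... = inn u (%e x. u e x - s e x) - inn s (%e x. u e x - s e x)"
   by (rule inn_diff[OF u sL LG_diff[OF u sL]])
  also have "inn u (%e x. u e x - s e x) = inn u u - inn s u"
   using inn_diff[OF u sL u] by (simp add: inn_commute)
  also have "inn s (%e x. u e x - s e x) = inn s u - inn s s"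
   using inn_diff[OF u sL sL] by (simp add: inn_commute)
  finally show "(nG u)^2 - (R F)^2 = (\<Sum>i\<in>F. (inn u (\<psi> i))^2)" by (simp add: us ss nG_sq)
 qed
 with lim show ?thesis unfolding has_sum_def by (simp add: tendsto_cong)
qed

lemma Parseval_inner:
 assumes u: "u \<in> LG" and v: "v \<in> LG"
 shows "((%i. inn u (\<psi> i) * inn v (\<psi> i)) has_sum inn u v) I"
proof -
 have 1: "((%i. (inn (%e x. 1 * u e x + c * v e x) (\<psi> i))^2) has_sum (nG (%e x. 1 * u e x + c * v e x))^2) I" for c
  by (rule Parseval[OF LG_lin[OF u v]])
 have 2: "(nG (%e x. 1 * u e x + c * v e x))^2 = inn u u + 2 * c * inn u v + c^2 * inn v v" for c
  unfolding nG_sq inn_lin[OF u v LG_lin[OF u v]] inn_lin2[OF u v u] inn_lin2[OF u v v] inn_commute[of v u]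
  by (simp add: algebra_simps power2_eq_square)
 have "((%i. 1/4 * ((inn (%e x. 1 * u e x + 1 * v e x) (\<psi> i))^2 - (inn (%e x. 1 * u e x + (-1) * v e x) (\<psi> i))^2))
   has_sum 1/4 * ((nG (%e x. 1 * u e x + 1 * v e x))^2 - (nG (%e x. 1 * u e x + (-1) * v e x))^2)) I"
  unfolding diff_conv_add_uminus by (intro has_sum_cmult_right has_sum_add has_sum_uminusI 1)
 also have "1/4 * ((nG (%e x. 1 * u e x + 1 * v e x))^2 - (nG (%e x. 1 * u e x + (-1) * v e x))^2) = inn u v"
  unfolding 2 by simp
 finally show ?thesis
 proof (rule has_sum_cong[THEN iffD1, rotated])
  fix i assume i: "i \<in> I"
  show "1/4 * ((inn (%e x. 1 * u e x + 1 * v e x) (\<psi> i))^2 - (inn (%e x. 1 * u e x + (-1) * v e x) (\<psi> i))^2)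
    = inn u (\<psi> i) * inn v (\<psi> i)"
   unfolding inn_lin[OF u v \<psi>_L2[OF i]] by (simp add: power2_eq_square algebra_simps)
 qed
qed

text \<open>
 Weyl's bound: on the span of the eigenfunctions with eigenvalue at most \<open>M\<close> the point evaluations
 have squared norm \<open>O(sqrt M)\<close>, and this squared norm integrates to the dimension of the span.
\<close>

lemma Weyl:
 "\<exists>C\<ge>0. \<forall>M\<ge>1. \<forall>F. finite F --> F \<subseteq> I --> (\<forall>i\<in>F. \<mu> i <= M) --> real (card F) <= C * sqrt M"
proof -
 define c where "c = 2 * sqrt (1 / a_lo)"
 define D where "D e = len G e * (1 / len G e + c)" for e
 have c0: "0 <= c" using a_lo(1) by (simp add: c_def)
 have "real (card F) <= (\<Sum>e\<in>Ed. D e) * sqrt M" if M: "1 <= M" and F: "finite F" "F \<subseteq> I" and \<mu>: "\<forall>i\<in>F. \<mu> i <= M" for M F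
 proof -
  have pt: "(\<Sum>i\<in>F. (\<Psi>0 i e x)^2) <= (1 / len G e + c) * sqrt M" if e: "e \<in> Ed" and x: "x \<in> {0..len G e}" for e x
  proof -
   \<comment> \<open>With these coefficients the partial sum is the reproducing kernel at the point:
     its value there is \<open>s\<close> and its norm is sqrt s, so the sup bound becomes an
     inequality for \<open>s\<close> alone.\<close>
   define b where "b i = \<Psi>0 i e x" for i
   define s where "s = (\<Sum>i\<in>F. (b i)^2)"
   have s0: "0 <= s" by (simp add: s_def sum_nonneg)
   note l = len_pos[OF e]
   have ac: "AC (len G e) (S0 F b e) (S1 F b e)"
    by (rule vert_fun_AC[OF form_fun_vert[OF op_fun_form[OF S_op_fun[OF F]]] e])
   have sx: "S0 F b e x = s" by (simp add: S0_def s_def b_def power2_eq_square)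
   have n0: "nG (S0 F b) = sqrt s" unfolding s_def using nG_S0[OF F, of b] by (metis nG_nonneg real_sqrt_unique)
   have "nG (S1 F b) <= sqrt (1 / a_lo) * sqrt (\<Sum>i\<in>F. \<mu> i * (b i)^2)" by (rule nG_S1[OF F])
   also have "... <= sqrt (1 / a_lo) * sqrt (\<Sum>i\<in>F. M * (b i)^2)"
    using \<mu> a_lo(1) by (intro mult_left_mono real_sqrt_le_mono sum_mono mult_right_mono) auto
   also have "... = sqrt (1 / a_lo) * (sqrt M * sqrt s)" by (simp add: s_def sum_distrib_left[symmetric] real_sqrt_mult)
   finally have n1: "nG (S1 F b) <= sqrt (1 / a_lo) * (sqrt M * sqrt s)" .
   have "s^2 <= (nrm (len G e) (S0 F b e))^2 / len G e + 2 * nrm (len G e) (S0 F b e) * nrm (len G e) (S1 F b e)"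
    using AC_sup_bound[OF ac l x] by (simp add: sx)
   also have "... <= (nG (S0 F b))^2 / len G e + 2 * nG (S0 F b) * nG (S1 F b)"
    using l by (intro add_mono divide_right_mono power_mono mult_mono nrm_le_nG e) auto
   also have "... <= s / len G e + 2 * sqrt s * (sqrt (1 / a_lo) * (sqrt M * sqrt s))"
    unfolding n0 using s0 by (intro add_mono mult_left_mono n1) auto
   also have "... = s * (1 / len G e + c * sqrt M)"
    using s0 by (simp add: c_def algebra_simps)
   finally have "s * s <= s * (1 / len G e + c * sqrt M)" by (simp add: power2_eq_square)
   moreover have nn: "0 <= 1 / len G e + c * sqrt M" using l c0 M by simp
   ultimately have "s <= 1 / len G e + c * sqrt M"
    using s0 by (cases "s = 0") (auto simp: mult_le_cancel_left)
   also have "... <= (1 / len G e) * sqrt M + c * sqrt M"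
    using mult_left_mono[of 1 "sqrt M" "1 / len G e"] l M by simp
   finally show ?thesis by (simp add: s_def b_def algebra_simps)
  qed
  have "real (card F) = (\<Sum>i\<in>F. (nG (\<Psi>0 i))^2)"
  proof -
   have "(nG (\<Psi>0 i))^2 = 1" if "i \<in> F" for i
   proof -
    have i: "i \<in> I" using F that by blast
    show ?thesis using \<psi>_orthonormal[OF i i] nG_cong_AE[OF \<Psi>0_L2[OF i] \<psi>_L2[OF i] \<Psi>(2)[OF i]] by (simp add: nG_sq)
   qed
   thus ?thesis by simp
  qed
  also have "... = (\<Sum>e\<in>Ed. \<Sum>i\<in>F. (nrm (len G e) (\<Psi>0 i e))^2)"
   unfolding nG_sq_sum by (rule sum.swap)
  also have "... <= (\<Sum>e\<in>Ed. D e * sqrt M)"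
  proof (rule sum_mono)
   fix e assume e: "e \<in> Ed"
   have cont: "cont (len G e) (\<Psi>0 i e)" if "i \<in> F" for i
    by (rule AC_continuous[OF vert_fun_AC[OF form_fun_vert[OF op_fun_form[OF \<Psi>(1)]] e]]) (use F that in auto)
   have "(\<Sum>i\<in>F. (nrm (len G e) (\<Psi>0 i e))^2) = (\<Sum>i\<in>F. integral {0..len G e} (%x. (\<Psi>0 i e x)^2))"
   proof (rule sum.cong[OF refl])
    fix i assume i: "i \<in> F"
    have "(nrm (len G e) (\<Psi>0 i e))^2 = integral {0..len G e} (%x. \<Psi>0 i e x * \<Psi>0 i e x)"
     unfolding nrm_sq by (intro inner_iv_integral L2_iv_continuous cont i)
    thus "(nrm (len G e) (\<Psi>0 i e))^2 = integral {0..len G e} (%x. (\<Psi>0 i e x)^2)"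
     by (simp only: power2_eq_square[of "\<Psi>0 i e _"])
   qed
   also have "... = integral {0..len G e} (%x. \<Sum>i\<in>F. (\<Psi>0 i e x)^2)"
    by (rule integral_sum[symmetric]) (use F in \<open>auto intro!: integrable_continuous_real continuous_intros cont\<close>)
   also have "... <= integral {0..len G e} (%x. (1 / len G e + c) * sqrt M)"
    by (rule integral_le) (use pt[OF e] in \<open>auto intro!: integrable_continuous_real continuous_intros cont\<close>)
   also have "... = D e * sqrt M" using len_pos[OF e] by (simp add: D_def)
   finally show "(\<Sum>i\<in>F. (nrm (len G e) (\<Psi>0 i e))^2) <= D e * sqrt M" .
  qed
  finally show ?thesis by (simp add: sum_distrib_right)
 qed
 moreover have "0 <= (\<Sum>e\<in>Ed. D e)" by (rule sum_nonneg) (use c0 in \<open>auto simp: D_def dest: len_pos\<close>)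
 ultimately show ?thesis by blast
qed

lemma half_power_powr_sq: "(hp j \<gamma>)^2 = 4 powr (- real j * \<gamma>)"
proof -
 have "(hp j \<gamma>)^2 = ((1/2) powr \<gamma>) ^ (j * 2)"
  unfolding half_power_powr by (rule power_mult[symmetric])
 also have "... = ((1/2) powr \<gamma>) powr real (j * 2)" by (rule powr_realpow[symmetric]) simp
 also have "... = (1/2) powr (2 * (real j * \<gamma>))" unfolding powr_powr by (simp add: mult_ac)
 also have "... = ((1/2) powr 2) powr (real j * \<gamma>)" by (simp only: powr_powr)
 also have "(1/2 :: real) powr 2 = 4 powr (-1)" by (simp add: powr_minus_divide power2_eq_square)
 also have "(4 powr (-1)) powr (real j * \<gamma>) = (4::real) powr (- real j * \<gamma>)" by (simp only: powr_powr) simp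
 finally show ?thesis .
qed

text \<open>By Weyl's bound the block ending at 4^(j + 1) holds O(2^j) eigenvalues, which is the
  rate \<gamma> = -1/2 in \<open>dyadic_block_sum\<close>; the series converges since -s <
  -1/2.\<close>

lemma Weyl_summable: assumes s: "1/2 < s" shows "(%i. \<mu> i powr (- s)) summable_on I"
proof (rule nonneg_bdd_above_summable_on)
 from Weyl obtain C where C: "0 <= C" and W: "\<forall>M\<ge>1. \<forall>F. finite F --> F \<subseteq> I --> (\<forall>i\<in>F. \<mu> i <= M) --> real (card F) <= C * sqrt M"
  by (elim exE conjE)
 have W': "real (card F) <= C * sqrt M" if "1 <= M" "finite F" "F \<subseteq> I" "\<forall>i\<in>F. \<mu> i <= M" for M F
  using W that by simp
 show "bdd_above (sum (%i. \<mu> i powr (- s)) ` {F. F \<subseteq> I & finite F})"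
 proof (rule bdd_aboveI2)
  fix F assume "F \<in> {F. F \<subseteq> I & finite F}"
  hence F: "finite F" "F \<subseteq> I" by auto
  have "(\<Sum>i\<in>F. \<mu> i powr (- s) * 1)
    <= (1 + \<kappa>_lo powr (- s) + 4 powr \<bar>- s\<bar> / (1 - 4 powr (- s - (- 1/2)))) * (2 * C)"
  proof (rule dyadic_block_sum[OF F(1)])
   show "(\<Sum>i | i \<in> F & \<mu> i <= 1. 1) <= 2 * C"
   proof -
    have "real (card {i \<in> F. \<mu> i <= 1}) <= C * sqrt 1" by (rule W') (use F in auto)
    thus ?thesis using C by simp
   qed
   show "(\<Sum>i | i \<in> F & 4 ^ j < \<mu> i & \<mu> i <= 4 ^ Suc j. 1) <= 2 * C * 4 powr (- real j * (- 1/2))" for j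
   proof -
    have "(\<Sum>i | i \<in> F & 4 ^ j < \<mu> i & \<mu> i <= 4 ^ Suc j. 1) <= C * sqrt (4 ^ Suc j)"
    proof -
     have "real (card {i \<in> F. 4 ^ j < \<mu> i & \<mu> i <= 4 ^ Suc j}) <= C * sqrt (4 ^ Suc j)"
     proof (rule W')
      show "(1::real) <= 4 ^ Suc j" by (rule one_le_power) simp
     qed (use F in auto)
     thus ?thesis by simp
    qed
    also have "sqrt ((4::real) ^ Suc j) = 2 * 2 ^ j" by (simp add: real_sqrt_mult real_sqrt_power)
    also have "(2::real) ^ j = 4 powr (- real j * (- 1/2))"
    proof -
     have "(4::real) powr (- real j * (- 1/2)) = (4 powr (1/2)) powr real j" by (simp add: powr_powr)
     also have "(4::real) powr (1/2) = 2" by (simp add: powr_half_sqrt)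
     finally show ?thesis by (simp add: powr_realpow)
    qed
    finally show ?thesis by simp
   qed
  qed (use F C s \<kappa>_lo(1) \<mu>_lower in auto)
  thus "(\<Sum>i\<in>F. \<mu> i powr (- s))
    <= (1 + \<kappa>_lo powr (- s) + 4 powr \<bar>- s\<bar> / (1 - 4 powr (- s - (- 1/2)))) * (2 * C)" by simp
 qed
qed simp

text \<open>Passes from a bound at every scale to a square sum over the scales, at the price t <
  \<gamma>. This is the spectral counterpart of the loss in
  \<open>interp_norm_sq_finite\<close>.\<close>

lemma hdot_if_dyadic:
 assumes t: "t < \<gamma>"
 shows "\<exists>C\<ge>0. hdot_from_tails t \<gamma> C"
proof -
 define C where "C = 1 + \<kappa>_lo powr t + 4 powr \<bar>t\<bar> / (1 - 4 powr (t - \<gamma>))"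
 have C0: "0 <= C" using t by (auto simp: C_def powr_less_one less_imp_le intro!: add_nonneg_nonneg divide_nonneg_nonneg)
 have "hdot_le t u (sqrt C * N)"
  if u: "u \<in> LG" and N: "0 <= N" "nG u <= N" and dec: "!!j F. finite F ==> F \<subseteq> I ==> (\<forall>i\<in>F. 4 ^ j < \<mu> i) ==>
   L2_set (%i. inn u (\<psi> i)) F <= N * hp j \<gamma>" for u N
 proof -
  have fin: "(\<Sum>i\<in>F. \<mu> i powr t * (inn u (\<psi> i))^2) <= C * N^2" if F: "finite F" "F \<subseteq> I" for F
   unfolding C_def
  proof (rule dyadic_block_sum[OF F(1)])
   have "(\<Sum>i | i \<in> F & \<mu> i <= 1. (inn u (\<psi> i))^2) <= (nG u)^2" by (rule Bessel[OF u]) (use F in auto)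
   also have "... <= N^2" using N by (intro power_mono) auto
   finally show "(\<Sum>i | i \<in> F & \<mu> i <= 1. (inn u (\<psi> i))^2) <= N^2" .
   fix j
   have "L2_set (%i. inn u (\<psi> i)) {i \<in> F. 4 ^ j < \<mu> i & \<mu> i <= 4 ^ Suc j} <= N * hp j \<gamma>"
    by (rule dec) (use F in auto)
   hence "(L2_set (%i. inn u (\<psi> i)) {i \<in> F. 4 ^ j < \<mu> i & \<mu> i <= 4 ^ Suc j})^2 <= (N * hp j \<gamma>)^2"
    by (intro power_mono) auto
   thus "(\<Sum>i | i \<in> F & 4 ^ j < \<mu> i & \<mu> i <= 4 ^ Suc j. (inn u (\<psi> i))^2) <= N^2 * 4 powr (- real j * \<gamma>)"
    by (simp add: L2_set_def sum_nonneg power_mult_distrib half_power_powr_sq)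
  qed (use F t \<kappa>_lo(1) \<mu>_lower in auto)
  have sm: "(%i. \<mu> i powr t * (inn u (\<psi> i))^2) summable_on I"
   by (rule nonneg_bdd_above_summable_on) (use fin in \<open>auto intro!: bdd_aboveI2\<close>)
  have "(\<Sum>\<^sub>\<infinity>i\<in>I. \<mu> i powr t * (inn u (\<psi> i))^2) <= C * N^2"
   by (rule infsum_le_finite_sums[OF sm fin])
  hence "hN t u <= sqrt (C * N^2)" unfolding hdot_fun_norm_def by (rule real_sqrt_le_mono)
  thus ?thesis using sm u N by (simp add: hdot_fun_def real_sqrt_mult)
 qed
 moreover have "0 <= sqrt C" using C0 by simp
 ultimately show ?thesis by blast
qed

end

section \<open>From weighted summability of the coefficients to Sobolev regularity with vertex
  conditions\<close>

lemma half_power_pos: "0 < (1/2 :: real) ^ j"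
 by simp

lemma half_powr_antimono: "a <= b ==> hp j b <= hp j a"
 by (rule powr_mono') (auto simp: half_power_le_1)

lemma half_powr_le_1: "0 <= a ==> hp j a <= 1"
 using half_powr_antimono[of 0 a j] by simp

lemma half_powr_ge_1: "a <= 0 ==> 1 <= hp j a"
 using half_powr_antimono[of a 0 j] by simp

lemma half_powr_tendsto_0: "0 < a ==> (%j. hp j a) ----> 0"
proof -
 assume "0 < a"
 hence "(1/2 :: real) powr a < (1/2) powr 0" by (intro powr_less_mono') auto
 thus ?thesis unfolding half_power_powr by (intro LIMSEQ_power_zero) simp
qed

lemma half_power_mult_powr: "(1/2 :: real) ^ j * hp j (a - 1) = hp j a"
 by (simp add: powr_mult_base)

lemma interp_if_dyadic:
 fixes N0 N1 :: "'f::minus => real"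
 assumes N: "!!z. 0 <= N0 z" "!!z. 0 <= N1 z" and z: "z \<in> X1" "N1 z = 0"
  and th: "0 < \<theta>" "\<theta> < \<theta>'" and x: "x \<in> X0" and b: "0 <= b"
  and y: "!!j. y j \<in> X1" "!!j. N0 (x - y j) <= b * hp j \<theta>'" "!!j. N1 (y j) <= b * hp j (\<theta>' - 1)"
 shows "x \<in> interp \<theta> X0 N0 X1 N1"
proof -
 have X1: "X1 \<noteq> {}" using z by blast
 define C where "C = max (2 * b) (N0 (x - z))"
 have "interp_norm_sq \<theta> N0 X1 N1 x < \<infinity>"
 proof (rule interp_norm_sq_finite_dyadic[where C = C, OF N X1 th])
  show "0 <= C" using b by (simp add: C_def)
  fix j
  let ?h = "(1/2 :: real) ^ j"
  have "K_functional N0 X1 N1 ?h x <= N0 (x - y j) + ?h * N1 (y j)"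
   by (rule K_functional_le[OF N y(1)]) simp
  also have "... <= b * hp j \<theta>' + ?h * (b * hp j (\<theta>' - 1))"
   by (intro add_mono y mult_left_mono) simp
  also have "... = b * hp j \<theta>' + b * (?h * hp j (\<theta>' - 1))" by (simp only: mult.left_commute)
  also have "... = 2 * b * hp j \<theta>'" unfolding half_power_mult_powr by simp
  also have "... <= C * hp j \<theta>'" by (intro mult_right_mono) (auto simp: C_def)
  finally show "K_functional N0 X1 N1 ?h x <= C * hp j \<theta>'" .
 next
  fix t :: real assume "1 <= t"
  hence "K_functional N0 X1 N1 t x <= N0 (x - z) + t * N1 z" by (intro K_functional_le N z) auto
  thus "K_functional N0 X1 N1 t x <= C" using z(2) by (simp add: C_def)
 qed
 with x show ?thesis by (simp add: interp_def)
qed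

lemma Hfrac_iv_if_AC:
 assumes l: "0 < l" and u: "u \<in> L2_iv l" and th: "0 < \<theta>" "\<theta> < \<theta>'" "\<theta>' <= 1" and b: "0 <= b"
  and Y: "!!j. AC l (Y j) (y j)" "!!j. nrm l (Y j) <= b"
  and e: "!!j. nrm l (%x. u x - Y j x) <= b * hp j \<theta>'"
  and g: "!!j. nrm l (y j) <= b * hp j (\<theta>' - 1)"
 shows "u \<in> Hfrac_iv \<theta> l"
 unfolding sqrt_inner_iv
proof (rule interp_if_dyadic[of "nrm l" "Hk_iv_norm 1 l" "%x. 0" "Hk_iv 1 l" \<theta> \<theta>' u "L2_iv l" "2 * b" Y,
   OF nrm_nonneg Hk_iv_norm_nonneg zero_Hk_iv_1[OF l] th(1,2) u])
 show "0 <= 2 * b" using b by simp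
 fix j
 have w: "has_weak_deriv 1 l (Y j) (y j)" by (rule AC_weak_deriv_1[OF l Y(1)])
 thus "Y j \<in> Hk_iv 1 l" using Hk_iv_1 by blast
 have "b * hp j \<theta>' <= 2 * b * hp j \<theta>'" using b by (intro mult_right_mono) auto
 thus "nrm l (u - Y j) <= 2 * b * hp j \<theta>'"
  using e[of j] by (simp add: fun_diff_def)
 have "Hk_iv_norm 1 l (Y j) <= nrm l (Y j) + nrm l (y j)"
  by (rule power2_le_imp_le) (use Hk_iv_norm_1[OF l w] in \<open>auto simp: power2_sum\<close>)
 also have "... <= b * hp j (\<theta>' - 1) + b * hp j (\<theta>' - 1)"
 proof (rule add_mono[OF _ g])
  have "b * 1 <= b * hp j (\<theta>' - 1)" using th b by (intro mult_left_mono half_powr_ge_1) auto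
  thus "nrm l (Y j) <= b * hp j (\<theta>' - 1)" using Y(2)[of j] by simp
 qed
 finally show "Hk_iv_norm 1 l (Y j) <= 2 * b * hp j (\<theta>' - 1)" by simp
qed

lemma Hs_iv_if_Hfrac:
 assumes l: "0 < l" and s: "s \<notin> \<int>" "nat \<lfloor>s\<rfloor> = k" and u: "u \<in> Hk_iv k l" and w: "has_weak_deriv k l u w" "w \<in> Hfrac_iv (frac s) l"
 shows "u \<in> Hs_iv s l"
proof -
 have "weak_deriv k l u \<in> Hfrac_iv (frac s) l"
  by (rule Hfrac_iv_lin[OF l w(2,2), of _ 1 0])
   (use weak_deriv_AE[OF l w(1)] has_weak_deriv_L2(2)[OF weak_deriv_has_weak_deriv[OF w(1)]] in auto)
 thus ?thesis using s u by (simp add: Hs_iv_def Let_def)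
qed

context metric_graph_loc
begin

text \<open>Completeness edge by edge, with the rate carried over to the limit; it is the rate that
  interpolation spaces consume.\<close>

lemma LG_complete:
 assumes f: "!!n. f n \<in> LG" and B: "!!m n. n <= m ==> nG (%e x. f m e x - f n e x) <= B n" and lim: "B ----> 0"
 shows "\<exists>u\<in>LG. \<forall>n. dG u (f n) <= B n"
proof -
 have "\<exists>g\<in>L2_iv (len G e). (%n. nrm (len G e) (%x. f n e x - g x)) ----> 0" if e: "e \<in> Ed" for e
 proof (rule L2_iv_complete[OF LG_D[OF f e]])
  fix d :: real assume "0 < d"
  then obtain N where N: "!!n. N <= n ==> B n < d"
   using lim by (metis order_tendstoD(2) eventually_sequentially)
  have 1: "nrm (len G e) (%x. f m e x - f n e x) < d" if "N <= n" "n <= m" for m n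
   using nrm_le_nG[OF e, of "%e x. f m e x - f n e x"] B[OF that(2)] N[OF that(1)] by linarith
  have "nrm (len G e) (%x. f m e x - f n e x) < d" if "N <= n" "N <= m" for m n
   using 1[of n m] 1[of m n] that nrm_diff_commute[of "len G e" "f m e" "f n e"] by (cases "n <= m") auto
  thus "\<exists>N. \<forall>m\<ge>N. \<forall>n\<ge>N. nrm (len G e) (%x. f m e x - f n e x) < d" by blast
 qed
 hence "\<forall>e\<in>Ed. \<exists>g. g \<in> L2_iv (len G e) & (%n. nrm (len G e) (%x. f n e x - g x)) ----> 0" by blast
 from bchoice[OF this] obtain u where
  u: "!!e. e \<in> Ed ==> u e \<in> L2_iv (len G e)" "!!e. e \<in> Ed ==> (%n. nrm (len G e) (%x. f n e x - u e x)) ----> 0"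
  by blast
 have uL: "u \<in> LG" by (rule LG_I[OF u(1)])
 have "(%n. \<Sum>e\<in>Ed. nrm (len G e) (%x. f n e x - u e x)) ----> (\<Sum>e\<in>Ed. 0)"
  by (rule tendsto_sum) (rule u(2))
 hence s: "(%n. \<Sum>e\<in>Ed. nrm (len G e) (%x. f n e x - u e x)) ----> 0" by simp
 have "dG u (f n) <= B n" for n
 proof (rule LIMSEQ_le_const)
  show "(%m. (\<Sum>e\<in>Ed. nrm (len G e) (%x. f m e x - u e x)) + B n) ----> B n"
   using tendsto_add[OF s tendsto_const[of "B n"]] by simp
  have "dG u (f n) <= (\<Sum>e\<in>Ed. nrm (len G e) (%x. f m e x - u e x)) + B n" if "n <= m" for m
  proof -
   have "dG u (f n) <= dG u (f m) + nG (%e x. f m e x - f n e x)"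
    by (rule nG_triangle[OF uL f f])
   moreover have "dG u (f m) <= (\<Sum>e\<in>Ed. nrm (len G e) (%x. f m e x - u e x))"
    unfolding nG_diff_commute[of u] by (rule nG_le_sum)
   ultimately show ?thesis using B[OF that] by linarith
  qed
  thus "\<exists>N. \<forall>m\<ge>N. dG u (f n) <= (\<Sum>e\<in>Ed. nrm (len G e) (%x. f m e x - u e x)) + B n" by blast
 qed
 with uL show ?thesis by blast
qed

lemma Hk_norm_1_le:
 assumes "!!e. e \<in> Ed ==> AC (len G e) (y e) (p e)" "y \<in> LG"
 shows "N1 y <= nG y + nG p"
 using AC_edges_Hk_edges(3)[OF assms(1) AEeq_refl assms(2)] sqrt_sum_squares_le_sum[of "nG y" "nG p"] by simp

lemma zero_Hk_graph_1: "(%e x. 0) \<in> Hk_graph G 1" "(%e x. 0) \<in> Hk_edges G 1" "N1 (%e x. 0) = 0"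
proof -
 have v: "vert_fun (%e x. 0) (%e x. 0)" by (auto simp: vert_fun_def endv_def AC_const)
 show 1: "(%e x. 0) \<in> Hk_graph G 1" by (rule vert_fun_Hk_graph[OF v AEeq_refl LG_zero])
 show "(%e x. 0) \<in> Hk_edges G 1" by (rule Hk_graph_edges[OF 1])
 show "N1 (%e x. 0) = 0"
  using AC_edges_Hk_edges(3)[OF vert_fun_AC[OF v] AEeq_refl LG_zero] by (simp add: nG_zero)
qed

end

context quantum_graph
begin

text \<open>An infinite set of eigenvalues below a bound would contain finite subsets larger than
  Weyl's count allows.\<close>

lemma finite_\<mu>_le: "finite {i \<in> I. \<mu> i <= M}"
proof (rule ccontr)
 assume inf: "infinite {i \<in> I. \<mu> i <= M}"
 from Weyl obtain C where C: "0 <= C" and W: "\<forall>M\<ge>1. \<forall>F. finite F --> F \<subseteq> I --> (\<forall>i\<in>F. \<mu> i <= M) --> real (card F) <= C * sqrt M"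
  by (elim exE conjE)
 obtain n where n: "C * sqrt (max 1 M) < real n" using reals_Archimedean2 by blast
 obtain F where F: "finite F" "card F = n" "F \<subseteq> {i \<in> I. \<mu> i <= M}" using infinite_arbitrarily_large[OF inf] by blast
 have "\<forall>i\<in>F. \<mu> i <= max 1 M" using F(3) by auto
 moreover have "F \<subseteq> I" using F(3) by blast
 ultimately have "real (card F) <= C * sqrt (max 1 M)" using W F(1) by simp
 with n F(2) show False by simp
qed

lemma weighted_summable_mono:
 assumes "wsummable s c" "s' <= s"
 shows "wsummable s' c"
proof (rule summable_on_comparison_test)
 show "(%i. \<kappa>_lo powr (s' - s) * (\<mu> i powr s * (c i)^2)) summable_on I"
  by (rule summable_on_cmult_right[OF assms(1)])
 fix i assume i: "i \<in> I"
 have "\<mu> i powr s' = \<mu> i powr (s' - s) * \<mu> i powr s" using \<mu>_pos[OF i] by (simp add: powr_add[symmetric])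
 also have "... <= \<kappa>_lo powr (s' - s) * \<mu> i powr s"
  using \<mu>_lower[OF i] \<kappa>_lo(1) assms(2) by (intro mult_right_mono powr_mono2') auto
 finally show "\<mu> i powr s' * (c i)^2 <= \<kappa>_lo powr (s' - s) * (\<mu> i powr s * (c i)^2)"
  by (simp only: mult.assoc[symmetric]) (intro mult_right_mono, auto)
qed auto

text \<open>Jackson and Bernstein estimates in one: high frequency parts measured in a weaker norm
  decay, low frequency parts measured in a stronger norm grow. Both carry the factor 2^(-j (s - k)),
  since powers of 4^j become powers of 2^j under the square root.\<close>

lemma weighted_sum_block:
 assumes c: "wsummable s c" and F: "finite F" "F \<subseteq> I"
  and k: "(k <= s & (\<forall>i\<in>F. 4 ^ j < \<mu> i)) \<or> (s <= k & (\<forall>i\<in>F. \<mu> i <= 4 ^ j))"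
 shows "sqrt (\<Sum>i\<in>F. \<mu> i powr k * (c i)^2) <= sqrt (wsum s c) * hp j (s - k)"
proof -
 define N2 where "N2 = (wsum s c)"
 have fs: "(\<Sum>i\<in>F. \<mu> i powr s * (c i)^2) <= N2"
  unfolding N2_def by (rule finite_sum_le_infsum[OF c F]) auto
 have "(\<Sum>i\<in>F. \<mu> i powr k * (c i)^2) <= (\<Sum>i\<in>F. 4 powr (- real j * (s - k)) * (\<mu> i powr s * (c i)^2))"
 proof (rule sum_mono)
  fix i assume i: "i \<in> F"
  hence pos: "0 < \<mu> i" using F \<mu>_pos by blast
  have e: "((4::real) ^ j) powr (k - s) = 4 powr (- real j * (s - k))"
  proof -
   have "((4::real) ^ j) powr (k - s) = (4 powr real j) powr (k - s)" by (simp add: powr_realpow)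
   also have "... = 4 powr (- real j * (s - k))" unfolding powr_powr by (simp add: algebra_simps)
   finally show ?thesis .
  qed
  have "\<mu> i powr (k - s) <= (4 ^ j) powr (k - s)"
   using k
  proof
   assume "k <= s & (\<forall>i\<in>F. 4 ^ j < \<mu> i)"
   thus ?thesis using i by (intro powr_mono2') (auto simp: less_imp_le)
  next
   assume "s <= k & (\<forall>i\<in>F. \<mu> i <= 4 ^ j)"
   thus ?thesis using i pos by (intro powr_mono2) auto
  qed
  hence "\<mu> i powr (k - s) * \<mu> i powr s * (c i)^2 <= 4 powr (- real j * (s - k)) * \<mu> i powr s * (c i)^2"
   unfolding e by (intro mult_right_mono) auto
  thus "\<mu> i powr k * (c i)^2 <= 4 powr (- real j * (s - k)) * (\<mu> i powr s * (c i)^2)"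
   using pos by (simp add: powr_add[symmetric] mult.assoc)
 qed
 also have "... <= 4 powr (- real j * (s - k)) * N2"
  unfolding sum_distrib_left[symmetric] by (intro mult_left_mono fs) auto
 also have "... = (hp j (s - k))^2 * N2" by (simp only: half_power_powr_sq)
 finally have "sqrt (\<Sum>i\<in>F. \<mu> i powr k * (c i)^2) <= sqrt ((hp j (s - k))^2 * N2)" by simp
 thus ?thesis by (simp add: real_sqrt_mult N2_def mult.commute)
qed

definition Fj :: "nat => nat set" where "Fj j = {i \<in> I. \<mu> i <= 4 ^ j}"

lemma Fj: "finite (Fj j)" "Fj j \<subseteq> I"
 using finite_\<mu>_le by (auto simp: Fj_def)

lemma Fj_mono: "j <= m ==> Fj j \<subseteq> Fj m"
 unfolding Fj_def using power_increasing[of j m "4::real"] by (auto intro: order_trans)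

lemma Fj_diff: "finite (Fj m - Fj j)" "Fj m - Fj j \<subseteq> I" "\<forall>i\<in>Fj m - Fj j. 4 ^ j < \<mu> i"
 using Fj by (auto simp: Fj_def)

lemma S_diff:
 assumes "j <= m"
 shows "(%e x. S0 (Fj m) c e x - S0 (Fj j) c e x) = S0 (Fj m - Fj j) c"
  "(%e x. S1 (Fj m) c e x - S1 (Fj j) c e x) = S1 (Fj m - Fj j) c"
 unfolding S0_def S1_def by (simp_all add: sum_diff[OF Fj(1) Fj_mono[OF assms]])

lemma nG_S0_eq: "finite F ==> F \<subseteq> I ==> nG (S0 F c) = sqrt (\<Sum>i\<in>F. \<mu> i powr 0 * (c i)^2)"
proof -
 assume F: "finite F" "F \<subseteq> I"
 have "(\<Sum>i\<in>F. \<mu> i powr 0 * (c i)^2) = (\<Sum>i\<in>F. (c i)^2)"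
  by (rule sum.cong) (use F \<mu>_pos in \<open>auto simp: subset_iff powr_zero_eq_one less_le\<close>)
 thus ?thesis using nG_S0[OF F, of c] by (metis nG_nonneg real_sqrt_unique)
qed

lemma nG_S1_le: "finite F ==> F \<subseteq> I ==> nG (S1 F c) <= sqrt (1 / a_lo) * sqrt (\<Sum>i\<in>F. \<mu> i powr 1 * (c i)^2)"
proof -
 assume F: "finite F" "F \<subseteq> I"
 have "(\<Sum>i\<in>F. \<mu> i powr 1 * (c i)^2) = (\<Sum>i\<in>F. \<mu> i * (c i)^2)"
  by (rule sum.cong) (use F \<mu>_pos in \<open>auto simp: subset_iff less_imp_le\<close>)
 thus ?thesis using nG_S1[OF F, of c] by simp
qed

lemma nG_S2_le: "\<exists>C\<ge>0. \<forall>F c. finite F --> F \<subseteq> I --> nG (S2 F c) <= C * sqrt (\<Sum>i\<in>F. \<mu> i powr 2 * (c i)^2)"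
proof -
 have "(\<Sum>i\<in>F. \<mu> i powr 2 * (c i)^2) = (\<Sum>i\<in>F. (\<mu> i * c i)^2)" if "F \<subseteq> I" for F c
  by (rule sum.cong) (use that \<mu>_pos in \<open>auto simp: subset_iff power_mult_distrib less_imp_le\<close>)
 thus ?thesis using nG_S2 by simp
qed

lemma partial_sums_limit:
 assumes c: "wsummable s c" and s: "0 < s"
 obtains u where "u \<in> LG" "\<forall>i\<in>I. inn u (\<psi> i) = c i"
  "\<forall>j. nG (%e x. u e x - S0 (Fj j) c e x) <= sqrt (wsum s c) * hp j s"
proof -
 define N where "N = sqrt (wsum s c)"
 define B where "B j = N * hp j s" for j :: nat
 have lim: "B ----> 0" unfolding B_def using tendsto_mult_right_zero[OF half_powr_tendsto_0[OF s]] .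
 have "\<exists>u\<in>LG. \<forall>j. nG (%e x. u e x - S0 (Fj j) c e x) <= B j"
 proof (rule LG_complete[OF S_L2(1)[OF Fj] _ lim])
  fix m n :: nat assume nm: "n <= m"
  show "nG (%e x. S0 (Fj m) c e x - S0 (Fj n) c e x) <= B n"
  proof -
   have "sqrt (\<Sum>i\<in>Fj m - Fj n. \<mu> i powr 0 * (c i)^2) <= N * hp n (s - 0)"
    unfolding N_def by (rule weighted_sum_block[OF c Fj_diff(1,2)]) (use Fj_diff(3)[of m n] s in auto)
   thus ?thesis
    unfolding S_diff[OF nm] nG_S0_eq[OF Fj_diff(1,2)] B_def by (simp only: diff_0_right)
  qed
 qed
 then obtain u where u: "u \<in> LG" "!!j. nG (%e x. u e x - S0 (Fj j) c e x) <= B j" by blast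
 have "inn u (\<psi> i) = c i" if i: "i \<in> I" for i
 proof -
  have n1: "nG (\<psi> i) = 1" using \<psi>_orthonormal[OF i i] by (simp add: L2_graph_norm_def)
  obtain j0 where j0: "\<mu> i < 4 ^ j0" using real_arch_pow[of 4 "\<mu> i"] by auto
  have b: "\<bar>inn u (\<psi> i) - c i\<bar> <= B j" if "j0 <= j" for j
  proof -
   have "(4::real) ^ j0 <= 4 ^ j" using that by (intro power_increasing) auto
   with j0 have "\<mu> i <= 4 ^ j" by linarith
   hence "i \<in> Fj j" using i by (auto simp: Fj_def)
   hence 1: "inn u (\<psi> i) - c i = inn (%e x. u e x - S0 (Fj j) c e x) (\<psi> i)"
    using inn_diff[OF u(1) S_L2(1)[OF Fj] \<psi>_L2[OF i]] coef_S0[OF Fj i] by simp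
   have "\<bar>inn u (\<psi> i) - c i\<bar> <= nG (%e x. u e x - S0 (Fj j) c e x) * nG (\<psi> i)"
    unfolding 1 by (rule inn_Cauchy_Schwarz[OF LG_diff[OF u(1) S_L2(1)[OF Fj]] \<psi>_L2[OF i]])
   thus ?thesis unfolding n1 mult_1_right using u(2)[of j] by (rule order_trans)
  qed
  have "\<bar>inn u (\<psi> i) - c i\<bar> <= 0"
   by (rule LIMSEQ_le_const[OF lim]) (use b in blast)
  thus ?thesis by simp
 qed
 with u show thesis using that unfolding B_def N_def by blast
qed

end

lemma AC_cong_AE:
 assumes F: "AC l F f" and g: "g \<in> L2_iv l" "aeq l f g"
 shows "AC l F g"
proof -
 have neg: "negligible {x\<in>{0..l}. f x \<noteq> g x}" using g(2) by (simp add: AE_iv_iff_negligible)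
 have "integral {0..x} f = integral {0..x} g" if "x \<in> {0..l}" for x
  by (rule integral_spike[OF neg]) (use that in auto)
 with F g(1) show ?thesis unfolding AC_def by metis
qed

context metric_graph_loc
begin

lemma Hfrac_graph_if_dyadic:
 assumes u: "u \<in> LG" and th: "0 < \<theta>" "\<theta> < \<theta>'" "\<theta>' <= 1" and b: "0 <= b"
  and Y: "!!j. vert_fun (Y j) (y j)" "!!j. nG (Y j) <= b"
  and e: "!!j. dG u (Y j) <= b * hp j \<theta>'"
  and g: "!!j. nG (y j) <= b * hp j (\<theta>' - 1)"
 shows "u \<in> Hfrac_graph G \<theta>"
 unfolding Hfrac_graph_def
proof (rule interp_if_dyadic[of nG "N1" "%e x. 0" "Hk_graph G 1" \<theta> \<theta>' u LG "2 * b" Y,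
   OF nG_nonneg Hk_graph_norm_nonneg zero_Hk_graph_1(1,3) th(1,2) u])
 show "0 <= 2 * b" using b by simp
 fix j
 have L: "Y j \<in> LG" by (rule vert_fun_L2(1)[OF Y(1)])
 show "Y j \<in> Hk_graph G 1" by (rule vert_fun_Hk_graph[OF Y(1) AEeq_refl L])
 have "b * hp j \<theta>' <= 2 * b * hp j \<theta>'" using b by (intro mult_right_mono) auto
 thus "nG (u - Y j) <= 2 * b * hp j \<theta>'"
  using e[of j] by (simp add: fun_diff_def)
 have 1: "N1 (Y j) <= nG (Y j) + nG (y j)" by (rule Hk_norm_1_le[OF vert_fun_AC[OF Y(1)] L])
 have "b * 1 <= b * hp j (\<theta>' - 1)" using th b by (intro mult_left_mono half_powr_ge_1) auto
 hence "nG (Y j) <= b * hp j (\<theta>' - 1)" using Y(2)[of j] by simp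
 with 1 g[of j] show "N1 (Y j) <= 2 * b * hp j (\<theta>' - 1)" by linarith
qed

lemma Hfrac_edges_if_dyadic:
 assumes u: "u \<in> LG" and th: "0 < \<theta>" "\<theta> < \<theta>'" "\<theta>' <= 1" and b: "0 <= b"
  and Y: "!!j e. e \<in> Ed ==> AC (len G e) (Y j e) (y j e)" "!!j. nG (Y j) <= b"
  and e: "!!j. dG u (Y j) <= b * hp j \<theta>'"
  and g: "!!j. nG (y j) <= b * hp j (\<theta>' - 1)"
 shows "u \<in> Hfrac_edges G \<theta>"
 unfolding Hfrac_edges_def
proof (rule interp_if_dyadic[of nG "N1" "%e x. 0" "Hk_edges G 1" \<theta> \<theta>' u LG "2 * b" Y,
   OF nG_nonneg Hk_graph_norm_nonneg zero_Hk_graph_1(2,3) th(1,2) u])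
 show "0 <= 2 * b" using b by simp
 fix j
 have L: "Y j \<in> LG" by (rule LG_I[OF AC_L2_fun[OF Y(1)]])
 show "Y j \<in> Hk_edges G 1" by (rule AC_edges_Hk_edges(1)[OF Y(1) AEeq_refl L])
 have "b * hp j \<theta>' <= 2 * b * hp j \<theta>'" using b by (intro mult_right_mono) auto
 thus "nG (u - Y j) <= 2 * b * hp j \<theta>'"
  using e[of j] by (simp add: fun_diff_def)
 have 1: "N1 (Y j) <= nG (Y j) + nG (y j)" by (rule Hk_norm_1_le[OF Y(1) L])
 have "b * 1 <= b * hp j (\<theta>' - 1)" using th b by (intro mult_left_mono half_powr_ge_1) auto
 hence "nG (Y j) <= b * hp j (\<theta>' - 1)" using Y(2)[of j] by simp
 with 1 g[of j] show "N1 (Y j) <= 2 * b * hp j (\<theta>' - 1)" by linarith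
qed

lemma edge_dyadic:
 assumes e: "e \<in> Ed"
  and "!!j. dG u (Y j) <= b * hp j \<theta>'"
 shows "nrm (len G e) (%x. u e x - Y j e x) <= b * hp j \<theta>'"
 using nrm_le_nG[OF e, of "%e x. u e x - Y j e x"] assms(2)[of j] by linarith

text \<open>The error bound is only recorded through its consequence for endpoint values, which is all that
 vertex conditions need.\<close>

lemma dyadic_limit_edges:
 assumes u: "u \<in> LG" and th: "1/2 < \<theta>" "\<theta> <= 1" and b: "0 <= b"
  and Y: "!!j e. e \<in> Ed ==> AC (len G e) (Y j e) (y j e)"
  and err: "!!j. dG u (Y j) <= b * hp j \<theta>"
  and g: "!!j. nG (y j) <= b * hp j (\<theta> - 1)"
 obtains F where "\<forall>e\<in>Ed. cont (len G e) (F e)" "AEeq F u"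
  "\<forall>e\<in>Ed. \<forall>x\<in>{0..len G e}. (%j. Y j e x) ----> F e x"
proof -
 have "\<exists>F. cont (len G e) F & (aeq (len G e) F (u e)) &
  (\<forall>x\<in>{0..len G e}. (%j. Y j e x) ----> F x)" if e: "e \<in> Ed" for e
 proof -
  let ?l = "len G e"
  have "nrm ?l (y j e) <= b * hp j (\<theta> - 1)" for j
   using nrm_le_nG[OF e, of "y j"] g[of j] by linarith
  from AC_dyadic_limit[OF len_pos[OF e] LG_D[OF u e] th b Y[OF e] edge_dyadic[OF e err] this]
  obtain F where F: "cont ?l F" "aeq ?l F (u e)"
   "\<forall>j. \<forall>x\<in>{0..?l}. \<bar>Y j e x - F x\<bar>
    <= sqrt (4 / ?l + 12) / (1 - (1/2) powr (\<theta> - 1/2)) * b * hp j (\<theta> - 1/2)"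
   by (elim exE conjE)
  define C where "C = sqrt (4 / ?l + 12) / (1 - (1/2) powr (\<theta> - 1/2)) * b"
  have "(%j. Y j e x) ----> F x" if x: "x \<in> {0..?l}" for x
  proof (rule LIM_zero_cancel, rule Lim_null_comparison)
   show "\<forall>\<^sub>F j in sequentially. norm (Y j e x - F x) <= C * hp j (\<theta> - 1/2)"
    using F(3) x unfolding C_def[symmetric] by simp
   show "(%j. C * hp j (\<theta> - 1/2)) ----> 0"
    using th by (intro tendsto_mult_right_zero half_powr_tendsto_0) simp
  qed
  with F show ?thesis by blast
 qed
 hence "\<forall>e\<in>Ed. \<exists>F. cont (len G e) F & (aeq (len G e) F (u e)) &
  (\<forall>x\<in>{0..len G e}. (%j. Y j e x) ----> F x)" by blast
 from bchoice[OF this] obtain F where "!!e. e \<in> Ed ==> cont (len G e) (F e)"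
  "!!e. e \<in> Ed ==> aeq (len G e) (F e) (u e)"
  "!!e x. e \<in> Ed ==> x \<in> {0..len G e} ==> (%j. Y j e x) ----> F e x" by blast
 thus thesis using that[of F] by (simp add: AEeq_def)
qed

lemma endv_point: "e \<in> Ed ==> (if b then len G e else 0) \<in> {0..len G e}"
 using len_pos[of e] by auto

lemma endv_limit:
 assumes "e \<in> Ed" "!!x. x \<in> {0..len G e} ==> (%j. Y j e x) ----> F e x"
 shows "(%j. endv (Y j) e b) ----> endv F e b"
 unfolding endv_def by (rule assms(2)[OF endv_point[OF assms(1)]])

lemma outv_limit:
 assumes "e \<in> Ed" "!!x. x \<in> {0..len G e} ==> (%j. Y j e x) ----> F e x"
 shows "(%j. outv (Y j) e b) ----> outv F e b"
 using assms(2)[of "len G e"] assms(2)[of 0] len_pos[OF assms(1)]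
 by (cases b) (auto simp: outv_def intro: tendsto_minus)

lemma D_space_1I:
 assumes u: "u \<in> LG" and s: "1/2 < s" "!!e. e \<in> Ed ==> u e \<in> Hs_iv s (len G e)"
  and F: "!!e. e \<in> Ed ==> cont (len G e) (F e)" "AEeq F u"
  and z: "!!v e b. v \<in> VD ==> (e, b) \<in> Dir G v ==> endv F e b = 0"
 shows "u \<in> D_space G VD 1"
proof -
 have ae: "AEeq F (DG 0 u)" by (rule AEeq_trans[OF F(2) AEeq_sym[OF D_graph_0_AEeq[OF u]]])
 have "end_value G e b (DG 0 u) = 0" if "v \<in> VD" "(e, b) \<in> Dir G v" for v e b
  using end_value_eq[where y = F and u = "DG 0 u", OF Dir_arcs[OF that(2)] F(1)[OF Dir_arcs[OF that(2)]], of b] ae z[OF that] Dir_arcs[OF that(2)]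
  by (simp add: AEeq_def)
 moreover have "\<exists>s > 2 * real 1 - 3/2. \<forall>e\<in>incident_edges G VD. u e \<in> Hs_iv s (len G e)"
  using s by (intro exI[of _ s]) (auto simp: incident_edges_def)
 ultimately show ?thesis using u by (auto simp: D_space_def)
qed

lemma K_space_1I:
 assumes u: "u \<in> LG" and s: "3/2 < s" "!!e. e \<in> Ed ==> u e \<in> Hs_iv s (len G e)"
  and F: "!!e. e \<in> Ed ==> AC (len G e) (F e) (P e)" "!!e. e \<in> Ed ==> cont (len G e) (P e)" "AEeq F u"
  and z: "!!v. v \<in> VK ==> (\<Sum>(e, b)\<in>Dir G v. outv P e b) = 0"
 shows "u \<in> K_space G VK 1"
proof -
 have ae: "AEeq F (DG 0 u)" by (rule AEeq_trans[OF F(3) AEeq_sym[OF D_graph_0_AEeq[OF u]]])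
 have "outward_deriv G e b (DG 0 u) = outv P e b" if "(e, b) \<in> Dir G v" for v e b
  using outward_deriv_eq[where y = F and p = P and u = "DG 0 u", OF Dir_arcs[OF that] F(1,2)[OF Dir_arcs[OF that]], of b] ae Dir_arcs[OF that]
  by (simp add: AEeq_def)
 hence eq: "(\<Sum>(e, b)\<in>Dir G v. outward_deriv G e b (DG 0 u)) = (\<Sum>(e, b)\<in>Dir G v. outv P e b)" for v
  by (intro sum.cong) auto
 have "\<exists>s > 2 * real 1 - 1/2. \<forall>e\<in>incident_edges G VK. u e \<in> Hs_iv s (len G e)"
  using s by (intro exI[of _ s]) (auto simp: incident_edges_def)
 with u z show ?thesis by (auto simp: K_space_def eq)
qed

lemma space_0: "u \<in> LG ==> u \<in> D_space G V 0" "u \<in> LG ==> u \<in> K_space G V 0"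
 by (simp_all add: D_space_def K_space_def)

end

context quantum_graph
begin

lemma partial_sums_low:
 assumes c: "wsummable s c" and s: "0 < s" "s <= 1"
 obtains u b where "u \<in> LG" "\<forall>i\<in>I. inn u (\<psi> i) = c i" "0 <= b"
  "\<forall>j. nG (S0 (Fj j) c) <= b" "\<forall>j. nG (%e x. u e x - S0 (Fj j) c e x) <= b * hp j s"
  "\<forall>j. nG (S1 (Fj j) c) <= b * hp j (s - 1)"
proof -
 define N where "N = sqrt (wsum s c)"
 have N0: "0 <= N" unfolding N_def by (intro real_sqrt_ge_zero infsum_nonneg) simp
 obtain u where u: "u \<in> LG" "\<forall>i\<in>I. inn u (\<psi> i) = c i"
  and e0: "\<forall>j. nG (%e x. u e x - S0 (Fj j) c e x) <= N * hp j s"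
  by (rule partial_sums_limit[OF c s(1), folded N_def])
 note e = e0[rule_format]
 define A where "A = sqrt (1 / a_lo)"
 have A: "0 <= A" using a_lo(1) by (simp add: A_def)
 define b where "b = nG u + N + A * N"
 have AN: "0 <= A * N" using A N0 by simp
 have b: "0 <= b" "N <= b" "A * N <= b" "nG u + N <= b" using AN N0 nG_nonneg[of u] by (auto simp: b_def)
 have 1: "nG (%e x. u e x - S0 (Fj j) c e x) <= b * hp j s" for j
  by (rule order_trans[OF e mult_right_mono[OF b(2)]]) simp
 have 2: "nG (S0 (Fj j) c) <= b" for j
 proof -
  have "nG (%e x. u e x - (u e x - S0 (Fj j) c e x)) <= nG u + nG (%e x. u e x - S0 (Fj j) c e x)"
   by (rule nG_diff[OF u(1) LG_diff[OF u(1) S_L2(1)[OF Fj]]])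
  moreover have "N * hp j s <= N * 1" using N0 s by (intro mult_left_mono half_powr_le_1) auto
  ultimately show ?thesis using e[of j] b(4) by simp
 qed
 have 3: "nG (S1 (Fj j) c) <= b * hp j (s - 1)" for j
 proof -
  have "sqrt (\<Sum>i\<in>Fj j. \<mu> i powr 1 * (c i)^2) <= N * hp j (s - 1)"
   unfolding N_def by (rule weighted_sum_block[OF c Fj]) (use s in \<open>auto simp: Fj_def\<close>)
  hence "nG (S1 (Fj j) c) <= A * (N * hp j (s - 1))"
   using nG_S1_le[OF Fj, of j c] mult_left_mono[OF _ A] unfolding A_def by (meson order_trans)
  also have "... <= b * hp j (s - 1)"
   using mult_right_mono[OF b(3), of "hp j (s - 1)"] by (simp add: mult.assoc)
  finally show ?thesis .
 qed
 show thesis by (rule that[OF u b(1)]) (use 1 2 3 in blast)+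
qed

text \<open>Above order 1 the derivatives of the partial sums converge too, with error of order s -
  1, while the second derivatives are bounded at the rate of order s - 2. These are the data needed
  to place the limit \<open>w\<close> in interpolation spaces of order below s - 1.\<close>

lemma partial_sums_high:
 assumes c: "wsummable s c" and s: "1 < s" "s < 2"
 obtains u w b where "u \<in> LG" "w \<in> LG" "\<forall>i\<in>I. inn u (\<psi> i) = c i" "0 <= b"
  "\<forall>j. nG (%e x. u e x - S0 (Fj j) c e x) <= b * hp j s"
  "\<forall>j. nG (S1 (Fj j) c) <= b"
  "\<forall>j. nG (%e x. w e x - S1 (Fj j) c e x) <= b * hp j (s - 1)"
  "\<forall>j. nG (S2 (Fj j) c) <= b * hp j (s - 2)"
proof -
 define N where "N = sqrt (wsum s c)"
 have N0: "0 <= N" unfolding N_def by (intro real_sqrt_ge_zero infsum_nonneg) simp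
 have s0: "0 < s" using s by simp
 obtain u where u: "u \<in> LG" "\<forall>i\<in>I. inn u (\<psi> i) = c i"
  and e0: "\<forall>j. nG (%e x. u e x - S0 (Fj j) c e x) <= N * hp j s"
  by (rule partial_sums_limit[OF c s0, folded N_def])
 note e = e0[rule_format]
 define A where "A = sqrt (1 / a_lo)"
 have A: "0 <= A" using a_lo(1) by (simp add: A_def)
 from nG_S2_le obtain A2 where A2: "0 <= A2"
  and "\<forall>F c. finite F --> F \<subseteq> I --> nG (S2 F c) <= A2 * sqrt (\<Sum>i\<in>F. \<mu> i powr 2 * (c i)^2)"
  by (elim exE conjE)
 hence S2: "nG (S2 (Fj j) c) <= A2 * sqrt (\<Sum>i\<in>Fj j. \<mu> i powr 2 * (c i)^2)" for j using Fj by simp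
 define B where "B j = A * N * hp j (s - 1)" for j :: nat
 have "\<exists>w\<in>LG. \<forall>j. nG (%e x. w e x - S1 (Fj j) c e x) <= B j"
 proof (rule LG_complete[OF S_L2(2)[OF Fj]])
  show "B ----> 0" unfolding B_def using s by (intro tendsto_mult_right_zero half_powr_tendsto_0) simp
  fix m n :: nat assume nm: "n <= m"
  have "sqrt (\<Sum>i\<in>Fj m - Fj n. \<mu> i powr 1 * (c i)^2) <= N * hp n (s - 1)"
   unfolding N_def by (rule weighted_sum_block[OF c Fj_diff(1,2)]) (use Fj_diff(3)[of m n] s in auto)
  hence "nG (S1 (Fj m - Fj n) c) <= A * (N * hp n (s - 1))"
   using nG_S1_le[OF Fj_diff(1,2), of m n c] mult_left_mono[OF _ A] unfolding A_def by (meson order_trans)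
  thus "nG (%e x. S1 (Fj m) c e x - S1 (Fj n) c e x) <= B n"
   unfolding S_diff(2)[OF nm] B_def by (simp only: mult.assoc)
 qed
 then obtain w where w: "w \<in> LG" "!!j. nG (%e x. w e x - S1 (Fj j) c e x) <= B j" by blast
 define b where "b = N + (nG w + A * N) + A2 * N"
 have AN: "0 <= A * N" "0 <= A2 * N" using A A2 N0 by simp_all
 have b: "0 <= b" "N <= b" "A * N <= b" "A2 * N <= b" "nG w + A * N <= b"
  using AN N0 nG_nonneg[of w] by (auto simp: b_def)
 have 1: "nG (%e x. u e x - S0 (Fj j) c e x) <= b * hp j s" for j
  by (rule order_trans[OF e mult_right_mono[OF b(2)]]) simp
 have 2: "nG (S1 (Fj j) c) <= b" for j
 proof -
  have "nG (%e x. w e x - (w e x - S1 (Fj j) c e x)) <= nG w + nG (%e x. w e x - S1 (Fj j) c e x)"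
   by (rule nG_diff[OF w(1) LG_diff[OF w(1) S_L2(2)[OF Fj]]])
  moreover have "B j <= A * N * 1" unfolding B_def using AN s by (intro mult_left_mono half_powr_le_1) auto
  ultimately show ?thesis using w(2)[of j] b(5) by simp
 qed
 have 3: "nG (%e x. w e x - S1 (Fj j) c e x) <= b * hp j (s - 1)" for j
  by (rule order_trans[OF w(2)[unfolded B_def] mult_right_mono[OF b(3)]]) simp
 have 4: "nG (S2 (Fj j) c) <= b * hp j (s - 2)" for j
 proof -
  have "sqrt (\<Sum>i\<in>Fj j. \<mu> i powr 2 * (c i)^2) <= N * hp j (s - 2)"
   unfolding N_def by (rule weighted_sum_block[OF c Fj]) (use s in \<open>auto simp: Fj_def\<close>)
  hence "nG (S2 (Fj j) c) <= A2 * (N * hp j (s - 2))"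
   using S2[of j] mult_left_mono[OF _ A2] by (meson order_trans)
  also have "... <= b * hp j (s - 2)"
   using mult_right_mono[OF b(4), of "hp j (s - 2)"] by (simp add: mult.assoc)
  finally show ?thesis .
 qed
 show thesis by (rule that[OF u(1) w(1) u(2) b(1)]) (use 1 2 3 4 in blast)+
qed

text \<open>Closedness of the form domain. Point values converge because the approximation order 1
  exceeds 1/2, the representation by a primitive survives since the derivatives converge in L2, and
  the conditions at the vertices are closed under pointwise limits.\<close>

lemma form_fun_limit:
 assumes u: "u \<in> LG" and w: "w \<in> LG" and b: "0 <= b" and y: "!!j. form_fun (y j) (p j)"
  and e: "!!j. dG u (y j) <= b * hp j 1" and g: "!!j. nG (p j) <= b"
  and lim: "(%j. dG (p j) w) ----> 0"
 obtains F where "form_fun F w" "AEeq F u"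
proof -
 have AC: "AC (len G e) (y j e) (p j e)" if "e \<in> Ed" for j e
  by (rule vert_fun_AC[OF form_fun_vert[OF y] that])
 have th: "1/2 < (1 :: real)" "(1 :: real) <= 1" by simp_all
 have g': "nG (p j) <= b * hp j (1 - 1)" for j using g[of j] by simp
 obtain F where F0: "\<forall>e\<in>Ed. cont (len G e) (F e)" "AEeq F u"
  and Fl0: "\<forall>e\<in>Ed. \<forall>x\<in>{0..len G e}. (%j. y j e x) ----> F e x"
  by (rule dyadic_limit_edges[OF u th b AC e g'])
 note F = F0[rule_format] and Fl = Fl0[rule_format]
 have "AC (len G e) (F e) (w e)" if e: "e \<in> Ed" for e
 proof -
  let ?l = "len G e"
  have nl: "(%j. nrm ?l (%x. p j e x - w e x)) ----> 0"
   by (rule Lim_null_comparison[OF _ lim]) (use nrm_le_nG[OF e, of "%e x. p _ e x - w e x"] in simp)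
  have "F e x = F e 0 + integral {0..x} (w e)" if x: "x \<in> {0..?l}" for x
  proof -
   have "(%j. y j e 0 + integral {0..x} (p j e)) ----> F e 0 + integral {0..x} (w e)"
    by (intro tendsto_add Fl[OF e] tendsto_integral_L2[OF AC_L2[OF AC[OF e]] LG_D[OF w e] nl]) (use x len_pos[OF e] in auto)
   hence "(%j. y j e x) ----> F e 0 + integral {0..x} (w e)" by (simp only: AC_eq[OF AC[OF e] x, symmetric])
   thus ?thesis by (rule LIMSEQ_unique[OF Fl[OF e x]])
  qed
  with LG_D[OF w e] show ?thesis unfolding AC_def by blast
 qed
 moreover have "\<exists>c. \<forall>(e, b)\<in>Dir G v. endv F e b = c" if v: "v \<in> verts G" for v
 proof (cases "Dir G v = {}")
  case False
  then obtain e0 b0 where 0: "(e0, b0) \<in> Dir G v" by auto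
  have "endv F e b = endv F e0 b0" if "(e, b) \<in> Dir G v" for e b
  proof -
   have "endv (y j) e b = endv (y j) e0 b0" for j
   proof -
    obtain c where c: "\<forall>(e, b)\<in>Dir G v. endv (y j) e b = c"
     using form_fun_vert[OF y, of j] v unfolding vert_fun_def by blast
    show ?thesis using bspec[OF c that] bspec[OF c 0] by simp
   qed
   with endv_limit[where Y = y and F = F, OF Dir_arcs[OF that] Fl[OF Dir_arcs[OF that]], of b]
   have "(%j. endv (y j) e0 b0) ----> endv F e b" by simp
   thus ?thesis
    using endv_limit[where Y = y and F = F, OF Dir_arcs[OF 0] Fl[OF Dir_arcs[OF 0]], of b0] by (rule LIMSEQ_unique)
  qed
  thus ?thesis by blast
 qed auto
 moreover have "endv F e b = 0" if "v \<in> VD" "(e, b) \<in> Dir G v" for v e b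
 proof -
  have "endv (y j) e b = 0" for j using y[of j] that by (auto simp: form_fun_def)
  with endv_limit[where Y = y and F = F, OF Dir_arcs[OF that(2)] Fl[OF Dir_arcs[OF that(2)]], of b]
  have "(%j. 0) ----> endv F e b" by simp
  thus ?thesis by (simp add: LIMSEQ_const_iff)
 qed
 ultimately have "form_fun F w" by (auto simp: form_fun_def vert_fun_def)
 thus thesis using F(2) by (rule that)
qed

lemma H_KD_floors:
 assumes "0 < \<beta>" "\<beta> < 2"
 shows "nat \<lfloor>\<beta>/2 + 1/4\<rfloor> = (if \<beta> < 3/2 then 0 else 1)" "nat \<lfloor>\<beta>/2 + 3/4\<rfloor> = (if \<beta> < 1/2 then 0 else 1)"
proof -
 have "\<lfloor>\<beta>/2 + 1/4\<rfloor> = (if \<beta> < 3/2 then 0 else 1)" using assms by (auto simp: floor_eq_iff)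
 thus "nat \<lfloor>\<beta>/2 + 1/4\<rfloor> = (if \<beta> < 3/2 then 0 else 1)" by simp
 have "\<lfloor>\<beta>/2 + 3/4\<rfloor> = (if \<beta> < 1/2 then 0 else 1)" using assms by (auto simp: floor_eq_iff)
 thus "nat \<lfloor>\<beta>/2 + 3/4\<rfloor> = (if \<beta> < 1/2 then 0 else 1)" by simp
qed

lemma not_Ints_between: "0 < x ==> x < 1 ==> (x::real) \<notin> \<int>"
 using frac_eq[of x] frac_eq_0_iff[of x] by auto

lemma H_KD_low:
 assumes c: "wsummable s c" and s: "0 < \<beta>" "\<beta> < s" "s <= 1"
 shows "\<exists>u\<in>H_KD G VK VD \<beta>. \<forall>i\<in>I. inn u (\<psi> i) = c i"
proof -
 have s0: "0 < s" using s by simp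
 obtain u b where u: "u \<in> LG" "\<forall>i\<in>I. inn u (\<psi> i) = c i" and b: "0 <= b"
  and y0: "\<forall>j. nG (S0 (Fj j) c) <= b" "\<forall>j. nG (%e x. u e x - S0 (Fj j) c e x) <= b * hp j s"
   "\<forall>j. nG (S1 (Fj j) c) <= b * hp j (s - 1)"
  by (rule partial_sums_low[OF c s0 s(3)])
 note y = y0[rule_format]
 have ff: "form_fun (S0 (Fj j) c) (S1 (Fj j) c)" for j by (rule op_fun_form[OF S_op_fun[OF Fj]])
 note vf = form_fun_vert[OF ff]
 have "u \<in> Hfrac_graph G \<beta>" by (rule Hfrac_graph_if_dyadic[OF u(1) s b vf y])
 hence H: "u \<in> H_graph G \<beta>" using not_Ints_between[of \<beta>] s by (simp add: H_graph_def)
 have D: "u \<in> D_space G VD 1" if \<beta>: "1/2 <= \<beta>"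
 proof -
  \<comment> \<open>The Dirichlet space asks for edge regularity strictly above 1/2, while \<beta>
    may equal 1/2; the room between \<beta> and \<open>s\<close> provides it.\<close>
  define t where "t = (\<beta> + s) / 2"
  have t: "1/2 < t" "t < s" "t < 1" using \<beta> s by (auto simp: t_def)
  have th: "1/2 < s" using \<beta> s by simp
  obtain F where F0: "\<forall>e\<in>Ed. cont (len G e) (F e)" "AEeq F u"
   and Fl0: "\<forall>e\<in>Ed. \<forall>x\<in>{0..len G e}. (%j. S0 (Fj j) c e x) ----> F e x"
   by (rule dyadic_limit_edges[OF u(1) th s(3) b vert_fun_AC[OF vf] y(2,3)])
  note F = F0[rule_format] and Fl = Fl0[rule_format]
  show ?thesis
  proof (rule D_space_1I[OF u(1) t(1) _ F])
   fix e assume e: "e \<in> Ed"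
   have t0: "0 < t" using t by simp
   have "u e \<in> Hfrac_iv t (len G e)"
    by (rule Hfrac_iv_if_AC[OF len_pos[OF e] LG_D[OF u(1) e] t0 t(2) s(3) b vert_fun_AC[OF vf e] _ edge_dyadic[OF e y(2)]])
     (use nrm_le_nG[OF e] y(1,3) in \<open>meson order_trans\<close>)+
   moreover have "t \<notin> \<int>" "nat \<lfloor>t\<rfloor> = 0" "frac t = t" using t not_Ints_between[of t] by (auto simp: frac_eq nat_eq_iff floor_eq_iff)
   ultimately show "u e \<in> Hs_iv t (len G e)"
    by (intro Hs_iv_if_Hfrac[OF len_pos[OF e] _ _ _ has_weak_deriv_0[OF LG_D[OF u(1) e]]])
     (auto simp: Hk_iv_0 LG_D[OF u(1) e])
  next
   fix v e b assume v: "v \<in> VD" "(e, b) \<in> Dir G v"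
   have "endv (S0 (Fj j) c) e b = 0" for j using ff[of j] v by (auto simp: form_fun_def)
   thus "endv F e b = 0"
    using LIMSEQ_unique[OF endv_limit[where Y = "%j. S0 (Fj j) c" and F = F, OF Dir_arcs[OF v(2)] Fl[OF Dir_arcs[OF v(2)]], of b]] by simp
  qed
 qed
 have "u \<in> H_KD G VK VD \<beta>"
  unfolding H_KD_def using H D space_0[OF u(1)] s H_KD_floors[of \<beta>] by auto
 with u(2) show ?thesis by blast
qed

text \<open>The limit \<open>w\<close> of the differentiated partial sums is the derivative of the
  limit \<open>u\<close>, and it takes over the role that \<open>u\<close> has at lower order: its
  interpolation order gives the regularity of \<open>u\<close>, and from order 3/2 of
  \<open>u\<close> on its traces inherit the Kirchhoff condition.\<close>

lemma H_KD_high: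
 assumes c: "wsummable s c" and s: "1 <= \<beta>" "\<beta> < s" "s < 2"
 shows "\<exists>u\<in>H_KD G VK VD \<beta>. \<forall>i\<in>I. inn u (\<psi> i) = c i"
proof -
 have s1: "1 < s" using s by simp
 obtain u w b where uL: "u \<in> LG" and w: "w \<in> LG" and uc: "\<forall>i\<in>I. inn u (\<psi> i) = c i" and b: "0 <= b"
  and y0: "\<forall>j. nG (%e x. u e x - S0 (Fj j) c e x) <= b * hp j s"
   "\<forall>j. nG (S1 (Fj j) c) <= b"
   "\<forall>j. nG (%e x. w e x - S1 (Fj j) c e x) <= b * hp j (s - 1)"
   "\<forall>j. nG (S2 (Fj j) c) <= b * hp j (s - 2)"
  by (rule partial_sums_high[OF c s1 s(3)])
 note y = y0[rule_format]
 note u = uL uc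
 have opf: "op_fun (S0 (Fj j) c) (S1 (Fj j) c) (S2 (Fj j) c)" for j by (rule S_op_fun[OF Fj])
 have y1: "nG (%e x. u e x - S0 (Fj j) c e x) <= b * hp j 1" for j
 proof -
  have "hp j s <= hp j 1" by (rule half_powr_antimono) (use s1 in simp)
  from mult_left_mono[OF this b] show ?thesis using y(1)[of j] by (rule order_trans[rotated])
 qed
 have y4: "nG (S2 (Fj j) c) <= b * hp j ((s - 1) - 1)" for j using y(4)[of j] by simp
 have "(%j. b * hp j (s - 1)) ----> 0"
  using s1 by (intro tendsto_mult_right_zero half_powr_tendsto_0) simp
 hence lim: "(%j. nG (%e x. S1 (Fj j) c e x - w e x)) ----> 0"
  by (rule Lim_null_comparison[rotated]) (use y(3) in \<open>simp add: nG_diff_commute[of _ w]\<close>)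
 obtain F where F: "form_fun F w" "AEeq F u"
  by (rule form_fun_limit[OF u(1) w b op_fun_form[OF opf] y1 y(2) lim])
 note AF = vert_fun_AC[OF form_fun_vert[OF F(1)]]
 have H1: "u \<in> Hk_graph G 1" by (rule vert_fun_Hk_graph[OF form_fun_vert[OF F(1)] F(2) u(1)])
 have D1: "AEeq (DG 1 u) w" by (rule AC_edges_Hk_edges(2)[OF AF F(2) u(1)])
 have D1L: "DG 1 u \<in> LG" by (rule D_graph_L2[OF Hk_graph_edges[OF H1]]) simp
 have H: "u \<in> H_graph G \<beta>"
 proof (cases "\<beta> = 1")
  case True
  thus ?thesis using H1 by (simp add: H_graph_def)
 next
  case False
  hence \<beta>: "1 < \<beta>" "\<beta> < 2" using s by auto
  have f: "nat \<lfloor>\<beta>\<rfloor> = 1" "frac \<beta> = \<beta> - 1" "\<beta> \<notin> \<int>"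
  proof -
   have fl: "\<lfloor>\<beta>\<rfloor> = 1" using \<beta> by (simp add: floor_eq_iff)
   thus "nat \<lfloor>\<beta>\<rfloor> = 1" "frac \<beta> = \<beta> - 1" by (simp_all add: frac_def)
   thus "\<beta> \<notin> \<int>" using \<beta> by (auto simp: frac_eq_0_iff[symmetric])
  qed
  have "DG 1 u \<in> Hfrac_edges G (\<beta> - 1)"
  proof (rule Hfrac_edges_if_dyadic[OF D1L _ _ _ b, where \<theta>' = "s - 1" and Y = "%j. S1 (Fj j) c" and y = "%j. S2 (Fj j) c"])
   fix j
   show "nG (%e x. DG 1 u e x - S1 (Fj j) c e x) <= b * hp j (s - 1)"
    using y(3)[of j] nG_cong_AE[OF LG_diff[OF D1L S_L2(2)[OF Fj]] LG_diff[OF w S_L2(2)[OF Fj]] AEeq_diff[OF D1 AEeq_refl]] by simp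
  qed (use \<beta> s y4 y(2) op_fun_AC[OF opf] in auto)
  thus ?thesis using f \<beta> H1 by (simp add: H_graph_def)
 qed
 have D: "u \<in> D_space G VD 1"
 proof (rule D_space_1I[OF u(1), of 1, OF _ _ _ F(2)])
  show "u e \<in> Hs_iv 1 (len G e)" if e: "e \<in> Ed" for e
   using Hk_iv_subset_Hs[OF len_pos[OF e], of 1 1] Hk_graph_edges[OF H1] e by (auto simp: Hk_edges_def)
  show "cont (len G e) (F e)" if e: "e \<in> Ed" for e by (rule AC_continuous[OF AF[OF e]])
  show "endv F e b = 0" if "v \<in> VD" "(e, b) \<in> Dir G v" for v e b using F(1) that by (auto simp: form_fun_def)
 qed simp
 have K: "u \<in> K_space G VK 1" if \<beta>: "3/2 <= \<beta>"
 proof -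
  \<comment> \<open>Likewise the Kirchhoff space asks for edge regularity strictly above 3/2,
    although \<beta> may equal 3/2.\<close>
  define t where "t = (\<beta> + s) / 2"
  have t: "3/2 < t" "t < s" "t < 2" using \<beta> s by (auto simp: t_def)
  have th: "1/2 < s - 1" "s - 1 <= 1" using \<beta> s by simp_all
  obtain P where P0: "\<forall>e\<in>Ed. cont (len G e) (P e)" "AEeq P w"
   and Pl0: "\<forall>e\<in>Ed. \<forall>x\<in>{0..len G e}. (%j. S1 (Fj j) c e x) ----> P e x"
   by (rule dyadic_limit_edges[OF w th b op_fun_AC[OF opf] y(3) y4])
  note P = P0[rule_format] and Pl = Pl0[rule_format]
  show ?thesis
  proof (rule K_space_1I[OF u(1) t(1) _ _ P(1) F(2)])
   fix e assume e: "e \<in> Ed"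
   have "w e \<in> Hfrac_iv (t - 1) (len G e)"
   proof (rule Hfrac_iv_if_AC[OF len_pos[OF e] LG_D[OF w e] _ _ th(2) b op_fun_AC[OF opf e] _ edge_dyadic[OF e y(3)]])
    show "nrm (len G e) (S1 (Fj j) c e) <= b" for j using nrm_le_nG[OF e, of "S1 (Fj j) c"] y(2)[of j] by linarith
    show "nrm (len G e) (S2 (Fj j) c e) <= b * hp j (s - 1 - 1)" for j using nrm_le_nG[OF e, of "S2 (Fj j) c"] y4[of j] by linarith
   qed (use t in auto)
   moreover have fl: "\<lfloor>t\<rfloor> = 1" using t by (simp add: floor_eq_iff)
   hence fr: "nat \<lfloor>t\<rfloor> = 1" "frac t = t - 1" by (simp_all add: frac_def)
   moreover have "t \<notin> \<int>" using t fr by (auto simp: frac_eq_0_iff[symmetric])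
   moreover have "u e \<in> Hk_iv 1 (len G e)" using Hk_graph_edges[OF H1] e by (simp add: Hk_edges_def)
   moreover have "has_weak_deriv 1 (len G e) (u e) (w e)"
    by (rule AC_has_weak_deriv[OF len_pos[OF e] AF[OF e] LG_D[OF u(1) e]]) (use F(2) e in \<open>simp add: AEeq_def\<close>)
   ultimately show "u e \<in> Hs_iv t (len G e)"
    by (intro Hs_iv_if_Hfrac[OF len_pos[OF e], where k = 1 and w = "w e"]) simp_all
   show "AC (len G e) (F e) (P e)"
    by (rule AC_cong_AE[OF AF[OF e] L2_iv_continuous[OF P(1)[OF e]]])
     (use AEeq_sym[OF P(2)] e in \<open>simp add: AEeq_def\<close>)
  next
   fix v assume v: "v \<in> VK"
   have "(%j. \<Sum>(e, b)\<in>Dir G v. outv (S1 (Fj j) c) e b) ----> (\<Sum>(e, b)\<in>Dir G v. outv P e b)"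
    unfolding case_prod_beta
    by (intro tendsto_sum outv_limit[where Y = "%j. S1 (Fj j) c" and F = P] Pl) (use Dir_arcs in force)+
   moreover have "(\<Sum>(e, b)\<in>Dir G v. outv (S1 (Fj j) c) e b) = 0" for j using opf[of j] v by (simp add: op_fun_def)
   ultimately have "(%j. 0) ----> (\<Sum>(e, b)\<in>Dir G v. outv P e b)" by simp
   thus "(\<Sum>(e, b)\<in>Dir G v. outv P e b) = 0" by (simp add: LIMSEQ_const_iff)
  qed
 qed
 have "u \<in> H_KD G VK VD \<beta>"
  unfolding H_KD_def using H D K space_0[OF u(1)] s H_KD_floors[of \<beta>] by auto
 with u(2) show ?thesis by blast
qed

text \<open>The half of the comparison that serves nonnegative orders, where the solution has to be
  exhibited as a function.\<close>

theorem H_KD_from_coefficients: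
 assumes c: "wsummable s c" and s: "0 <= \<beta>" "\<beta> < s" "s < 2"
 shows "\<exists>u\<in>H_KD G VK VD \<beta>. \<forall>i\<in>I. inn u (\<psi> i) = c i"
proof (cases "\<beta> < 1")
 case False
 thus ?thesis using H_KD_high[OF c] s by simp
next
 case True
 \<comment> \<open>Below order 1 the construction needs \<open>s <= 1\<close>; truncating
   \<open>s\<close> at 1 keeps it above \<beta>.\<close>
 have m: "0 < min s 1" "min s 1 <= 1" "\<beta> < min s 1" using s True by auto
 have c': "wsummable (min s 1) c" by (rule weighted_summable_mono[OF c]) simp
 show ?thesis
 proof (cases "\<beta> = 0")
  case True
  obtain u where "u \<in> LG" "\<forall>i\<in>I. inn u (\<psi> i) = c i" by (rule partial_sums_limit[OF c' m(1)])
  with True show ?thesis by (auto simp: H_KD_def)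
 next
  case False
  thus ?thesis using H_KD_low[OF c' _ m(3,2)] s by simp
 qed
qed

end

section \<open>Corrections of end values by localized bumps\<close>

lemma AC_piecewise:
 assumes c: "cont l F" and S: "finite S" and f: "f \<in> L2_iv l"
  and d: "!!x. x \<in> {0..l} - S ==> (F has_real_derivative f x) (at x)"
 shows "AC l F f"
proof -
 have "F x = F 0 + integral {0..x} f" if x: "x \<in> {0..l}" for x
 proof -
  have "(f has_integral (F x - F 0)) {0..x}"
  proof (rule fundamental_theorem_of_calculus_strong[OF S])
   show "0 <= x" using x by simp
   show "cont x F" by (rule continuous_on_subset[OF c]) (use x in auto)
   show "(F has_vector_derivative f y) (at y)" if "y \<in> {0..x} - S" for y
    using d[of y] that x by (auto simp: has_real_derivative_iff_has_vector_derivative[symmetric])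
  qed
  hence "integral {0..x} f = F x - F 0" by (rule integral_unique)
  thus ?thesis by simp
 qed
 with f show ?thesis unfolding AC_def by blast
qed

lemma nrm_le_support:
 assumes f: "f \<in> L2_iv l" and pq: "0 <= p" "p <= q" "q <= l" and C: "0 <= C"
  and b: "!!x. x \<in> {0..l} ==> \<bar>f x\<bar> <= C" and z: "!!x. x \<in> {0..l} ==> x \<notin> {p..q} ==> f x = 0"
 shows "nrm l f <= C * sqrt (q - p)"
proof -
 let ?M = "leb l"
 have m: "{p..q} \<in> sets ?M" using pq by (auto simp: sets_restrict_space_iff)
 have me: "measure ?M {p..q} = q - p" using pq by (subst measure_restrict_space) auto
 interpret finite_measure ?M by (rule finite_measure_iv)
 have "inner_iv l f f <= (LINT x|?M. C^2 * indicator {p..q} x)"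
  unfolding inner_iv_def
 proof (rule integral_mono)
  show "integrable ?M (%x. f x * f x)" by (rule L2_iv_mult_integrable[OF f f])
  show "integrable ?M (%x. C^2 * indicator {p..q} x)"
   by (intro integrable_mult_right integrable_real_indicator m) (simp add: emeasure_eq_measure)
  fix x assume "x \<in> space ?M"
  hence x: "x \<in> {0..l}" by simp
  have "f x * f x <= C^2" using b[OF x] abs_le_square_iff[of "f x" C] C by (simp add: power2_eq_square)
  thus "f x * f x <= C^2 * indicator {p..q} x" using z[OF x] by (auto simp: indicator_def)
 qed
 also have "... = C^2 * measure ?M ({p..q} \<inter> space ?M)" by (simp del: Int_atLeastAtMost space_lebesgue_on)
 also have "{p..q} \<inter> space ?M = {p..q}" using pq by auto
 also have "C^2 * measure ?M {p..q} = C^2 * (q - p)" by (simp only: me)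
 finally have "nrm l f <= sqrt (C^2 * (q - p))" unfolding nrm_def by (rule real_sqrt_le_mono)
 thus ?thesis using C by (simp add: real_sqrt_mult)
qed

text \<open>The zero mean of the bump lets it change the derivative at one end of an edge without changing
 the increment of the function along the edge.\<close>

definition bump :: "real => real" where "bump r = (if r <= 1 then (1 - r) * (1 - 3 * r) else 0)"
definition bump' :: "real => real" where "bump' r = (if r <= 1 then 6 * r - 4 else 0)"
text \<open>The polynomial r (1 - r)^2 vanishes at 0 and at 1, so its derivative (1 - r) (1 - 3 r)
  has mean zero on the unit interval, while being 1 at 0 and 0 at 1. At 1 only a kink remains, which
  \<open>AC_piecewise\<close> admits.\<close>

definition bump_primitive :: "real => real" where "bump_primitive r = (if r <= 1 then r * (1 - r)^2 else 0)"

text \<open>The bump occupies the fraction \<open>h\<close> of the edge next to the chosen end. For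
  \<open>h <= 1\<close> it vanishes at the other end, so both end values of an edge can be
  prescribed independently.\<close>

definition end_bump :: "real => bool => real => real => real" where
 "end_bump l b h x = bump ((if b then l - x else x) / (h * l))"
definition end_bump' :: "real => bool => real => real => real" where
 "end_bump' l b h x = (if b then - 1 else 1) / (h * l) * bump' ((if b then l - x else x) / (h * l))"

lemma continuous_bump: "continuous_on UNIV bump" "continuous_on UNIV bump_primitive"
proof -
 have c: "continuous_on ({..1} \<union> {1..}) (%r::real. if r <= 1 then g r else 0)" if "continuous_on {..1} g" "g 1 = 0" for g :: "real => real"
  using that by (intro continuous_on_If) auto
 have U: "UNIV = {..1} \<union> {1::real..}" by auto
 show "continuous_on UNIV bump" unfolding bump_def[abs_def] U by (intro c continuous_intros) simp
 show "continuous_on UNIV bump_primitive" unfolding bump_primitive_def[abs_def] U by (intro c continuous_intros) simp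
qed

lemma bump_deriv:
 assumes "r \<noteq> 1"
 shows "(bump has_real_derivative bump' r) (at r)" "(bump_primitive has_real_derivative bump r) (at r)"
proof -
 have *: "(G has_real_derivative g) (at r)"
  if "(H has_real_derivative g) (at r)" "open T" "r \<in> T" "!!x. x \<in> T ==> G x = H x" for G H :: "real => real" and g T
  by (rule has_field_derivative_transform_within_open[OF that(1-3)]) (simp add: that(4))
 have "(bump has_real_derivative bump' r) (at r) & (bump_primitive has_real_derivative bump r) (at r)"
 proof (cases "r < 1")
  case True
  have "(bump has_real_derivative bump' r) (at r)"
   by (rule *[of "%r. (1 - r) * (1 - 3 * r)" _ "{..<1}"])
    (use True in \<open>auto simp: bump_def bump'_def intro!: derivative_eq_intros\<close>)
  moreover have "(bump_primitive has_real_derivative bump r) (at r)"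
   by (rule *[of "%r. r * (1 - r)^2" _ "{..<1}"])
    (use True in \<open>auto simp: bump_def bump_primitive_def power2_eq_square algebra_simps intro!: derivative_eq_intros\<close>)
  ultimately show ?thesis by blast
 next
  case False
  with assms have r: "1 < r" by simp
  have "(bump has_real_derivative bump' r) (at r)"
   by (rule *[of "%r. 0" _ "{1<..}"]) (use r in \<open>auto simp: bump_def bump'_def\<close>)
  moreover have "(bump_primitive has_real_derivative bump r) (at r)"
   by (rule *[of "%r. 0" _ "{1<..}"]) (use r in \<open>auto simp: bump_def bump_primitive_def\<close>)
  ultimately show ?thesis by blast
 qed
 thus "(bump has_real_derivative bump' r) (at r)" "(bump_primitive has_real_derivative bump r) (at r)" by simp_all
qed

lemma bump_le: "0 <= r ==> \<bar>bump r\<bar> <= 1" "0 <= r ==> \<bar>bump' r\<bar> <= 4"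
proof -
 assume r: "0 <= r"
 show "\<bar>bump' r\<bar> <= 4" using r by (auto simp: bump'_def)
 show "\<bar>bump r\<bar> <= 1"
 proof (cases "r <= 1")
  case True
  have "(1 - r) * (1 - 3 * r) = 1 - r * (4 - 3 * r)" by (simp add: algebra_simps)
  moreover have "0 <= r * (4 - 3 * r)" using r True by simp
  moreover have "0 <= 3 * (r - 2/3)^2" by simp
  hence "r * (4 - 3 * r) <= 2" by (simp add: power2_eq_square algebra_simps)
  ultimately show ?thesis using True by (simp add: bump_def)
 qed (simp add: bump_def)
qed

lemma end_bump'_measurable: "end_bump' l b h \<in> borel_measurable (leb l)"
proof -
 have "end_bump' l b h \<in> borel_measurable borel"
  unfolding end_bump'_def[abs_def] bump'_def by measurable
 thus ?thesis by (simp add: measurable_completion measurable_restrict_space1)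
qed

lemma end_bump:
 assumes l: "0 < l" and h: "0 < h" "h <= 1"
 shows "AC l (end_bump l b h) (end_bump' l b h)"
  and "end_bump l b h (if b then l else 0) = 1" "end_bump l b h (if b then 0 else l) = 0"
  and "integral {0..l} (end_bump l b h) = 0"
  and "nrm l (end_bump l b h) <= sqrt l * sqrt h" "nrm l (end_bump' l b h) <= 4 / sqrt l / sqrt h"
proof -
 define s where "s x = (if b then l - x else x) / (h * l)" for x
 have hl: "0 < h * l" "h * l <= l" using l h by (simp_all add: mult_le_cancel_right1)
 have s: "0 <= s x" if "x \<in> {0..l}" for x using that hl by (auto simp: s_def)
 define x1 where "x1 = (if b then l - h * l else h * l)"
 have x1: "s x = 1 \<longleftrightarrow> x = x1" for x using hl by (auto simp: s_def x1_def field_simps)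
 have sd: "(s has_real_derivative (if b then - 1 else 1) / (h * l)) (at x)" for x
  unfolding s_def[abs_def] using hl by (cases b) (auto intro!: derivative_eq_intros)
 have cs: "cont l s" unfolding s_def[abs_def] using hl by (cases b) (auto intro!: continuous_intros)
 have eb: "end_bump l b h = (%x. bump (s x))" "end_bump' l b h = (%x. (if b then - 1 else 1) / (h * l) * bump' (s x))"
  by (auto simp: end_bump_def end_bump'_def s_def fun_eq_iff)
 have cb: "cont l (end_bump l b h)"
  unfolding eb by (rule continuous_on_compose2[OF continuous_bump(1) cs]) simp
 have bl': "\<bar>end_bump' l b h x\<bar> <= 4 / (h * l)" if "x \<in> {0..l}" for x
  using bump_le(2)[OF s[OF that]] hl h by (simp add: eb abs_mult divide_right_mono)
 have L': "end_bump' l b h \<in> L2_iv l" by (rule L2_iv_bounded[OF end_bump'_measurable AE_iv_I[OF bl']])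
 have L: "end_bump l b h \<in> L2_iv l" by (rule L2_iv_continuous[OF cb])
 show "AC l (end_bump l b h) (end_bump' l b h)"
 proof (rule AC_piecewise[OF cb _ L', of "{x1}"])
  fix x assume "x \<in> {0..l} - {x1}"
  hence "s x \<noteq> 1" using x1 by simp
  from DERIV_chain2[OF bump_deriv(1)[OF this] sd]
  show "(end_bump l b h has_real_derivative end_bump' l b h x) (at x)" by (simp add: eb mult.commute)
 qed simp
 show "end_bump l b h (if b then l else 0) = 1" by (simp add: end_bump_def bump_def)
 show "end_bump l b h (if b then 0 else l) = 0"
  using h l by (auto simp: end_bump_def bump_def)
 define Q where "Q x = (if b then - 1 else 1) * (h * l) * bump_primitive (s x)" for x
 have "AC l Q (end_bump l b h)"
 proof (rule AC_piecewise[OF _ _ L, of _ "{x1}"])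
  show "cont l Q" unfolding Q_def[abs_def]
   by (intro continuous_on_mult_left continuous_on_compose2[OF continuous_bump(2) cs]) simp
  fix x assume "x \<in> {0..l} - {x1}"
  hence "s x \<noteq> 1" using x1 by simp
  from DERIV_cmult[OF DERIV_chain2[OF bump_deriv(2)[OF this] sd], of "(if b then - 1 else 1) * (h * l)"]
  moreover have "(if b then - 1 else 1) * (h * l) * (bump (s x) * ((if b then - 1 else 1) / (h * l))) = bump (s x)"
   using hl h(1) by (cases b) simp_all
  ultimately show "(Q has_real_derivative end_bump l b h x) (at x)" unfolding eb Q_def[abs_def] by metis
 qed simp
 from AC_eq[OF this, of l] have "integral {0..l} (end_bump l b h) = Q l - Q 0" using l by simp
 also have "... = 0"
 proof -
  have "bump_primitive 0 = 0" "bump_primitive (l / (h * l)) = 0" using h l by (auto simp: bump_primitive_def)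
  thus ?thesis by (simp add: Q_def s_def)
 qed
 finally show "integral {0..l} (end_bump l b h) = 0" .
 define p q where "p = (if b then l - h * l else 0)" and "q = (if b then l else h * l)"
 have pq: "0 <= p" "p <= q" "q <= l" "q - p = h * l" using hl by (auto simp: p_def q_def)
 have out: "1 < s x" if "x \<in> {0..l}" "x \<notin> {p..q}" for x
  using that hl by (auto simp: s_def p_def q_def field_simps split: if_splits)
 have bump_out: "bump (s x) = 0" if "x \<in> {0..l}" "x \<notin> {p..q}" for x
  using out[OF that] by (simp add: bump_def)
 have "nrm l (end_bump l b h) <= 1 * sqrt (q - p)"
  by (rule nrm_le_support[OF L pq(1-3)]) (use bump_le(1)[OF s] bump_out in \<open>simp_all add: eb\<close>)
 thus "nrm l (end_bump l b h) <= sqrt l * sqrt h" by (simp add: pq(4) real_sqrt_mult mult.commute)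
 have "nrm l (end_bump' l b h) <= 4 / (h * l) * sqrt (q - p)"
 proof (rule nrm_le_support[OF L' pq(1-3) _ bl'])
  show "end_bump' l b h x = 0" if "x \<in> {0..l}" "x \<notin> {p..q}" for x
   using out[OF that] by (simp add: eb bump'_def)
 qed (use hl in auto)
 also have "... = 4 / sqrt l / sqrt h"
 proof -
  have "h = sqrt h * sqrt h" "l = sqrt l * sqrt l" using h l by simp_all
  thus ?thesis unfolding pq(4) real_sqrt_mult using h l by (simp add: field_simps)
 qed
 finally show "nrm l (end_bump' l b h) <= 4 / sqrt l / sqrt h" .
qed

context metric_graph_loc
begin

text \<open>\<open>d\<close> lists the end values to be produced; the width of the bumps is tied to
  the scale (1/2)^j of the approximation being corrected.\<close>

definition corr :: "('e => bool => real) => nat => 'e graph_fun" where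
 "corr d j e x = d e False * end_bump (len G e) False ((1/2) ^ j) x + d e True * end_bump (len G e) True ((1/2) ^ j) x"
definition corr' :: "('e => bool => real) => nat => 'e graph_fun" where
 "corr' d j e x = d e False * end_bump' (len G e) False ((1/2) ^ j) x + d e True * end_bump' (len G e) True ((1/2) ^ j) x"

lemma corr:
 assumes e: "e \<in> Ed"
 shows "AC (len G e) (corr d j e) (corr' d j e)" "endv (corr d j) e b = d e b" "integral {0..len G e} (corr d j e) = 0"
proof -
 note E = end_bump[OF len_pos[OF e] half_power_pos half_power_le_1]
 show "AC (len G e) (corr d j e) (corr' d j e)"
  unfolding corr_def[abs_def] corr'_def[abs_def] by (rule AC_lin[OF E(1) E(1)])
 show "endv (corr d j) e b = d e b"
  using E(2,3)[of True j] E(2,3)[of False j] by (simp add: endv_def corr_def)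
 have i: "end_bump (len G e) c ((1/2) ^ j) integrable_on {0..len G e}" for c
  by (rule L2_iv_integrable_on[OF AC_L2_fun[OF E(1)]]) auto
 show "integral {0..len G e} (corr d j e) = 0"
  unfolding corr_def[abs_def]
  by (subst integral_add) (use E(4) in \<open>auto intro!: integrable_on_mult_right i\<close>)
qed

abbreviation (input) "corr_le K \<equiv> \<forall>d M \<theta> j. 0 <= M --> (\<forall>e\<in>Ed. \<forall>b. \<bar>d e b\<bar> <= M * hp j (\<theta> - 1/2)) -->
  nG (corr d j) <= K * M * hp j \<theta> & nG (corr' d j) <= K * M * hp j (\<theta> - 1)"

text \<open>End values of size h^(\<theta> - 1/2) times the bump norms of order h^(1/2) and h^(-1/2)
  give h^\<theta> and h^(\<theta> - 1): the correction is no larger than the error and the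
  derivative of what it corrects.\<close>

lemma corr_norm:
 "\<exists>K\<ge>0. corr_le K"
proof -
 define K where "K = (\<Sum>e\<in>Ed. 2 * sqrt (len G e)) + (\<Sum>e\<in>Ed. 8 / sqrt (len G e))"
 have K1: "0 <= (\<Sum>e\<in>Ed. 2 * sqrt (len G e))" "0 <= (\<Sum>e\<in>Ed. 8 / sqrt (len G e))"
  using len_pos by (auto intro!: sum_nonneg simp: less_imp_le)
 have "nG (corr d j) <= K * M * hp j \<theta> & nG (corr' d j) <= K * M * hp j (\<theta> - 1)"
  if M: "0 <= M" and d: "\<forall>e\<in>Ed. \<forall>b. \<bar>d e b\<bar> <= M * hp j (\<theta> - 1/2)" for d M \<theta> j
 proof -
  let ?h = "(1/2 :: real) ^ j"
  define m where "m = M * hp j (\<theta> - 1/2)"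
  have sq: "sqrt ?h = hp j (1/2)" by (simp add: powr_half_sqrt)
  have m1: "m * sqrt ?h = M * hp j \<theta>" unfolding m_def sq by (simp add: powr_add[symmetric])
  have m2: "m / sqrt ?h = M * hp j (\<theta> - 1)"
  proof -
   have "hp j (\<theta> - 1/2) / hp j (1/2) = hp j (\<theta> - 1)" by (simp add: powr_diff[symmetric])
   thus ?thesis unfolding m_def sq by (metis times_divide_eq_right)
  qed
  have bd: "nrm (len G e) (corr d j e) <= 2 * sqrt (len G e) * (m * sqrt ?h)"
   "nrm (len G e) (corr' d j e) <= 8 / sqrt (len G e) * (m / sqrt ?h)" if e: "e \<in> Ed" for e
  proof -
   note E = end_bump[OF len_pos[OF e] half_power_pos half_power_le_1]
   have dm: "\<bar>d e c\<bar> <= m" for c using d e by (simp add: m_def)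
   have *: "nrm (len G e) (%x. d e False * f False x + d e True * f True x) <= 2 * B * m"
    if f: "!!c. f c \<in> L2_iv (len G e)" "!!c. nrm (len G e) (f c) <= B" for f B
   proof -
    have "nrm (len G e) (%x. d e False * f False x + d e True * f True x)
     <= nrm (len G e) (%x. d e False * f False x) + nrm (len G e) (%x. d e True * f True x)"
     by (intro nrm_add L2_iv_cmult f)
    also have "... <= m * B + m * B" unfolding nrm_cmult
     by (intro add_mono mult_mono dm f) (use dm[of True] in auto)
    finally show ?thesis by (simp add: mult_ac)
   qed
   have "nrm (len G e) (corr d j e) <= 2 * (sqrt (len G e) * sqrt ?h) * m"
    unfolding corr_def[abs_def] by (rule *[OF AC_L2_fun[OF E(1)] E(5)])
   thus "nrm (len G e) (corr d j e) <= 2 * sqrt (len G e) * (m * sqrt ?h)" by (simp add: mult_ac)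
   have "nrm (len G e) (corr' d j e) <= 2 * (4 / sqrt (len G e) / sqrt ?h) * m"
    unfolding corr'_def[abs_def] by (rule *[OF AC_L2[OF E(1)] E(6)])
   thus "nrm (len G e) (corr' d j e) <= 8 / sqrt (len G e) * (m / sqrt ?h)" by (simp add: mult_ac)
  qed
  have n0: "0 <= M * hp j \<theta>" "0 <= M * hp j (\<theta> - 1)" using M by simp_all
  have "nG (corr d j) <= (\<Sum>e\<in>Ed. 2 * sqrt (len G e)) * (M * hp j \<theta>)"
   by (rule nG_le_if_edges) (use bd(1) m1 in simp)
  also have "... <= K * (M * hp j \<theta>)" using K1 n0 by (intro mult_right_mono) (auto simp: K_def)
  finally have 1: "nG (corr d j) <= K * M * hp j \<theta>" by (simp only: mult.assoc)
  have "nG (corr' d j) <= (\<Sum>e\<in>Ed. 8 / sqrt (len G e)) * (M * hp j (\<theta> - 1))"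
   by (rule nG_le_if_edges) (use bd(2) m2 in simp)
  also have "... <= K * (M * hp j (\<theta> - 1))" using K1 n0 by (intro mult_right_mono) (auto simp: K_def)
  finally have 2: "nG (corr' d j) <= K * M * hp j (\<theta> - 1)" by (simp only: mult.assoc)
  from 1 2 show ?thesis by blast
 qed
 moreover have "0 <= K" using K1 by (simp add: K_def)
 ultimately show ?thesis by blast
qed

section \<open>Linearity of the Sobolev spaces with vertex conditions\<close>

lemma continuous_graph_lin:
 assumes u: "continuous_graph G u" and v: "continuous_graph G v" and z: "AEeq z (lc c u d v)"
 shows "continuous_graph G z"
proof -
 from u obtain U where U: "\<forall>e\<in>Ed. cont (len G e) (U e) & (aeq (len G e) (U e) (u e))"
  "\<forall>v\<in>verts G. \<exists>c. \<forall>(e, b)\<in>Dir G v. U e (natural_param G e b 0) = c"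
  unfolding continuous_graph_def by (elim exE conjE)
 from v obtain V where V: "\<forall>e\<in>Ed. cont (len G e) (V e) & (aeq (len G e) (V e) (v e))"
  "\<forall>v\<in>verts G. \<exists>c. \<forall>(e, b)\<in>Dir G v. V e (natural_param G e b 0) = c"
  unfolding continuous_graph_def by (elim exE conjE)
 define Z where "Z e x = c * U e x + d * V e x" for e x
 have "AEeq U u" "AEeq V v" using U(1) V(1) by (auto simp: AEeq_def)
 from AEeq_trans[OF AEeq_lin[OF this] AEeq_sym[OF z]] have "AEeq Z z" by (simp add: Z_def[abs_def])
 moreover have "cont (len G e) (Z e)" if "e \<in> Ed" for e
  unfolding Z_def[abs_def] using U(1) V(1) that by (intro continuous_intros) auto
 moreover have "\<exists>c. \<forall>(e, b)\<in>Dir G v. Z e (natural_param G e b 0) = c" if v: "v \<in> verts G" for v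
 proof -
  obtain p q where "\<forall>(e, b)\<in>Dir G v. U e (natural_param G e b 0) = p" "\<forall>(e, b)\<in>Dir G v. V e (natural_param G e b 0) = q"
   using bspec[OF U(2) v] bspec[OF V(2) v] by (elim exE)
  hence "\<forall>(e, b)\<in>Dir G v. Z e (natural_param G e b 0) = c * p + d * q" by (auto simp: Z_def)
  thus ?thesis by blast
 qed
 ultimately show ?thesis unfolding continuous_graph_def by (intro exI[of _ Z]) (simp add: AEeq_def)
qed

lemma Hk_edges_lin:
 assumes "u \<in> Hk_edges G k" "v \<in> Hk_edges G k"
 shows "(lc c u d v) \<in> Hk_edges G k"
 using assms by (simp add: Hk_edges_def Hk_iv_lin)

lemma D_graph_lin:
 assumes "u \<in> Hk_edges G k" "v \<in> Hk_edges G k" "j <= k"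
 shows "AEeq (DG j (lc c u d v)) (%e x. c * DG j u e x + d * DG j v e x)"
 unfolding AEeq_def D_graph_def
 by (intro ballI weak_deriv_lin_AE[OF len_pos]) (use assms in \<open>auto simp: Hk_edges_def\<close>)

lemma Hk_graph_lin:
 assumes u: "u \<in> Hk_graph G k" and v: "v \<in> Hk_graph G k"
 shows "(lc c u d v) \<in> Hk_graph G k"
proof -
 have "continuous_graph G (DG (2 * m) (lc c u d v))" if m: "int m <= (int k - 1) div 2" for m
 proof (rule continuous_graph_lin)
  show "continuous_graph G (DG (2 * m) u)" "continuous_graph G (DG (2 * m) v)"
   using u v m by (simp_all add: Hk_graph_def)
  have "2 * m <= k" using m by presburger
  thus "AEeq (DG (2 * m) (lc c u d v)) (%e x. c * DG (2 * m) u e x + d * DG (2 * m) v e x)"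
   by (rule D_graph_lin[OF Hk_graph_edges[OF u] Hk_graph_edges[OF v]])
 qed
 thus ?thesis using Hk_edges_lin[OF Hk_graph_edges[OF u] Hk_graph_edges[OF v]] by (simp add: Hk_graph_def)
qed

lemma Hk_graph_norm_1_lin:
 assumes "u \<in> Hk_edges G 1" "v \<in> Hk_edges G 1"
 shows "N1 (lc c u d v) <= \<bar>c\<bar> * N1 u + \<bar>d\<bar> * N1 v"
proof -
 let ?N = "%u e. Hk_iv_norm 1 (len G e) (u e)"
 have n: "N1 u = L2_set (?N u) (Ed)" for u by (simp add: Hk_graph_norm_def L2_set_def)
 have "L2_set (?N (lc c u d v)) (Ed) <= L2_set (%e. \<bar>c\<bar> * ?N u e + \<bar>d\<bar> * ?N v e) (Ed)"
  by (rule L2_set_mono) (use assms Hk_iv_norm_1_lin[OF len_pos] Hk_iv_norm_nonneg in \<open>auto simp: Hk_edges_def\<close>)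
 also have "... <= L2_set (%e. \<bar>c\<bar> * ?N u e) (Ed) + L2_set (%e. \<bar>d\<bar> * ?N v e) (Ed)"
  by (rule L2_set_triangle_ineq)
 also have "... = \<bar>c\<bar> * L2_set (?N u) (Ed) + \<bar>d\<bar> * L2_set (?N v) (Ed)"
  by (simp add: L2_set_right_distrib)
 finally show ?thesis unfolding n .
qed

text \<open>\<open>X1\<close> is left open in order to serve both for functions continuous across
  the vertices and for edgewise H^1 functions.\<close>

lemma interp_graph_lin:
 assumes X1: "X1 \<subseteq> Hk_edges G 1" "X1 \<noteq> {}" "!!x y. x \<in> X1 ==> y \<in> X1 ==> (%e t. c * x e t + d * y e t) \<in> X1"
  and u: "u \<in> interp \<theta> LG nG X1 (N1)" and v: "v \<in> interp \<theta> LG nG X1 (N1)"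
  and z: "z \<in> LG" "AEeq z (lc c u d v)"
 shows "z \<in> interp \<theta> LG nG X1 (N1)"
proof -
 have uL: "u \<in> LG" and vL: "v \<in> LG" using u v by (simp_all add: interp_def)
 have "interp_norm_sq \<theta> nG X1 (N1) z < \<infinity>"
 proof (rule interp_norm_sq_combine[where A = "\<bar>c\<bar>" and B = "\<bar>d\<bar>" and x = u and y = v,
    OF nG_nonneg Hk_graph_norm_nonneg X1(2)])
  show "interp_norm_sq \<theta> nG X1 (N1) u < \<infinity>" "interp_norm_sq \<theta> nG X1 (N1) v < \<infinity>"
   using u v by (simp_all add: interp_def)
  fix x y assume xy: "x \<in> X1" "y \<in> X1"
  have xL: "x \<in> LG" and yL: "y \<in> LG" using xy X1(1) Hk_edges_L2 by blast+
  let ?z = "%e t. c * x e t + d * y e t"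
  have "nG (%e t. z e t - ?z e t) = nG (%e t. (c * u e t + d * v e t) - ?z e t)"
   by (rule nG_cong_AE[OF LG_diff[OF z(1) LG_lin[OF xL yL]] LG_diff[OF LG_lin[OF uL vL] LG_lin[OF xL yL]] AEeq_diff[OF z(2) AEeq_refl]])
  also have "... = nG (%e t. c * (u e t - x e t) + d * (v e t - y e t))" by (simp add: algebra_simps)
  also have "... <= \<bar>c\<bar> * nG (%e t. u e t - x e t) + \<bar>d\<bar> * nG (%e t. v e t - y e t)"
   by (rule nG_lin[OF LG_diff[OF uL xL] LG_diff[OF vL yL]])
  finally have "nG (z - ?z) <= \<bar>c\<bar> * nG (u - x) + \<bar>d\<bar> * nG (v - y)" by (simp add: fun_diff_def)
  moreover have "N1 ?z <= \<bar>c\<bar> * N1 x + \<bar>d\<bar> * N1 y"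
   by (rule Hk_graph_norm_1_lin) (use xy X1(1) in auto)
  ultimately show "\<exists>z1\<in>X1. nG (z - z1) <= \<bar>c\<bar> * nG (u - x) + \<bar>d\<bar> * nG (v - y) &
    N1 z1 <= \<bar>c\<bar> * N1 x + \<bar>d\<bar> * N1 y"
   using X1(3)[OF xy] by blast
 qed simp_all
 with z(1) show ?thesis by (simp add: interp_def)
qed

lemma Hfrac_lin:
 assumes z: "z \<in> LG" "AEeq z (lc c u d v)"
 shows "u \<in> Hfrac_graph G \<theta> ==> v \<in> Hfrac_graph G \<theta> ==> z \<in> Hfrac_graph G \<theta>"
  and "u \<in> Hfrac_edges G \<theta> ==> v \<in> Hfrac_edges G \<theta> ==> z \<in> Hfrac_edges G \<theta>"
proof -
 show "u \<in> Hfrac_graph G \<theta> ==> v \<in> Hfrac_graph G \<theta> ==> z \<in> Hfrac_graph G \<theta>"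
  unfolding Hfrac_graph_def
  by (rule interp_graph_lin[OF _ _ _ _ _ z]) (use zero_Hk_graph_1(1) Hk_graph_edges in \<open>auto intro: Hk_graph_lin\<close>)
 show "u \<in> Hfrac_edges G \<theta> ==> v \<in> Hfrac_edges G \<theta> ==> z \<in> Hfrac_edges G \<theta>"
  unfolding Hfrac_edges_def
  by (rule interp_graph_lin[OF _ _ _ _ _ z]) (use zero_Hk_graph_1(2) in \<open>auto intro: Hk_edges_lin\<close>)
qed

lemma Hfrac_L2: "u \<in> Hfrac_graph G \<theta> ==> u \<in> LG" "u \<in> Hfrac_edges G \<theta> ==> u \<in> LG"
 by (simp_all add: Hfrac_graph_def Hfrac_edges_def interp_def)

lemma H_graph_lin:
 assumes u: "u \<in> H_graph G \<gamma>" and v: "v \<in> H_graph G \<gamma>"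
 shows "(lc c u d v) \<in> H_graph G \<gamma>"
proof -
 let ?k = "nat \<lfloor>\<gamma>\<rfloor>" and ?z = "%e x. c * u e x + d * v e x"
 consider "\<gamma> \<in> \<int>" | "\<gamma> \<notin> \<int>" "\<gamma> < 1" | "\<gamma> \<notin> \<int>" "\<not> \<gamma> < 1" by blast
 thus ?thesis
 proof cases
  case 1
  thus ?thesis using u v Hk_graph_lin by (simp add: H_graph_def)
 next
  case 2
  hence uv: "u \<in> Hfrac_graph G \<gamma>" "v \<in> Hfrac_graph G \<gamma>" using u v by (simp_all add: H_graph_def)
  have "?z \<in> Hfrac_graph G \<gamma>" by (rule Hfrac_lin(1)[OF LG_lin[OF Hfrac_L2(1)[OF uv(1)] Hfrac_L2(1)[OF uv(2)]] AEeq_refl uv])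
  thus ?thesis using 2 by (simp add: H_graph_def)
 next
  case 3
  define X where "X = (if odd ?k then Hfrac_edges G (frac \<gamma>) else Hfrac_graph G (frac \<gamma>))"
  have H: "H_graph G \<gamma> = {u \<in> Hk_graph G ?k. DG ?k u \<in> X}"
   using 3 by (auto simp: H_graph_def X_def Let_def)
  have uv: "u \<in> Hk_graph G ?k" "v \<in> Hk_graph G ?k" "DG ?k u \<in> X" "DG ?k v \<in> X"
   using u v unfolding H by auto
  have z: "?z \<in> Hk_graph G ?k" by (rule Hk_graph_lin[OF uv(1,2)])
  have "DG ?k ?z \<in> LG" by (rule D_graph_L2[OF Hk_graph_edges[OF z]]) simp
  moreover have "AEeq (DG ?k ?z) (%e x. c * DG ?k u e x + d * DG ?k v e x)"
   by (rule D_graph_lin[OF Hk_graph_edges[OF uv(1)] Hk_graph_edges[OF uv(2)]]) simp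
  ultimately have "DG ?k ?z \<in> X"
   using uv(3,4) Hfrac_lin unfolding X_def by (simp split: if_splits)
  with z show ?thesis unfolding H by blast
 qed
qed

lemma incident_edges_Dir: "v \<in> V ==> (e, b) \<in> Dir G v ==> e \<in> incident_edges G V"
 by (auto simp: incident_edges_def Dir_def split: if_splits)

lemma incident_edges_arcs: "e \<in> incident_edges G V ==> e \<in> Ed"
 by (simp add: incident_edges_def)

text \<open>Two members of a vertex condition space may come with different regularity exponents;
  the smaller one serves for both.\<close>

lemma Hs_common:
 assumes "\<exists>s>a. \<forall>e\<in>incident_edges G V. u e \<in> Hs_iv s (len G e)" "\<exists>s>a. \<forall>e\<in>incident_edges G V. v e \<in> Hs_iv s (len G e)" "0 <= a"
 obtains s where "a < s" "\<forall>e\<in>incident_edges G V. u e \<in> Hs_iv s (len G e)" "\<forall>e\<in>incident_edges G V. v e \<in> Hs_iv s (len G e)"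
proof -
 from assms(1) obtain s1 where 1: "a < s1" "\<forall>e\<in>incident_edges G V. u e \<in> Hs_iv s1 (len G e)" by blast
 from assms(2) obtain s2 where 2: "a < s2" "\<forall>e\<in>incident_edges G V. v e \<in> Hs_iv s2 (len G e)" by blast
 show thesis
 proof (rule that[of "min s1 s2"])
  show "a < min s1 s2" using 1 2 by simp
  show "\<forall>e\<in>incident_edges G V. u e \<in> Hs_iv (min s1 s2) (len G e)"
   using 1 2 assms(3) Hs_iv_mono[OF len_pos[OF incident_edges_arcs], of _ V "min s1 s2" s1] by fastforce
  show "\<forall>e\<in>incident_edges G V. v e \<in> Hs_iv (min s1 s2) (len G e)"
   using 1 2 assms(3) Hs_iv_mono[OF len_pos[OF incident_edges_arcs], of _ V "min s1 s2" s2] by fastforce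
 qed
qed

lemma Hs_weak_deriv_lin:
 assumes e: "e \<in> Ed" and s: "real m <= s" and uv: "u e \<in> Hs_iv s (len G e)" "v e \<in> Hs_iv s (len G e)"
 shows "AE x in leb (len G e). DG m (lc c u d v) e x
  = c * DG m u e x + d * DG m v e x"
 unfolding D_graph_def
 by (rule weak_deriv_lin_AE[OF len_pos[OF e]]) (use uv s Hs_iv_subset_Hk le_nat_floor in blast)+

lemma AE_lin_trans:
 assumes "aeq l F u" "aeq l F' u'"
  "AE x in leb l. z x = c * u x + d * u' x"
 shows "AE x in leb l. c * F x + d * F' x = z x"
 using assms by eventually_elim simp

text \<open>\<open>outward_deriv\<close> differentiates a chosen continuous representative, so
  additivity is shown through C^1 representatives. They exist because the exponent exceeds 2 n -
  1/2, which is at least 2 j + 3/2 for \<open>j < n\<close>.\<close>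

lemma K_space_lin:
 assumes u: "u \<in> K_space G V n" and v: "v \<in> K_space G V n"
 shows "(lc c u d v) \<in> K_space G V n"
proof (cases "n = 0")
 case True
 thus ?thesis using u v LG_lin by (simp add: K_space_def)
next
 case False
 let ?z = "%e x. c * u e x + d * v e x"
 have L: "u \<in> LG" "v \<in> LG" using u v by (simp_all add: K_space_def)
 have a0: "0 <= 2 * real n - 1/2" using False by (cases n) auto
 obtain s where s: "2 * real n - 1/2 < s" and us: "\<forall>e\<in>incident_edges G V. u e \<in> Hs_iv s (len G e)"
  and vs: "\<forall>e\<in>incident_edges G V. v e \<in> Hs_iv s (len G e)"
  using Hs_common[OF _ _ a0, of V u v] u v False by (auto simp: K_space_def)
 have "\<forall>e\<in>incident_edges G V. ?z e \<in> Hs_iv s (len G e)"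
  using us vs Hs_iv_lin[OF len_pos[OF incident_edges_arcs]] by blast
 moreover have "(\<Sum>(e, b)\<in>Dir G w. outward_deriv G e b (DG (2 * j) ?z)) = 0" if w: "w \<in> V" and j: "j < n" for w j
 proof -
  have sj: "real (2 * j) + 3/2 < s" using s j by linarith
  have "outward_deriv G e b (DG (2 * j) ?z)
   = c * outward_deriv G e b (DG (2 * j) u) + d * outward_deriv G e b (DG (2 * j) v)"
   if D: "(e, b) \<in> Dir G w" for e b
  proof -
   have e: "e \<in> Ed" by (rule Dir_arcs[OF D])
   have ue: "u e \<in> Hs_iv s (len G e)" "v e \<in> Hs_iv s (len G e)"
    using us vs incident_edges_Dir[OF w D] by auto
   obtain F f where F: "AC (len G e) F f" "cont (len G e) f"
    "AE x in leb (len G e). F x = DG (2 * j) u e x"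
    using Hs_iv_C1_weak_deriv[OF len_pos[OF e] sj ue(1)] unfolding D_graph_def by (elim exE conjE)
   obtain F' f' where F': "AC (len G e) F' f'" "cont (len G e) f'"
    "AE x in leb (len G e). F' x = DG (2 * j) v e x"
    using Hs_iv_C1_weak_deriv[OF len_pos[OF e] sj ue(2)] unfolding D_graph_def by (elim exE conjE)
   have "real (2 * j) <= s" using sj by simp
   note ae = AE_lin_trans[OF F(3) F'(3) Hs_weak_deriv_lin[where u = u and v = v, OF e this ue]]
   have "outward_deriv G e b (DG (2 * j) u) = outv (%_. f) e b"
    by (rule outward_deriv_eq[where y = "%_. F" and p = "%_. f" and u = "DG (2 * j) u", OF e F])
   moreover have "outward_deriv G e b (DG (2 * j) v) = outv (%_. f') e b"
    by (rule outward_deriv_eq[where y = "%_. F'" and p = "%_. f'" and u = "DG (2 * j) v", OF e F'])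
   moreover have "outward_deriv G e b (DG (2 * j) ?z) = outv (%_ x. c * f x + d * f' x) e b"
    by (rule outward_deriv_eq[where y = "%_ x. c * F x + d * F' x" and p = "%_ x. c * f x + d * f' x"
      and u = "DG (2 * j) ?z", OF e AC_lin[OF F(1) F'(1)] _ ae])
     (intro continuous_intros F(2) F'(2))
   ultimately show ?thesis by (simp add: outv_def algebra_simps)
  qed
  hence "(\<Sum>(e, b)\<in>Dir G w. outward_deriv G e b (DG (2 * j) ?z))
   = (\<Sum>(e, b)\<in>Dir G w. c * outward_deriv G e b (DG (2 * j) u) + d * outward_deriv G e b (DG (2 * j) v))"
   by (intro sum.cong) auto
  also have "... = c * (\<Sum>(e, b)\<in>Dir G w. outward_deriv G e b (DG (2 * j) u))
   + d * (\<Sum>(e, b)\<in>Dir G w. outward_deriv G e b (DG (2 * j) v))"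
   by (simp add: case_prod_beta sum.distrib sum_distrib_left)
  also have "... = 0" using u v w j by (auto simp: K_space_def)
  finally show ?thesis .
 qed
 ultimately show ?thesis using LG_lin[OF L] s by (auto simp: K_space_def)
qed

lemma D_space_end_value:
 assumes u: "u \<in> D_space G V n" and w: "w \<in> V" "j < n" and D: "(e, b) \<in> Dir G w"
 shows "end_value G e b (DG (2 * j) u) = 0"
proof -
 have "\<forall>x\<in>Dir G w. case x of (e, b) => end_value G e b (DG (2 * j) u) = 0"
  using u w unfolding D_space_def by blast
 from bspec[OF this D] show ?thesis by simp
qed

lemma D_space_lin:
 assumes u: "u \<in> D_space G V n" and v: "v \<in> D_space G V n"
 shows "(lc c u d v) \<in> D_space G V n"
proof (cases "n = 0")
 case True
 thus ?thesis using u v LG_lin by (simp add: D_space_def)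
next
 case False
 let ?z = "%e x. c * u e x + d * v e x"
 have L: "u \<in> LG" "v \<in> LG" using u v by (simp_all add: D_space_def)
 have a0: "0 <= 2 * real n - 3/2" using False by (cases n) auto
 obtain s where s: "2 * real n - 3/2 < s" and us: "\<forall>e\<in>incident_edges G V. u e \<in> Hs_iv s (len G e)"
  and vs: "\<forall>e\<in>incident_edges G V. v e \<in> Hs_iv s (len G e)"
  using Hs_common[OF _ _ a0, of V u v] u v False by (auto simp: D_space_def)
 have "\<forall>e\<in>incident_edges G V. ?z e \<in> Hs_iv s (len G e)"
  using us vs Hs_iv_lin[OF len_pos[OF incident_edges_arcs]] by blast
 moreover have "end_value G e b (DG (2 * j) ?z) = 0" if w: "w \<in> V" and j: "j < n" and D: "(e, b) \<in> Dir G w" for w j e b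
 proof -
  have sj: "real (2 * j) + 1/2 < s" using s j by linarith
  have e: "e \<in> Ed" by (rule Dir_arcs[OF D])
  have ue: "u e \<in> Hs_iv s (len G e)" "v e \<in> Hs_iv s (len G e)"
   using us vs incident_edges_Dir[OF w D] by auto
  obtain F where F: "cont (len G e) F" "AE x in leb (len G e). F x = DG (2 * j) u e x"
   using Hs_iv_continuous_weak_deriv[OF len_pos[OF e] sj ue(1)] unfolding D_graph_def by (elim exE conjE)
  obtain F' where F': "cont (len G e) F'" "AE x in leb (len G e). F' x = DG (2 * j) v e x"
   using Hs_iv_continuous_weak_deriv[OF len_pos[OF e] sj ue(2)] unfolding D_graph_def by (elim exE conjE)
  have "real (2 * j) <= s" using sj by simp
  note ae = AE_lin_trans[OF F(2) F'(2) Hs_weak_deriv_lin[where u = u and v = v, OF e this ue]]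
  have "end_value G e b (DG (2 * j) u) = endv (%_. F) e b" by (rule end_value_eq[where y = "%_. F" and u = "DG (2 * j) u", OF e F])
  moreover have "end_value G e b (DG (2 * j) v) = endv (%_. F') e b" by (rule end_value_eq[where y = "%_. F'" and u = "DG (2 * j) v", OF e F'])
  moreover have "end_value G e b (DG (2 * j) ?z) = endv (%_ x. c * F x + d * F' x) e b"
   by (rule end_value_eq[where y = "%_ x. c * F x + d * F' x" and u = "DG (2 * j) ?z", OF e _ ae]) (intro continuous_intros F(1) F'(1))
  moreover have "end_value G e b (DG (2 * j) u) = 0" "end_value G e b (DG (2 * j) v) = 0"
   by (rule D_space_end_value[OF u w j D], rule D_space_end_value[OF v w j D])
  ultimately show ?thesis by (simp add: endv_def)
 qed
 ultimately show ?thesis using LG_lin[OF L] s by (auto simp: D_space_def)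
qed

text \<open>Used when a functional on the spectral space is restricted to this one: the linearity
  clause of \<open>dual_space\<close> evaluates it at linear combinations.\<close>

lemma H_KD_lin:
 assumes "u \<in> H_KD G VK VD \<gamma>" "v \<in> H_KD G VK VD \<gamma>"
 shows "(lc c u d v) \<in> H_KD G VK VD \<gamma>"
 using assms LG_lin H_graph_lin K_space_lin D_space_lin by (auto simp: H_KD_def split: if_splits)

end

context metric_graph_loc
begin

text \<open>Below order 1/2 the end values of the approximations may grow, and the reference value is 0;
 above it they converge to those of the continuous representative.\<close>

abbreviation (input) "end_bound \<theta> M b Y u \<equiv> \<exists>F. (1/2 < \<theta> --> (\<forall>e\<in>Ed. cont (len G e) (F e)) & AEeq F u) &
  (\<theta> < 1/2 --> F = (%e x. 0)) &
  (\<forall>j::nat. \<forall>e\<in>Ed. \<forall>c. \<bar>endv (Y j) e c - endv F e c\<bar> <= M * b * hp j (\<theta> - 1/2))"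
abbreviation (input) "end_bounds \<theta> M \<equiv> \<forall>u b Y y. u \<in> LG --> 0 <= b --> (\<forall>j. \<forall>e\<in>Ed. AC (len G e) (Y j e) (y j e)) -->
  (\<forall>j::nat. dG u (Y j) <= b * hp j \<theta>) -->
  (\<forall>j. nG (y j) <= b * hp j (\<theta> - 1)) --> nG (Y 0) <= b --> end_bound \<theta> M b Y u"

text \<open>Joins \<open>AC_dyadic_growth\<close> and \<open>AC_dyadic_limit\<close>. At \<theta> =
  1/2 the increments of point values are merely bounded, and neither geometric series is
  available.\<close>

lemma dyadic_endv:
 assumes th: "0 < \<theta>" "\<theta> <= 1" "\<theta> \<noteq> 1/2"
 shows "\<exists>M\<ge>0. end_bounds \<theta> M"
proof -
 define A where "A e = \<bar>sqrt (1 / len G e + 2) + sqrt (4 / len G e + 12) / ((1/2) powr (\<theta> - 1/2) - 1)\<bar>" for e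
 define B where "B e = \<bar>sqrt (4 / len G e + 12) / (1 - (1/2) powr (\<theta> - 1/2))\<bar>" for e
 define M where "M = (\<Sum>e\<in>Ed. A e + B e)"
 have M0: "0 <= M" unfolding M_def by (intro sum_nonneg) (simp add: A_def B_def)
 have M: "A e + B e <= M" if "e \<in> Ed" for e
  unfolding M_def by (rule member_le_sum[OF that]) (auto simp: A_def B_def)
 have "end_bound \<theta> M b Y u"
  if u: "u \<in> LG" and b: "0 <= b" and Y: "\<forall>j. \<forall>e\<in>Ed. AC (len G e) (Y j e) (y j e)"
   and er: "\<forall>j. dG u (Y j) <= b * hp j \<theta>"
   and g: "\<forall>j. nG (y j) <= b * hp j (\<theta> - 1)" and Y0: "nG (Y 0) <= b" for u b Y y
 proof -
  have Y': "AC (len G e) (Y j e) (y j e)" if "e \<in> Ed" for e j using Y that by blast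
  have er': "nrm (len G e) (%x. u e x - Y j e x) <= b * hp j \<theta>" if "e \<in> Ed" for e j
   by (rule edge_dyadic[OF that er[rule_format]])
  have g': "nrm (len G e) (y j e) <= b * hp j (\<theta> - 1)" if "e \<in> Ed" for e j
   by (rule order_trans[OF nrm_le_nG[OF that] g[rule_format]])
  have Y0': "nrm (len G e) (Y 0 e) <= b" if "e \<in> Ed" for e
   by (rule order_trans[OF nrm_le_nG[OF that] Y0])
  have le: "K * b * hp j (\<theta> - 1/2) <= M * b * hp j (\<theta> - 1/2)" if "K <= M" for K and j :: nat
   using that b by (intro mult_right_mono) auto
  show ?thesis
  proof (cases "\<theta> < 1/2")
   case True
   have th0: "0 <= \<theta>" using th by simp
   have "\<bar>endv (Y j) e c - endv (%e x. 0) e c\<bar> <= M * b * hp j (\<theta> - 1/2)" if e: "e \<in> Ed" for j e c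
   proof -
    have "\<bar>endv (Y j) e c\<bar> <= (sqrt (1 / len G e + 2) + sqrt (4 / len G e + 12) / ((1/2) powr (\<theta> - 1/2) - 1)) * b * hp j (\<theta> - 1/2)"
     unfolding endv_def
     by (rule AC_dyadic_growth[OF len_pos[OF e] LG_D[OF u e] th0 True b Y'[OF e] er'[OF e] g'[OF e] Y0'[OF e] endv_point[OF e]])
    also have "... <= M * b * hp j (\<theta> - 1/2)"
     by (rule le) (use M[OF e] in \<open>unfold A_def B_def, linarith\<close>)
    finally show ?thesis by (simp add: endv_def)
   qed
   with True show ?thesis by (intro exI[of _ "%e x. 0"]) simp
  next
   case False
   hence t: "1/2 < \<theta>" using th by simp
   have "\<exists>F. cont (len G e) F & (aeq (len G e) F (u e)) &
    (\<forall>j. \<forall>x\<in>{0..len G e}. \<bar>Y j e x - F x\<bar> <= M * b * hp j (\<theta> - 1/2))" if e: "e \<in> Ed" for e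
   proof -
    from AC_dyadic_limit[OF len_pos[OF e] LG_D[OF u e] t th(2) b Y'[OF e] er'[OF e] g'[OF e]]
    obtain F where F: "cont (len G e) F" "aeq (len G e) F (u e)"
     "\<forall>j. \<forall>x\<in>{0..len G e}. \<bar>Y j e x - F x\<bar>
      <= sqrt (4 / len G e + 12) / (1 - (1/2) powr (\<theta> - 1/2)) * b * hp j (\<theta> - 1/2)"
     by (elim exE conjE)
    have "sqrt (4 / len G e + 12) / (1 - (1/2) powr (\<theta> - 1/2)) <= M"
     using M[OF e] unfolding A_def B_def by linarith
    hence "\<forall>j. \<forall>x\<in>{0..len G e}. \<bar>Y j e x - F x\<bar> <= M * b * hp j (\<theta> - 1/2)"
     using F(3) le by (meson order_trans)
    with F(1,2) show ?thesis by blast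
   qed
   hence "\<forall>e\<in>Ed. \<exists>F. cont (len G e) F & (aeq (len G e) F (u e)) &
    (\<forall>j. \<forall>x\<in>{0..len G e}. \<bar>Y j e x - F x\<bar> <= M * b * hp j (\<theta> - 1/2))" by blast
   from bchoice[OF this] obtain F where F: "\<forall>e\<in>Ed. cont (len G e) (F e) & (aeq (len G e) (F e) (u e)) &
    (\<forall>j. \<forall>x\<in>{0..len G e}. \<bar>Y j e x - F e x\<bar> <= M * b * hp j (\<theta> - 1/2))" by (elim exE)
   have "\<forall>j. \<forall>e\<in>Ed. \<forall>c. \<bar>endv (Y j) e c - endv F e c\<bar> <= M * b * hp j (\<theta> - 1/2)"
    unfolding endv_def using F endv_point by simp
   moreover have "\<forall>e\<in>Ed. cont (len G e) (F e)" "AEeq F u" using F by (simp_all add: AEeq_def)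
   ultimately show ?thesis using False by (intro exI[of _ F]) simp
  qed
 qed
 with M0 show ?thesis by blast
qed

end

section \<open>From Sobolev regularity with vertex conditions to decay of the eigenfunction
  coefficients\<close>

context quantum_graph
begin

lemma coef_split:
 assumes "u \<in> LG" "v \<in> LG" "F \<subseteq> I"
 shows "L2_set (%i. inn u (\<psi> i)) F <= L2_set (%i. inn (%e x. u e x - v e x) (\<psi> i)) F + L2_set (%i. inn v (\<psi> i)) F"
proof -
 have "L2_set (%i. inn u (\<psi> i)) F = L2_set (%i. inn (%e x. u e x - v e x) (\<psi> i) + inn v (\<psi> i)) F"
  by (rule L2_set_cong) (use inn_diff[OF assms(1,2) \<psi>_L2] assms(3) in auto)
 thus ?thesis using L2_set_triangle_ineq by simp
qed

abbreviation (input) "form_appr \<theta> b u V q \<equiv> \<forall>j::nat. form_fun (V j) (q j) & dG u (V j) <= b * hp j \<theta> &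
  nG (q j) <= b * hp j (\<theta> - 1)"
text \<open>The remainder \<open>z\<close> is kept in the form domain instead of being measured in
  L2 alone: its H^1 size h^(\<theta> - 1), with h = (1/2)^j, and the factor h of
  \<open>tail_form\<close> give h^\<theta>, while \<open>V\<close> has H^2 size h^(\<theta> - 2) and
  gains h^2 from \<open>tail_op\<close>.\<close>

abbreviation (input) "op_appr \<theta> b u V q r z w \<equiv> \<forall>j::nat. op_fun (V j) (q j) (r j) & form_fun (z j) (w j) &
  AEeq u (%e x. V j e x + z j e x) & nG (V j) <= b & nG (q j) <= b & nG (r j) <= b * hp j (\<theta> - 2) &
  nG (z j) <= b * hp j (\<theta> - 1) & nG (w j) <= b * hp j (\<theta> - 1)"

definition form_approx :: "real => real => 'e graph_fun => bool" where
 "form_approx \<theta> b u \<longleftrightarrow> (\<exists>V q. form_appr \<theta> b u V q)"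

definition op_approx :: "real => real => 'e graph_fun => bool" where
 "op_approx \<theta> b u \<longleftrightarrow> (\<exists>V q r z w. op_appr \<theta> b u V q r z w)"

abbreviation (input) "hdot_from_form \<theta> t C \<equiv> \<forall>u\<in>LG. \<forall>b\<ge>0. nG u <= b --> form_approx \<theta> b u --> hdot_le t u (C * b)"
abbreviation (input) "hdot_from_op \<theta> t C \<equiv> \<forall>u\<in>LG. \<forall>b\<ge>0. nG u <= b --> op_approx \<theta> b u --> hdot_le t u (C * b)"

text \<open>Split \<open>u\<close> into u - V and V at scale \<open>j\<close>: Bessel's inequality
  bounds the first tail by the error h^\<theta>, and for the second the form estimate gains a factor
  h over the derivative bound h^(\<theta> - 1).\<close>

lemma hdot_if_form_approx:
 assumes th: "0 < \<theta>" "\<theta> <= 1" and t: "t < \<theta>"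
 shows "\<exists>C\<ge>0. hdot_from_form \<theta> t C"
proof -
 from hdot_if_dyadic[OF t] obtain C1 where C1: "0 <= C1"
  and H: "hdot_from_tails t \<theta> C1" by (elim exE conjE)
 from coef_tail_form obtain C0 where C0: "0 <= C0"
  and T: "tail_form C0" by (elim exE conjE)
 define K where "K = 1 + 3 * C0"
 have K: "1 <= K" "0 <= K" using C0 by (simp_all add: K_def)
 have "hdot_le t u (C1 * K * b)"
  if u: "u \<in> LG" and b: "0 <= b" and ub: "nG u <= b" and A: "form_approx \<theta> b u" for u b
 proof -
  from A obtain V q where V: "form_appr \<theta> b u V q" unfolding form_approx_def by (elim exE)
  have tail: "L2_set (%i. inn u (\<psi> i)) F <= K * b * hp j \<theta>"
   if F: "finite F" "F \<subseteq> I" "\<forall>i\<in>F. 4 ^ j < \<mu> i" for j F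
  proof -
   let ?h = "(1/2 :: real) ^ j"
   have f: "form_fun (V j) (q j)" and e: "dG u (V j) <= b * hp j \<theta>"
    and g: "nG (q j) <= b * hp j (\<theta> - 1)" using V by auto
   have VL: "V j \<in> LG" by (rule form_fun_L2(1)[OF f])
   have "nG (%e x. u e x - (u e x - V j e x)) <= nG u + dG u (V j)"
    by (rule nG_diff[OF u LG_diff[OF u VL]])
   moreover have "b * hp j \<theta> <= b * 1" using b th by (intro mult_left_mono half_powr_le_1) auto
   ultimately have V2: "nG (V j) <= 2 * b" using e ub by simp
   have "L2_set (%i. inn u (\<psi> i)) F <= dG u (V j) + C0 * ?h * (nG (V j) + nG (q j))"
    using coef_split[OF u VL F(2)] coef_tail_L2[OF LG_diff[OF u VL] F(1,2)] T[rule_format, OF f F(1,2) F(3)[rule_format]]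
    by linarith
   also have "... <= b * hp j \<theta> + C0 * ?h * (2 * b * hp j (\<theta> - 1) + b * hp j (\<theta> - 1))"
   proof (intro add_mono mult_left_mono e g)
    have "2 * b * 1 <= 2 * b * hp j (\<theta> - 1)" using b th by (intro mult_left_mono half_powr_ge_1) auto
    thus "nG (V j) <= 2 * b * hp j (\<theta> - 1)" using V2 by simp
   qed (use C0 in simp)
   also have "... = b * hp j \<theta> + 3 * C0 * b * (?h * hp j (\<theta> - 1))" by (simp add: algebra_simps)
   also have "... = K * b * hp j \<theta>" unfolding half_power_mult_powr K_def by (simp add: algebra_simps)
   finally show ?thesis .
  qed
  have "nG u <= K * b" using ub mult_right_mono[OF K(1) b] by simp
  moreover have "0 <= K * b" using K b by simp
  ultimately have "hdot_le t u (C1 * (K * b))"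
   using H u tail by blast
  thus ?thesis by (simp only: mult.assoc)
 qed
 moreover have "0 <= C1 * K" using C1 K by simp
 ultimately show ?thesis by blast
qed

lemma hdot_if_op_approx:
 assumes th: "1 < \<theta>" "\<theta> <= 2" and t: "t < \<theta>"
 shows "\<exists>C\<ge>0. hdot_from_op \<theta> t C"
proof -
 from hdot_if_dyadic[OF t] obtain C1 where C1: "0 <= C1"
  and H: "hdot_from_tails t \<theta> C1" by (elim exE conjE)
 from coef_tail_form obtain C0 where C0: "0 <= C0"
  and T: "tail_form C0" by (elim exE conjE)
 from coef_tail_op obtain C2 where C2: "0 <= C2"
  and T2: "tail_op C2" by (elim exE conjE)
 define K where "K = 1 + 2 * C0 + 3 * C2"
 have K: "1 <= K" "0 <= K" using C0 C2 by (simp_all add: K_def)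
 have "hdot_le t u (C1 * K * b)"
  if u: "u \<in> LG" and b: "0 <= b" and ub: "nG u <= b" and A: "op_approx \<theta> b u" for u b
 proof -
  from A obtain V q r z w where V: "op_appr \<theta> b u V q r z w"
   unfolding op_approx_def by (elim exE)
  have tail: "L2_set (%i. inn u (\<psi> i)) F <= K * b * hp j \<theta>"
   if F: "finite F" "F \<subseteq> I" "\<forall>i\<in>F. 4 ^ j < \<mu> i" for j F
  proof -
   let ?h = "(1/2 :: real) ^ j"
   have f: "op_fun (V j) (q j) (r j)" "form_fun (z j) (w j)" and ae: "AEeq u (%e x. V j e x + z j e x)"
    and n: "nG (V j) <= b" "nG (q j) <= b" "nG (r j) <= b * hp j (\<theta> - 2)"
     "nG (z j) <= b * hp j (\<theta> - 1)" "nG (w j) <= b * hp j (\<theta> - 1)"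
    using V by auto
   have VL: "V j \<in> LG" by (rule form_fun_L2(1)[OF op_fun_form[OF f(1)]])
   have zL: "z j \<in> LG" by (rule form_fun_L2(1)[OF f(2)])
   have zi: "inn (%e x. u e x - V j e x) (\<psi> i) = inn (z j) (\<psi> i)" if "i \<in> F" for i
   proof (rule inn_cong_AE[OF LG_diff[OF u VL] _ zL _ _ AEeq_refl])
    show "\<psi> i \<in> LG" "\<psi> i \<in> LG" using that F(2) \<psi>_L2 by auto
    have "AEeq (%e x. u e x - V j e x) (%e x. (V j e x + z j e x) - V j e x)" by (rule AEeq_diff[OF ae AEeq_refl])
    thus "AEeq (%e x. u e x - V j e x) (z j)" by simp
   qed
   have "L2_set (%i. inn (%e x. u e x - V j e x) (\<psi> i)) F = L2_set (%i. inn (z j) (\<psi> i)) F"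
    by (rule L2_set_cong[OF refl zi])
   hence "L2_set (%i. inn u (\<psi> i)) F <= L2_set (%i. inn (z j) (\<psi> i)) F + L2_set (%i. inn (V j) (\<psi> i)) F"
    using coef_split[OF u VL F(2)] by simp
   also have "... <= C0 * ?h * (nG (z j) + nG (w j)) + C2 * (1/4) ^ j * (nG (V j) + nG (q j) + nG (r j))"
    by (intro add_mono T[rule_format] T2[rule_format] f F(1,2)) (use F in auto)
   also have "... <= C0 * ?h * (b * hp j (\<theta> - 1) + b * hp j (\<theta> - 1))
    + C2 * (1/4) ^ j * (b * hp j (\<theta> - 2) + b * hp j (\<theta> - 2) + b * hp j (\<theta> - 2))"
   proof (intro add_mono mult_left_mono n)
    have "b * 1 <= b * hp j (\<theta> - 2)" using b th by (intro mult_left_mono half_powr_ge_1) auto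
    thus "nG (V j) <= b * hp j (\<theta> - 2)" "nG (q j) <= b * hp j (\<theta> - 2)" using n by simp_all
   qed (use C0 C2 in simp_all)
   also have "... = 2 * C0 * b * (?h * hp j (\<theta> - 1)) + 3 * C2 * b * ((1/4) ^ j * hp j (\<theta> - 2))"
    by (simp add: algebra_simps)
   also have "(1/4 :: real) ^ j * hp j (\<theta> - 2) = hp j \<theta>"
   proof -
    have "(1/4 :: real) ^ j = ?h * ?h" by (simp add: power_mult_distrib[symmetric])
    hence "(1/4 :: real) ^ j * hp j (\<theta> - 2) = ?h * (?h * hp j ((\<theta> - 1) - 1))" by (simp add: mult.assoc)
    thus ?thesis unfolding half_power_mult_powr .
   qed
   also have "2 * C0 * b * (?h * hp j (\<theta> - 1)) = 2 * C0 * b * hp j \<theta>" unfolding half_power_mult_powr ..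
   also have "2 * C0 * b * hp j \<theta> + 3 * C2 * b * hp j \<theta> <= K * b * hp j \<theta>"
    using b by (simp add: K_def algebra_simps)
   finally show ?thesis .
  qed
  have "nG u <= K * b" using ub mult_right_mono[OF K(1) b] by simp
  moreover have "0 <= K * b" using K b by simp
  ultimately have "hdot_le t u (C1 * (K * b))"
   using H u tail by blast
  thus ?thesis by (simp only: mult.assoc)
 qed
 moreover have "0 <= C1 * K" using C1 K by simp
 ultimately show ?thesis by blast
qed

end

text \<open>Dyadic approximations need a constant strictly above three times the interpolation norm;
  this removes the excess afterwards.\<close>

lemma le_if_gt_cmult:
 fixes x C B :: real
 assumes "0 <= C" "!!b. B < b ==> x <= C * b"
 shows "x <= C * B"
proof (rule field_le_epsilon)
 fix e :: real assume e: "0 < e"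
 have "x <= C * (B + e / (C + 1))" by (rule assms(2)) (use e assms(1) in simp)
 also have "... <= C * B + e"
 proof -
  have "C * e <= e * (C + 1)" using e by (simp add: algebra_simps)
  hence "C * e / (C + 1) <= e" using assms(1) by (simp add: divide_le_eq)
  thus ?thesis by (simp add: algebra_simps)
 qed
 finally show "x <= C * B + e" .
qed

context metric_graph_loc
begin

definition end_vertex :: "'e => bool => 'v" where "end_vertex e b = (if b then head G e else tail G e)"

lemma Dir_iff: "(e, b) \<in> Dir G v \<longleftrightarrow> e \<in> Ed & end_vertex e b = v"
 by (auto simp: Dir_def end_vertex_def)

lemma endv_diff: "endv (%e x. u e x - v e x) e b = endv u e b - endv v e b"
 by (simp add: endv_def)

lemma Hk_graph_1_reps:
 assumes "\<forall>j. y j \<in> Hk_graph G 1"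
 obtains Y p where "\<forall>j. vert_fun (Y j) (p j)" "\<forall>j. AEeq (Y j) (y j)" "\<forall>j. AEeq (p j) (DG 1 (y j))"
proof -
 have "\<forall>j. \<exists>Y p. vert_fun Y p & AEeq Y (y j) & AEeq p (DG 1 (y j))"
 proof
  fix j
  obtain Y p where "vert_fun Y p" "AEeq Y (y j)" "AEeq p (DG 1 (y j))"
   by (rule Hk_graph_1_vert_fun[OF assms[rule_format, of j]])
  thus "\<exists>Y p. vert_fun Y p & AEeq Y (y j) & AEeq p (DG 1 (y j))" by blast
 qed
 from choice[OF this] obtain Y where "\<forall>j. \<exists>p. vert_fun (Y j) p & AEeq (Y j) (y j) & AEeq p (DG 1 (y j))" by (elim exE)
 from choice[OF this] obtain p where "\<forall>j. vert_fun (Y j) (p j) & AEeq (Y j) (y j) & AEeq (p j) (DG 1 (y j))" by (elim exE)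
 thus thesis using that[of Y p] by simp
qed

lemma Hk_edges_1_reps:
 assumes "\<forall>j. y j \<in> Hk_edges G 1"
 obtains Y p where "\<forall>j. \<forall>e\<in>Ed. AC (len G e) (Y j e) (p j e)" "\<forall>j. AEeq (Y j) (y j)" "\<forall>j. AEeq (p j) (DG 1 (y j))"
proof -
 have "\<forall>j. \<exists>Y p. (\<forall>e\<in>Ed. AC (len G e) (Y e) (p e)) & AEeq Y (y j) & AEeq p (DG 1 (y j))"
 proof
  fix j
  show "\<exists>Y p. (\<forall>e\<in>Ed. AC (len G e) (Y e) (p e)) & AEeq Y (y j) & AEeq p (DG 1 (y j))"
   by (rule Hk_edges_1_AC[OF assms[rule_format, of j]]) blast
 qed
 from choice[OF this] obtain Y where "\<forall>j. \<exists>p. (\<forall>e\<in>Ed. AC (len G e) (Y j e) (p e)) & AEeq (Y j) (y j) & AEeq p (DG 1 (y j))" by (elim exE)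
 from choice[OF this] obtain p where "\<forall>j. (\<forall>e\<in>Ed. AC (len G e) (Y j e) (p j e)) & AEeq (Y j) (y j) & AEeq (p j) (DG 1 (y j))" by (elim exE)
 thus thesis using that[of Y p] by simp
qed

lemma Hk_rep_norms:
 assumes y: "y \<in> Hk_edges G 1" and Y: "Y \<in> LG" "p \<in> LG" "AEeq Y y" "AEeq p (DG 1 y)"
 shows "nG Y <= N1 y" "nG p <= N1 y"
proof -
 have L: "DG 0 y \<in> LG" "DG 1 y \<in> LG" using D_graph_L2[OF y] by simp_all
 have "nG Y = nG (DG 0 y)"
  by (rule nG_cong_AE[OF Y(1) L(1) AEeq_trans[OF Y(3) AEeq_sym[OF D_graph_0_AEeq[OF Hk_edges_L2[OF y]]]]])
 thus "nG Y <= N1 y" using nG_D_graph_le[of 0 1 y] by simp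
 have "nG p = nG (DG 1 y)" by (rule nG_cong_AE[OF Y(2) L(2) Y(4)])
 thus "nG p <= N1 y" using nG_D_graph_le[of 1 1 y] by simp
qed

lemma nG_diff_cong:
 assumes "u \<in> LG" "v \<in> LG" "w \<in> LG" "z \<in> LG" "AEeq u w" "AEeq v z"
 shows "dG u v = dG w z"
 by (rule nG_cong_AE[OF LG_diff[OF assms(1,2)] LG_diff[OF assms(3,4)] AEeq_diff[OF assms(5,6)]])

lemma half_powr_exp_mono: "0 <= b ==> s <= t ==> b * hp j t <= b * hp j s"
 by (intro mult_left_mono half_powr_antimono)

end

context quantum_graph
begin

text \<open>The functions supplied by interpolation are continuous across the vertices but need not
  vanish on \<open>VD\<close>; bumps subtract their values there. These are small enough relative to
  the scale: above 1/2 they converge to the zero trace of \<open>u\<close>, and below 1/2 their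
  growth is bounded although \<open>u\<close> need not have a trace.\<close>

lemma form_approx_low:
 assumes \<gamma>: "0 < \<gamma>" "\<gamma> < 1" and th: "0 < \<theta>" "\<theta> <= \<gamma>" "\<theta> \<noteq> 1/2"
 shows "\<exists>K\<ge>0. \<forall>u\<in>H_KD G VK VD \<gamma>. \<forall>b. 3 * Hfrac_graph_norm G \<gamma> u < b --> nG u <= K * b & form_approx \<theta> (K * b) u"
proof -
 have th1: "\<theta> <= 1" using \<gamma> th by simp
 from corr_norm obtain K0 where K0: "0 <= K0" and CN: "corr_le K0"
  by (elim exE conjE)
 from dyadic_endv[OF th(1) th1 th(3)] obtain M where M: "0 <= M" and
  DE: "end_bounds \<theta> M"
  by (elim exE conjE)
 define K where "K = 2 + K0 * M"
 have KM: "0 <= K0 * M" using K0 M by simp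
 have "nG u <= K * b & form_approx \<theta> (K * b) u"
  if u: "u \<in> H_KD G VK VD \<gamma>" and ub: "3 * Hfrac_graph_norm G \<gamma> u < b" for u b
 proof -
  have uH: "u \<in> Hfrac_graph G \<gamma>"
   using u \<gamma> not_Ints_between[of \<gamma>] by (simp add: H_KD_def H_graph_def)
  have uL: "u \<in> LG" by (rule Hfrac_L2(1)[OF uH])
  have "0 <= Hfrac_graph_norm G \<gamma> u" by (simp add: Hfrac_graph_norm_def interp_norm_def)
  hence b: "0 <= b" using ub by simp
  have ne: "Hk_graph G 1 \<noteq> {}" using zero_Hk_graph_1(1) by blast
  have "\<exists>y. \<forall>j. y j \<in> Hk_graph G 1 & nG (u - y j) <= b * hp j \<gamma> & N1 (y j) <= b * hp j (\<gamma> - 1)"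
   by (rule interp_dyadic[OF nG_nonneg Hk_graph_norm_nonneg ne uH[unfolded Hfrac_graph_def] \<gamma>(1)])
    (use \<gamma> ub in \<open>simp_all add: Hfrac_graph_norm_def\<close>)
  then obtain y where y: "\<forall>j. y j \<in> Hk_graph G 1 & nG (u - y j) <= b * hp j \<gamma> & N1 (y j) <= b * hp j (\<gamma> - 1)"
   by (elim exE)
  obtain Y p where vf0: "\<forall>j. vert_fun (Y j) (p j)" and aeY: "\<forall>j. AEeq (Y j) (y j)" and aep: "\<forall>j. AEeq (p j) (DG 1 (y j))"
   by (rule Hk_graph_1_reps[of y]) (use y in auto)
  note vf = vf0[rule_format]
  note L = vert_fun_L2[OF vf]
  have yE: "y j \<in> Hk_edges G 1" for j using y Hk_graph_edges by blast
  have e: "dG u (Y j) <= b * hp j \<theta>" for j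
  proof -
   have "dG u (Y j) = dG u (y j)"
    by (rule nG_diff_cong[OF uL L(1) uL Hk_edges_L2[OF yE] AEeq_refl aeY[rule_format]])
   also have "... <= b * hp j \<gamma>" using y by (simp add: fun_diff_def)
   also have "... <= b * hp j \<theta>" by (rule half_powr_exp_mono[OF b th(2)])
   finally show ?thesis .
  qed
  have N1: "N1 (y j) <= b * hp j (\<theta> - 1)" for j
  proof -
   have "b * hp j (\<gamma> - 1) <= b * hp j (\<theta> - 1)" by (rule half_powr_exp_mono[OF b]) (use th in simp)
   with y show ?thesis by (meson order_trans)
  qed
  note RN = Hk_rep_norms[OF yE L aeY[rule_format] aep[rule_format]]
  have g: "nG (p j) <= b * hp j (\<theta> - 1)" for j by (rule order_trans[OF RN(2) N1])
  have Y0: "nG (Y 0) <= b" using order_trans[OF RN(1) N1, of 0] by simp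
  have ACY: "\<forall>j. \<forall>e\<in>Ed. AC (len G e) (Y j e) (p j e)" using vert_fun_AC[OF vf] by blast
  obtain F where F1: "1/2 < \<theta> --> (\<forall>e\<in>Ed. cont (len G e) (F e)) & AEeq F u"
   and F2: "\<theta> < 1/2 --> F = (%e x. 0)"
   and F3: "\<forall>j. \<forall>e\<in>Ed. \<forall>c. \<bar>endv (Y j) e c - endv F e c\<bar> <= M * b * hp j (\<theta> - 1/2)"
   using DE[THEN spec[of _ u], THEN spec[of _ b], THEN spec[of _ Y], THEN spec[of _ p], THEN mp[OF _ uL], THEN mp[OF _ b],
    THEN mp[OF _ ACY], THEN mp[OF _ allI[OF e]], THEN mp[OF _ allI[OF g]], THEN mp[OF _ Y0]]
   by (elim exE conjE)
  have F0: "endv F e c = 0" if v: "v \<in> VD" "(e, c) \<in> Dir G v" for v e c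
  proof (cases "\<theta> < 1/2")
   case True
   thus ?thesis using F2 by (simp add: endv_def)
  next
   case False
   hence t: "1/2 < \<theta>" using th by simp
   hence "u \<in> D_space G VD 1" using u \<gamma> th H_KD_floors[of \<gamma>] by (simp add: H_KD_def)
   from D_space_end_value[OF this v(1) _ v(2), of 0] have z: "end_value G e c (DG 0 u) = 0" by simp
   have ae: "AEeq F (DG 0 u)" by (rule AEeq_trans[OF _ AEeq_sym[OF D_graph_0_AEeq[OF uL]]]) (use F1 t in simp)
   have ea: "e \<in> Ed" by (rule Dir_arcs[OF v(2)])
   have "end_value G e c (DG 0 u) = endv F e c"
    by (rule end_value_eq[where y = F and u = "DG 0 u", OF ea]) (use F1 t ea ae in \<open>simp_all add: AEeq_def\<close>)
   with z show ?thesis by simp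
  qed
  \<comment> \<open>All ends at a vertex of \<open>VD\<close> are corrected to 0 and the others are
    left alone, so continuity at the vertices is kept.\<close>
  define d where "d j e c = (if end_vertex e c \<in> VD then endv (Y j) e c else 0)" for j e c
  have db: "\<bar>d j e c\<bar> <= (M * b) * hp j (\<theta> - 1/2)" if ea: "e \<in> Ed" for j e c
  proof (cases "end_vertex e c \<in> VD")
   case True
   hence "endv F e c = 0" using F0 Dir_iff ea by blast
   thus ?thesis using F3[rule_format, OF ea, of j c] True by (simp add: d_def)
  qed (use M b in \<open>simp add: d_def\<close>)
  have Mb: "0 <= M * b" using M b by simp
  have cn: "nG (corr (d j) j) <= K0 * (M * b) * hp j \<theta>" "nG (corr' (d j) j) <= K0 * (M * b) * hp j (\<theta> - 1)" for j
   using CN[rule_format, OF Mb db] by auto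
  define V where "V j e x = Y j e x - corr (d j) j e x" for j e x
  define q where "q j e x = p j e x - corr' (d j) j e x" for j e x
  have cL: "corr (d j) j \<in> LG" "corr' (d j) j \<in> LG" for j
   using LG_I[OF AC_L2_fun[OF corr(1)]] LG_I[OF AC_L2[OF corr(1)]] by auto
  have ev: "endv (V j) e c = endv (Y j) e c - d j e c" if "e \<in> Ed" for j e c
   using endv_diff[of "Y j" "corr (d j) j" e c] corr(2)[OF that] by (simp add: V_def[abs_def])
  have ff: "form_fun (V j) (q j)" for j
   unfolding form_fun_def vert_fun_def
  proof (intro conjI ballI)
   fix e assume ea: "e \<in> Ed"
   show "AC (len G e) (V j e) (q j e)"
    unfolding V_def[abs_def] q_def[abs_def] by (rule AC_diff[OF vert_fun_AC[OF vf ea] corr(1)[OF ea]])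
  next
   fix v assume v: "v \<in> verts G"
   obtain c where c: "\<forall>(e, b)\<in>Dir G v. endv (Y j) e b = c" using vf[of j] v unfolding vert_fun_def by blast
   have "endv (V j) e b = (if v \<in> VD then 0 else c)" if D: "(e, b) \<in> Dir G v" for e b
    using bspec[OF c D] ev[OF Dir_arcs[OF D]] D by (auto simp: d_def Dir_iff)
   thus "\<exists>c. \<forall>(e, b)\<in>Dir G v. endv (V j) e b = c" by blast
  next
   fix v assume v: "v \<in> VD"
   show "case x of (e, b) => endv (V j) e b = 0" if D: "x \<in> Dir G v" for x
    using ev[OF Dir_arcs, of "fst x" "snd x" v] D v by (auto simp: d_def Dir_iff)
  qed
  have "dG u (V j) <= K * b * hp j \<theta>" for j
  proof -
   have "dG u (V j) = nG (%e x. (u e x - Y j e x) + corr (d j) j e x)"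
    by (simp add: V_def algebra_simps)
   also have "... <= dG u (Y j) + nG (corr (d j) j)" by (rule nG_add[OF LG_diff[OF uL L(1)] cL(1)])
   also have "... <= b * hp j \<theta> + K0 * (M * b) * hp j \<theta>" by (rule add_mono[OF e cn(1)])
   also have "... <= K * b * hp j \<theta>" using b by (simp add: K_def algebra_simps)
   finally show ?thesis .
  qed
  moreover have "nG (q j) <= K * b * hp j (\<theta> - 1)" for j
  proof -
   have "nG (q j) <= nG (p j) + nG (corr' (d j) j)" unfolding q_def[abs_def] by (rule nG_diff[OF L(2) cL(2)])
   also have "... <= b * hp j (\<theta> - 1) + K0 * (M * b) * hp j (\<theta> - 1)" by (rule add_mono[OF g cn(2)])
   also have "... <= K * b * hp j (\<theta> - 1)" using b by (simp add: K_def algebra_simps)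
   finally show ?thesis .
  qed
  ultimately have "form_approx \<theta> (K * b) u" unfolding form_approx_def using ff by blast
  moreover have "nG u <= K * b"
  proof -
   have "nG (%e x. (u e x - Y 0 e x) + Y 0 e x) <= dG u (Y 0) + nG (Y 0)"
    by (rule nG_add[OF LG_diff[OF uL L(1)] L(1)])
   hence "nG u <= b + b" using e[of 0] Y0 by simp
   also have "... <= K * b" using mult_right_mono[OF KM b] by (simp add: K_def algebra_simps)
   finally show ?thesis .
  qed
  ultimately show ?thesis by blast
 qed
 moreover have "0 <= K" using KM by (simp add: K_def)
 ultimately show ?thesis by blast
qed

lemma K_space_sum_0:
 assumes u: "u \<in> K_space G VK 1" and v: "v \<in> VK"
  and F: "!!e. e \<in> Ed ==> AC (len G e) (y e) (F e)" "!!e. e \<in> Ed ==> cont (len G e) (F e)" "AEeq y u"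
 shows "(\<Sum>(e, b)\<in>Dir G v. outv F e b) = 0"
proof -
 have uL: "u \<in> LG" using u by (simp add: K_space_def)
 have ae: "AEeq y (DG 0 u)" by (rule AEeq_trans[OF F(3) AEeq_sym[OF D_graph_0_AEeq[OF uL]]])
 have "outward_deriv G e b (DG 0 u) = outv F e b" if "(e, b) \<in> Dir G v" for e b
  by (rule outward_deriv_eq[where y = y and p = F and u = "DG 0 u", OF Dir_arcs[OF that] F(1,2)[OF Dir_arcs[OF that]]])
   (use ae Dir_arcs[OF that] in \<open>simp add: AEeq_def\<close>)
 hence "(\<Sum>(e, b)\<in>Dir G v. outv F e b) = (\<Sum>(e, b)\<in>Dir G v. outward_deriv G e b (DG (2 * 0) u))"
  by (intro sum.cong) auto
 also have "... = 0" using u v by (simp add: K_space_def)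
 finally show ?thesis .
qed

text \<open>Added to \<open>Q\<close> on the edge, the constant \<open>c e\<close> restores the
  total increment given by \<open>w\<close>; Cauchy-Schwarz bounds it by the L2 distance.\<close>

lemma mean_shift:
 assumes w: "w \<in> LG" and Q: "Q \<in> LG"
 defines "c \<equiv> %e. (integral {0..len G e} (w e) - integral {0..len G e} (Q e)) / len G e"
 shows "nG (%e x. c e) <= real (card (Ed)) * dG w Q"
  and "e \<in> Ed ==> \<bar>c e\<bar> <= (\<Sum>e\<in>Ed. 1 / sqrt (len G e)) * dG w Q"
proof -
 have b: "\<bar>c e\<bar> <= 1 / sqrt (len G e) * nrm (len G e) (%x. w e x - Q e x)" if e: "e \<in> Ed" for e
 proof -
  have l: "0 < len G e" by (rule len_pos[OF e])
  have i: "w e integrable_on {0..len G e}" "Q e integrable_on {0..len G e}"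
   using L2_iv_integrable_on[OF LG_D[OF w e]] L2_iv_integrable_on[OF LG_D[OF Q e]] by auto
  have "\<bar>integral {0..len G e} (%x. w e x - Q e x)\<bar> <= sqrt (len G e) * nrm (len G e) (%x. w e x - Q e x)"
   by (rule abs_integral_le_nrm[OF L2_iv_diff[OF LG_D[OF w e] LG_D[OF Q e]]]) (use l in auto)
  hence "\<bar>c e\<bar> <= sqrt (len G e) * nrm (len G e) (%x. w e x - Q e x) / len G e"
   using l unfolding c_def integral_diff[OF i, symmetric] by (simp add: abs_divide divide_right_mono)
  also have "... = 1 / sqrt (len G e) * nrm (len G e) (%x. w e x - Q e x)"
  proof -
   have "r * m / (r * r) = 1 / r * m" if "0 < r" for r m :: real using that by simp
   from this[of "sqrt (len G e)"] show ?thesis using l by simp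
  qed
  finally show ?thesis .
 qed
 have "nG (%e x. c e) <= (\<Sum>e\<in>Ed. 1) * dG w Q"
 proof (rule nG_le_if_edges)
  fix e assume e: "e \<in> Ed"
  have l: "0 < len G e" by (rule len_pos[OF e])
  have "nrm (len G e) (%x. c e) <= \<bar>c e\<bar> * sqrt (len G e)"
   by (rule nrm_le_bound) (use l L2_iv_const in auto)
  also have "... <= (1 / sqrt (len G e) * nrm (len G e) (%x. w e x - Q e x)) * sqrt (len G e)"
   using l by (intro mult_right_mono b[OF e]) simp
  also have "... = nrm (len G e) (%x. w e x - Q e x)" using l by simp
  also have "... <= 1 * dG w Q" using nrm_le_nG[OF e, of "%e x. w e x - Q e x"] by simp
  finally show "nrm (len G e) (%x. c e) <= 1 * dG w Q" .
 qed
 thus "nG (%e x. c e) <= real (card (Ed)) * dG w Q" by simp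
 assume e: "e \<in> Ed"
 have "1 / sqrt (len G e) <= (\<Sum>e\<in>Ed. 1 / sqrt (len G e))"
  by (rule member_le_sum[OF e]) (use len_pos in \<open>auto simp: less_imp_le\<close>)
 hence "1 / sqrt (len G e) * nrm (len G e) (%x. w e x - Q e x) <= (\<Sum>e\<in>Ed. 1 / sqrt (len G e)) * dG w Q"
  using nrm_le_nG[OF e, of "%e x. w e x - Q e x"] by (rule mult_mono) (use len_pos in \<open>auto intro!: sum_nonneg simp: less_imp_le\<close>)
 with b[OF e] show "\<bar>c e\<bar> <= (\<Sum>e\<in>Ed. 1 / sqrt (len G e)) * dG w Q" by linarith
qed

text \<open>The derivative is approximated and then integrated. A constant on each edge and bumps of
  mean zero adjust the approximate derivative: its primitive keeps the end values of
  \<open>u\<close>, and its outward derivatives at each vertex of \<open>VK\<close> add up to zero.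
  So the primitive lies in the operator domain, and the remainder, which vanishes at all ends, in
  the form domain.\<close>

lemma op_approx_high:
 assumes \<gamma>: "1 < \<gamma>" "\<gamma> < 2" and th: "1 < \<theta>" "\<theta> <= \<gamma>" "\<theta> \<noteq> 3/2"
 shows "\<exists>K\<ge>0. \<forall>u\<in>H_KD G VK VD \<gamma>. \<forall>b. N1 u < b --> 3 * Hfrac_edges_norm G (\<gamma> - 1) (DG 1 u) < b -->
  nG u <= K * b & op_approx \<theta> (K * b) u"
proof -
 have \<gamma>1: "0 < \<gamma> - 1" using \<gamma> by simp
 have th1: "0 < \<theta> - 1" "\<theta> - 1 <= 1" "\<theta> - 1 \<noteq> 1/2" using \<gamma> th by simp_all
 from corr_norm obtain K0 where K0: "0 <= K0" and CN: "corr_le K0"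
  by (elim exE conjE)
 from dyadic_endv[OF th1] obtain M where M: "0 <= M" and
  DE: "end_bounds (\<theta> - 1) M"
  by (elim exE conjE)
 define \<Lambda> where "\<Lambda> = (\<Sum>e\<in>Ed. 1 / sqrt (len G e))"
 define n where "n = real (card (Ed))"
 define lt where "lt = (\<Sum>e\<in>Ed. len G e)"
 define M1 where "M1 = M + \<Lambda>"
 define K1 where "K1 = 1 + n + K0 * M1"
 define K where "K = 1 + K1 + lt * K1"
 have \<Lambda>: "0 <= \<Lambda>" unfolding \<Lambda>_def using len_pos by (intro sum_nonneg) (auto simp: less_imp_le)
 have lt: "0 <= lt" unfolding lt_def using len_pos by (intro sum_nonneg) (auto simp: less_imp_le)
 have M1: "0 <= M1" "0 <= K0 * M1" using M \<Lambda> K0 by (simp_all add: M1_def)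
 have K1: "1 <= K1" "1 + K0 * M1 <= K1" using M1 by (simp_all add: K1_def n_def)
 have ltK: "0 <= lt * K1" using lt K1 by simp
 have K: "K1 <= K" "1 + K1 <= K" "lt * K1 <= K" "1 + lt * K1 <= K" "0 <= K" "1 <= K" "1 + K0 * M1 <= K"
  using ltK K1 by (auto simp: K_def)
 have "nG u <= K * b & op_approx \<theta> (K * b) u"
  if u: "u \<in> H_KD G VK VD \<gamma>" and b1: "N1 u < b" and ub: "3 * Hfrac_edges_norm G (\<gamma> - 1) (DG 1 u) < b" for u b
 proof -
  have fl: "\<lfloor>\<gamma>\<rfloor> = 1" using \<gamma> by (simp add: floor_eq_iff)
  hence f: "nat \<lfloor>\<gamma>\<rfloor> = 1" "frac \<gamma> = \<gamma> - 1" by (simp_all add: frac_def)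
  hence fI: "\<gamma> \<notin> \<int>" using \<gamma> by (auto simp: frac_eq_0_iff[symmetric])
  have u1: "u \<in> Hk_graph G 1" and Du: "DG 1 u \<in> Hfrac_edges G (\<gamma> - 1)" and uD: "u \<in> D_space G VD 1"
   using u \<gamma> f fI H_KD_floors[of \<gamma>] by (simp_all add: H_KD_def H_graph_def)
  have uL: "u \<in> LG" by (rule Hk_edges_L2[OF Hk_graph_edges[OF u1]])
  have DL: "DG 1 u \<in> LG" by (rule Hfrac_L2(2)[OF Du])
  have b: "0 <= b" using b1 Hk_graph_norm_nonneg[of 1 u] by simp
  obtain y0 p0 where ff0: "form_fun y0 p0" and ae0: "AEeq y0 u" "AEeq p0 (DG 1 u)"
   by (rule form_fun_rep[OF u1 uD zero_less_one])
  note L0 = form_fun_L2[OF ff0]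
  note AC0 = vert_fun_AC[OF form_fun_vert[OF ff0]]
  note R0 = Hk_rep_norms[OF Hk_graph_edges[OF u1] L0 ae0]
  have ne: "Hk_edges G 1 \<noteq> {}" using zero_Hk_graph_1(2) by blast
  have "\<exists>P. \<forall>j. P j \<in> Hk_edges G 1 & nG (DG 1 u - P j) <= b * hp j (\<gamma> - 1) & N1 (P j) <= b * hp j (\<gamma> - 1 - 1)"
   by (rule interp_dyadic[OF nG_nonneg Hk_graph_norm_nonneg ne Du[unfolded Hfrac_edges_def] \<gamma>1])
    (use \<gamma> ub in \<open>simp_all add: Hfrac_edges_norm_def\<close>)
  then obtain P where P: "\<forall>j. P j \<in> Hk_edges G 1 & nG (DG 1 u - P j) <= b * hp j (\<gamma> - 1) & N1 (P j) <= b * hp j (\<gamma> - 1 - 1)"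
   by (elim exE)
  have PE: "P j \<in> Hk_edges G 1" for j using P by blast
  obtain Q r where ACQ0: "\<forall>j. \<forall>e\<in>Ed. AC (len G e) (Q j e) (r j e)" and aeQ: "\<forall>j. AEeq (Q j) (P j)" and aer: "\<forall>j. AEeq (r j) (DG 1 (P j))"
   by (rule Hk_edges_1_reps[of P]) (use P in auto)
  have ACQ: "AC (len G e) (Q j e) (r j e)" if "e \<in> Ed" for j e using ACQ0 that by blast
  have L: "Q j \<in> LG" "r j \<in> LG" for j using LG_I[OF AC_L2_fun[OF ACQ]] LG_I[OF AC_L2[OF ACQ]] by auto
  note RN = Hk_rep_norms[OF PE L aeQ[rule_format] aer[rule_format]]
  have e: "dG p0 (Q j) <= b * hp j (\<theta> - 1)" for j
  proof -
   have "dG p0 (Q j) = nG (%e x. DG 1 u e x - P j e x)"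
    by (rule nG_diff_cong[OF L0(2) L(1) DL Hk_edges_L2[OF PE] ae0(2) aeQ[rule_format]])
   also have "... <= b * hp j (\<gamma> - 1)" using P by (simp add: fun_diff_def)
   also have "... <= b * hp j (\<theta> - 1)" by (rule half_powr_exp_mono[OF b]) (use th in simp)
   finally show ?thesis .
  qed
  have N1: "N1 (P j) <= b * hp j (\<theta> - 1 - 1)" for j
  proof -
   have "b * hp j (\<gamma> - 1 - 1) <= b * hp j (\<theta> - 1 - 1)" by (rule half_powr_exp_mono[OF b]) (use th in simp)
   with P show ?thesis by (meson order_trans)
  qed
  have g: "nG (r j) <= b * hp j (\<theta> - 1 - 1)" for j by (rule order_trans[OF RN(2) N1])
  have Q0: "nG (Q 0) <= b" using order_trans[OF RN(1) N1, of 0] by simp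
  have "end_bound (\<theta> - 1) M b Q p0"
   by (rule DE[THEN spec[of _ p0], THEN spec[of _ b], THEN spec[of _ Q], THEN spec[of _ r], THEN mp[OF _ L0(2)], THEN mp[OF _ b],
    THEN mp[OF _ ACQ0], THEN mp[OF _ allI[OF e]], THEN mp[OF _ allI[OF g]], THEN mp[OF _ Q0]])
  then obtain F where F1: "1/2 < \<theta> - 1 --> (\<forall>e\<in>Ed. cont (len G e) (F e)) & AEeq F p0"
   and F2: "\<theta> - 1 < 1/2 --> F = (%e x. 0)"
   and F3: "\<forall>j. \<forall>e\<in>Ed. \<forall>c. \<bar>endv (Q j) e c - endv F e c\<bar> <= M * b * hp j (\<theta> - 1 - 1/2)"
   by (elim exE conjE)
  have F0: "(\<Sum>(e, c)\<in>Dir G v. outv F e c) = 0" if v: "v \<in> VK" for v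
  proof (cases "\<theta> - 1 < 1/2")
   case True
   hence "F = (%e x. 0)" using F2 by blast
   thus ?thesis by (auto simp: outv_def intro!: sum.neutral)
  next
   case False
   hence t: "1/2 < \<theta> - 1" using th1 by simp
   hence uK: "u \<in> K_space G VK 1" using u \<gamma> th H_KD_floors[of \<gamma>] by (simp add: H_KD_def)
   have Fc: "cont (len G e) (F e)" if "e \<in> Ed" for e using F1 t that by blast
   show ?thesis
   proof (rule K_space_sum_0[OF uK v _ Fc ae0(1)])
    fix e assume ea: "e \<in> Ed"
    have "AEeq p0 F" by (rule AEeq_sym) (use F1 t in simp)
    thus "AC (len G e) (y0 e) (F e)"
     by (intro AC_cong_AE[OF AC0[OF ea] L2_iv_continuous[OF Fc[OF ea]]]) (use ea in \<open>simp add: AEeq_def\<close>)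
   qed
  qed
  define c where "c j e = (integral {0..len G e} (p0 e) - integral {0..len G e} (Q j e)) / len G e" for j e
  note MS = mean_shift[OF L0(2) L(1), folded c_def n_def \<Lambda>_def]
  have cn1: "nG (%e x. c j e) <= n * (b * hp j (\<theta> - 1))" for j
   by (rule order_trans[OF MS(1) mult_left_mono[OF e]]) (simp add: n_def)
  have c2: "\<bar>c j e\<bar> <= \<Lambda> * b * hp j (\<theta> - 1 - 1/2)" if ea: "e \<in> Ed" for j e
  proof -
   have "\<bar>c j e\<bar> <= \<Lambda> * (b * hp j (\<theta> - 1))" by (rule order_trans[OF MS(2)[OF ea] mult_left_mono[OF e \<Lambda>]])
   also have "... <= \<Lambda> * (b * hp j (\<theta> - 1 - 1/2))" by (intro mult_left_mono[OF _ \<Lambda>] half_powr_exp_mono[OF b]) simp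
   finally show ?thesis by (simp only: mult.assoc)
  qed
  define Q' where "Q' j e x = Q j e x + c j e" for j e x
  have ovd: "\<bar>outv (Q' j) e k - outv F e k\<bar> <= M1 * b * hp j (\<theta> - 1 - 1/2)" if ea: "e \<in> Ed" for j e k
  proof -
   have "\<bar>outv (Q' j) e k - outv F e k\<bar> <= \<bar>endv (Q j) e k - endv F e k\<bar> + \<bar>c j e\<bar>"
    by (cases k) (simp_all add: outv_def endv_def Q'_def)
   also have "... <= M * b * hp j (\<theta> - 1 - 1/2) + \<Lambda> * b * hp j (\<theta> - 1 - 1/2)"
    by (intro add_mono F3[rule_format, OF ea] c2[OF ea])
   finally show ?thesis by (simp add: M1_def algebra_simps)
  qed
  define S where "S j v = (\<Sum>(e, k)\<in>Dir G v. outv (Q' j) e k)" for j v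
  have Sb: "\<bar>S j v\<bar> <= real (card (Dir G v)) * (M1 * b * hp j (\<theta> - 1 - 1/2))" if v: "v \<in> VK" for j v
  proof -
   have "S j v = (\<Sum>(e, k)\<in>Dir G v. outv (Q' j) e k) - (\<Sum>(e, k)\<in>Dir G v. outv F e k)" unfolding S_def F0[OF v] by simp
   also have "... = (\<Sum>(e, k)\<in>Dir G v. outv (Q' j) e k - outv F e k)" by (simp add: case_prod_beta sum_subtractf)
   also have "\<bar>...\<bar> <= (\<Sum>(e, k)\<in>Dir G v. \<bar>outv (Q' j) e k - outv F e k\<bar>)" by (simp add: case_prod_beta)
   also have "... <= (\<Sum>x\<in>Dir G v. M1 * b * hp j (\<theta> - 1 - 1/2))"
    by (rule sum_mono) (use ovd Dir_arcs in \<open>auto simp only: case_prod_conv split_paired_all\<close>)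
   finally show ?thesis by simp
  qed
  \<comment> \<open>The defect \<open>S\<close> of the Kirchhoff sum is shared equally among the
    ends at the vertex; the sign turns an outward derivative into an end value in the reference
    coordinate.\<close>
  define d where "d j e k = (if end_vertex e k \<in> VK then (if k then - 1 else 1) * (S j (end_vertex e k) / real (card (Dir G (end_vertex e k)))) else 0)" for j e k
  have M1b: "0 <= M1 * b" using M1 b by simp
  have db: "\<bar>d j e k\<bar> <= (M1 * b) * hp j (\<theta> - 1 - 1/2)" if ea: "e \<in> Ed" for j e k
  proof (cases "end_vertex e k \<in> VK")
   case True
   let ?D = "Dir G (end_vertex e k)"
   have "(e, k) \<in> ?D" using ea by (simp add: Dir_iff)
   hence cp: "0 < real (card ?D)" using card_gt_0_iff by fastforce
   have "\<bar>d j e k\<bar> = \<bar>S j (end_vertex e k)\<bar> / real (card ?D)" using True by (simp add: d_def)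
   also have "... <= M1 * b * hp j (\<theta> - 1 - 1/2)"
    using Sb[OF True, of j] cp by (simp add: divide_le_eq mult.commute)
   finally show ?thesis .
  qed (use M1b in \<open>simp add: d_def\<close>)
  have cn: "nG (corr (d j) j) <= K0 * (M1 * b) * hp j (\<theta> - 1)" "nG (corr' (d j) j) <= K0 * (M1 * b) * hp j (\<theta> - 1 - 1)" for j
   using CN[rule_format, OF M1b db] by auto
  have cL: "corr (d j) j \<in> LG" "corr' (d j) j \<in> LG" for j
   using LG_I[OF AC_L2_fun[OF corr(1)]] LG_I[OF AC_L2[OF corr(1)]] by auto
  define q where "q j e x = Q' j e x - corr (d j) j e x" for j e x
  define r' where "r' j e x = r j e x - corr' (d j) j e x" for j e x
  define V where "V j e x = y0 e 0 + integral {0..x} (q j e)" for j e x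
  define z where "z j e x = y0 e x - V j e x" for j e x
  define w where "w j e x = p0 e x - q j e x" for j e x
  have cL2: "(%e x. c j e) \<in> LG" for j by (rule LG_I[OF L2_iv_const])
  have ACq: "AC (len G e) (q j e) (r' j e)" if ea: "e \<in> Ed" for j e
  proof -
   have "AC (len G e) (%x. Q j e x + c j e) (%x. r j e x + 0)" by (rule AC_add[OF ACQ[OF ea] AC_const])
   hence "AC (len G e) (Q' j e) (r j e)" by (simp add: Q'_def[abs_def])
   from AC_diff[OF this corr(1)[OF ea]] show ?thesis by (simp add: q_def[abs_def] r'_def[abs_def])
  qed
  have qL: "q j \<in> LG" for j by (rule LG_I[OF AC_L2_fun[OF ACq]])
  have ACV: "AC (len G e) (V j e) (q j e)" if ea: "e \<in> Ed" for j e
   unfolding V_def[abs_def] by (rule AC_primitive[OF AC_L2_fun[OF ACq[OF ea]]])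
  \<comment> \<open>The shift restores the increment along the edge and the bumps have mean zero, so
    the primitive \<open>V\<close> ends at the value of \<open>y0\<close> as well as starting from
    it.\<close>
  have intq: "integral {0..len G e} (q j e) = integral {0..len G e} (p0 e)" if ea: "e \<in> Ed" for j e
  proof -
   have l: "0 < len G e" by (rule len_pos[OF ea])
   have i: "Q j e integrable_on {0..len G e}" "(%x. c j e) integrable_on {0..len G e}" "corr (d j) j e integrable_on {0..len G e}"
    using L2_iv_integrable_on[OF LG_D[OF L(1) ea]] L2_iv_integrable_on[OF LG_D[OF cL(1) ea]] by auto
   have "integral {0..len G e} (q j e) = integral {0..len G e} (%x. Q j e x + c j e) - integral {0..len G e} (corr (d j) j e)"
    unfolding q_def[abs_def] Q'_def by (rule integral_diff[OF integrable_add[OF i(1,2)] i(3)])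
   also have "... = integral {0..len G e} (Q j e) + c j e * len G e"
    using integral_add[OF i(1,2)] corr(3)[OF ea] l by simp
   also have "... = integral {0..len G e} (p0 e)" using l by (simp add: c_def)
   finally show ?thesis .
  qed
  have V0: "V j e 0 = y0 e 0" for j e by (simp add: V_def)
  have Vl: "V j e (len G e) = y0 e (len G e)" if ea: "e \<in> Ed" for j e
   using AC_eq[OF AC0[OF ea], of "len G e"] len_pos[OF ea] unfolding V_def intq[OF ea] by simp
  have evV: "endv (V j) e k = endv y0 e k" if ea: "e \<in> Ed" for j e k
   using V0 Vl[OF ea] by (simp add: endv_def)
  have evz: "endv (z j) e k = 0" if ea: "e \<in> Ed" for j e k
   using evV[OF ea] unfolding z_def[abs_def] endv_diff by simp
  have ACz: "AC (len G e) (z j e) (w j e)" if ea: "e \<in> Ed" for j e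
   unfolding z_def[abs_def] w_def[abs_def] by (rule AC_diff[OF AC0[OF ea] ACV[OF ea]])
  have ffz: "form_fun (z j) (w j)" for j
   unfolding form_fun_def vert_fun_def
  proof (intro conjI ballI)
   show "AC (len G e) (z j e) (w j e)" if "e \<in> Ed" for e by (rule ACz[OF that])
   show "\<exists>c. \<forall>(e, b)\<in>Dir G v. endv (z j) e b = c" for v using evz[OF Dir_arcs] by (intro exI[of _ 0]) auto
   show "case x of (e, b) => endv (z j) e b = 0" if "x \<in> Dir G v" for v x using evz[OF Dir_arcs] that by auto
  qed
  have ffV: "form_fun (V j) (q j)" for j
   unfolding form_fun_def vert_fun_def
  proof (intro conjI ballI)
   show "AC (len G e) (V j e) (q j e)" if "e \<in> Ed" for e by (rule ACV[OF that])
  next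
   fix v assume v: "v \<in> verts G"
   obtain k where k: "\<forall>(e, b)\<in>Dir G v. endv y0 e b = k" using form_fun_vert[OF ff0] v unfolding vert_fun_def by blast
   have "endv (V j) e b = k" if D: "(e, b) \<in> Dir G v" for e b using bspec[OF k D] evV[OF Dir_arcs[OF D]] by simp
   thus "\<exists>c. \<forall>(e, b)\<in>Dir G v. endv (V j) e b = c" by (intro exI[of _ k]) auto
  next
   fix v x assume v: "v \<in> VD" and x: "x \<in> Dir G v"
   obtain e b where eb: "x = (e, b)" by (cases x)
   have "\<forall>(e, b)\<in>Dir G v. endv y0 e b = 0" using ff0 v by (simp add: form_fun_def)
   from bspec[OF this x] show "case x of (e, b) => endv (V j) e b = 0" using evV[OF Dir_arcs] x by (simp add: eb)
  qed
  have opV: "op_fun (V j) (q j) (r' j)" for j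
   unfolding op_fun_def
  proof (intro conjI ballI ffV ACq)
   fix v assume v: "v \<in> VK"
   have "outv (q j) e k = outv (Q' j) e k - S j v / real (card (Dir G v))" if D: "(e, k) \<in> Dir G v" for e k
   proof -
    have ea: "e \<in> Ed" and ev: "end_vertex e k = v" using D by (auto simp: Dir_iff)
    have "outv (q j) e k = outv (Q' j) e k - (if k then - d j e k else d j e k)"
     using corr(2)[OF ea, of "d j" j k] by (cases k) (simp_all add: outv_def endv_def q_def)
    moreover have "d j e k = (if k then - 1 else 1) * (S j v / real (card (Dir G v)))"
     unfolding d_def ev using v by simp
    ultimately show ?thesis by (cases k) simp_all
   qed
   hence "(\<Sum>(e, k)\<in>Dir G v. outv (q j) e k) = (\<Sum>(e, k)\<in>Dir G v. outv (Q' j) e k - S j v / real (card (Dir G v)))"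
    by (intro sum.cong) auto
   also have "... = S j v - real (card (Dir G v)) * (S j v / real (card (Dir G v)))"
    by (simp add: case_prod_beta sum_subtractf S_def)
   \<comment> \<open>At an isolated vertex the sum \<open>S j v\<close> is empty, which settles the
     case of division by zero.\<close>
   also have "... = 0"
    by (cases "card (Dir G v) = 0") (auto simp: S_def card_eq_0_iff)
   finally show "(\<Sum>(e, k)\<in>Dir G v. outv (q j) e k) = 0" .
  qed
  let ?H = "%j. hp j (\<theta> - 1)"
  have Hn: "0 <= b * ?H j" for j using b by simp
  have Hle: "b * ?H j <= b" for j using mult_left_mono[OF half_powr_le_1[of "\<theta> - 1" j] b] th by simp
  have wn: "nG (w j) <= K1 * (b * ?H j)" for j
  proof -
   have "nG (w j) = nG (%e x. ((p0 e x - Q j e x) - c j e) + corr (d j) j e x)"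
    by (simp add: w_def[abs_def] q_def Q'_def algebra_simps)
   also have "... <= nG (%e x. (p0 e x - Q j e x) - c j e) + nG (corr (d j) j)"
    by (rule nG_add[OF LG_diff[OF LG_diff[OF L0(2) L(1)] cL2] cL(1)])
   also have "nG (%e x. (p0 e x - Q j e x) - c j e) <= dG p0 (Q j) + nG (%e x. c j e)"
    by (rule nG_diff[OF LG_diff[OF L0(2) L(1)] cL2])
   finally have "nG (w j) <= b * ?H j + n * (b * ?H j) + K0 * (M1 * b) * ?H j"
    using e[of j] cn1[of j] cn(1)[of j] by linarith
   thus ?thesis by (simp add: K1_def algebra_simps)
  qed
  have zn: "nG (z j) <= lt * K1 * (b * ?H j)" for j
  proof -
   have "nG (z j) <= (\<Sum>e\<in>Ed. len G e) * nG (w j)"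
   proof (rule nG_le_if_edges)
    fix e assume ea: "e \<in> Ed"
    have l: "0 < len G e" by (rule len_pos[OF ea])
    have z0: "z j e 0 = 0" by (simp add: z_def V0)
    have "\<bar>z j e x\<bar> <= sqrt (len G e) * nrm (len G e) (w j e)" if x: "x \<in> {0..len G e}" for x
     using AC_increment_le[OF ACz[OF ea], of 0 x j] x l by (simp add: z0)
    hence "nrm (len G e) (z j e) <= sqrt (len G e) * nrm (len G e) (w j e) * sqrt (len G e)"
     by (intro nrm_le_bound AE_iv_I AC_L2_fun[OF ACz[OF ea]]) (use l in auto)
    also have "... = len G e * nrm (len G e) (w j e)" using l by (simp add: mult.commute mult.left_commute)
    also have "... <= len G e * nG (w j)" using l by (intro mult_left_mono nrm_le_nG[OF ea]) simp
    finally show "nrm (len G e) (z j e) <= len G e * nG (w j)" .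
   qed
   also have "... <= lt * (K1 * (b * ?H j))" unfolding lt_def[symmetric] by (rule mult_left_mono[OF wn lt])
   finally show ?thesis by (simp only: mult.assoc)
  qed
  have wL: "w j \<in> LG" and zL: "z j \<in> LG" for j using form_fun_L2[OF ffz] by auto
  have up: "x * (b * ?H j) <= K * b * ?H j" if "x <= K" for x j
   using mult_right_mono[OF that Hn[of j]] by (simp only: mult.assoc)
  have 1: "nG (z j) <= K * b * ?H j" "nG (w j) <= K * b * ?H j" for j
   using order_trans[OF zn up[OF K(3)]] order_trans[OF wn up[OF K(1)]] by blast+
  have K10: "0 <= K1" using K1 by simp
  have 2: "nG (V j) <= K * b" for j
  proof -
   have "dG y0 (z j) <= nG y0 + nG (z j)" by (rule nG_diff[OF L0(1) zL])
   moreover have "(%e x. y0 e x - z j e x) = V j" by (simp add: z_def fun_eq_iff)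
   moreover have "lt * K1 * (b * ?H j) <= lt * K1 * b" by (rule mult_left_mono[OF Hle ltK])
   moreover have "(1 + lt * K1) * b <= K * b" by (rule mult_right_mono[OF K(4) b])
   ultimately show ?thesis using zn[of j] R0(1) b1 by (simp add: algebra_simps)
  qed
  have 3: "nG (q j) <= K * b" for j
  proof -
   have "dG p0 (w j) <= nG p0 + nG (w j)" by (rule nG_diff[OF L0(2) wL])
   moreover have "(%e x. p0 e x - w j e x) = q j" by (simp add: w_def fun_eq_iff)
   moreover have "K1 * (b * ?H j) <= K1 * b" by (rule mult_left_mono[OF Hle K10])
   moreover have "(1 + K1) * b <= K * b" by (rule mult_right_mono[OF K(2) b])
   ultimately show ?thesis using wn[of j] R0(2) b1 by (simp add: algebra_simps)
  qed
  have 4: "nG (r' j) <= K * b * hp j (\<theta> - 2)" for j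
  proof -
   have "nG (r' j) <= nG (r j) + nG (corr' (d j) j)" unfolding r'_def[abs_def] by (rule nG_diff[OF L(2) cL(2)])
   also have "... <= b * hp j (\<theta> - 1 - 1) + K0 * (M1 * b) * hp j (\<theta> - 1 - 1)"
    by (rule add_mono[OF g cn(2)])
   also have "... = (1 + K0 * M1) * (b * hp j (\<theta> - 1 - 1))" by (simp add: algebra_simps)
   also have "... <= K * (b * hp j (\<theta> - 1 - 1))" by (rule mult_right_mono[OF K(7)]) (use b in simp)
   finally show ?thesis by (simp add: mult.assoc)
  qed
  have 5: "AEeq u (%e x. V j e x + z j e x)" for j
  proof -
   have "(%e x. V j e x + z j e x) = y0" by (simp add: z_def fun_eq_iff)
   thus ?thesis using AEeq_sym[OF ae0(1)] by simp
  qed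
  have "op_approx \<theta> (K * b) u"
   unfolding op_approx_def
   by (intro exI[of _ V] exI[of _ q] exI[of _ r'] exI[of _ z] exI[of _ w] allI conjI opV ffz 1 2 3 4 5)
  moreover have "nG u <= K * b"
  proof -
   have "nG u = nG y0" by (rule nG_cong_AE[OF uL L0(1) AEeq_sym[OF ae0(1)]])
   also have "... <= 1 * b" using R0(1) b1 by simp
   also have "... <= K * b" by (rule mult_right_mono[OF K(6) b])
   finally show ?thesis .
  qed
  ultimately show ?thesis by blast
 qed
 with K(5) show ?thesis by blast
qed

end

context metric_graph_loc
begin

lemma H_graph_Hk:
 assumes "1 <= \<gamma>" "u \<in> H_graph G \<gamma>"
 shows "u \<in> Hk_graph G (nat \<lfloor>\<gamma>\<rfloor>)" "Hk_graph_norm G (nat \<lfloor>\<gamma>\<rfloor>) u <= H_graph_norm G \<gamma> u"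
proof -
 show "u \<in> Hk_graph G (nat \<lfloor>\<gamma>\<rfloor>)" using assms unfolding H_graph_def Let_def by (simp split: if_split_asm)
 show "Hk_graph_norm G (nat \<lfloor>\<gamma>\<rfloor>) u <= H_graph_norm G \<gamma> u" using assms(1) by (auto simp: H_graph_norm_def Let_def)
qed

lemma nG_rep_le:
 assumes u: "u \<in> Hk_edges G k" "j <= k" and Y: "Y \<in> LG" "AEeq Y (DG j u)"
 shows "nG Y <= Hk_graph_norm G k u"
 using nG_cong_AE[OF Y(1) D_graph_L2[OF u] Y(2)] nG_D_graph_le[OF u(2), of u] by simp

end

context quantum_graph
begin

lemma H_KD_hdot_below_1:
 assumes \<gamma>: "0 < \<gamma>" "\<gamma> < 1" and t: "0 <= t" "t < \<gamma>"
 shows "\<exists>C. \<forall>u\<in>H_KD G VK VD \<gamma>. hdot_le t u (C * H_graph_norm G \<gamma> u)"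
proof -
 define \<theta> where "\<theta> = (if \<gamma> = 1/2 then (t + 1/2) / 2 else \<gamma>)"
 have th: "0 < \<theta>" "\<theta> <= \<gamma>" "\<theta> \<noteq> 1/2" "\<theta> <= 1" "t < \<theta>" using \<gamma> t by (auto simp: \<theta>_def)
 from form_approx_low[OF \<gamma> th(1-3)] obtain K where K: "0 <= K"
  and A: "\<forall>u\<in>H_KD G VK VD \<gamma>. \<forall>b. 3 * Hfrac_graph_norm G \<gamma> u < b --> nG u <= K * b & form_approx \<theta> (K * b) u"
  by (elim exE conjE)
 from hdot_if_form_approx[OF th(1,4,5)] obtain C where C: "0 <= C"
  and H: "hdot_from_form \<theta> t C"
  by (elim exE conjE)
 have "hdot_le t u (C * K * 3 * H_graph_norm G \<gamma> u)"
  if u: "u \<in> H_KD G VK VD \<gamma>" for u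
 proof -
  have uH: "u \<in> Hfrac_graph G \<gamma>" and n: "H_graph_norm G \<gamma> u = Hfrac_graph_norm G \<gamma> u"
   using u \<gamma> not_Ints_between[of \<gamma>] by (simp_all add: H_KD_def H_graph_def H_graph_norm_def)
  have uL: "u \<in> LG" by (rule Hfrac_L2(1)[OF uH])
  have n0: "0 <= Hfrac_graph_norm G \<gamma> u" by (simp add: Hfrac_graph_norm_def interp_norm_def)
  have 1: "hdot_le t u (C * K * b)" if b: "3 * Hfrac_graph_norm G \<gamma> u < b" for b
  proof -
   have b0: "0 <= K * b" using K b n0 by simp
   from A u b have a: "nG u <= K * b" "form_approx \<theta> (K * b) u" by blast+
   show ?thesis using H[THEN bspec, OF uL, THEN spec, THEN mp, OF b0, THEN mp, OF a(1), THEN mp, OF a(2)] by (simp add: mult.assoc)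
  qed
  have "hN t u <= C * K * (3 * Hfrac_graph_norm G \<gamma> u)"
   by (rule le_if_gt_cmult) (use C K 1 in auto)
  moreover have "u \<in> hF t" using 1[of "3 * Hfrac_graph_norm G \<gamma> u + 1"] by simp
  ultimately show ?thesis using n by (simp add: mult.assoc)
 qed
 thus ?thesis by blast
qed

text \<open>At order 1 the function itself has a representative in the form domain, so the constant
  sequence is an approximation with zero error.\<close>

lemma H_KD_hdot_1:
 assumes t: "t < 1"
 shows "\<exists>C. \<forall>u\<in>H_KD G VK VD 1. hdot_le t u (C * H_graph_norm G 1 u)"
proof -
 from hdot_if_form_approx[OF zero_less_one order_refl t] obtain C where
  H: "hdot_from_form 1 t C"
  by (elim exE conjE)
 have "hdot_le t u (C * H_graph_norm G 1 u)"
  if u: "u \<in> H_KD G VK VD 1" for u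
 proof -
  define b where "b = N1 u"
  have n: "H_graph_norm G 1 u = b" by (simp add: H_graph_norm_def b_def)
  have u1: "u \<in> Hk_graph G 1" and uD: "u \<in> D_space G VD 1"
   using u H_KD_floors[of 1] by (simp_all add: H_KD_def H_graph_def)
  note uE = Hk_graph_edges[OF u1]
  have uL: "u \<in> LG" by (rule Hk_edges_L2[OF uE])
  obtain y p where ff: "form_fun y p" and ae: "AEeq y u" "AEeq p (DG 1 u)"
   by (rule form_fun_rep[OF u1 uD zero_less_one])
  note L = form_fun_L2[OF ff]
  note R = Hk_rep_norms[OF uE L ae, folded b_def]
  have b0: "0 <= b" using Hk_graph_norm_nonneg by (simp add: b_def)
  have "AEeq (%e x. u e x - y e x) (%e x. u e x - u e x)" by (rule AEeq_diff[OF AEeq_refl ae(1)])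
  hence "AEeq (%e x. u e x - y e x) (%e x. 0)" by simp
  from nG_cong_AE[OF LG_diff[OF uL L(1)] LG_zero this] have z: "dG u y = 0" by (simp add: nG_zero)
  have "form_approx 1 b u"
   unfolding form_approx_def by (rule exI[of _ "%_. y"], rule exI[of _ "%_. p"]) (use ff z b0 R in auto)
  moreover have "nG u <= b" using nG_cong_AE[OF L(1) uL ae(1)] R(1) by simp
  ultimately show ?thesis using H uL b0 unfolding n by blast
 qed
 thus ?thesis by blast
qed

lemma H_KD_hdot_below_2:
 assumes \<gamma>: "1 < \<gamma>" "\<gamma> < 2" and t: "t < \<gamma>"
 shows "\<exists>C. \<forall>u\<in>H_KD G VK VD \<gamma>. hdot_le t u (C * H_graph_norm G \<gamma> u)"
proof -
 \<comment> \<open>The critical order 3/2 is avoided in the same way; \<open>max t 1\<close> keeps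
   \<theta> above 1, as the operator approximation requires.\<close>
 define \<theta> where "\<theta> = (if \<gamma> = 3/2 then (max t 1 + 3/2) / 2 else \<gamma>)"
 have th: "1 < \<theta>" "\<theta> <= \<gamma>" "\<theta> \<noteq> 3/2" "\<theta> <= 2" "t < \<theta>" using \<gamma> t by (auto simp: \<theta>_def max_def)
 have fl: "\<lfloor>\<gamma>\<rfloor> = 1" using \<gamma> by (simp add: floor_eq_iff)
 hence f: "nat \<lfloor>\<gamma>\<rfloor> = 1" "frac \<gamma> = \<gamma> - 1" by (simp_all add: frac_def)
 hence fI: "\<gamma> \<notin> \<int>" using \<gamma> by (auto simp: frac_eq_0_iff[symmetric])
 from op_approx_high[OF \<gamma> th(1-3)] obtain K where K: "0 <= K"
  and A: "\<forall>u\<in>H_KD G VK VD \<gamma>. \<forall>b. N1 u < b --> 3 * Hfrac_edges_norm G (\<gamma> - 1) (DG 1 u) < b -->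
   nG u <= K * b & op_approx \<theta> (K * b) u"
  by (elim exE conjE)
 from hdot_if_op_approx[OF th(1,4,5)] obtain C where C: "0 <= C"
  and H: "hdot_from_op \<theta> t C"
  by (elim exE conjE)
 have "hdot_le t u (C * K * 3 * H_graph_norm G \<gamma> u)"
  if u: "u \<in> H_KD G VK VD \<gamma>" for u
 proof -
  define N where "N = H_graph_norm G \<gamma> u"
  have u1: "u \<in> Hk_graph G 1" using u \<gamma> f fI by (simp add: H_KD_def H_graph_def)
  have uL: "u \<in> LG" by (rule Hk_edges_L2[OF Hk_graph_edges[OF u1]])
  have "N = sqrt ((N1 u)^2 + (Hfrac_edges_norm G (\<gamma> - 1) (DG 1 u))^2)"
   using \<gamma> f fI by (simp add: N_def H_graph_norm_def)
  hence N: "N1 u <= N" "Hfrac_edges_norm G (\<gamma> - 1) (DG 1 u) <= N" by simp_all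
  have N0: "0 <= N" using N(1) Hk_graph_norm_nonneg[of 1 u] by linarith
  have 1: "hdot_le t u (C * K * b)" if b: "3 * N < b" for b
  proof -
   have b0: "0 <= K * b" using K b N0 by simp
   have "N1 u < b" "3 * Hfrac_edges_norm G (\<gamma> - 1) (DG 1 u) < b" using N N0 b by linarith+
   with A u have a: "nG u <= K * b" "op_approx \<theta> (K * b) u" by blast+
   show ?thesis using H[THEN bspec, OF uL, THEN spec, THEN mp, OF b0, THEN mp, OF a(1), THEN mp, OF a(2)] by (simp add: mult.assoc)
  qed
  have "hN t u <= C * K * (3 * N)"
   by (rule le_if_gt_cmult) (use C K 1 in auto)
  moreover have "u \<in> hF t" using 1[of "3 * N + 1"] by simp
  ultimately show ?thesis by (simp add: N_def mult.assoc)
 qed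
 thus ?thesis by blast
qed

text \<open>From order 2 on both vertex conditions are in force, so the function has a
  representative in the operator domain; the constant sequence with zero remainder has order
  2.\<close>

lemma H_KD_hdot_ge_2:
 assumes \<gamma>: "2 <= \<gamma>" and t: "t < 2"
 shows "\<exists>C. \<forall>u\<in>H_KD G VK VD \<gamma>. hdot_le t u (C * H_graph_norm G \<gamma> u)"
proof -
 have th: "1 < (2::real)" by simp
 from hdot_if_op_approx[OF th order_refl t] obtain C where
  H: "hdot_from_op 2 t C"
  by (elim exE conjE)
 define k where "k = nat \<lfloor>\<gamma>\<rfloor>"
 have k: "2 <= k" using \<gamma> by (simp add: k_def le_nat_iff le_floor_iff)
 have "hdot_le t u (C * H_graph_norm G \<gamma> u)"
  if u: "u \<in> H_KD G VK VD \<gamma>" for u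
 proof -
  define b where "b = H_graph_norm G \<gamma> u"
  have uH: "u \<in> H_graph G \<gamma>" using u \<gamma> by (simp add: H_KD_def)
  have g1: "1 <= \<gamma>" using \<gamma> by simp
  note Hk = H_graph_Hk[OF g1 uH, folded k_def b_def]
  have u2: "u \<in> Hk_graph G 2" using Hk(1) Hk_graph_mono[OF k] by blast
  note uE = Hk_graph_edges[OF Hk(1)]
  have uL: "u \<in> LG" by (rule Hk_edges_L2[OF uE])
  have uD: "u \<in> D_space G VD (nat \<lfloor>\<gamma>/2 + 3/4\<rfloor>)" and uK: "u \<in> K_space G VK (nat \<lfloor>\<gamma>/2 + 1/4\<rfloor>)"
   using u \<gamma> by (simp_all add: H_KD_def)
  have pos: "0 < nat \<lfloor>\<gamma>/2 + 3/4\<rfloor>" "0 < nat \<lfloor>\<gamma>/2 + 1/4\<rfloor>" using \<gamma> by simp_all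
  obtain y p r where op: "op_fun y p r" and ae: "AEeq y u" "AEeq p (DG 1 u)" "AEeq r (DG 2 u)"
   by (rule op_fun_rep[OF u2 uD pos(1) uK pos(2)])
  note L = form_fun_L2[OF op_fun_form[OF op]] op_fun_L2[OF op]
  have ae0: "AEeq y (DG 0 u)" by (rule AEeq_trans[OF ae(1) AEeq_sym[OF D_graph_0_AEeq[OF uL]]])
  have n: "nG y <= b" "nG p <= b" "nG r <= b"
   using nG_rep_le[OF uE _ L(1) ae0] nG_rep_le[OF uE _ L(2) ae(2)] nG_rep_le[OF uE _ L(3) ae(3)] k Hk(2) by auto
  have b0: "0 <= b" using n(1) nG_nonneg[of y] by linarith
  have "op_approx 2 b u"
   unfolding op_approx_def
   by (rule exI[of _ "%_. y"], rule exI[of _ "%_. p"], rule exI[of _ "%_. r"],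
     rule exI[of _ "%_ e x. 0"], rule exI[of _ "%_ e x. 0"])
    (use op n b0 AEeq_sym[OF ae(1)] op_fun_form[OF op_fun_zero] nG_zero in auto)
  moreover have "nG u <= b" using nG_cong_AE[OF L(1) uL ae(1)] n(1) by simp
  ultimately show ?thesis using H uL b0 unfolding b_def by blast
 qed
 thus ?thesis by blast
qed

text \<open>The half of the comparison that serves negative orders, by duality. Each range of
  \<gamma> has its own approximation: corrected functions, the function itself, primitives of
  corrected derivatives, and again the function itself.\<close>

theorem H_KD_embedding:
 assumes t: "0 <= t" "t < 2" "t < \<gamma>"
 shows "\<exists>C. \<forall>u\<in>H_KD G VK VD \<gamma>. hdot_le t u (C * H_graph_norm G \<gamma> u)"
proof -
 consider "\<gamma> < 1" | "\<gamma> = 1" | "1 < \<gamma>" "\<gamma> < 2" | "2 <= \<gamma>" by linarith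
 thus ?thesis
 proof cases
  case 1
  show ?thesis by (rule H_KD_hdot_below_1) (use 1 t in auto)
 next
  case 2
  show ?thesis unfolding 2 by (rule H_KD_hdot_1) (use 2 t in auto)
 next
  case 3
  show ?thesis by (rule H_KD_hdot_below_2) (use 3 t in auto)
 next
  case 4
  show ?thesis by (rule H_KD_hdot_ge_2) (use 4 t in auto)
 qed
qed

end

section \<open>Functionals, their coefficients and duality\<close>

lemma infsum_Cauchy_Schwarz:
 fixes x y :: "'i => real"
 assumes x: "(%i. (x i)^2) summable_on A" and y: "(%i. (y i)^2) summable_on A"
 shows "(%i. x i * y i) summable_on A"
  and "\<bar>\<Sum>\<^sub>\<infinity>i\<in>A. x i * y i\<bar> <= sqrt (\<Sum>\<^sub>\<infinity>i\<in>A. (x i)^2) * sqrt (\<Sum>\<^sub>\<infinity>i\<in>A. (y i)^2)"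
proof -
 let ?B = "sqrt (\<Sum>\<^sub>\<infinity>i\<in>A. (x i)^2) * sqrt (\<Sum>\<^sub>\<infinity>i\<in>A. (y i)^2)"
 have fin: "(\<Sum>i\<in>F. \<bar>x i * y i\<bar>) <= ?B" if F: "finite F" "F \<subseteq> A" for F
 proof -
  have "(\<Sum>i\<in>F. \<bar>x i * y i\<bar>) <= L2_set x F * L2_set y F"
   using L2_set_mult_ineq[of x y F] by (simp add: abs_mult)
  also have "... <= ?B"
   unfolding L2_set_def
   by (intro mult_mono real_sqrt_le_mono finite_sum_le_infsum x y F) (auto intro!: infsum_nonneg sum_nonneg)
  finally show ?thesis .
 qed
 have s: "(%i. \<bar>x i * y i\<bar>) summable_on A"
  by (rule nonneg_bdd_above_summable_on) (use fin in \<open>auto intro!: bdd_aboveI2\<close>)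
 hence s': "(%i. norm (x i * y i)) summable_on A" by simp
 thus "(%i. x i * y i) summable_on A" by (rule abs_summable_summable)
 have "\<bar>\<Sum>\<^sub>\<infinity>i\<in>A. x i * y i\<bar> <= (\<Sum>\<^sub>\<infinity>i\<in>A. \<bar>x i * y i\<bar>)" using norm_infsum_bound[OF s'] by simp
 also have "... <= ?B" by (rule infsum_le_finite_sums[OF s fin])
 finally show "\<bar>\<Sum>\<^sub>\<infinity>i\<in>A. x i * y i\<bar> <= ?B" .
qed

lemma infsum_single:
 fixes f :: "'i => real"
 assumes "a \<in> A" "!!i. i \<in> A ==> i \<noteq> a ==> f i = 0"
 shows "infsum f A = f a"
proof -
 have "infsum f A = infsum f {a}" by (rule infsum_cong_neutral) (use assms in auto)
 thus ?thesis by simp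
qed

context quantum_graph
begin

abbreviation "hT \<equiv> hdot_test G I \<psi> \<mu>"

lemma hF_L2: "\<phi> \<in> hF t ==> \<phi> \<in> LG"
 by (simp add: hdot_fun_def)

lemma hT_hF: "0 <= t ==> \<phi> \<in> hT ==> \<phi> \<in> hF t"
 by (simp add: hdot_test_def)

lemma \<mu>_powr_sq: "i \<in> I ==> (\<mu> i powr (s / 2) * c)^2 = \<mu> i powr s * c^2"
 by (simp add: power_mult_distrib power2_eq_square[of "\<mu> i powr (s / 2)"] powr_add[symmetric])

lemma \<mu>_powr_cancel: "i \<in> I ==> \<mu> i powr (- s) * \<mu> i powr s = 1"
 using \<mu>_pos[of i] by (simp add: powr_add[symmetric])

lemma hF_lin:
 assumes "\<phi> \<in> hF t" "\<eta> \<in> hF t"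
 shows "(lc c \<phi> d \<eta>) \<in> hF t"
proof -
 have L: "\<phi> \<in> LG" "\<eta> \<in> LG" using assms hF_L2 by auto
 have "(%i. \<mu> i powr t * (inn (lc c \<phi> d \<eta>) (\<psi> i))^2) summable_on I"
 proof (rule summable_on_comparison_test)
  show "(%i. 2 * c^2 * (\<mu> i powr t * (inn \<phi> (\<psi> i))^2) + 2 * d^2 * (\<mu> i powr t * (inn \<eta> (\<psi> i))^2)) summable_on I"
   using assms by (intro summable_on_add summable_on_cmult_right) (auto simp: hdot_fun_def)
  fix i assume i: "i \<in> I"
  let ?x = "inn \<phi> (\<psi> i)" and ?y = "inn \<eta> (\<psi> i)"
  have "(c * ?x + d * ?y)^2 <= 2 * c^2 * ?x^2 + 2 * d^2 * ?y^2"
   using sum_squares_bound[of "c * ?x" "d * ?y"] by (simp add: power2_sum power_mult_distrib)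
  from mult_left_mono[OF this, of "\<mu> i powr t"]
  show "\<mu> i powr t * (inn (lc c \<phi> d \<eta>) (\<psi> i))^2
   <= 2 * c^2 * (\<mu> i powr t * ?x^2) + 2 * d^2 * (\<mu> i powr t * ?y^2)"
   unfolding inn_lin[OF L \<psi>_L2[OF i]] by (simp add: algebra_simps)
 qed auto
 thus ?thesis using LG_lin[OF L] by (simp add: hdot_fun_def)
qed

lemma hF_finite:
 assumes "u \<in> LG" "finite A" "!!i. i \<in> I - A ==> inn u (\<psi> i) = 0"
 shows "u \<in> hF t"
proof -
 have "(%i. \<mu> i powr t * (inn u (\<psi> i))^2) summable_on I \<longleftrightarrow> (%i. \<mu> i powr t * (inn u (\<psi> i))^2) summable_on (I \<inter> A)"
  by (rule summable_on_cong_neutral) (use assms(3) in auto)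
 thus ?thesis using assms(1,2) by (simp add: hdot_fun_def)
qed

lemma \<psi>_test: "i \<in> I ==> \<psi> i \<in> hT"
 unfolding hdot_test_def using hF_finite[OF \<psi>_L2, of i "{i}"] \<psi>_orthonormal[of i] by auto

text \<open>The formal series with coefficients \<open>c\<close>, acting on functions.
  \<open>infsum\<close> is 0 for a divergent series, so this is a genuine pairing only where
  \<open>Fn_bound\<close> applies. Restricted to the test space, as \<open>Uf c\<close>, it is the
  normal form of the elements of the scale.\<close>

definition Fn :: "(nat => real) => 'e graph_fun => real" where
 "Fn c \<phi> = (\<Sum>\<^sub>\<infinity>i\<in>I. c i * inn \<phi> (\<psi> i))"

abbreviation "Uf c \<equiv> restrict (Fn c) hT"

lemma Fn_cong: "(!!i. i \<in> I ==> c i = d i) ==> Fn c = Fn d"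
 unfolding Fn_def fun_eq_iff by (auto intro!: infsum_cong)

lemma Fn_bound:
 assumes c: "wsummable (- t) c" and \<phi>: "\<phi> \<in> hF t"
 shows "(%i. c i * inn \<phi> (\<psi> i)) summable_on I"
  and "\<bar>Fn c \<phi>\<bar> <= sqrt (wsum (- t) c) * hN t \<phi>"
proof -
 let ?x = "%i. \<mu> i powr (- t / 2) * c i" and ?y = "%i. \<mu> i powr (t / 2) * inn \<phi> (\<psi> i)"
 have x: "(?x i)^2 = \<mu> i powr (- t) * (c i)^2" and y: "(?y i)^2 = \<mu> i powr t * (inn \<phi> (\<psi> i))^2" if "i \<in> I" for i
  using \<mu>_powr_sq[OF that, of "- t"] \<mu>_powr_sq[OF that, of t] by simp_all
 have xy: "?x i * ?y i = c i * inn \<phi> (\<psi> i)" if "i \<in> I" for i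
  using \<mu>_powr_cancel[OF that, of "t / 2"] by (simp add: algebra_simps)
 have sx: "(%i. (?x i)^2) summable_on I" using c x by (simp cong: summable_on_cong)
 have sy: "(%i. (?y i)^2) summable_on I" using \<phi> y by (simp add: hdot_fun_def cong: summable_on_cong)
 have e: "(\<Sum>\<^sub>\<infinity>i\<in>I. (?x i)^2) = (wsum (- t) c)"
  "(\<Sum>\<^sub>\<infinity>i\<in>I. (?y i)^2) = (\<Sum>\<^sub>\<infinity>i\<in>I. \<mu> i powr t * (inn \<phi> (\<psi> i))^2)"
  "(\<Sum>\<^sub>\<infinity>i\<in>I. ?x i * ?y i) = Fn c \<phi>"
  unfolding Fn_def by (rule infsum_cong, rule x, assumption, rule infsum_cong, rule y, assumption, rule infsum_cong, rule xy)
 show "(%i. c i * inn \<phi> (\<psi> i)) summable_on I"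
  using infsum_Cauchy_Schwarz(1)[OF sx sy] summable_on_cong[of I "%i. ?x i * ?y i", OF xy] by blast
 show "\<bar>Fn c \<phi>\<bar> <= sqrt (wsum (- t) c) * hN t \<phi>"
  using infsum_Cauchy_Schwarz(2)[OF sx sy] unfolding e hdot_fun_norm_def .
qed

lemma Fn_lin:
 assumes c: "wsummable (- t) c" and \<phi>: "\<phi> \<in> hF t" and \<eta>: "\<eta> \<in> hF t"
 shows "Fn c (lc p \<phi> q \<eta>) = p * Fn c \<phi> + q * Fn c \<eta>"
proof -
 have "Fn c (lc p \<phi> q \<eta>) = (\<Sum>\<^sub>\<infinity>i\<in>I. p * (c i * inn \<phi> (\<psi> i)) + q * (c i * inn \<eta> (\<psi> i)))"
  unfolding Fn_def
 proof (rule infsum_cong)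
  fix i assume i: "i \<in> I"
  show "c i * inn (lc p \<phi> q \<eta>) (\<psi> i) = p * (c i * inn \<phi> (\<psi> i)) + q * (c i * inn \<eta> (\<psi> i))"
   unfolding inn_lin[OF hF_L2[OF \<phi>] hF_L2[OF \<eta>] \<psi>_L2[OF i]] by (simp add: algebra_simps)
 qed
 also have "... = p * Fn c \<phi> + q * Fn c \<eta>"
  unfolding Fn_def
  by (subst infsum_add) (auto intro!: summable_on_cmult_right Fn_bound(1)[OF c] \<phi> \<eta> simp: infsum_cmult_right' )
 finally show ?thesis .
qed

text \<open>Stated for a space \<open>X\<close> inside \<open>hF t\<close>, because the same
  functional is needed on the spectral space and on a Sobolev space embedded in it.\<close>

lemma Fn_dual:
 assumes c: "wsummable (- t) c"
  and X: "X \<subseteq> hF t" "!!\<phi> \<eta> p q. \<phi> \<in> X ==> \<eta> \<in> X ==> (lc p \<phi> q \<eta>) \<in> X"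
  and N: "!!\<phi>. \<phi> \<in> X ==> hN t \<phi> <= K * N \<phi>"
 shows "restrict (Fn c) X \<in> dual_space X N"
proof -
 let ?S = "sqrt (wsum (- t) c)"
 have S: "0 <= ?S" by (intro real_sqrt_ge_zero infsum_nonneg) simp
 have "\<bar>restrict (Fn c) X \<phi>\<bar> <= ?S * K * N \<phi>" if \<phi>: "\<phi> \<in> X" for \<phi>
 proof -
  have "\<bar>Fn c \<phi>\<bar> <= ?S * hN t \<phi>" by (rule Fn_bound(2)[OF c]) (use X \<phi> in blast)
  also have "... <= ?S * (K * N \<phi>)" by (rule mult_left_mono[OF N[OF \<phi>] S])
  finally show ?thesis using \<phi> by (simp add: mult.assoc)
 qed
 moreover have "restrict (Fn c) X (lc p \<phi> q \<eta>) = p * restrict (Fn c) X \<phi> + q * restrict (Fn c) X \<eta>"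
  if "\<phi> \<in> X" "\<eta> \<in> X" for \<phi> \<eta> p q
  using that X Fn_lin[OF c, of \<phi> \<eta> p q] by (simp add: subset_iff)
 ultimately show ?thesis unfolding dual_space_def by auto
qed

lemma Uf_hdot:
 assumes t: "0 < t" and c: "wsummable (- t) c"
 shows "Uf c \<in> hdot G I \<psi> \<mu> (- t)"
proof -
 have "restrict (Fn c) (hF t) \<in> dual_space (hF t) (hN t)"
  by (rule Fn_dual[where K = 1, OF c subset_refl hF_lin]) simp_all
 moreover have "Uf c = restrict (restrict (Fn c) (hF t)) hT"
  by (rule ext) (simp add: restrict_def hT_hF[OF less_imp_le[OF t]])
 ultimately have "Uf c \<in> (%F. restrict F hT) ` dual_space (hF t) (hN t)" by (intro image_eqI)
 thus ?thesis using t by (simp add: hdot_def)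
qed

lemma Fn_\<psi>: "i \<in> I ==> Fn c (\<psi> i) = c i"
 unfolding Fn_def using \<psi>_orthonormal by (subst infsum_single[of i]) auto

lemma Uf_\<psi>: "i \<in> I ==> Uf c (\<psi> i) = c i"
 using \<psi>_test Fn_\<psi> by simp

lemma op_power_Uf:
 "op_power G I \<psi> \<mu> \<gamma> (Uf c) = Uf (%i. \<mu> i powr \<gamma> * c i)"
proof -
 have "(\<Sum>\<^sub>\<infinity>i\<in>I. \<mu> i powr \<gamma> * Uf c (\<psi> i) * inn (\<psi> i) \<phi>) = Fn (%i. \<mu> i powr \<gamma> * c i) \<phi>" for \<phi>
  unfolding Fn_def[of "%i. \<mu> i powr \<gamma> * c i"] by (rule infsum_cong) (simp only: Uf_\<psi> inn_commute)
 thus ?thesis by (simp only: op_power_def)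
qed

lemma dual_space_lin:
 assumes "F \<in> dual_space X N" "\<phi> \<in> X" "\<eta> \<in> X"
 shows "F (lc c \<phi> d \<eta>) = c * F \<phi> + d * F \<eta>"
 using assms unfolding dual_space_def by blast

lemma dual_sum:
 assumes F: "F \<in> dual_space (hF t) (hN t)" and A: "finite A" "A \<subseteq> I"
 shows "F (%e x. \<Sum>i\<in>A. c i * \<psi> i e x) = (\<Sum>i\<in>A. c i * F (\<psi> i))"
  and "(%e x. \<Sum>i\<in>A. c i * \<psi> i e x) \<in> hF t"
proof -
 note lin = dual_space_lin[OF F]
 have p: "\<psi> i \<in> hF t" if "i \<in> I" for i using hF_finite[OF \<psi>_L2[OF that], of "{i}"] \<psi>_orthonormal[OF that] by auto
 have z: "(%e x. 0) \<in> hF t" by (rule hF_finite[OF LG_zero, of "{}"]) (simp_all add: inn_zero)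
 have "F (%e x. \<Sum>i\<in>A. c i * \<psi> i e x) = (\<Sum>i\<in>A. c i * F (\<psi> i)) & (%e x. \<Sum>i\<in>A. c i * \<psi> i e x) \<in> hF t"
  using A
 proof (induction A rule: finite_induct)
  case empty
  have "F (%e x. 0 * 0 + 0 * 0) = 0 * F (%e x. 0) + 0 * F (%e x. 0)" by (rule lin[OF z z])
  thus ?case using z by simp
 next
  case (insert j A)
  let ?s = "%e x. \<Sum>i\<in>A. c i * \<psi> i e x"
  have s: "?s \<in> hF t" "F ?s = (\<Sum>i\<in>A. c i * F (\<psi> i))" and j: "\<psi> j \<in> hF t" using insert p by auto
  have eq: "(%e x. \<Sum>i\<in>insert j A. c i * \<psi> i e x) = (%e x. c j * \<psi> j e x + 1 * ?s e x)"
   using insert.hyps by simp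
  show ?case unfolding eq lin[OF j s(1)] using insert.hyps s hF_lin[OF j s(1), of "c j" 1] by simp
 qed
 thus "F (%e x. \<Sum>i\<in>A. c i * \<psi> i e x) = (\<Sum>i\<in>A. c i * F (\<psi> i))"
  "(%e x. \<Sum>i\<in>A. c i * \<psi> i e x) \<in> hF t" by simp_all
qed

lemma inn_sum_\<psi>:
 assumes "finite A" "A \<subseteq> I" "i \<in> I"
 shows "inn (%e x. \<Sum>i\<in>A. c i * \<psi> i e x) (\<psi> i) = (if i \<in> A then c i else 0)"
proof -
 have "inn (%e x. \<Sum>i\<in>A. c i * \<psi> i e x) (\<psi> i) = (\<Sum>k\<in>A. c k * inn (\<psi> k) (\<psi> i))"
  by (rule inn_sum[OF assms(1) _ \<psi>_L2[OF assms(3)]]) (use assms \<psi>_L2 in auto)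
 also have "... = (\<Sum>k\<in>A. if k = i then c k else 0)"
  by (rule sum.cong) (use assms \<psi>_orthonormal in auto)
 finally show ?thesis using assms(1) by simp
qed

text \<open>\<open>F\<close> is tested on the finite sum with coefficients
  \<open>\<mu> i powr (- t) * F (\<psi> i)\<close>, as in the Riesz representation: the value of
  \<open>F\<close> there and the squared norm of the sum are both the partial sum to be
  bounded.\<close>

lemma dual_coef_summable:
 assumes F: "F \<in> dual_space (hF t) (hN t)"
 shows "(%i. \<mu> i powr (- t) * (F (\<psi> i))^2) summable_on I"
proof -
 obtain C where C: "!!\<phi>. \<phi> \<in> hF t ==> \<bar>F \<phi>\<bar> <= C * hN t \<phi>" using F unfolding dual_space_def by blast
 have "(\<Sum>i\<in>A. \<mu> i powr (- t) * (F (\<psi> i))^2) <= C^2" if A: "finite A" "A \<subseteq> I" for A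
 proof -
  let ?S = "\<Sum>i\<in>A. \<mu> i powr (- t) * (F (\<psi> i))^2"
  let ?c = "%i. \<mu> i powr (- t) * F (\<psi> i)"
  let ?\<phi> = "%e x. \<Sum>i\<in>A. ?c i * \<psi> i e x"
  have S0: "0 <= ?S" by (intro sum_nonneg) simp
  have "(\<Sum>\<^sub>\<infinity>i\<in>I. \<mu> i powr t * (inn ?\<phi> (\<psi> i))^2) = (\<Sum>\<^sub>\<infinity>i\<in>A. \<mu> i powr (- t) * (F (\<psi> i))^2)"
  proof (rule infsum_cong_neutral)
   fix i assume i: "i \<in> I \<inter> A"
   have "\<mu> i powr t * (?c i)^2 = (\<mu> i powr (- t) * \<mu> i powr t) * (\<mu> i powr (- t) * (F (\<psi> i))^2)"
    by (simp add: power2_eq_square algebra_simps)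
   also have "... = \<mu> i powr (- t) * (F (\<psi> i))^2" using i \<mu>_powr_cancel[of i t] by simp
   finally show "\<mu> i powr t * (inn ?\<phi> (\<psi> i))^2 = \<mu> i powr (- t) * (F (\<psi> i))^2"
    using i inn_sum_\<psi>[OF A, of i ?c] by simp
  qed (use A inn_sum_\<psi>[OF A] in auto)
  hence hN: "hN t ?\<phi> = sqrt ?S" using A(1) by (simp add: hdot_fun_norm_def)
  have "F ?\<phi> = ?S" unfolding dual_sum(1)[OF F A] by (simp add: power2_eq_square mult.assoc)
  hence "?S <= C * sqrt ?S" using C[OF dual_sum(2)[OF F A, of ?c]] hN by simp
  hence "sqrt ?S * sqrt ?S <= C * sqrt ?S" using S0 by simp
  moreover have "r <= \<bar>C\<bar>" if "r * r <= C * r" "0 <= r" for r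
   using that mult_right_le_imp_le[of r r C] by (cases "r = 0") auto
  ultimately have "sqrt ?S <= \<bar>C\<bar>" using S0 real_sqrt_ge_zero by blast
  hence "(sqrt ?S)^2 <= \<bar>C\<bar>^2" using S0 by (intro power_mono) auto
  thus ?thesis using S0 by simp
 qed
 thus ?thesis by (intro nonneg_bdd_above_summable_on bdd_aboveI2) auto
qed

text \<open>The finite partial sums of the expansion of \<phi> converge to \<phi> in the norm of
  \<open>hF t\<close>, in which \<open>F\<close> is continuous.\<close>

lemma dual_repr:
 assumes F: "F \<in> dual_space (hF t) (hN t)" and \<phi>: "\<phi> \<in> hF t"
 shows "F \<phi> = Fn (%i. F (\<psi> i)) \<phi>"
proof -
 obtain C where C: "!!\<phi>. \<phi> \<in> hF t ==> \<bar>F \<phi>\<bar> <= C * hN t \<phi>" using F unfolding dual_space_def by blast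
 let ?g = "%i. \<mu> i powr t * (inn \<phi> (\<psi> i))^2"
 let ?s = "%A e x. \<Sum>i\<in>A. inn \<phi> (\<psi> i) * \<psi> i e x"
 have g: "?g summable_on I" using \<phi> by (simp add: hdot_fun_def)
 have "((%A. infsum ?g I - sum ?g A) \<longlongrightarrow> infsum ?g I - infsum ?g I) (finite_subsets_at_top I)"
  by (intro tendsto_diff tendsto_const) (use has_sum_infsum[OF g] in \<open>simp add: has_sum_def\<close>)
 hence lim: "((%A. C * sqrt (infsum ?g I - sum ?g A)) \<longlongrightarrow> C * sqrt 0) (finite_subsets_at_top I)"
  by (intro tendsto_mult tendsto_const tendsto_real_sqrt) simp
 have b: "\<bar>(\<Sum>i\<in>A. F (\<psi> i) * inn \<phi> (\<psi> i)) - F \<phi>\<bar> <= C * sqrt (infsum ?g I - sum ?g A)" if A: "finite A" "A \<subseteq> I" for A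
 proof -
  have sL: "?s A \<in> hF t" by (rule dual_sum(2)[OF F A])
  have "F (%e x. 1 * ?s A e x + - 1 * \<phi> e x) = 1 * F (?s A) + - 1 * F \<phi>"
   by (rule dual_space_lin[OF F sL \<phi>])
  hence e1: "F (%e x. 1 * ?s A e x + - 1 * \<phi> e x) = (\<Sum>i\<in>A. F (\<psi> i) * inn \<phi> (\<psi> i)) - F \<phi>"
   unfolding dual_sum(1)[OF F A] by (simp add: mult.commute)
  have "(\<Sum>\<^sub>\<infinity>i\<in>I. \<mu> i powr t * (inn (%e x. 1 * ?s A e x + - 1 * \<phi> e x) (\<psi> i))^2) = infsum ?g (I - A)"
  proof (rule infsum_cong_neutral)
   have in1: "inn (%e x. 1 * ?s A e x + - 1 * \<phi> e x) (\<psi> i) = (if i \<in> A then 0 else - inn \<phi> (\<psi> i))" if i: "i \<in> I" for i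
    unfolding inn_lin[OF hF_L2[OF sL] hF_L2[OF \<phi>] \<psi>_L2[OF i]] inn_sum_\<psi>[OF A i] by simp
   show "\<mu> i powr t * (inn (%e x. 1 * ?s A e x + - 1 * \<phi> e x) (\<psi> i))^2 = 0" if "i \<in> I - (I - A)" for i
    using that in1 by auto
   show "\<mu> i powr t * (inn (%e x. 1 * ?s A e x + - 1 * \<phi> e x) (\<psi> i))^2 = ?g i" if "i \<in> I \<inter> (I - A)" for i
    using that in1 by auto
  qed auto
  also have "... = infsum ?g I - sum ?g A"
   by (subst infsum_Diff) (use g A in auto)
  finally have "hN t (%e x. 1 * ?s A e x + - 1 * \<phi> e x) = sqrt (infsum ?g I - sum ?g A)" by (simp only: hdot_fun_norm_def)
  thus ?thesis using C[OF hF_lin[OF sL \<phi>, of 1 "- 1"]] unfolding e1 by simp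
 qed
 have "((%A. \<Sum>i\<in>A. F (\<psi> i) * inn \<phi> (\<psi> i)) \<longlongrightarrow> F \<phi>) (finite_subsets_at_top I)"
 proof (rule LIM_zero_cancel, rule Lim_null_comparison)
  show "\<forall>\<^sub>F A in finite_subsets_at_top I. norm ((\<Sum>i\<in>A. F (\<psi> i) * inn \<phi> (\<psi> i)) - F \<phi>) <= C * sqrt (infsum ?g I - sum ?g A)"
   by (rule eventually_finite_subsets_at_top_weakI) (use b in simp)
  show "((%A. C * sqrt (infsum ?g I - sum ?g A)) \<longlongrightarrow> 0) (finite_subsets_at_top I)" using lim by simp
 qed
 hence "((%i. F (\<psi> i) * inn \<phi> (\<psi> i)) has_sum F \<phi>) I" by (simp add: has_sum_def)
 thus ?thesis unfolding Fn_def by (rule infsumI[symmetric])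
qed

lemma inner_repr:
 assumes "u \<in> LG" "\<phi> \<in> LG"
 shows "inn u \<phi> = Fn (%i. inn u (\<psi> i)) \<phi>"
 unfolding Fn_def by (rule infsumI[OF Parseval_inner[OF assms], symmetric])

lemma fun_functional_Uf:
 assumes "u \<in> LG" "!!i. i \<in> I ==> inn u (\<psi> i) = c i"
 shows "fun_functional G I \<psi> \<mu> u = Uf c"
proof -
 have "inn u \<phi> = Fn c \<phi>" if "\<phi> \<in> hT" for \<phi>
 proof -
  have "\<phi> \<in> LG" using hF_L2[OF hT_hF[OF order_refl that]] .
  hence "inn u \<phi> = Fn (%i. inn u (\<psi> i)) \<phi>" by (rule inner_repr[OF assms(1)])
  also have "... = Fn c \<phi>" by (rule fun_cong[OF Fn_cong[OF assms(2)]])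
  finally show ?thesis .
 qed
 thus ?thesis unfolding fun_functional_def by (auto simp: restrict_def fun_eq_iff)
qed

text \<open>An element of the scale is determined by its values at the eigenfunctions; the
  uniqueness of the solution rests on this.\<close>

lemma hdot_repr:
 assumes "U \<in> hdot G I \<psi> \<mu> s"
 shows "U = Uf (%i. U (\<psi> i))"
proof (cases "0 <= s")
 case True
 then obtain u where u: "u \<in> LG" and U: "U = fun_functional G I \<psi> \<mu> u" using assms hF_L2 by (auto simp: hdot_def)
 have "U (\<psi> i) = inn u (\<psi> i)" if "i \<in> I" for i using \<psi>_test[OF that] by (simp add: U fun_functional_def)
 thus ?thesis using fun_functional_Uf[OF u, of "%i. U (\<psi> i)"] U by simp
next
 case False
 then obtain F where F: "F \<in> dual_space (hF (- s)) (hN (- s))" and U: "U = restrict F hT" using assms by (auto simp: hdot_def)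
 have Ui: "U (\<psi> i) = F (\<psi> i)" if "i \<in> I" for i using \<psi>_test[OF that] by (simp add: U)
 have "F \<phi> = Fn (%i. U (\<psi> i)) \<phi>" if "\<phi> \<in> hT" for \<phi>
  using dual_repr[OF F hT_hF[OF _ that]] False Fn_cong[of "%i. U (\<psi> i)" "%i. F (\<psi> i)", OF Ui] by simp
 thus ?thesis unfolding U by (auto simp: restrict_def fun_eq_iff)
qed

lemma hdot_coef_summable:
 assumes "U \<in> hdot G I \<psi> \<mu> (- t)" "0 < t"
 shows "(%i. \<mu> i powr (- t) * (U (\<psi> i))^2) summable_on I"
proof -
 obtain F where F: "F \<in> dual_space (hF t) (hN t)" and U: "U = restrict F hT" using assms by (auto simp: hdot_def)
 have "U (\<psi> i) = F (\<psi> i)" if "i \<in> I" for i using \<psi>_test[OF that] by (simp add: U)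
 thus ?thesis using dual_coef_summable[OF F] by (simp cong: summable_on_cong)
qed

end

section \<open>White noise and the solution of the equation\<close>

context quantum_graph
begin

text \<open>The squared norm of the remainder after finitely many terms is the tail of a convergent
  series.\<close>

lemma noise_path:
 assumes X: "!!s. 1/2 < s ==> (%i. \<mu> i powr (- s) * (W (\<psi> i) \<omega>)^2) summable_on I"
 shows "is_noise_path G I \<psi> \<mu> W \<omega> (Uf (%i. W (\<psi> i) \<omega>))"
 unfolding is_noise_path_def
proof (intro allI impI conjI)
 fix \<delta> :: real assume \<delta>: "0 < \<delta>"
 let ?t = "1/2 + \<delta>" and ?X = "%i. W (\<psi> i) \<omega>"
 let ?g = "%i. \<mu> i powr (- ?t) * (?X i)^2"
 let ?R = "%A \<phi>. Uf ?X \<phi> - (\<Sum>i\<in>A. ?X i * fun_functional G I \<psi> \<mu> (\<psi> i) \<phi>)"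
 have t: "- 1/2 - \<delta> = - ?t" by simp
 have g: "?g summable_on I" by (rule X) (use \<delta> in simp)
 show "Uf ?X \<in> hdot G I \<psi> \<mu> (- 1/2 - \<delta>)" unfolding t by (rule Uf_hdot[OF _ g]) (use \<delta> in simp)
 have eq: "hdot_norm I \<psi> \<mu> (- ?t) (?R A) = sqrt (infsum ?g I - sum ?g A)" if A: "finite A" "A \<subseteq> I" for A
 proof -
  have R: "?R A (\<psi> j) = (if j \<in> A then 0 else ?X j)" if j: "j \<in> I" for j
  proof -
   have "(\<Sum>i\<in>A. ?X i * fun_functional G I \<psi> \<mu> (\<psi> i) (\<psi> j)) = (\<Sum>i\<in>A. if i = j then ?X i else 0)"
    by (rule sum.cong) (use A j \<psi>_test[OF j] \<psi>_orthonormal in \<open>auto simp: fun_functional_def\<close>)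
   thus ?thesis using A(1) Uf_\<psi>[OF j] by simp
  qed
  have "(\<Sum>\<^sub>\<infinity>j\<in>I. \<mu> j powr (- ?t) * (?R A (\<psi> j))^2) = infsum ?g (I - A)"
   by (rule infsum_cong_neutral) (use R in auto)
  also have "... = infsum ?g I - sum ?g A" by (subst infsum_Diff) (use g A in auto)
  finally show ?thesis by (simp only: hdot_norm_def)
 qed
 have "((%A. infsum ?g I - sum ?g A) \<longlongrightarrow> infsum ?g I - infsum ?g I) (finite_subsets_at_top I)"
  by (intro tendsto_diff tendsto_const) (use has_sum_infsum[OF g] in \<open>simp add: has_sum_def\<close>)
 hence "((%A. sqrt (infsum ?g I - sum ?g A)) \<longlongrightarrow> sqrt 0) (finite_subsets_at_top I)"
  by (intro tendsto_real_sqrt) simp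
 moreover have "\<forall>\<^sub>F A in finite_subsets_at_top I. sqrt (infsum ?g I - sum ?g A) = hdot_norm I \<psi> \<mu> (- ?t) (?R A)"
  by (rule eventually_finite_subsets_at_top_weakI) (use eq in simp)
 ultimately have "((%A. hdot_norm I \<psi> \<mu> (- ?t) (?R A)) \<longlongrightarrow> sqrt 0) (finite_subsets_at_top I)"
  by (rule Lim_transform_eventually)
 thus "((%A. hdot_norm I \<psi> \<mu> (- 1/2 - \<delta>) (?R A)) \<longlongrightarrow> 0) (finite_subsets_at_top I)" unfolding t by simp
qed

text \<open>Convergence in one norm of the family, here for \<delta> = 1, controls every coefficient
  of the remainder; once the finite set contains \<open>i\<close>, that coefficient is the fixed
  number \<open>Z (\<psi> i) - W (\<psi> i) \<omega>\<close>.\<close>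

lemma noise_path_coef:
 assumes X: "!!s. 1/2 < s ==> (%i. \<mu> i powr (- s) * (W (\<psi> i) \<omega>)^2) summable_on I"
  and Z: "is_noise_path G I \<psi> \<mu> W \<omega> Z" and i: "i \<in> I"
 shows "Z (\<psi> i) = W (\<psi> i) \<omega>"
proof -
 let ?X = "%i. W (\<psi> i) \<omega>"
 let ?R = "%A \<phi>. Z \<phi> - (\<Sum>i\<in>A. ?X i * fun_functional G I \<psi> \<mu> (\<psi> i) \<phi>)"
 have t: "- 1/2 - 1 = - (3/2 :: real)" by simp
 have "0 < (1 :: real)" by simp
 with Z have ZZ: "Z \<in> hdot G I \<psi> \<mu> (- 1/2 - 1) &
  ((%A. hdot_norm I \<psi> \<mu> (- 1/2 - 1) (?R A)) \<longlongrightarrow> 0) (finite_subsets_at_top I)"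
  unfolding is_noise_path_def by blast
 hence ZH: "Z \<in> hdot G I \<psi> \<mu> (- (3/2))" and lim: "((%A. hdot_norm I \<psi> \<mu> (- (3/2)) (?R A)) \<longlongrightarrow> 0) (finite_subsets_at_top I)"
  unfolding t by blast+
 have sZ: "(%j. \<mu> j powr (- (3/2)) * (Z (\<psi> j))^2) summable_on I" by (rule hdot_coef_summable[OF ZH]) simp
 have sX: "(%j. \<mu> j powr (- (3/2)) * (?X j)^2) summable_on I" by (rule X) simp
 have b: "sqrt (\<mu> i powr (- (3/2)) * (Z (\<psi> i) - ?X i)^2) <= hdot_norm I \<psi> \<mu> (- (3/2)) (?R A)" if A: "finite A" "A \<subseteq> I" "i \<in> A" for A
 proof -
  have R: "?R A (\<psi> j) = Z (\<psi> j) - (if j \<in> A then ?X j else 0)" if j: "j \<in> I" for j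
  proof -
   have "(\<Sum>i\<in>A. ?X i * fun_functional G I \<psi> \<mu> (\<psi> i) (\<psi> j)) = (\<Sum>i\<in>A. if i = j then ?X i else 0)"
    by (rule sum.cong) (use A j \<psi>_test[OF j] \<psi>_orthonormal in \<open>auto simp: fun_functional_def\<close>)
   thus ?thesis using A(1) by simp
  qed
  \<comment> \<open>\<open>hdot_norm\<close> is built on \<open>infsum\<close>, which is 0 for a
    divergent series, so summability must be known before a single term can be bounded by the
    norm.\<close>
  have s: "(%j. \<mu> j powr (- (3/2)) * (?R A (\<psi> j))^2) summable_on I"
  proof (rule summable_on_comparison_test)
   show "(%j. 2 * (\<mu> j powr (- (3/2)) * (Z (\<psi> j))^2) + 2 * (\<mu> j powr (- (3/2)) * (?X j)^2)) summable_on I"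
    by (intro summable_on_add summable_on_cmult_right sZ sX)
   fix j assume j: "j \<in> I"
   have "(?R A (\<psi> j))^2 <= 2 * (Z (\<psi> j))^2 + 2 * (?X j)^2"
    unfolding R[OF j] using sum_squares_bound[of "Z (\<psi> j)" "- ?X j"] by (simp add: power2_diff)
   from mult_left_mono[OF this, of "\<mu> j powr (- (3/2))"]
   show "\<mu> j powr (- (3/2)) * (?R A (\<psi> j))^2 <= 2 * (\<mu> j powr (- (3/2)) * (Z (\<psi> j))^2) + 2 * (\<mu> j powr (- (3/2)) * (?X j)^2)"
    by (simp add: algebra_simps)
  qed auto
  have "(\<Sum>j\<in>{i}. \<mu> j powr (- (3/2)) * (?R A (\<psi> j))^2) <= (\<Sum>\<^sub>\<infinity>j\<in>I. \<mu> j powr (- (3/2)) * (?R A (\<psi> j))^2)"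
   by (rule finite_sum_le_infsum[OF s]) (use i in auto)
  hence "\<mu> i powr (- (3/2)) * (Z (\<psi> i) - ?X i)^2 <= (\<Sum>\<^sub>\<infinity>j\<in>I. \<mu> j powr (- (3/2)) * (?R A (\<psi> j))^2)"
   using R[OF i] A(3) by simp
  thus ?thesis unfolding hdot_norm_def by (rule real_sqrt_le_mono)
 qed
 have "sqrt (\<mu> i powr (- (3/2)) * (Z (\<psi> i) - ?X i)^2) <= 0"
 proof (rule tendsto_lowerbound[OF lim])
  show "\<forall>\<^sub>F A in finite_subsets_at_top I. sqrt (\<mu> i powr (- (3/2)) * (Z (\<psi> i) - ?X i)^2) <= hdot_norm I \<psi> \<mu> (- (3/2)) (?R A)"
   unfolding eventually_finite_subsets_at_top by (rule exI[of _ "{i}"]) (use i b in auto)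
 qed simp
 hence "\<mu> i powr (- (3/2)) * (Z (\<psi> i) - ?X i)^2 <= 0" by simp
 moreover have "0 < \<mu> i powr (- (3/2))" using \<mu>_pos[OF i] by simp
 ultimately have "(Z (\<psi> i) - ?X i)^2 <= 0" by (simp add: mult_le_0_iff)
 thus ?thesis by simp
qed

lemma power_coef_summable:
 assumes X: "!!s. 1/2 < s ==> wsummable (- s) X" and s: "s < \<alpha> - 1/2"
 shows "(%i. \<mu> i powr s * (\<mu> i powr (- \<alpha> / 2) * X i)^2) summable_on I"
proof -
 have "\<mu> i powr s * (\<mu> i powr (- \<alpha> / 2) * X i)^2 = \<mu> i powr (- (\<alpha> - s)) * (X i)^2" if "i \<in> I" for i
  unfolding \<mu>_powr_sq[OF that] by (simp add: mult.assoc[symmetric] powr_add[symmetric])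
 moreover have "wsummable (- (\<alpha> - s)) X" by (rule X) (use s in simp)
 ultimately show ?thesis by (simp cong: summable_on_cong)
qed

text \<open>For \<beta> >= 0, an order strictly between \<beta> and \<alpha> - 1/2 is below 2 since
  \<alpha> < 5/2. For \<beta> < 0, the functional lives on \<open>hF t\<close> when t > 1/2 -
  \<alpha>, and the Sobolev space of order -\<beta> embeds there when t < 2 and t < -\<beta>; such
  \<open>t\<close> exist because \<alpha> > -3/2.\<close>

lemma in_H_KD_if_coef:
 assumes c: "!!s. s < \<alpha> - 1/2 ==> wsummable s c"
  and \<alpha>: "- 3/2 < \<alpha>" "\<alpha> < 5/2" and \<beta>: "\<beta> < \<alpha> - 1/2"
 shows "in_H_KD G VK VD I \<psi> \<mu> \<beta> (Uf c)"
proof (cases "0 <= \<beta>")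
 case True
 define s where "s = (\<beta> + (\<alpha> - 1/2)) / 2"
 have s: "\<beta> < s" "s < 2" "s < \<alpha> - 1/2" using \<beta> \<alpha> by (auto simp: s_def)
 from H_KD_from_coefficients[OF c[OF s(3)] True s(1,2)] obtain u where u: "u \<in> H_KD G VK VD \<beta>" and ui: "\<forall>i\<in>I. inn u (\<psi> i) = c i"
  by blast
 have uL: "u \<in> LG" using u by (auto simp: H_KD_def K_space_def split: if_splits)
 have "fun_functional G I \<psi> \<mu> u = Uf c" by (rule fun_functional_Uf[OF uL]) (use ui in blast)
 hence "Uf c \<in> fun_functional G I \<psi> \<mu> ` H_KD G VK VD \<beta>" using u by (metis imageI)
 thus ?thesis using True by (simp add: in_H_KD_def)
next
 case False
 define \<gamma> where "\<gamma> = - \<beta>"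
 define p where "p = min 2 \<gamma>"
 \<comment> \<open>The midpoint between the two bounds, raised to 0 if it is negative because
   \<open>in_H_KD\<close> and the embedding take a nonnegative order.\<close>
 define t where "t = max 0 ((1/2 - \<alpha> + p) / 2)"
 have \<gamma>: "0 < \<gamma>" "1/2 - \<alpha> < \<gamma>" using False \<beta> by (simp_all add: \<gamma>_def)
 have p: "1/2 - \<alpha> < p" "0 < p" "p <= 2" "p <= \<gamma>" using \<gamma> \<alpha> by (auto simp: p_def)
 have t0: "(1/2 - \<alpha> + p) / 2 <= t" "0 <= t" "t < p" using p by (auto simp: t_def)
 have "1/2 - \<alpha> < t" using t0(1) p(1) by (simp add: field_simps)
 with t0 p have t: "0 <= t" "t < 2" "t < \<gamma>" "- t < \<alpha> - 1/2" by auto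
 obtain C where C: "\<forall>u\<in>H_KD G VK VD \<gamma>. u \<in> hF t & hN t u <= C * H_graph_norm G \<gamma> u"
  using H_KD_embedding[OF t(1-3)] by (elim exE)
 let ?F = "restrict (Fn c) (hF t)"
 note ct = c[OF t(4)]
 have F: "?F \<in> dual_space (hF t) (hN t)" by (rule Fn_dual[where K = 1, OF ct subset_refl hF_lin]) simp_all
 have sub: "H_KD G VK VD \<gamma> \<subseteq> hF t" using C by blast
 have "restrict (Fn c) (H_KD G VK VD \<gamma>) \<in> dual_space (H_KD G VK VD \<gamma>) (H_graph_norm G \<gamma>)"
  by (rule Fn_dual[where K = C, OF ct sub H_KD_lin]) (use C in blast)+
 moreover have "restrict ?F (H_KD G VK VD \<gamma>) = restrict (Fn c) (H_KD G VK VD \<gamma>)"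
  by (rule ext) (use sub in \<open>auto simp: restrict_def\<close>)
 moreover have "Uf c = restrict ?F hT" by (rule ext) (simp add: restrict_def hT_hF[OF t(1)])
 ultimately show ?thesis
  using False F sub t(1) unfolding in_H_KD_def \<gamma>_def[symmetric] by metis
qed

lemma solution:
 assumes X: "!!s. 1/2 < s ==> (%i. \<mu> i powr (- s) * (W (\<psi> i) \<omega>)^2) summable_on I"
  and \<alpha>: "- 3/2 < \<alpha>" "\<alpha> < 5/2" and \<epsilon>: "0 < \<epsilon>"
 shows "\<exists>U. is_solution G I \<psi> \<mu> \<alpha> W \<omega> U & in_H_KD G VK VD I \<psi> \<mu> (\<alpha> - 1/2 - \<epsilon>) U &
  (\<forall>U'. is_solution G I \<psi> \<mu> \<alpha> W \<omega> U' --> U' = U)"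
proof -
 define c where "c i = \<mu> i powr (- \<alpha> / 2) * W (\<psi> i) \<omega>" for i
 have cs: "wsummable s c" if "s < \<alpha> - 1/2" for s
  unfolding c_def by (rule power_coef_summable[OF X that])
 have cancel: "\<mu> i powr (\<alpha> / 2) * c i = W (\<psi> i) \<omega>" if "i \<in> I" for i
  using \<mu>_powr_cancel[OF that, of "\<alpha> / 2"] by (simp add: c_def algebra_simps)
 have "Uf (%i. \<mu> i powr (\<alpha> / 2) * c i) = Uf (%i. W (\<psi> i) \<omega>)"
  using Fn_cong[of "%i. \<mu> i powr (\<alpha> / 2) * c i" "%i. W (\<psi> i) \<omega>", OF cancel] by simp
 hence op: "is_noise_path G I \<psi> \<mu> W \<omega> (op_power G I \<psi> \<mu> (\<alpha> / 2) (Uf c))"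
  unfolding op_power_Uf using noise_path[where W = W and \<omega> = \<omega>, OF X] by simp
 \<comment> \<open>Any order below \<alpha> - 1/2 would do; this one is negative as well, as
   \<open>Uf_hdot\<close> requires.\<close>
 have "Uf c \<in> hdot G I \<psi> \<mu> (- (\<bar>\<alpha>\<bar> + 1))"
  by (rule Uf_hdot[OF _ cs]) linarith+
 hence sol: "is_solution G I \<psi> \<mu> \<alpha> W \<omega> (Uf c)" using op by (auto simp: is_solution_def)
 have HKD: "in_H_KD G VK VD I \<psi> \<mu> (\<alpha> - 1/2 - \<epsilon>) (Uf c)"
  by (rule in_H_KD_if_coef[OF cs \<alpha>]) (use \<epsilon> in simp_all)
 have "U' = Uf c" if U': "is_solution G I \<psi> \<mu> \<alpha> W \<omega> U'" for U'
 proof -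
  obtain s where "U' \<in> hdot G I \<psi> \<mu> s" using U' by (auto simp: is_solution_def)
  note rep = hdot_repr[OF this]
  have n: "is_noise_path G I \<psi> \<mu> W \<omega> (op_power G I \<psi> \<mu> (\<alpha> / 2) (Uf (%i. U' (\<psi> i))))"
   using U' rep by (simp add: is_solution_def)
  have "U' (\<psi> i) = c i" if i: "i \<in> I" for i
  proof -
   have "\<mu> i powr (\<alpha> / 2) * U' (\<psi> i) = W (\<psi> i) \<omega>"
    using noise_path_coef[where W = W and \<omega> = \<omega>, OF X n i] unfolding op_power_Uf Uf_\<psi>[OF i] .
   hence "c i = (\<mu> i powr (- (\<alpha> / 2)) * \<mu> i powr (\<alpha> / 2)) * U' (\<psi> i)" by (simp add: c_def)
   thus ?thesis using \<mu>_powr_cancel[OF i, of "\<alpha> / 2"] by simp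
  qed
  hence "Uf (%i. U' (\<psi> i)) = Uf c" using Fn_cong[of "%i. U' (\<psi> i)" c] by simp
  with rep show ?thesis by simp
 qed
 with sol HKD show ?thesis by blast
qed

lemma white_noise_coef:
 assumes W: "white_noise G M W" and i: "i \<in> I"
 shows "W (\<psi> i) \<in> borel_measurable M" "(\<integral>\<^sup>+\<omega>. ennreal ((W (\<psi> i) \<omega>)^2) \<partial>M) = 1"
proof -
 have "gaussian_rv M (%\<omega>. \<Sum>h\<in>{\<psi> i}. 1 * W h \<omega>)"
  using W \<psi>_L2[OF i] unfolding white_noise_def by (elim conjE) (erule allE[of _ "{\<psi> i}"], erule allE[of _ "%_. 1"], simp)
 thus m: "W (\<psi> i) \<in> borel_measurable M" by (simp add: gaussian_rv_def)
 have "integral\<^sup>L M (%\<omega>. W (\<psi> i) \<omega> * W (\<psi> i) \<omega>) = inn (\<psi> i) (\<psi> i)"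
  using W \<psi>_L2[OF i] unfolding white_noise_def by blast
 hence I1: "integral\<^sup>L M (%\<omega>. (W (\<psi> i) \<omega>)^2) = 1" using \<psi>_orthonormal[OF i i] by (simp add: power2_eq_square)
 \<comment> \<open>The integral is 1, whereas the integral of a nonintegrable function is 0 by
   convention.\<close>
 hence "integrable M (%\<omega>. (W (\<psi> i) \<omega>)^2)" using not_integrable_integral_eq by fastforce
 from nn_integral_eq_integral[OF this] show "(\<integral>\<^sup>+\<omega>. ennreal ((W (\<psi> i) \<omega>)^2) \<partial>M) = 1" using I1 by simp
qed

text \<open>The coefficients have second moment 1, so by monotone convergence the expectation of the
  series is the sum in \<open>Weyl_summable\<close>. A nonnegative variable with finite expectation
  is finite almost surely.\<close>

lemma white_noise_summable:
 assumes W: "white_noise G M W" and s: "1/2 < s"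
 shows "AE \<omega> in M. (%i. \<mu> i powr (- s) * (W (\<psi> i) \<omega>)^2) summable_on I"
proof -
 define m where "m i = (if i \<in> I then \<mu> i powr (- s) else 0)" for i
 define f where "f i \<omega> = (if i \<in> I then \<mu> i powr (- s) * (W (\<psi> i) \<omega>)^2 else 0)" for i \<omega>
 have fm: "f i \<in> borel_measurable M" for i
  unfolding f_def[abs_def] using white_noise_coef(1)[OF W] by (cases "i \<in> I") auto
 have fi: "(\<integral>\<^sup>+\<omega>. ennreal (f i \<omega>) \<partial>M) = ennreal (m i)" for i
 proof (cases "i \<in> I")
  case True
  hence "(\<integral>\<^sup>+\<omega>. ennreal (f i \<omega>) \<partial>M) = (\<integral>\<^sup>+\<omega>. ennreal (\<mu> i powr (- s)) * ennreal ((W (\<psi> i) \<omega>)^2) \<partial>M)"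
   by (simp add: f_def ennreal_mult)
  also have "... = ennreal (\<mu> i powr (- s)) * (\<integral>\<^sup>+\<omega>. ennreal ((W (\<psi> i) \<omega>)^2) \<partial>M)"
   by (rule nn_integral_cmult) (use white_noise_coef(1)[OF W True] in measurable)
  finally show ?thesis using True white_noise_coef(2)[OF W True] by (simp add: m_def)
 qed (simp add: f_def m_def)
 have restr: "h summable_on I \<longleftrightarrow> summable (%i. if i \<in> I then h i else 0)" if "!!i. 0 <= h i" for h :: "nat => real"
 proof -
  have "h summable_on I \<longleftrightarrow> (%i. if i \<in> I then h i else 0) summable_on UNIV"
   by (rule summable_on_cong_neutral) auto
  thus ?thesis using summable_on_UNIV_nonneg_real_iff[of "%i. if i \<in> I then h i else 0"] that by simp
 qed
 have "summable m" using Weyl_summable[OF s] restr[of "%i. \<mu> i powr (- s)"] by (simp add: m_def[abs_def])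
 hence ms: "(\<Sum>i. ennreal (m i)) \<noteq> \<infinity>"
  by (subst suminf_ennreal2) (auto simp: m_def)
 have "(\<integral>\<^sup>+\<omega>. (\<Sum>i. ennreal (f i \<omega>)) \<partial>M) = (\<Sum>i. ennreal (m i))"
  unfolding fi[symmetric] by (rule nn_integral_suminf) (use fm in measurable)
 with ms have fin: "(\<integral>\<^sup>+\<omega>. (\<Sum>i. ennreal (f i \<omega>)) \<partial>M) \<noteq> \<infinity>" by simp
 have "AE \<omega> in M. (\<Sum>i. ennreal (f i \<omega>)) \<noteq> \<infinity>"
  by (rule nn_integral_PInf_AE[OF _ fin]) (use fm in measurable)
 thus ?thesis
 proof eventually_elim
  case (elim \<omega>)
  have "0 <= f i \<omega>" for i by (simp add: f_def)
  hence "summable (%i. f i \<omega>)" using elim summable_suminf_not_top[of "%i. f i \<omega>"] by simp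
  thus ?case using restr[of "%i. \<mu> i powr (- s) * (W (\<psi> i) \<omega>)^2"] by (simp add: f_def)
 qed
qed

text \<open>The exceptional null set must not depend on \<open>s\<close>. Countably many exponents
  decreasing to 1/2 are enough, since summability passes on to all larger exponents.\<close>

lemma white_noise_all_summable:
 assumes W: "white_noise G M W"
 shows "AE \<omega> in M. \<forall>s>1/2. (%i. \<mu> i powr (- s) * (W (\<psi> i) \<omega>)^2) summable_on I"
proof -
 have "AE \<omega> in M. \<forall>n::nat. (%i. \<mu> i powr (- (1/2 + 1 / real (Suc n))) * (W (\<psi> i) \<omega>)^2) summable_on I"
  unfolding AE_all_countable by (intro allI white_noise_summable[OF W]) simp
 thus ?thesis
 proof eventually_elim
  case (elim \<omega>)
  show ?case
  proof (intro allI impI)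
   fix s :: real assume "1/2 < s"
   then obtain n where "1 / real (Suc n) < s - 1/2" using nat_approx_posE[of "s - 1/2"] by auto
   thus "(%i. \<mu> i powr (- s) * (W (\<psi> i) \<omega>)^2) summable_on I"
    by (intro weighted_summable_mono[OF elim[rule_format, of n]]) simp
  qed
 qed
qed

end

theorem corollary5:
  fixes G :: "('v, 'e) metric_graph"
    and VK VD :: "'v set"
    and a \<kappa> :: "'e graph_fun"
    and I :: "nat set" and \<psi> :: "nat \<Rightarrow> 'e graph_fun" and \<mu> :: "nat \<Rightarrow> real"
    and \<alpha> \<epsilon> :: real
    and M :: "'w measure" and W :: "'e graph_fun \<Rightarrow> 'w \<Rightarrow> real"
  assumes "compact_metric_graph G"
    and "VK \<union> VD = verts G" and "VK \<inter> VD = {}"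
    and "a \<in> Linf_graph G" and "\<kappa> \<in> Linf_graph G"
    and "ess_inf_pos G a" and "ess_inf_pos G \<kappa>"
    and "Lipschitz_graph G a"
    and "orthonormal_eigenbasis G VK VD a \<kappa> I \<psi> \<mu>"
    and "- 3/2 < \<alpha>" and "\<alpha> < 5/2" and "0 < \<epsilon>"
    and "white_noise G M W"
  shows "AE \<omega> in M. \<exists>U. is_solution G I \<psi> \<mu> \<alpha> W \<omega> U \<and>
           in_H_KD G VK VD I \<psi> \<mu> (\<alpha> - 1/2 - \<epsilon>) U \<and>
           (\<forall>U'. is_solution G I \<psi> \<mu> \<alpha> W \<omega> U' \<longrightarrow> U' = U)"
proof -
  interpret quantum_graph G VK VD a \<kappa> I \<psi> \<mu>
    by (unfold_locales; fact assms)
  from white_noise_all_summable[OF assms(13)] show ?thesis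
  proof eventually_elim
    case (elim \<omega>)
    show ?case by (rule solution[where W = W and \<omega> = \<omega>, OF elim[rule_format] assms(10-12)])
  qed
qed

end
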